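(* Let $\mathcal{H}$ be a cocommutative Hopf $K$-algebra with a symmetric partial action on a unital $K$-algebra $A$. (1) For a fixed $A\#\mathcal{H}$-bimodule $M$, the functors $$\operatorname{Hom}_{\mathcal{H}_{par}}(-,\operatorname{Hom}_{A^e}(A,M))\quad\text{and}\quad\operatorname{Hom}_{(A\#\mathcal{H})^e}(-\otimes_{\mathcal{B}}A\#\mathcal{H},M)$$ from $\mathcal{H}_{par}$-Mod to $K$-Mod (contravariant) are naturally isomorphic. (2) For a fixed left $\mathcal{H}_{par}$-module $X$, the functors $$\operatorname{Hom}_{\mathcal{H}_{par}}(X,\operatorname{Hom}_{A^e}(A,-))\quad\text{and}\quad\operatorname{Hom}_{(A\#\mathcal{H})^e}(X\otimes_{\mathcal{B}}A\#\mathcal{H},-)$$ from $(A\#\mathcal{H})^e$-Mod to $K$-Mod are naturally isomorphic.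
   Context: $K$ is a commutative unital ring, $\otimes=\otimes_K$, all algebras are associative unital $K$-algebras. $\mathcal{H}$ has counit $\varepsilon$, antipode $S$, and Sweedler notation $\Delta(h)=h_{(1)}\otimes h_{(2)}$ is used. $R$-Mod denotes left $R$-modules. Symmetric partial action: a linear map $\mathcal{H}\otimes A\to A$, $h\otimes a\mapsto h\cdot a$, with $1_{\mathcal{H}}\cdot a=a$; $h\cdot(ab)=(h_{(1)}\cdot a)(h_{(2)}\cdot b)$; $h\cdot(k\cdot a)=(h_{(1)}\cdot 1_A)(h_{(2)}k\cdot a)$; and $h\cdot(k\cdot a)=(h_{(1)}k\cdot a)(h_{(2)}\cdot 1_A)$ (symmetry). Partial smash product: $A\otimes\mathcal{H}$ has the associative product $(a\otimes h)(b\otimes k)=a(h_{(1)}\cdot b)\otimes h_{(2)}k$, and $A\#\mathcal{H}:=(A\otimes\mathcal{H})(1_A\otimes 1_{\mathcal{H}})$, a unital algebra generated by the elements $a\#h:=a(h_{(1)}\cdot 1_A)\otimes h_{(2)}$. For an algebra $R$, $R^e=R\otimes R^{op}$; an $R$-bimodule $X$ is a left $R^e$-module by $(a\otimes b)\cdot x=a\cdot x\cdot b$. An $A\#\mathcal{H}$-bimodule is an $A$-bimodule via $a\mapsto a\#1_{\mathcal{H}}$. The algebra $\mathcal{H}_{par}$ is the quotient of the tensor algebra $T(\mathcal{H})$ by the ideal generated by the elements ($h,k\in\mathcal{H}$): $1_{\mathcal{H}}-1_{T(\mathcal{H})}$; $h\otimes k_{(1)}\otimes S(k_{(2)})-hk_{(1)}\otimes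 S(k_{(2)})$; $h_{(1)}\otimes S(h_{(2)})\otimes k-h_{(1)}\otimes S(h_{(2)})k$; $h\otimes S(k_{(1)})\otimes k_{(2)}-hS(k_{(1)})\otimes k_{(2)}$; $S(h_{(1)})\otimes h_{(2)}\otimes k-S(h_{(1)})\otimes h_{(2)}k$. The class of $h$ is $[h]$. $\mathcal{B}\subseteq\mathcal{H}_{par}$ is the subalgebra generated by the elements $e_h:=[h_{(1)}][S(h_{(2)})]$, $h\in\mathcal{H}$. Module structures used: (i) an $A\#\mathcal{H}$-bimodule $M$ is a left $\mathcal{H}_{par}$-module by $[h]\triangleright m=(1_A\#h_{(1)})\cdot m\cdot(1_A\#S(h_{(2)}))$, and $\operatorname{Hom}_{A^e}(A,M)$ is a left $\mathcal{H}_{par}$-module by $([h]\triangleright f)(a)=[h_{(1)}]\triangleright f(S(h_{(2)})\cdot a)$. (ii) Any left $\mathcal{H}_{par}$-module $X$ is a right $\mathcal{H}_{par}$-module by $x\cdot[h]=[S(h)]\cdot x$, hence a right $\mathcal{B}$-module by restriction. (iii) $A\#\mathcal{H}$ is a left $\mathcal{H}_{par}$-module by $[h]\triangleright(a\#k)=(1_A\#h)(a\#k)$, hence a left $\mathcal{B}$-module by restriction. (iv) For a left $\mathcal{H}_{par}$-module $X$, $X\otimes_{\mathcal{B}}(A\#\mathcal{H})$ is an $A\#\mathcal{H}$-bimodule by $(a\#h)\cdot(x\otimes_{\mathcal{B}}c\#t)=[h_{(1)}]\cdot x\otimes_{\mathcal{B}}(a\#h_{(2)})(c\#t)$ and $(x\otimes_{\mathcal{B}}c\#t)\cdot(a\#h)=x\otimes_{\mathcal{B}}(c\#t)(a\#h)$.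 *)

theory Defs
  imports "HOL-Algebra.Free_Abelian_Groups" "HOL-Algebra.QuotRing" "HOL-Algebra.Subrings"
    "HOL-Algebra.Module"
begin

section \<open>Modules and algebras\<close>

text \<open>
  The library's \<^locale>\<open>module\<close> and \<^locale>\<open>algebra\<close> are confined to commutative rings and to
  commutative algebras.  Modules over an arbitrary ring and arbitrary associative unital algebras
  use the same record type; as in the library, the fields \<^const>\<open>mult\<close> and \<^const>\<open>one\<close> of a
  record that is only a module carry no information.
\<close>

locale left_module = R?: ring R + M?: abelian_group M
  for R :: "('r, 's) ring_scheme" (structure) and M :: "('r, 'x, 'z) module_scheme" (structure) +
  assumes smult_closed:
      "\<lbrakk>r \<in> carrier R; x \<in> carrier M\<rbrakk> \<Longrightarrow> r \<odot>\<^bsub>M\<^esub> x \<in> carrier M"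
    and smult_l_distr:
      "\<lbrakk>r \<in> carrier R; s \<in> carrier R; x \<in> carrier M\<rbrakk> \<Longrightarrow>
        (r \<oplus>\<^bsub>R\<^esub> s) \<odot>\<^bsub>M\<^esub> x = r \<odot>\<^bsub>M\<^esub> x \<oplus>\<^bsub>M\<^esub> s \<odot>\<^bsub>M\<^esub> x"
    and smult_r_distr:
      "\<lbrakk>r \<in> carrier R; x \<in> carrier M; y \<in> carrier M\<rbrakk> \<Longrightarrow>
        r \<odot>\<^bsub>M\<^esub> (x \<oplus>\<^bsub>M\<^esub> y) = r \<odot>\<^bsub>M\<^esub> x \<oplus>\<^bsub>M\<^esub> r \<odot>\<^bsub>M\<^esub> y"
    and smult_assoc:
      "\<lbrakk>r \<in> carrier R; s \<in> carrier R; x \<in> carrier M\<rbrakk> \<Longrightarrow>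
        (r \<otimes>\<^bsub>R\<^esub> s) \<odot>\<^bsub>M\<^esub> x = r \<odot>\<^bsub>M\<^esub> (s \<odot>\<^bsub>M\<^esub> x)"
    and smult_one: "x \<in> carrier M \<Longrightarrow> \<one>\<^bsub>R\<^esub> \<odot>\<^bsub>M\<^esub> x = x"

locale unital_algebra = module K A + ring A
  for K :: "('k, 's) ring_scheme" (structure) and A :: "('k, 'a, 'z) module_scheme" (structure) +
  assumes smult_mult_left:
      "\<lbrakk>k \<in> carrier K; x \<in> carrier A; y \<in> carrier A\<rbrakk> \<Longrightarrow>
        (k \<odot>\<^bsub>A\<^esub> x) \<otimes>\<^bsub>A\<^esub> y = k \<odot>\<^bsub>A\<^esub> (x \<otimes>\<^bsub>A\<^esub> y)"
    and smult_mult_right: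
      "\<lbrakk>k \<in> carrier K; x \<in> carrier A; y \<in> carrier A\<rbrakk> \<Longrightarrow>
        x \<otimes>\<^bsub>A\<^esub> (k \<odot>\<^bsub>A\<^esub> y) = k \<odot>\<^bsub>A\<^esub> (x \<otimes>\<^bsub>A\<^esub> y)"

definition linear_map ::
    "('r, 's) ring_scheme \<Rightarrow> ('r, 'x, 't) module_scheme \<Rightarrow> ('r, 'y, 'u) module_scheme \<Rightarrow> ('x \<Rightarrow> 'y) \<Rightarrow> bool"
  where "linear_map R X Y f \<longleftrightarrow>
    f \<in> carrier X \<rightarrow> carrier Y \<and>
    (\<forall>x\<in>carrier X. \<forall>y\<in>carrier X. f (x \<oplus>\<^bsub>X\<^esub> y) = f x \<oplus>\<^bsub>Y\<^esub> f y) \<and>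
    (\<forall>r\<in>carrier R. \<forall>x\<in>carrier X. f (r \<odot>\<^bsub>X\<^esub> x) = r \<odot>\<^bsub>Y\<^esub> f x)"

text \<open>Homomorphisms are extensional, so that equality in a Hom set is equality on the carrier.\<close>

definition mod_hom ::
    "('r, 's) ring_scheme \<Rightarrow> ('r, 'x, 't) module_scheme \<Rightarrow> ('r, 'y, 'u) module_scheme \<Rightarrow> ('x \<Rightarrow> 'y) set"
  where "mod_hom R X Y = {f \<in> extensional (carrier X). linear_map R X Y f}"

definition mod_iso ::
    "('r, 's) ring_scheme \<Rightarrow> ('r, 'x, 't) module_scheme \<Rightarrow> ('r, 'y, 'u) module_scheme \<Rightarrow> ('x \<Rightarrow> 'y) set"
  where "mod_iso R X Y = {f \<in> mod_hom R X Y. bij_betw f (carrier X) (carrier Y)}"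

definition with_smult :: "('x, 'z) ring_scheme \<Rightarrow> ('s \<Rightarrow> 'x \<Rightarrow> 'x) \<Rightarrow> ('s, 'x) module"
  where "with_smult X \<sigma> =
    \<lparr>carrier = carrier X, mult = mult X, one = one X, zero = zero X, add = add X, smult = \<sigma>\<rparr>"

text \<open>A module over a \<open>K\<close>-algebra \<open>R\<close>, regarded as a \<open>K\<close>-module.\<close>

definition restrict_K :: "('k, 'r, 's) module_scheme \<Rightarrow> ('r, 'x, 't) module_scheme \<Rightarrow> ('k, 'x) module"
  where "restrict_K R X = with_smult X (\<lambda>k x. (k \<odot>\<^bsub>R\<^esub> \<one>\<^bsub>R\<^esub>) \<odot>\<^bsub>X\<^esub> x)"

definition hom_module ::
    "('k, 'r, 's) module_scheme \<Rightarrow> ('r, 'x, 't) module_scheme \<Rightarrow> ('r, 'y, 'u) module_scheme \<Rightarrow>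
      ('k, 'x \<Rightarrow> 'y) module"
  where "hom_module R X Y =
    \<lparr>carrier = mod_hom R X Y, mult = undefined, one = undefined,
     zero = (\<lambda>x\<in>carrier X. \<zero>\<^bsub>Y\<^esub>),
     add = (\<lambda>f g. \<lambda>x\<in>carrier X. f x \<oplus>\<^bsub>Y\<^esub> g x),
     smult = (\<lambda>k f. \<lambda>x\<in>carrier X. k \<odot>\<^bsub>restrict_K R Y\<^esub> f x)\<rparr>"

definition opp :: "('r, 's) ring_scheme \<Rightarrow> ('r, 's) ring_scheme"
  where "opp R = R\<lparr>mult := \<lambda>x y. y \<otimes>\<^bsub>R\<^esub> x\<rparr>"

definition subalgebra_gen :: "('k, 's) ring_scheme \<Rightarrow> ('k, 'r, 't) module_scheme \<Rightarrow> 'r set \<Rightarrow> 'r set"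
  where "subalgebra_gen K R E =
    \<Inter>{C. subring C R \<and> (\<forall>k\<in>carrier K. \<forall>c\<in>C. k \<odot>\<^bsub>R\<^esub> c \<in> C) \<and> E \<subseteq> C}"


section \<open>Tensor products\<close>

text \<open>
  \<open>X \<otimes>\<^sub>R Y\<close> is the free abelian group on pairs modulo the usual relations.  A right \<open>R\<close>-module \<open>X\<close>
  is represented by a record whose scalar multiplication \<open>r \<odot> x\<close> is to be read as \<open>x \<cdot> r\<close>.
\<close>

type_synonym ('x, 'y) tensor = "(('x \<times> 'y) \<Rightarrow>\<^sub>0 int) set"

definition tensor_relations ::
    "('r, 's) ring_scheme \<Rightarrow> ('r, 'x, 't) module_scheme \<Rightarrow> ('r, 'y, 'u) module_scheme \<Rightarrow>
      (('x \<times> 'y) \<Rightarrow>\<^sub>0 int) set"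
  where "tensor_relations R X Y =
    {frag_of (x \<oplus>\<^bsub>X\<^esub> x', y) - frag_of (x, y) - frag_of (x', y) | x x' y.
       x \<in> carrier X \<and> x' \<in> carrier X \<and> y \<in> carrier Y} \<union>
    {frag_of (x, y \<oplus>\<^bsub>Y\<^esub> y') - frag_of (x, y) - frag_of (x, y') | x y y'.
       x \<in> carrier X \<and> y \<in> carrier Y \<and> y' \<in> carrier Y} \<union>
    {frag_of (r \<odot>\<^bsub>X\<^esub> x, y) - frag_of (x, r \<odot>\<^bsub>Y\<^esub> y) | r x y.
       r \<in> carrier R \<and> x \<in> carrier X \<and> y \<in> carrier Y}"

definition tensor_kernel ::
    "('r, 's) ring_scheme \<Rightarrow> ('r, 'x, 't) module_scheme \<Rightarrow> ('r, 'y, 'u) module_scheme \<Rightarrow> ('x, 'y) tensor"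
  where "tensor_kernel R X Y =
    generate (free_Abelian_group (carrier X \<times> carrier Y)) (tensor_relations R X Y)"

definition pure_tensor ::
    "('r, 's) ring_scheme \<Rightarrow> ('r, 'x, 't) module_scheme \<Rightarrow> ('r, 'y, 'u) module_scheme \<Rightarrow>
      'x \<Rightarrow> 'y \<Rightarrow> ('x, 'y) tensor"
  where "pure_tensor R X Y x y =
    tensor_kernel R X Y #>\<^bsub>free_Abelian_group (carrier X \<times> carrier Y)\<^esub> frag_of (x, y)"

definition tensor_group ::
    "('r, 's) ring_scheme \<Rightarrow> ('r, 'x, 't) module_scheme \<Rightarrow> ('r, 'y, 'u) module_scheme \<Rightarrow>
      ('x, 'y) tensor ring"
  where "tensor_group R X Y =
    (let G = free_Abelian_group (carrier X \<times> carrier Y) Mod tensor_kernel R X Y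
     in \<lparr>carrier = carrier G, mult = undefined, one = undefined, zero = \<one>\<^bsub>G\<^esub>, add = mult G\<rparr>)"

text \<open>
  The additive map \<open>X \<otimes>\<^sub>R Y \<rightarrow> P\<close> with \<open>x \<otimes> y \<mapsto> f x y\<close>, evaluated on an arbitrary representative.
  It does not depend on the representative when \<open>f\<close> is biadditive and \<open>R\<close>-balanced, and is only
  used for such \<open>f\<close>.
\<close>

definition tensor_lift :: "('p, 's) ring_scheme \<Rightarrow> ('x \<Rightarrow> 'y \<Rightarrow> 'p) \<Rightarrow> ('x, 'y) tensor \<Rightarrow> 'p"
  where "tensor_lift P f t =
    (let c = (SOME c. c \<in> t)
     in \<Oplus>\<^bsub>P\<^esub>p\<in>Poly_Mapping.keys c. [Poly_Mapping.lookup c p] \<cdot>\<^bsub>P\<^esub> f (fst p) (snd p))"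

text \<open>For commutative \<open>K\<close>, the \<open>K\<close>-module \<open>X \<otimes> Y\<close> and the \<open>K\<close>-algebra \<open>A \<otimes> B\<close>.\<close>

definition tensor ::
    "('k, 's) ring_scheme \<Rightarrow> ('k, 'x, 't) module_scheme \<Rightarrow> ('k, 'y, 'u) module_scheme \<Rightarrow>
      ('k, ('x, 'y) tensor) module"
  where "tensor K X Y =
    with_smult (tensor_group K X Y)
      (\<lambda>k. tensor_lift (tensor_group K X Y) (\<lambda>x y. pure_tensor K X Y (k \<odot>\<^bsub>X\<^esub> x) y))"

definition tensor_alg ::
    "('k, 's) ring_scheme \<Rightarrow> ('k, 'a, 't) module_scheme \<Rightarrow> ('k, 'b, 'u) module_scheme \<Rightarrow>
      ('k, ('a, 'b) tensor) module"
  where "tensor_alg K A B = (tensor K A B)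
    \<lparr>mult := \<lambda>s t.
       tensor_lift (tensor K A B) (\<lambda>a b.
         tensor_lift (tensor K A B) (\<lambda>a' b'.
           pure_tensor K A B (a \<otimes>\<^bsub>A\<^esub> a') (b \<otimes>\<^bsub>B\<^esub> b')) t) s,
     one := pure_tensor K A B \<one>\<^bsub>A\<^esub> \<one>\<^bsub>B\<^esub>\<rparr>"


section \<open>Enveloping algebras and bimodules\<close>

definition env ::
    "('k, 's) ring_scheme \<Rightarrow> ('k, 'a, 't) module_scheme \<Rightarrow> ('k, ('a, 'a) tensor) module"
  where "env K R = tensor_alg K R (opp R)"

definition left_act ::
    "('k, 's) ring_scheme \<Rightarrow> ('k, 'a, 't) module_scheme \<Rightarrow> (('a, 'a) tensor, 'x, 'u) module_scheme \<Rightarrow>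
      'a \<Rightarrow> 'x \<Rightarrow> 'x"
  where "left_act K R X a x = pure_tensor K R (opp R) a \<one>\<^bsub>R\<^esub> \<odot>\<^bsub>X\<^esub> x"

definition right_act ::
    "('k, 's) ring_scheme \<Rightarrow> ('k, 'a, 't) module_scheme \<Rightarrow> (('a, 'a) tensor, 'x, 'u) module_scheme \<Rightarrow>
      'x \<Rightarrow> 'a \<Rightarrow> 'x"
  where "right_act K R X x b = pure_tensor K R (opp R) \<one>\<^bsub>R\<^esub> b \<odot>\<^bsub>X\<^esub> x"

text \<open>
  The left module over an enveloping algebra given by the bimodule structure \<open>l a x = a \<cdot> x\<close>,
  \<open>r x b = x \<cdot> b\<close> on the abelian group \<open>P\<close>.
\<close>

definition bimodule ::
    "('p, 's) ring_scheme \<Rightarrow> ('a \<Rightarrow> 'p \<Rightarrow> 'p) \<Rightarrow> ('p \<Rightarrow> 'a \<Rightarrow> 'p) \<Rightarrow> (('a, 'a) tensor, 'p) module"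
  where "bimodule P l r = with_smult P (\<lambda>t x. tensor_lift P (\<lambda>a b. r (l a x) b) t)"

definition regular_bimodule :: "('k, 'a, 's) module_scheme \<Rightarrow> (('a, 'a) tensor, 'a) module"
  where "regular_bimodule A = bimodule A (mult A) (mult A)"


section \<open>Hopf algebras\<close>

record ('k, 'h) hopf = "('k, 'h) module" +
  comult :: "'h \<Rightarrow> ('h, 'h) tensor"
  counit :: "'h \<Rightarrow> 'k"
  antipode :: "'h \<Rightarrow> 'h"

text \<open>\<open>sweedler H P f h\<close> is the sum, formed in \<open>P\<close>, that is written \<open>f(h\<^sub>(\<^sub>1\<^sub>), h\<^sub>(\<^sub>2\<^sub>))\<close>.\<close>

definition sweedler ::
    "('k, 'h, 's) hopf_scheme \<Rightarrow> ('p, 't) ring_scheme \<Rightarrow> ('h \<Rightarrow> 'h \<Rightarrow> 'p) \<Rightarrow> 'h \<Rightarrow> 'p"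
  where "sweedler H P f h = tensor_lift P f (comult H h)"

locale hopf_algebra = unital_algebra K H
  for K :: "('k, 's) ring_scheme" (structure) and H :: "('k, 'h, 'z) hopf_scheme" (structure) +
  assumes comult_linear: "linear_map K H (tensor K H H) (comult H)"
    and comult_hom: "comult H \<in> ring_hom H (tensor_alg K H H)"
    and counit_linear: "\<lbrakk>k \<in> carrier K; h \<in> carrier H\<rbrakk> \<Longrightarrow> counit H (k \<odot>\<^bsub>H\<^esub> h) = k \<otimes>\<^bsub>K\<^esub> counit H h"
    and counit_hom: "counit H \<in> ring_hom H K"
    and antipode_linear: "linear_map K H H (antipode H)"
    and coassociative: "h \<in> carrier H \<Longrightarrow>
      sweedler H (tensor K (tensor K H H) H)
        (\<lambda>x y. pure_tensor K (tensor K H H) H (comult H x) y) h =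
      sweedler H (tensor K (tensor K H H) H)
        (\<lambda>x y. sweedler H (tensor K (tensor K H H) H)
          (\<lambda>u v. pure_tensor K (tensor K H H) H (pure_tensor K H H x u) v) y) h"
    and counit_left: "h \<in> carrier H \<Longrightarrow> sweedler H H (\<lambda>x y. counit H x \<odot>\<^bsub>H\<^esub> y) h = h"
    and counit_right: "h \<in> carrier H \<Longrightarrow> sweedler H H (\<lambda>x y. counit H y \<odot>\<^bsub>H\<^esub> x) h = h"
    and antipode_left: "h \<in> carrier H \<Longrightarrow>
      sweedler H H (\<lambda>x y. antipode H x \<otimes>\<^bsub>H\<^esub> y) h = counit H h \<odot>\<^bsub>H\<^esub> \<one>\<^bsub>H\<^esub>"
    and antipode_right: "h \<in> carrier H \<Longrightarrow>
      sweedler H H (\<lambda>x y. x \<otimes>\<^bsub>H\<^esub> antipode H y) h = counit H h \<odot>\<^bsub>H\<^esub> \<one>\<^bsub>H\<^esub>"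

locale cocommutative_hopf_algebra = hopf_algebra +
  assumes cocommutative: "h \<in> carrier H \<Longrightarrow>
    sweedler H (tensor K H H) (\<lambda>x y. pure_tensor K H H y x) h = comult H h"


section \<open>Symmetric partial actions and the partial smash product\<close>

locale symmetric_partial_action = hopf_algebra K H + A?: unital_algebra K A
  for K :: "('k, 's) ring_scheme" (structure) and H :: "('k, 'h, 'z) hopf_scheme" (structure)
    and A :: "('k, 'a, 'w) module_scheme" (structure) +
  fixes act :: "'h \<Rightarrow> 'a \<Rightarrow> 'a"
  assumes act_linear_left: "a \<in> carrier A \<Longrightarrow> linear_map K H A (\<lambda>h. act h a)"
    and act_linear_right: "h \<in> carrier H \<Longrightarrow> linear_map K A A (act h)"
    and act_one: "a \<in> carrier A \<Longrightarrow> act \<one>\<^bsub>H\<^esub> a = a"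
    and act_mult: "\<lbrakk>h \<in> carrier H; a \<in> carrier A; b \<in> carrier A\<rbrakk> \<Longrightarrow>
      act h (a \<otimes>\<^bsub>A\<^esub> b) = sweedler H A (\<lambda>x y. act x a \<otimes>\<^bsub>A\<^esub> act y b) h"
    and act_act: "\<lbrakk>h \<in> carrier H; k \<in> carrier H; a \<in> carrier A\<rbrakk> \<Longrightarrow>
      act h (act k a) = sweedler H A (\<lambda>x y. act x \<one>\<^bsub>A\<^esub> \<otimes>\<^bsub>A\<^esub> act (y \<otimes>\<^bsub>H\<^esub> k) a) h"
    and act_act_symmetric: "\<lbrakk>h \<in> carrier H; k \<in> carrier H; a \<in> carrier A\<rbrakk> \<Longrightarrow>
      act h (act k a) = sweedler H A (\<lambda>x y. act (x \<otimes>\<^bsub>H\<^esub> k) a \<otimes>\<^bsub>A\<^esub> act y \<one>\<^bsub>A\<^esub>) h"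

definition smash_mult ::
    "('k, 's) ring_scheme \<Rightarrow> ('k, 'h, 't) hopf_scheme \<Rightarrow> ('k, 'a, 'u) module_scheme \<Rightarrow>
      ('h \<Rightarrow> 'a \<Rightarrow> 'a) \<Rightarrow> ('a, 'h) tensor \<Rightarrow> ('a, 'h) tensor \<Rightarrow> ('a, 'h) tensor"
  where "smash_mult K H A act s t =
    tensor_lift (tensor K A H) (\<lambda>a h.
      tensor_lift (tensor K A H) (\<lambda>b k.
        sweedler H (tensor K A H) (\<lambda>x y.
          pure_tensor K A H (a \<otimes>\<^bsub>A\<^esub> act x b) (y \<otimes>\<^bsub>H\<^esub> k)) h) t) s"

definition smash ::
    "('k, 's) ring_scheme \<Rightarrow> ('k, 'h, 't) hopf_scheme \<Rightarrow> ('k, 'a, 'u) module_scheme \<Rightarrow>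
      ('h \<Rightarrow> 'a \<Rightarrow> 'a) \<Rightarrow> ('k, ('a, 'h) tensor) module"
  where "smash K H A act =
    (let e = pure_tensor K A H \<one>\<^bsub>A\<^esub> \<one>\<^bsub>H\<^esub>
     in (tensor K A H)
       \<lparr>carrier := (\<lambda>z. smash_mult K H A act z e) ` carrier (tensor K A H),
        mult := smash_mult K H A act,
        one := e\<rparr>)"

text \<open>The element \<open>a # h = a(h\<^sub>(\<^sub>1\<^sub>) \<cdot> 1\<^sub>A) \<otimes> h\<^sub>(\<^sub>2\<^sub>)\<close>.\<close>

definition smash_elem ::
    "('k, 's) ring_scheme \<Rightarrow> ('k, 'h, 't) hopf_scheme \<Rightarrow> ('k, 'a, 'u) module_scheme \<Rightarrow>
      ('h \<Rightarrow> 'a \<Rightarrow> 'a) \<Rightarrow> 'a \<Rightarrow> 'h \<Rightarrow> ('a, 'h) tensor"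
  where "smash_elem K H A act a h =
    sweedler H (tensor K A H) (\<lambda>x y. pure_tensor K A H (a \<otimes>\<^bsub>A\<^esub> act x \<one>\<^bsub>A\<^esub>) y) h"


section \<open>The tensor algebra and the algebra \<open>H\<^sub>p\<^sub>a\<^sub>r\<close>\<close>

text \<open>
  The pair \<open>(k, [v\<^sub>1, \<dots>, v\<^sub>n])\<close> stands for \<open>k v\<^sub>1 \<otimes> \<dots> \<otimes> v\<^sub>n\<close>.  The tensor algebra of a
  \<open>K\<close>-module \<open>V\<close> is the free abelian group on these pairs modulo multilinearity in \<open>k\<close> and in the
  letters \<open>v\<^sub>i\<close>; the words of length \<open>n\<close> contribute the \<open>n\<close>-th tensor power of \<open>V\<close>, which is \<open>K\<close>
  for \<open>n = 0\<close>, and the product is concatenation.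
\<close>

type_synonym ('k, 'v) words = "('k \<times> 'v list) \<Rightarrow>\<^sub>0 int"

definition word_ring ::
    "('k, 's) ring_scheme \<Rightarrow> ('k, 'v, 't) module_scheme \<Rightarrow> ('k, 'v) words ring"
  where "word_ring K V =
    \<lparr>carrier = carrier (free_Abelian_group (carrier K \<times> lists (carrier V))),
     mult = (\<lambda>c d. frag_extend (\<lambda>(k, u). frag_extend (\<lambda>(l, v). frag_of (k \<otimes>\<^bsub>K\<^esub> l, u @ v)) d) c),
     one = frag_of (\<one>\<^bsub>K\<^esub>, []), zero = 0, add = (+)\<rparr>"

definition word_relations ::
    "('k, 's) ring_scheme \<Rightarrow> ('k, 'v, 't) module_scheme \<Rightarrow> ('k, 'v) words set"
  where "word_relations K V =
    {frag_of (k \<oplus>\<^bsub>K\<^esub> l, w) - frag_of (k, w) - frag_of (l, w) | k l w.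
       k \<in> carrier K \<and> l \<in> carrier K \<and> w \<in> lists (carrier V)} \<union>
    {frag_of (k, u @ [x \<oplus>\<^bsub>V\<^esub> y] @ v) - frag_of (k, u @ [x] @ v) - frag_of (k, u @ [y] @ v) | k u x y v.
       k \<in> carrier K \<and> u \<in> lists (carrier V) \<and> x \<in> carrier V \<and> y \<in> carrier V \<and> v \<in> lists (carrier V)} \<union>
    {frag_of (k, u @ [l \<odot>\<^bsub>V\<^esub> x] @ v) - frag_of (k \<otimes>\<^bsub>K\<^esub> l, u @ [x] @ v) | k l u x v.
       k \<in> carrier K \<and> l \<in> carrier K \<and> u \<in> lists (carrier V) \<and> x \<in> carrier V \<and> v \<in> lists (carrier V)}"

definition tensor_word ::
    "('k, 's) ring_scheme \<Rightarrow> ('k, 'v, 't) module_scheme \<Rightarrow> 'k \<Rightarrow> 'v list \<Rightarrow> ('k, 'v) words set"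
  where "tensor_word K V k w =
    (Idl\<^bsub>word_ring K V\<^esub> (word_relations K V)) +>\<^bsub>word_ring K V\<^esub> frag_of (k, w)"

definition tensor_algebra ::
    "('k, 's) ring_scheme \<Rightarrow> ('k, 'v, 't) module_scheme \<Rightarrow> ('k, ('k, 'v) words set) module"
  where "tensor_algebra K V =
    (let Q = word_ring K V Quot (Idl\<^bsub>word_ring K V\<^esub> (word_relations K V))
     in with_smult Q (\<lambda>k t. tensor_word K V k [] \<otimes>\<^bsub>Q\<^esub> t))"

definition hpar_relations ::
    "('k, 's) ring_scheme \<Rightarrow> ('k, 'h, 't) hopf_scheme \<Rightarrow> ('k, 'h) words set set"
  where "hpar_relations K H =
    (let T = tensor_algebra K H; \<tau> = tensor_word K H \<one>\<^bsub>K\<^esub>; S = antipode H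
     in {\<tau> [\<one>\<^bsub>H\<^esub>] \<ominus>\<^bsub>T\<^esub> \<one>\<^bsub>T\<^esub>} \<union>
       (\<Union>h\<in>carrier H. \<Union>k\<in>carrier H.
         {sweedler H T (\<lambda>x y. \<tau> [h, x, S y]) k \<ominus>\<^bsub>T\<^esub> sweedler H T (\<lambda>x y. \<tau> [h \<otimes>\<^bsub>H\<^esub> x, S y]) k,
          sweedler H T (\<lambda>x y. \<tau> [x, S y, k]) h \<ominus>\<^bsub>T\<^esub> sweedler H T (\<lambda>x y. \<tau> [x, S y \<otimes>\<^bsub>H\<^esub> k]) h,
          sweedler H T (\<lambda>x y. \<tau> [h, S x, y]) k \<ominus>\<^bsub>T\<^esub> sweedler H T (\<lambda>x y. \<tau> [h \<otimes>\<^bsub>H\<^esub> S x, y]) k,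
          sweedler H T (\<lambda>x y. \<tau> [S x, y, k]) h \<ominus>\<^bsub>T\<^esub> sweedler H T (\<lambda>x y. \<tau> [S x, y \<otimes>\<^bsub>H\<^esub> k]) h}))"

definition hpar_class ::
    "('k, 's) ring_scheme \<Rightarrow> ('k, 'h, 't) hopf_scheme \<Rightarrow> ('k, 'h) words set \<Rightarrow> ('k, 'h) words set set"
  where "hpar_class K H t =
    (Idl\<^bsub>tensor_algebra K H\<^esub> (hpar_relations K H)) +>\<^bsub>tensor_algebra K H\<^esub> t"

definition Hpar ::
    "('k, 's) ring_scheme \<Rightarrow> ('k, 'h, 't) hopf_scheme \<Rightarrow> ('k, ('k, 'h) words set set) module"
  where "Hpar K H =
    (let Q = tensor_algebra K H Quot (Idl\<^bsub>tensor_algebra K H\<^esub> (hpar_relations K H))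
     in with_smult Q (\<lambda>k t. hpar_class K H (tensor_word K H k []) \<otimes>\<^bsub>Q\<^esub> t))"

definition bracket ::
    "('k, 's) ring_scheme \<Rightarrow> ('k, 'h, 't) hopf_scheme \<Rightarrow> 'h \<Rightarrow> ('k, 'h) words set set"
  where "bracket K H h = hpar_class K H (tensor_word K H \<one>\<^bsub>K\<^esub> [h])"

definition hpar_e ::
    "('k, 's) ring_scheme \<Rightarrow> ('k, 'h, 't) hopf_scheme \<Rightarrow> 'h \<Rightarrow> ('k, 'h) words set set"
  where "hpar_e K H h =
    sweedler H (Hpar K H) (\<lambda>x y. bracket K H x \<otimes>\<^bsub>Hpar K H\<^esub> bracket K H (antipode H y)) h"

definition Bpar ::
    "('k, 's) ring_scheme \<Rightarrow> ('k, 'h, 't) hopf_scheme \<Rightarrow> ('k, ('k, 'h) words set set) module"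
  where "Bpar K H = (Hpar K H)
    \<lparr>carrier := subalgebra_gen K (Hpar K H) (hpar_e K H ` carrier H)\<rparr>"

text \<open>
  An \<open>H\<^sub>p\<^sub>a\<^sub>r\<close>-module structure on a \<open>K\<close>-module \<open>P\<close> is determined by the action \<open>g h\<close> of the
  generators \<open>[h]\<close>: the class of a combination of words acts by applying \<open>g\<close> letter by letter, in
  any representative.  For a left module the last letter acts first, for a right module the first
  one.  Elements of \<open>H\<^sub>p\<^sub>a\<^sub>r\<close> are cosets of cosets of combinations of words, hence the union.
\<close>

definition hpar_eval :: "('k, 'p, 's) module_scheme \<Rightarrow> ('h list \<Rightarrow> 'p) \<Rightarrow> ('k, 'h) words set set \<Rightarrow> 'p"
  where "hpar_eval P f t =
    (let c = (SOME c. c \<in> \<Union>t)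
     in \<Oplus>\<^bsub>P\<^esub>m\<in>Poly_Mapping.keys c. [Poly_Mapping.lookup c m] \<cdot>\<^bsub>P\<^esub> (fst m \<odot>\<^bsub>P\<^esub> f (snd m)))"

definition hpar_left_module ::
    "('k, 'p, 's) module_scheme \<Rightarrow> ('h \<Rightarrow> 'p \<Rightarrow> 'p) \<Rightarrow> (('k, 'h) words set set, 'p) module"
  where "hpar_left_module P g = with_smult P (\<lambda>t p. hpar_eval P (\<lambda>w. foldr g w p) t)"

definition hpar_right_module ::
    "('k, 'p, 's) module_scheme \<Rightarrow> ('h \<Rightarrow> 'p \<Rightarrow> 'p) \<Rightarrow> (('k, 'h) words set set, 'p) module"
  where "hpar_right_module P g = with_smult P (\<lambda>t p. hpar_eval P (\<lambda>w. fold g w p) t)"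


section \<open>Functors between module categories\<close>

text \<open>
  The objects of the category of \<open>R\<close>-modules are the modules whose carrier is contained in a given
  type.  The morphism part of a functor takes the source, the target and the homomorphism.
\<close>

record ('r, 'x, 'q, 'y) mfunctor =
  fobj :: "('r, 'x) module \<Rightarrow> ('q, 'y) module"
  fmor :: "('r, 'x) module \<Rightarrow> ('r, 'x) module \<Rightarrow> ('x \<Rightarrow> 'x) \<Rightarrow> 'y \<Rightarrow> 'y"

definition mcomp ::
    "('q, 'y, 'p, 'z) mfunctor \<Rightarrow> ('r, 'x, 'q, 'y) mfunctor \<Rightarrow> ('r, 'x, 'p, 'z) mfunctor"
    (infixr \<open>\<circ>\<^sub>F\<close> 55)
  where "G \<circ>\<^sub>F F =
    \<lparr>fobj = (\<lambda>X. fobj G (fobj F X)),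
     fmor = (\<lambda>X Y u. fmor G (fobj F X) (fobj F Y) (fmor F X Y u))\<rparr>"

definition covariant_functor ::
    "('r, 's) ring_scheme \<Rightarrow> ('q, 't) ring_scheme \<Rightarrow> ('r, 'x, 'q, 'y) mfunctor \<Rightarrow> bool"
  where "covariant_functor R Q F \<longleftrightarrow>
    (\<forall>X. left_module R X \<longrightarrow>
       left_module Q (fobj F X) \<and>
       fmor F X X (\<lambda>x\<in>carrier X. x) = (\<lambda>y\<in>carrier (fobj F X). y)) \<and>
    (\<forall>X Y u. left_module R X \<and> left_module R Y \<and> u \<in> mod_hom R X Y \<longrightarrow>
       fmor F X Y u \<in> mod_hom Q (fobj F X) (fobj F Y)) \<and>
    (\<forall>X Y Z u v. left_module R X \<and> left_module R Y \<and> left_module R Z \<and>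
       u \<in> mod_hom R X Y \<and> v \<in> mod_hom R Y Z \<longrightarrow>
       fmor F X Z (compose (carrier X) v u) =
       compose (carrier (fobj F X)) (fmor F Y Z v) (fmor F X Y u))"

definition contravariant_functor ::
    "('r, 's) ring_scheme \<Rightarrow> ('q, 't) ring_scheme \<Rightarrow> ('r, 'x, 'q, 'y) mfunctor \<Rightarrow> bool"
  where "contravariant_functor R Q F \<longleftrightarrow>
    (\<forall>X. left_module R X \<longrightarrow>
       left_module Q (fobj F X) \<and>
       fmor F X X (\<lambda>x\<in>carrier X. x) = (\<lambda>y\<in>carrier (fobj F X). y)) \<and>
    (\<forall>X Y u. left_module R X \<and> left_module R Y \<and> u \<in> mod_hom R X Y \<longrightarrow>
       fmor F X Y u \<in> mod_hom Q (fobj F Y) (fobj F X)) \<and>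
    (\<forall>X Y Z u v. left_module R X \<and> left_module R Y \<and> left_module R Z \<and>
       u \<in> mod_hom R X Y \<and> v \<in> mod_hom R Y Z \<longrightarrow>
       fmor F X Z (compose (carrier X) v u) =
       compose (carrier (fobj F Z)) (fmor F X Y u) (fmor F Y Z v))"

definition covariant_nat_iso ::
    "('r, 's) ring_scheme \<Rightarrow> ('q, 't) ring_scheme \<Rightarrow>
      ('r, 'x, 'q, 'y) mfunctor \<Rightarrow> ('r, 'x, 'q, 'z) mfunctor \<Rightarrow> bool"
  where "covariant_nat_iso R Q F G \<longleftrightarrow>
    covariant_functor R Q F \<and> covariant_functor R Q G \<and>
    (\<exists>\<eta>. (\<forall>X. left_module R X \<longrightarrow> \<eta> X \<in> mod_iso Q (fobj F X) (fobj G X)) \<and>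
      (\<forall>X Y u. left_module R X \<and> left_module R Y \<and> u \<in> mod_hom R X Y \<longrightarrow>
        (\<forall>f\<in>carrier (fobj F X). \<eta> Y (fmor F X Y u f) = fmor G X Y u (\<eta> X f))))"

definition contravariant_nat_iso ::
    "('r, 's) ring_scheme \<Rightarrow> ('q, 't) ring_scheme \<Rightarrow>
      ('r, 'x, 'q, 'y) mfunctor \<Rightarrow> ('r, 'x, 'q, 'z) mfunctor \<Rightarrow> bool"
  where "contravariant_nat_iso R Q F G \<longleftrightarrow>
    contravariant_functor R Q F \<and> contravariant_functor R Q G \<and>
    (\<exists>\<eta>. (\<forall>X. left_module R X \<longrightarrow> \<eta> X \<in> mod_iso Q (fobj F X) (fobj G X)) \<and>
      (\<forall>X Y u. left_module R X \<and> left_module R Y \<and> u \<in> mod_hom R X Y \<longrightarrow>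
        (\<forall>f\<in>carrier (fobj F Y). \<eta> X (fmor F X Y u f) = fmor G X Y u (\<eta> Y f))))"

text \<open>The functors \<open>Hom\<^sub>R(-, N)\<close> and \<open>Hom\<^sub>R(X, -)\<close> to \<open>K\<close>-modules, for a \<open>K\<close>-algebra \<open>R\<close>.\<close>

definition Hom_to ::
    "('k, 'r, 's) module_scheme \<Rightarrow> ('r, 'y) module \<Rightarrow> ('r, 'x, 'k, 'x \<Rightarrow> 'y) mfunctor"
  where "Hom_to R N =
    \<lparr>fobj = (\<lambda>X. hom_module R X N),
     fmor = (\<lambda>X Y u. \<lambda>f\<in>mod_hom R Y N. compose (carrier X) f u)\<rparr>"

definition Hom_from ::
    "('k, 'r, 's) module_scheme \<Rightarrow> ('r, 'x) module \<Rightarrow> ('r, 'y, 'k, 'x \<Rightarrow> 'y) mfunctor"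
  where "Hom_from R X =
    \<lparr>fobj = (\<lambda>N. hom_module R X N),
     fmor = (\<lambda>N N' u. \<lambda>f\<in>mod_hom R X N. compose (carrier X) u f)\<rparr>"


section \<open>The functor \<open>Hom\<close> over \<open>A\<^sup>e\<close> out of \<open>A\<close>\<close>

definition restrict_bimodule ::
    "('k, 's) ring_scheme \<Rightarrow> ('k, 'h, 't) hopf_scheme \<Rightarrow> ('k, 'a, 'u) module_scheme \<Rightarrow>
      ('h \<Rightarrow> 'a \<Rightarrow> 'a) \<Rightarrow> ((('a, 'h) tensor, ('a, 'h) tensor) tensor, 'm) module \<Rightarrow>
      (('a, 'a) tensor, 'm) module"
  where "restrict_bimodule K H A act M =
    (let S = smash K H A act; \<iota> = (\<lambda>a. smash_elem K H A act a \<one>\<^bsub>H\<^esub>)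
     in bimodule M (\<lambda>a m. left_act K S M (\<iota> a) m) (\<lambda>m b. right_act K S M m (\<iota> b)))"

text \<open>\<open>[h] \<triangleright> m = (1\<^sub>A # h\<^sub>(\<^sub>1\<^sub>)) \<cdot> m \<cdot> (1\<^sub>A # S(h\<^sub>(\<^sub>2\<^sub>)))\<close>\<close>

definition bimodule_par_act ::
    "('k, 's) ring_scheme \<Rightarrow> ('k, 'h, 't) hopf_scheme \<Rightarrow> ('k, 'a, 'u) module_scheme \<Rightarrow>
      ('h \<Rightarrow> 'a \<Rightarrow> 'a) \<Rightarrow> ((('a, 'h) tensor, ('a, 'h) tensor) tensor, 'm) module \<Rightarrow> 'h \<Rightarrow> 'm \<Rightarrow> 'm"
  where "bimodule_par_act K H A act M h m =
    (let S = smash K H A act; j = smash_elem K H A act \<one>\<^bsub>A\<^esub>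
     in sweedler H M (\<lambda>x y. right_act K S M (left_act K S M (j x) m) (j (antipode H y))) h)"

text \<open>\<open>([h] \<triangleright> f)(a) = [h\<^sub>(\<^sub>1\<^sub>)] \<triangleright> f(S(h\<^sub>(\<^sub>2\<^sub>)) \<cdot> a)\<close>\<close>

definition hom_par_act ::
    "('k, 's) ring_scheme \<Rightarrow> ('k, 'h, 't) hopf_scheme \<Rightarrow> ('k, 'a, 'u) module_scheme \<Rightarrow>
      ('h \<Rightarrow> 'a \<Rightarrow> 'a) \<Rightarrow> ((('a, 'h) tensor, ('a, 'h) tensor) tensor, 'm) module \<Rightarrow>
      'h \<Rightarrow> ('a \<Rightarrow> 'm) \<Rightarrow> 'a \<Rightarrow> 'm"
  where "hom_par_act K H A act M h f =
    (\<lambda>a\<in>carrier A.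
      sweedler H M (\<lambda>x y. bimodule_par_act K H A act M x (f (act (antipode H y) a))) h)"

definition Hom_A ::
    "('k, 's) ring_scheme \<Rightarrow> ('k, 'h, 't) hopf_scheme \<Rightarrow> ('k, 'a, 'u) module_scheme \<Rightarrow>
      ('h \<Rightarrow> 'a \<Rightarrow> 'a) \<Rightarrow> ((('a, 'h) tensor, ('a, 'h) tensor) tensor, 'm) module \<Rightarrow>
      (('k, 'h) words set set, 'a \<Rightarrow> 'm) module"
  where "Hom_A K H A act M =
    hpar_left_module
      (hom_module (env K A) (regular_bimodule A) (restrict_bimodule K H A act M))
      (hom_par_act K H A act M)"

definition Hom_A_functor ::
    "('k, 's) ring_scheme \<Rightarrow> ('k, 'h, 't) hopf_scheme \<Rightarrow> ('k, 'a, 'u) module_scheme \<Rightarrow>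
      ('h \<Rightarrow> 'a \<Rightarrow> 'a) \<Rightarrow>
      ((('a, 'h) tensor, ('a, 'h) tensor) tensor, 'm, ('k, 'h) words set set, 'a \<Rightarrow> 'm) mfunctor"
  where "Hom_A_functor K H A act =
    \<lparr>fobj = Hom_A K H A act,
     fmor = (\<lambda>M M' u. \<lambda>f\<in>carrier (Hom_A K H A act M). compose (carrier A) u f)\<rparr>"


section \<open>The functor \<open>- \<otimes>\<^sub>B A#H\<close>\<close>

text \<open>The right module with \<open>x \<cdot> [h] = [S(h)] \<cdot> x\<close>.\<close>

definition right_twist ::
    "('k, 's) ring_scheme \<Rightarrow> ('k, 'h, 't) hopf_scheme \<Rightarrow> (('k, 'h) words set set, 'x) module \<Rightarrow>
      (('k, 'h) words set set, 'x) module"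
  where "right_twist K H X =
    hpar_right_module (restrict_K (Hpar K H) X) (\<lambda>h x. bracket K H (antipode H h) \<odot>\<^bsub>X\<^esub> x)"

definition smash_par_module ::
    "('k, 's) ring_scheme \<Rightarrow> ('k, 'h, 't) hopf_scheme \<Rightarrow> ('k, 'a, 'u) module_scheme \<Rightarrow>
      ('h \<Rightarrow> 'a \<Rightarrow> 'a) \<Rightarrow> (('k, 'h) words set set, ('a, 'h) tensor) module"
  where "smash_par_module K H A act =
    hpar_left_module (smash K H A act) (\<lambda>h. smash_mult K H A act (smash_elem K H A act \<one>\<^bsub>A\<^esub> h))"

definition balanced ::
    "('k, 's) ring_scheme \<Rightarrow> ('k, 'h, 't) hopf_scheme \<Rightarrow> ('k, 'a, 'u) module_scheme \<Rightarrow>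
      ('h \<Rightarrow> 'a \<Rightarrow> 'a) \<Rightarrow> (('k, 'h) words set set, 'x) module \<Rightarrow> ('x, ('a, 'h) tensor) tensor ring"
  where "balanced K H A act X =
    tensor_group (Bpar K H) (right_twist K H X) (smash_par_module K H A act)"

definition balanced_pure ::
    "('k, 's) ring_scheme \<Rightarrow> ('k, 'h, 't) hopf_scheme \<Rightarrow> ('k, 'a, 'u) module_scheme \<Rightarrow>
      ('h \<Rightarrow> 'a \<Rightarrow> 'a) \<Rightarrow> (('k, 'h) words set set, 'x) module \<Rightarrow>
      'x \<Rightarrow> ('a, 'h) tensor \<Rightarrow> ('x, ('a, 'h) tensor) tensor"
  where "balanced_pure K H A act X =
    pure_tensor (Bpar K H) (right_twist K H X) (smash_par_module K H A act)"

text \<open>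
  \<open>(a # h) \<cdot> (x \<otimes>\<^sub>B c) = [h\<^sub>(\<^sub>1\<^sub>)] \<cdot> x \<otimes>\<^sub>B (a # h\<^sub>(\<^sub>2\<^sub>)) c\<close>, extended additively: an element
  \<open>p = \<Sum>\<^sub>i a\<^sub>i \<otimes> h\<^sub>i\<close> of \<open>A#H\<close> satisfies \<open>p = p(1\<^sub>A \<otimes> 1\<^sub>H) = \<Sum>\<^sub>i a\<^sub>i # h\<^sub>i\<close>.
\<close>

definition balanced_left ::
    "('k, 's) ring_scheme \<Rightarrow> ('k, 'h, 't) hopf_scheme \<Rightarrow> ('k, 'a, 'u) module_scheme \<Rightarrow>
      ('h \<Rightarrow> 'a \<Rightarrow> 'a) \<Rightarrow> (('k, 'h) words set set, 'x) module \<Rightarrow>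
      ('a, 'h) tensor \<Rightarrow> ('x, ('a, 'h) tensor) tensor \<Rightarrow> ('x, ('a, 'h) tensor) tensor"
  where "balanced_left K H A act X p z =
    tensor_lift (balanced K H A act X) (\<lambda>a h.
      tensor_lift (balanced K H A act X) (\<lambda>x c.
        sweedler H (balanced K H A act X) (\<lambda>u v.
          balanced_pure K H A act X
            (bracket K H u \<odot>\<^bsub>X\<^esub> x) (smash_mult K H A act (smash_elem K H A act a v) c)) h) z) p"

definition balanced_right ::
    "('k, 's) ring_scheme \<Rightarrow> ('k, 'h, 't) hopf_scheme \<Rightarrow> ('k, 'a, 'u) module_scheme \<Rightarrow>
      ('h \<Rightarrow> 'a \<Rightarrow> 'a) \<Rightarrow> (('k, 'h) words set set, 'x) module \<Rightarrow>
      ('x, ('a, 'h) tensor) tensor \<Rightarrow> ('a, 'h) tensor \<Rightarrow> ('x, ('a, 'h) tensor) tensor"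
  where "balanced_right K H A act X z q =
    tensor_lift (balanced K H A act X)
      (\<lambda>x c. balanced_pure K H A act X x (smash_mult K H A act c q)) z"

definition tensor_smash ::
    "('k, 's) ring_scheme \<Rightarrow> ('k, 'h, 't) hopf_scheme \<Rightarrow> ('k, 'a, 'u) module_scheme \<Rightarrow>
      ('h \<Rightarrow> 'a \<Rightarrow> 'a) \<Rightarrow> (('k, 'h) words set set, 'x) module \<Rightarrow>
      ((('a, 'h) tensor, ('a, 'h) tensor) tensor, ('x, ('a, 'h) tensor) tensor) module"
  where "tensor_smash K H A act X =
    bimodule (balanced K H A act X) (balanced_left K H A act X) (balanced_right K H A act X)"

definition tensor_smash_functor ::
    "('k, 's) ring_scheme \<Rightarrow> ('k, 'h, 't) hopf_scheme \<Rightarrow> ('k, 'a, 'u) module_scheme \<Rightarrow>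
      ('h \<Rightarrow> 'a \<Rightarrow> 'a) \<Rightarrow>
      (('k, 'h) words set set, 'x,
       (('a, 'h) tensor, ('a, 'h) tensor) tensor, ('x, ('a, 'h) tensor) tensor) mfunctor"
  where "tensor_smash_functor K H A act =
    \<lparr>fobj = tensor_smash K H A act,
     fmor = (\<lambda>X Y u. \<lambda>z\<in>carrier (tensor_smash K H A act X).
       tensor_lift (tensor_smash K H A act Y) (\<lambda>x c. balanced_pure K H A act Y (u x) c) z)\<rparr>"

end

theory Submission
  imports Defs
begin

text \<open>
  Write \<open>S = A#H\<close>, \<open>\<S>\<close> for the antipode, \<open>\<iota>(a) = a#1\<close> and \<open>\<pi>(h) = 1#h\<close>, so that \<open>a#h = \<iota>(a)\<pi>(h)\<close>.
  An \<open>A\<close>-bimodule map \<open>f : A \<rightarrow> M\<close> is \<open>a \<mapsto> \<iota>(a)m\<close> for \<open>m = f(1)\<close>, and \<open>m\<close> ranges over the central elements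
  \<open>Z(M) = {m. \<iota>(a)m = m\<iota>(a) for all a}\<close> (\<open>hom_cfun\<close>, \<open>cfun_hom\<close>).  Under this identification \<open>[h]\<close> acts on
  \<open>Hom(A, M)\<close> as \<open>[h] \<triangleright> m = \<pi>(h\<^sub>1)m\<pi>(\<S>(h\<^sub>2))\<close> on \<open>Z(M)\<close> (\<open>hom_par_act_cfun\<close>), and the theorem says that for an
  \<open>H\<^sub>p\<^sub>a\<^sub>r\<close>-module \<open>X\<close> the \<open>H\<^sub>p\<^sub>a\<^sub>r\<close>-linear maps \<open>\<phi> : X \<rightarrow> Z(M)\<close> correspond to the bimodule maps
  \<open>G : X \<otimes>\<^sub>B S \<rightarrow> M\<close> by
    \<open>G(x \<otimes> c) = \<phi>(x)c\<close> and \<open>\<phi>(x) = G(x \<otimes> 1)\<close>.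

  From \<open>\<phi>\<close> to \<open>G\<close>: the generator \<open>e\<^sub>h = [h\<^sub>1][\<S>(h\<^sub>2)]\<close> of \<open>B\<close> acts on \<open>Z(M)\<close> as multiplication by the central
  element \<open>\<iota>(h\<cdot>1)\<close> (\<open>twist_partial_rep\<close>), so \<open>G\<close> is balanced (\<open>F_balanced\<close>); and \<open>([h\<^sub>1] \<triangleright> m)\<pi>(h\<^sub>2) = \<pi>(h)m\<close>
  (\<open>twist_\<pi>\<close>) makes it left linear (\<open>F_lact\<close>).  From \<open>G\<close> to \<open>\<phi>\<close>: in \<open>X \<otimes>\<^sub>B S\<close> one has
  \<open>\<pi>(h\<^sub>1)(x \<otimes> 1)\<pi>(\<S>(h\<^sub>2)) = [h]x \<otimes> 1\<close> (\<open>twist_pure\<close>), so \<open>\<phi>\<close> is linear over \<open>H\<^sub>p\<^sub>a\<^sub>r\<close> (\<open>G_br\<close>).  The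
  two constructions are visibly inverse to each other (\<open>adjunct_iso\<close>) and natural in \<open>X\<close> and in \<open>M\<close>.

  Before that, the objects themselves have to be shown to be what their names say: \<open>S\<close> is an algebra,
  \<open>H\<^sub>p\<^sub>a\<^sub>r\<close> is the algebra universal for partial representations, \<open>Z(M)\<close>, \<open>S\<close> and \<open>X\<close> carry such
  representations (\<open>partial_rep_criterion\<close>, \<open>right_twist_antirep\<close>), and the left action on \<open>X \<otimes>\<^sub>B S\<close> is
  well defined (\<open>lact_eH\<close>).  Cocommutativity enters through \<open>\<S>\<^sup>2 = id\<close>, through \<open>\<Delta>(\<S>(h)) = \<S>(h\<^sub>1) \<otimes> \<S>(h\<^sub>2)\<close>, and
  as the freedom to permute the Sweedler factors of \<open>h\<close>.
\<close>

section \<open>Notation\<close>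

text \<open>
  A structure index that is a single symbol is written as a subscript, \<open>x \<otimes>\<^sub>S y\<close>, and \<open>x : X\<close> stands for
  membership in the carrier of \<open>X\<close>, in place of membership in a set.
\<close>

syntax "_index" :: "logic \<Rightarrow> index" (\<open>\<^sub>_\<close> [1000] 1000)

no_notation (ASCII) Set.member (\<open>(\<open>notation=\<open>infix :\<close>\<close>_/ : _)\<close> [51, 51] 50)

abbreviation in_carrier (\<open>(_/ : _)\<close> [51, 51] 50)
  where "x : X \<equiv> x \<in> carrier X"

type_synonym ('a, 'h, 'm) smash_env_module = "((('a, 'h) tensor, ('a, 'h) tensor) tensor, 'm) module"
type_synonym ('k, 'h, 'x) par_module = "(('k, 'h) words set set, 'x) module"

section \<open>Additive maps and finite integer combinations\<close>

definition additive_map :: "('p, 's) ring_scheme \<Rightarrow> ('q, 't) ring_scheme \<Rightarrow> ('p \<Rightarrow> 'q) \<Rightarrow> bool"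
  where "additive_map P Q \<phi> \<longleftrightarrow> \<phi> \<in> carrier P \<rightarrow> carrier Q \<and>
    (\<forall>x\<in>carrier P. \<forall>y\<in>carrier P. \<phi> (x \<oplus>\<^sub>P y) = \<phi> x \<oplus>\<^sub>Q \<phi> y)"

lemma additive_mapI:
  assumes "\<And>x. x : P ==> \<phi> x : Q"
    and "\<And>x y. [|x : P; y : P|] ==> \<phi> (x \<oplus>\<^sub>P y) = \<phi> x \<oplus>\<^sub>Q \<phi> y"
  shows "additive_map P Q \<phi>"
  using assms by (auto simp: additive_map_def)

lemma additive_mapD:
  assumes "additive_map P Q \<phi>"
  shows "x : P ==> \<phi> x : Q"
    and "[|x : P; y : P|] ==> \<phi> (x \<oplus>\<^sub>P y) = \<phi> x \<oplus>\<^sub>Q \<phi> y"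
  using assms by (auto simp: additive_map_def)

lemma additive_map_group_hom:
  assumes "additive_map P Q \<phi>" "abelian_group P" "abelian_group Q"
  shows "group_hom (add_monoid P) (add_monoid Q) \<phi>"
  using assms by (auto simp: group_hom_def group_hom_axioms_def hom_def additive_map_def
      intro: abelian_group.a_group)

lemma additive_map_zero:
  assumes "additive_map P Q \<phi>" "abelian_group P" "abelian_group Q"
  shows "\<phi> \<zero>\<^sub>P = \<zero>\<^sub>Q"
  using group_hom.hom_one[OF additive_map_group_hom[OF assms]] by simp

lemma additive_map_minus:
  assumes "additive_map P Q \<phi>" "abelian_group P" "abelian_group Q" "x : P"
  shows "\<phi> (\<ominus>\<^sub>P x) = \<ominus>\<^sub>Q \<phi> x"
  using group_hom.hom_inv[OF additive_map_group_hom[OF assms(1-3)]] assms(4)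
  by (simp add: a_inv_def)

lemma additive_map_int_mult:
  assumes "additive_map P Q \<phi>" "abelian_group P" "abelian_group Q" "x : P"
  shows "\<phi> ([(n::int)] \<cdot>\<^sub>P x) = [n] \<cdot>\<^sub>Q \<phi> x"
  using group_hom.hom_int_pow[OF additive_map_group_hom[OF assms(1-3)]] assms(4)
  by (simp add: add_pow_def)

lemma additive_map_finsum:
  assumes "additive_map P Q \<phi>" "abelian_group P" "abelian_group Q" "g \<in> I \<rightarrow> carrier P"
  shows "\<phi> (finsum P g I) = finsum Q (\<lambda>i. \<phi> (g i)) I"
proof -
  interpret P: abelian_group P by fact
  interpret Q: abelian_group Q by fact
  show ?thesis
  proof (cases "finite I")
    case True
    then show ?thesis using assms(4)
    proof (induction I)
      case (insert i I)
      then show ?case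
        using additive_mapD[OF assms(1)] by (simp add: Pi_iff)
    qed (simp add: additive_map_zero[OF assms(1-3)])
  qed (simp add: additive_map_zero[OF assms(1-3)])
qed

lemma additive_map_comp:
  assumes "additive_map P Q \<phi>" "additive_map Q R \<psi>"
  shows "additive_map P R (\<lambda>x. \<psi> (\<phi> x))"
  using assms by (intro additive_mapI) (simp_all add: additive_mapD[OF assms(1)] additive_mapD[OF assms(2)])

text \<open>
  The additive extension of \<open>F\<close> from a basis to the free abelian group on it.  Maps out of tensor products
  and of tensor algebras are such sums, evaluated on a representative of a coset.
\<close>

definition frag_sum :: "('p, 's) ring_scheme \<Rightarrow> ('i \<Rightarrow> 'p) \<Rightarrow> ('i \<Rightarrow>\<^sub>0 int) \<Rightarrow> 'p"
  where "frag_sum P F c = (\<Oplus>\<^bsub>P\<^esub>i\<in>Poly_Mapping.keys c. [Poly_Mapping.lookup c i] \<cdot>\<^sub>P F i)"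

context abelian_group
begin

lemma diff_eq_zero_iff:
  "[|x : G; y : G|] ==> x \<ominus> y = \<zero> \<longleftrightarrow> x = y"
  by (metis a_minus_def add.inv_closed minus_equality minus_minus r_neg)

lemma diff_diff_eq_zero_iff:
  "[|x : G; y : G; z : G|] ==> x \<ominus> y \<ominus> z = \<zero> \<longleftrightarrow> x = y \<oplus> z"
  using diff_eq_zero_iff[of x "y \<oplus> z"] by (simp add: a_minus_def a_assoc minus_add)

lemma int_mult_closed [simp]: "x : G ==> [(n::int)] \<cdot> x : G"
  by (rule add.int_pow_closed)

lemma int_mult_add: "x : G ==> [(m + n::int)] \<cdot> x = [m] \<cdot> x \<oplus> [n] \<cdot> x"
  by (rule add.int_pow_mult[symmetric, THEN sym])

lemma int_mult_distrib:
  "[|x : G; y : G|] ==> [(n::int)] \<cdot> (x \<oplus> y) = [n] \<cdot> x \<oplus> [n] \<cdot> y"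
  by (rule add.int_pow_distrib)

lemma int_mult_simps [simp]:
  "[(0::int)] \<cdot> x = \<zero>" "x : G ==> [(1::int)] \<cdot> x = x" "[(n::int)] \<cdot> \<zero> = \<zero>"
  using add.int_pow_1[of x] add.int_pow_one[of n] by (simp_all add: add_pow_def)

lemma frag_sum_closed:
  assumes "\<And>i. i \<in> U ==> F i : G" "Poly_Mapping.keys c \<subseteq> U"
  shows "frag_sum G F c : G"
  unfolding frag_sum_def using assms by (auto intro!: finsum_closed)

lemma frag_sum_over:
  assumes "finite B" "Poly_Mapping.keys c \<subseteq> B" "\<And>i. i \<in> B ==> F i : G"
  shows "frag_sum G F c = (\<Oplus>i\<in>B. [Poly_Mapping.lookup c i] \<cdot> F i)"
  unfolding frag_sum_def
  using assms by (intro add.finprod_mono_neutral_cong_left) (auto simp: in_keys_iff)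

lemma frag_sum_add:
  assumes "\<And>i. i \<in> U ==> F i : G" "Poly_Mapping.keys c \<subseteq> U" "Poly_Mapping.keys d \<subseteq> U"
  shows "frag_sum G F (c + d) = frag_sum G F c \<oplus> frag_sum G F d"
proof -
  let ?B = "Poly_Mapping.keys c \<union> Poly_Mapping.keys d"
  have F: "\<And>i. i \<in> ?B ==> F i : G" using assms by auto
  have "frag_sum G F (c + d) = (\<Oplus>i\<in>?B. [Poly_Mapping.lookup (c + d) i] \<cdot> F i)"
    using F Poly_Mapping.keys_add[of c d] by (intro frag_sum_over) auto
  also have "\<dots> = (\<Oplus>i\<in>?B. [Poly_Mapping.lookup c i] \<cdot> F i \<oplus> [Poly_Mapping.lookup d i] \<cdot> F i)"
    using F by (intro finsum_cong') (auto simp: lookup_add int_mult_add)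
  also have "\<dots> = (\<Oplus>i\<in>?B. [Poly_Mapping.lookup c i] \<cdot> F i) \<oplus> (\<Oplus>i\<in>?B. [Poly_Mapping.lookup d i] \<cdot> F i)"
    using F by (intro finsum_addf) auto
  also have "\<dots> = frag_sum G F c \<oplus> frag_sum G F d"
    using F frag_sum_over[of ?B c F] frag_sum_over[of ?B d F] by simp
  finally show ?thesis .
qed

lemma frag_sum_zero [simp]: "frag_sum G F 0 = \<zero>"
  by (simp add: frag_sum_def)

lemma frag_sum_of:
  assumes "F i : G"
  shows "frag_sum G F (frag_of i) = F i"
  using assms by (simp add: frag_sum_def keys_frag_of finsum_insert)

lemma frag_sum_uminus:
  assumes "\<And>i. i \<in> U ==> F i : G" "Poly_Mapping.keys c \<subseteq> U"
  shows "frag_sum G F (- c) = \<ominus> frag_sum G F c"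
proof -
  have "frag_sum G F (- c) \<oplus> frag_sum G F c = \<zero>"
    using frag_sum_add[where F=F and U=U and c="- c" and d=c] assms by simp
  then show ?thesis
    using assms by (intro minus_equality[symmetric]) (auto intro!: frag_sum_closed[where U=U])
qed

lemma frag_sum_diff:
  assumes "\<And>i. i \<in> U ==> F i : G" "Poly_Mapping.keys c \<subseteq> U" "Poly_Mapping.keys d \<subseteq> U"
  shows "frag_sum G F (c - d) = frag_sum G F c \<ominus> frag_sum G F d"
  using frag_sum_add[where F=F and U=U and c=c and d="- d"]
    frag_sum_uminus[where F=F and U=U and c=d] assms
  by (simp add: a_minus_def)

lemma frag_sum_hom:
  assumes "\<And>i. i \<in> U ==> F i : G"
  shows "frag_sum G F \<in> hom (free_Abelian_group U) (add_monoid G)"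
  using assms by (auto simp: hom_def frag_sum_add[where U=U] intro!: frag_sum_closed[where U=U])

lemma frag_sum_cong:
  assumes "\<And>i. i \<in> U ==> F i = F' i" "\<And>i. i \<in> U ==> F' i : G" "Poly_Mapping.keys c \<subseteq> U"
  shows "frag_sum G F c = frag_sum G F' c"
  unfolding frag_sum_def using assms
  by (intro finsum_cong') (auto simp: subset_iff)

lemma frag_sum_map:
  assumes "additive_map G Q \<phi>" "abelian_group Q"
    and "\<And>i. i \<in> U ==> F i : G" "Poly_Mapping.keys c \<subseteq> U"
  shows "\<phi> (frag_sum G F c) = frag_sum Q (\<lambda>i. \<phi> (F i)) c"
proof -
  interpret Q: abelian_group Q by fact
  have F: "\<And>i. i \<in> Poly_Mapping.keys c ==> F i : G" using assms by auto
  have "\<phi> (frag_sum G F c) = (\<Oplus>\<^bsub>Q\<^esub>i\<in>Poly_Mapping.keys c. \<phi> ([Poly_Mapping.lookup c i] \<cdot> F i))"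
    unfolding frag_sum_def
    using assms F by (intro additive_map_finsum) (auto intro: abelian_group_axioms)
  also have "\<dots> = frag_sum Q (\<lambda>i. \<phi> (F i)) c"
    unfolding frag_sum_def
    using F additive_mapD(1)[OF assms(1)] assms(2)
    by (intro Q.finsum_cong') (auto simp: additive_map_int_mult[OF assms(1) abelian_group_axioms])
  finally show ?thesis .
qed

lemma frag_sum_add_fun:
  assumes "\<And>i. i \<in> U ==> F i : G" "\<And>i. i \<in> U ==> F' i : G"
    and "Poly_Mapping.keys c \<subseteq> U"
  shows "frag_sum G (\<lambda>i. F i \<oplus> F' i) c = frag_sum G F c \<oplus> frag_sum G F' c"
proof -
  have F: "\<And>i. i \<in> Poly_Mapping.keys c ==> F i : G \<and> F' i : G" using assms by auto
  have "frag_sum G (\<lambda>i. F i \<oplus> F' i) c =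
    (\<Oplus>i\<in>Poly_Mapping.keys c. [Poly_Mapping.lookup c i] \<cdot> F i \<oplus> [Poly_Mapping.lookup c i] \<cdot> F' i)"
    unfolding frag_sum_def using F by (intro finsum_cong') (auto simp: int_mult_distrib)
  also have "\<dots> = frag_sum G F c \<oplus> frag_sum G F' c"
    unfolding frag_sum_def using F by (intro finsum_addf) auto
  finally show ?thesis .
qed

lemma frag_sum_additive:
  assumes "\<And>i. i \<in> U ==> additive_map P G (\<lambda>x. F x i)" "Poly_Mapping.keys c \<subseteq> U"
  shows "additive_map P G (\<lambda>x. frag_sum G (F x) c)"
proof (rule additive_mapI)
  fix x y assume xy: "x : P" "y : P"
  have "frag_sum G (F (x \<oplus>\<^sub>P y)) c = frag_sum G (\<lambda>i. F x i \<oplus> F y i) c"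
    using xy additive_mapD[OF assms(1)] assms(2) by (intro frag_sum_cong[where U=U]) auto
  also have "\<dots> = frag_sum G (F x) c \<oplus> frag_sum G (F y) c"
    using xy additive_mapD[OF assms(1)] assms(2) by (intro frag_sum_add_fun[where U=U]) auto
  finally show "frag_sum G (F (x \<oplus>\<^sub>P y)) c = frag_sum G (F x) c \<oplus> frag_sum G (F y) c" .
next
  fix x assume "x : P"
  then show "frag_sum G (F x) c : G"
    using additive_mapD(1)[OF assms(1)] assms(2) by (intro frag_sum_closed[where U=U]) auto
qed

lemma frag_sum_swap:
  assumes F: "\<And>i j. i \<in> U ==> j \<in> V ==> F i j : G"
    and c: "Poly_Mapping.keys c \<subseteq> U" and d: "Poly_Mapping.keys d \<subseteq> V"
  shows "frag_sum G (\<lambda>i. frag_sum G (F i) d) c = frag_sum G (\<lambda>j. frag_sum G (\<lambda>i. F i j) c) d"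
proof -
  have neg: "additive_map G G (\<lambda>x. \<ominus> x)"
    by (rule additive_mapI) (auto simp: minus_add)
  have H: "\<And>i. i \<in> U ==> frag_sum G (F i) d : G"
    using F d by (intro frag_sum_closed[where U=V]) auto
  from c have "Poly_Mapping.keys c \<subseteq> U \<and> ?thesis"
  proof (induction c rule: frag_induction)
    case zero
    have "frag_sum G (\<lambda>j. \<zero>) d = \<zero>"
      unfolding frag_sum_def by (intro add.finprod_one_eqI) simp
    then show ?case by simp
  next
    case (one i)
    have "frag_sum G (\<lambda>i. frag_sum G (F i) d) (frag_of i) = frag_sum G (F i) d"
      using one H by (intro frag_sum_of) auto
    also have "\<dots> = frag_sum G (\<lambda>j. frag_sum G (\<lambda>i. F i j) (frag_of i)) d"
      using F d one by (intro frag_sum_cong[where U=V]) (auto simp: frag_sum_of)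
    finally show ?case using one by (simp add: keys_frag_of)
  next
    case (diff a b)
    then have ab: "Poly_Mapping.keys a \<subseteq> U" "Poly_Mapping.keys b \<subseteq> U" by auto
    let ?L = "\<lambda>c. frag_sum G (\<lambda>i. frag_sum G (F i) d) c"
    let ?f = "\<lambda>c j. frag_sum G (\<lambda>i. F i j) c"
    have f: "?f c j : G" if "Poly_Mapping.keys c \<subseteq> U" "j \<in> V" for c j
      using F that by (intro frag_sum_closed[where U=U]) auto
    have "frag_sum G (?f (a - b)) d = frag_sum G (\<lambda>j. ?f a j \<oplus> \<ominus> ?f b j) d"
      using ab F d by (intro frag_sum_cong[where U=V])
        (auto simp: frag_sum_diff[where U=U] a_minus_def intro!: f)
    also have "\<dots> = frag_sum G (?f a) d \<oplus> frag_sum G (\<lambda>j. \<ominus> ?f b j) d"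
      using ab d f by (intro frag_sum_add_fun[where U=V]) auto
    also have "frag_sum G (\<lambda>j. \<ominus> ?f b j) d = \<ominus> frag_sum G (?f b) d"
      using ab d f by (intro frag_sum_map[OF neg abelian_group_axioms, where U=V, symmetric]) auto
    finally have "frag_sum G (?f (a - b)) d = ?L a \<ominus> ?L b"
      using diff by (simp add: a_minus_def)
    moreover have "?L (a - b) = ?L a \<ominus> ?L b"
      using ab H by (intro frag_sum_diff[where U=U]) auto
    moreover have "Poly_Mapping.keys (a - b) \<subseteq> U" using ab Poly_Mapping.keys_diff[of a b] by blast
    ultimately show ?case by simp
  qed
  then show ?thesis ..
qed

end

section \<open>Tensor products over a ring\<close>

definition middle_linear ::
    "('r, 's) ring_scheme \<Rightarrow> ('r, 'x, 't) module_scheme \<Rightarrow> ('r, 'y, 'u) module_scheme \<Rightarrow>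
      ('p, 'v) ring_scheme \<Rightarrow> ('x \<Rightarrow> 'y \<Rightarrow> 'p) \<Rightarrow> bool"
  where "middle_linear R X Y P f \<longleftrightarrow>
    (\<forall>x\<in>carrier X. additive_map Y P (f x)) \<and>
    (\<forall>y\<in>carrier Y. additive_map X P (\<lambda>x. f x y)) \<and>
    (\<forall>r\<in>carrier R. \<forall>x\<in>carrier X. \<forall>y\<in>carrier Y. f (r \<odot>\<^sub>X x) y = f x (r \<odot>\<^sub>Y y))"

lemma middle_linearI:
  assumes "\<And>x. x : X ==> additive_map Y P (f x)"
    and "\<And>y. y : Y ==> additive_map X P (\<lambda>x. f x y)"
    and "\<And>r x y. [|r : R; x : X; y : Y|] ==> f (r \<odot>\<^sub>X x) y = f x (r \<odot>\<^sub>Y y)"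
  shows "middle_linear R X Y P f"
  using assms by (auto simp: middle_linear_def)

lemma middle_linearD:
  assumes "middle_linear R X Y P f"
  shows "x : X ==> additive_map Y P (f x)"
    and "y : Y ==> additive_map X P (\<lambda>x. f x y)"
    and "[|r : R; x : X; y : Y|] ==> f (r \<odot>\<^sub>X x) y = f x (r \<odot>\<^sub>Y y)"
    and "[|x : X; y : Y|] ==> f x y : P"
  using assms by (auto simp: middle_linear_def additive_map_def)

lemma tensor_lift_eq_frag_sum:
  "tensor_lift P f t = frag_sum P (\<lambda>p. f (fst p) (snd p)) (SOME c. c \<in> t)"
  by (simp add: tensor_lift_def frag_sum_def Let_def)

text \<open>
  Over a noncommutative ring the tensor product only needs that the scalars act by endomaps of the
  two carriers.
\<close>

locale tensor_pair = X: abelian_group X + Y: abelian_group Y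
  for R :: "('r, 's) ring_scheme" and X :: "('r, 'x, 't) module_scheme"
    and Y :: "('r, 'y, 'u) module_scheme" +
  assumes X_smult_closed: "[|r : R; x : X|] ==> r \<odot>\<^sub>X x : X"
    and Y_smult_closed: "[|r : R; y : Y|] ==> r \<odot>\<^sub>Y y : Y"
begin

abbreviation "FG \<equiv> free_Abelian_group (carrier X \<times> carrier Y)"
abbreviation "N \<equiv> tensor_kernel R X Y"
abbreviation "T \<equiv> tensor_group R X Y"
abbreviation "pure \<equiv> pure_tensor R X Y"

lemma frag_of_FG: "[|x : X; y : Y|] ==> frag_of (x, y) : FG"
  by (simp add: keys_frag_of)

lemma diff_FG: "[|c : FG; d : FG|] ==> c - d : FG"
  using keys_diff[of c d] by auto

lemma relations_FG: "tensor_relations R X Y \<subseteq> carrier FG"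
  unfolding tensor_relations_def
  by (auto simp del: carrier_free_Abelian_group_iff
      intro!: diff_FG frag_of_FG X_smult_closed Y_smult_closed)

lemma N_normal: "N \<lhd> FG"
  unfolding tensor_kernel_def
  by (rule comm_group.subgroup_imp_normal[OF abelian_free_Abelian_group])
    (rule group.generate_is_subgroup[OF group_free_Abelian_group relations_FG])

lemma N_subgroup: "subgroup N FG"
  using N_normal by (simp add: normal_def)

lemma T_simps:
  "carrier T = rcosets\<^bsub>FG\<^esub> N" "zero T = N" "add T = (<#>\<^bsub>FG\<^esub>)"
  by (simp_all add: tensor_group_def Let_def FactGroup_def)

lemma T_monoid: "\<lparr>carrier = carrier T, mult = add T, one = zero T\<rparr> = FG Mod N"
  by (simp add: T_simps FactGroup_def)

lemma T_abelian: "abelian_group T"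
proof (rule abelian_group.intro, rule abelian_monoid.intro)
  have "comm_group (FG Mod N)"
    by (rule comm_group.abelian_FactGroup[OF abelian_free_Abelian_group N_subgroup])
  then show "comm_monoid (add_monoid T)" "abelian_group_axioms T"
    by (auto simp: T_monoid abelian_group_axioms_def comm_group_def)
qed

sublocale T: abelian_group T by (rule T_abelian)

lemma coset_closed: "c : FG ==> N #>\<^bsub>FG\<^esub> c : T"
  unfolding T_simps by (auto simp: RCOSETS_def)

lemma coset_cases:
  assumes "t : T"
  obtains c where "c : FG" "t = N #>\<^bsub>FG\<^esub> c"
  using assms unfolding T_simps by (auto simp: RCOSETS_def)

lemma coset_add: "[|c : FG; d : FG|] ==>
    (N #>\<^bsub>FG\<^esub> c) \<oplus>\<^sub>T (N #>\<^bsub>FG\<^esub> d) = N #>\<^bsub>FG\<^esub> (c + d)"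
  using normal.rcos_sum[OF N_normal, of c d] by (simp add: T_simps)

lemma coset_zero: "n \<in> N ==> N #>\<^bsub>FG\<^esub> n = \<zero>\<^sub>T"
  using subgroup.rcos_const[OF N_subgroup group_free_Abelian_group] by (simp add: T_simps)

lemma coset_minus: 
  assumes "c : FG" shows "N #>\<^bsub>FG\<^esub> (- c) = \<ominus>\<^sub>T (N #>\<^bsub>FG\<^esub> c)"
proof -
  have m: "- c : FG" using assms by simp
  have "(N #>\<^bsub>FG\<^esub> (- c)) \<oplus>\<^sub>T (N #>\<^bsub>FG\<^esub> c) = \<zero>\<^sub>T"
    unfolding coset_add[OF m assms] using subgroup.one_closed[OF N_subgroup] by (simp add: coset_zero)
  then show ?thesis
    by (intro T.minus_equality[symmetric]) (auto intro!: coset_closed m assms)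
qed

lemma coset_diff: "[|c : FG; d : FG|] ==>
    N #>\<^bsub>FG\<^esub> (c - d) = (N #>\<^bsub>FG\<^esub> c) \<ominus>\<^sub>T (N #>\<^bsub>FG\<^esub> d)"
  using coset_add[of c "- d"] coset_minus[of d] by (simp add: a_minus_def)

lemma pure_closed [simp, intro]: "[|x : X; y : Y|] ==> pure x y : T"
  unfolding pure_tensor_def by (intro coset_closed frag_of_FG)

lemma relation_coset: "n \<in> tensor_relations R X Y ==> N #>\<^bsub>FG\<^esub> n = \<zero>\<^sub>T"
  by (rule coset_zero) (simp add: tensor_kernel_def generate.incl)

lemma pure_add_left:
  assumes "x : X" "x' : X" "y : Y"
  shows "pure (x \<oplus>\<^sub>X x') y = pure x y \<oplus>\<^sub>T pure x' y"
proof -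
  have "N #>\<^bsub>FG\<^esub> (frag_of (x \<oplus>\<^sub>X x', y) - frag_of (x, y) - frag_of (x', y)) = \<zero>\<^sub>T"
    by (rule relation_coset) (use assms in \<open>auto simp: tensor_relations_def\<close>)
  then have "pure (x \<oplus>\<^sub>X x') y \<ominus>\<^sub>T pure x y \<ominus>\<^sub>T pure x' y = \<zero>\<^sub>T"
    using assms by (simp add: coset_diff diff_FG frag_of_FG pure_tensor_def
        del: carrier_free_Abelian_group_iff)
  then show ?thesis
    using assms by (simp add: T.diff_diff_eq_zero_iff)
qed

lemma pure_add_right:
  assumes "x : X" "y : Y" "y' : Y"
  shows "pure x (y \<oplus>\<^sub>Y y') = pure x y \<oplus>\<^sub>T pure x y'"
proof -
  have "N #>\<^bsub>FG\<^esub> (frag_of (x, y \<oplus>\<^sub>Y y') - frag_of (x, y) - frag_of (x, y')) = \<zero>\<^sub>T"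
    by (rule relation_coset) (use assms in \<open>auto simp: tensor_relations_def\<close>)
  then have "pure x (y \<oplus>\<^sub>Y y') \<ominus>\<^sub>T pure x y \<ominus>\<^sub>T pure x y' = \<zero>\<^sub>T"
    using assms by (simp add: coset_diff diff_FG frag_of_FG pure_tensor_def
        del: carrier_free_Abelian_group_iff)
  then show ?thesis
    using assms by (simp add: T.diff_diff_eq_zero_iff)
qed

lemma pure_middle:
  assumes "r : R" "x : X" "y : Y"
  shows "pure (r \<odot>\<^sub>X x) y = pure x (r \<odot>\<^sub>Y y)"
proof -
  have "N #>\<^bsub>FG\<^esub> (frag_of (r \<odot>\<^sub>X x, y) - frag_of (x, r \<odot>\<^sub>Y y)) = \<zero>\<^sub>T"
    by (rule relation_coset) (use assms in \<open>auto simp: tensor_relations_def\<close>)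
  then have "pure (r \<odot>\<^sub>X x) y \<ominus>\<^sub>T pure x (r \<odot>\<^sub>Y y) = \<zero>\<^sub>T"
    using assms by (simp add: coset_diff frag_of_FG pure_tensor_def X_smult_closed Y_smult_closed
        del: carrier_free_Abelian_group_iff)
  then show ?thesis
    using assms by (simp add: X_smult_closed Y_smult_closed T.diff_eq_zero_iff)
qed

lemma pure_middle_linear: "middle_linear R X Y T pure"
  by (rule middle_linearI) (auto intro!: additive_mapI simp: pure_add_left pure_add_right pure_middle)

lemma tensor_induct [consumes 1, case_names zero pure add]:
  assumes t: "t : T"
    and z: "Q \<zero>\<^sub>T" and p: "\<And>x y. [|x : X; y : Y|] ==> Q (pure x y)"
    and a: "\<And>s t. [|s : T; t : T; Q s; Q t|] ==> Q (s \<oplus>\<^sub>T t)"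
  shows "Q t"
proof -
  have mp: "\<ominus>\<^sub>T pure x y = pure (\<ominus>\<^sub>X x) y" if "x : X" "y : Y" for x y
    using that additive_map_minus[OF middle_linearD(2)[OF pure_middle_linear]
        X.abelian_group_axioms T_abelian, of y x] by simp
  obtain c where c: "c : FG" "t = N #>\<^bsub>FG\<^esub> c" using t by (rule coset_cases)
  have "Poly_Mapping.keys c \<subseteq> carrier X \<times> carrier Y" using c by simp
  then have "c : FG \<and> Q (N #>\<^bsub>FG\<^esub> c) \<and> Q (\<ominus>\<^sub>T (N #>\<^bsub>FG\<^esub> c))"
  proof (induction c rule: frag_induction)
    case zero
    then show ?case using z coset_zero[OF subgroup.one_closed[OF N_subgroup]]
        T.add.inv_one by (simp add: a_inv_def)
  next
    case (one p)
    then show ?case using p mp by (cases p) (simp add: pure_tensor_def keys_frag_of)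
  next
    case (diff c d)
    then have "N #>\<^bsub>FG\<^esub> (c - d) = (N #>\<^bsub>FG\<^esub> c) \<oplus>\<^sub>T \<ominus>\<^sub>T (N #>\<^bsub>FG\<^esub> d)"
      by (simp add: coset_diff a_minus_def del: carrier_free_Abelian_group_iff)
    moreover have "\<ominus>\<^sub>T (\<dots>) = \<ominus>\<^sub>T (N #>\<^bsub>FG\<^esub> c) \<oplus>\<^sub>T (N #>\<^bsub>FG\<^esub> d)"
      using diff by (simp add: T.minus_add coset_closed del: carrier_free_Abelian_group_iff)
    ultimately show ?case using diff diff_FG[of c d]
      by (auto intro!: a coset_closed simp del: carrier_free_Abelian_group_iff)
  qed
  then show ?thesis using c by simp
qed

lemma some_rep:
  assumes "t : T"
  shows "(SOME c. c \<in> t) \<in> t" "Poly_Mapping.keys (SOME c. c \<in> t) \<subseteq> carrier X \<times> carrier Y"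
proof -
  obtain c where c: "c : FG" "t = N #>\<^bsub>FG\<^esub> c" using assms by (rule coset_cases)
  have "c \<in> t" unfolding c(2)
    by (rule group.rcos_self[OF group_free_Abelian_group c(1) N_subgroup])
  then show s: "(SOME c. c \<in> t) \<in> t" by (rule someI)
  have "t \<subseteq> carrier FG" unfolding c(2)
    using monoid.r_coset_subset_G[OF group.is_monoid[OF group_free_Abelian_group] subgroup.subset[OF N_subgroup] c(1)] .
  from subsetD[OF this s]
  show "Poly_Mapping.keys (SOME c. c \<in> t) \<subseteq> carrier X \<times> carrier Y" by simp
qed

lemma tensor_lift_closed:
  assumes "abelian_group P" "t : T"
    and "\<And>x y. [|x : X; y : Y|] ==> f x y : P"
  shows "tensor_lift P f t : P"
  unfolding tensor_lift_eq_frag_sum using some_rep[OF assms(2)] assms(3)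
  by (intro abelian_group.frag_sum_closed[OF assms(1), where U="carrier X \<times> carrier Y"]) auto

lemma tensor_lift_cong:
  assumes "abelian_group P" "t : T"
    and "\<And>x y. [|x : X; y : Y|] ==> f x y = g x y"
    and "\<And>x y. [|x : X; y : Y|] ==> g x y : P"
  shows "tensor_lift P f t = tensor_lift P g t"
  unfolding tensor_lift_eq_frag_sum using some_rep[OF assms(2)] assms(3,4)
  by (intro abelian_group.frag_sum_cong[OF assms(1), where U="carrier X \<times> carrier Y"]) auto

lemma tensor_lift_map:
  assumes "additive_map P Q \<phi>" "abelian_group P" "abelian_group Q" "t : T"
    and "\<And>x y. [|x : X; y : Y|] ==> f x y : P"
  shows "\<phi> (tensor_lift P f t) = tensor_lift Q (\<lambda>x y. \<phi> (f x y)) t"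
  unfolding tensor_lift_eq_frag_sum using some_rep[OF assms(4)] assms(5)
  by (intro abelian_group.frag_sum_map[OF assms(2,1,3), where U="carrier X \<times> carrier Y"]) auto

lemma tensor_lift_additive_fun:
  assumes "abelian_group P" "t : T"
    and "\<And>x y. [|x : X; y : Y|] ==> additive_map Z P (\<lambda>z. f z x y)"
  shows "additive_map Z P (\<lambda>z. tensor_lift P (f z) t)"
  unfolding tensor_lift_eq_frag_sum using some_rep[OF assms(2)] assms(3)
  by (intro abelian_group.frag_sum_additive[OF assms(1), where U="carrier X \<times> carrier Y"]) auto

context
  fixes P :: "('p, 'v) ring_scheme" and f
  assumes P: "abelian_group P" and f: "middle_linear R X Y P f"
begin

interpretation P: abelian_group P by (rule P)

abbreviation (input) "F \<equiv> frag_sum P (\<lambda>p. f (fst p) (snd p))"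

lemma F_in: "p \<in> carrier X \<times> carrier Y ==> f (fst p) (snd p) : P"
  using middle_linearD(4)[OF f] by auto

lemma F_group_hom: "group_hom FG (add_monoid P) F"
  using P.frag_sum_hom[of "carrier X \<times> carrier Y" "\<lambda>p. f (fst p) (snd p)", OF F_in]
  by (auto simp: group_hom_def group_hom_axioms_def P.a_group)

lemma F_closed: "c : FG ==> F c : P"
  using group_hom.hom_closed[OF F_group_hom] by auto

lemma F_diff: "[|c : FG; d : FG|] ==> F (c - d) = F c \<ominus>\<^sub>P F d"
  by (rule P.frag_sum_diff[where U="carrier X \<times> carrier Y"]) (auto intro: F_in simp del: mem_Times_iff)

lemma F_add: "[|c : FG; d : FG|] ==> F (c + d) = F c \<oplus>\<^sub>P F d"
  by (rule P.frag_sum_add[where U="carrier X \<times> carrier Y"]) (auto intro: F_in simp del: mem_Times_iff)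

lemma F_of: "[|x : X; y : Y|] ==> F (frag_of (x, y)) = f x y"
  using P.frag_sum_of[of "\<lambda>p. f (fst p) (snd p)" "(x, y)"] F_in[of "(x,y)"] by simp

text \<open>
  The generating relations are killed because \<open>f\<close> is biadditive and balanced; this makes the sum independent
  of the representative.
\<close>

lemma F_kernel:
  assumes "n \<in> N" shows "F n = \<zero>\<^sub>P"
proof -
  have rel: "F n = \<zero>\<^sub>P" if "n \<in> tensor_relations R X Y" for n
    using that unfolding tensor_relations_def
  proof (elim UnE CollectE exE conjE)
    fix x x' y assume n: "n = frag_of (x \<oplus>\<^sub>X x', y) - frag_of (x, y) - frag_of (x', y)"
      and *: "x : X" "x' : X" "y : Y"
    have "F n = f (x \<oplus>\<^sub>X x') y \<ominus>\<^sub>P f x y \<ominus>\<^sub>P f x' y"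
      unfolding n using * by (simp add: F_diff F_of diff_FG frag_of_FG del: carrier_free_Abelian_group_iff)
    then show "F n = \<zero>\<^sub>P"
      using * middle_linearD(4)[OF f] additive_mapD(2)[OF middle_linearD(2)[OF f]]
      by (simp add: P.diff_diff_eq_zero_iff)
  next
    fix x y y' assume n: "n = frag_of (x, y \<oplus>\<^sub>Y y') - frag_of (x, y) - frag_of (x, y')"
      and *: "x : X" "y : Y" "y' : Y"
    have "F n = f x (y \<oplus>\<^sub>Y y') \<ominus>\<^sub>P f x y \<ominus>\<^sub>P f x y'"
      unfolding n using * by (simp add: F_diff F_of diff_FG frag_of_FG del: carrier_free_Abelian_group_iff)
    then show "F n = \<zero>\<^sub>P"
      using * middle_linearD(4)[OF f] additive_mapD(2)[OF middle_linearD(1)[OF f]]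
      by (simp add: P.diff_diff_eq_zero_iff)
  next
    fix r x y assume n: "n = frag_of (r \<odot>\<^sub>X x, y) - frag_of (x, r \<odot>\<^sub>Y y)"
      and *: "r : R" "x : X" "y : Y"
    have "F n = f (r \<odot>\<^sub>X x) y \<ominus>\<^sub>P f x (r \<odot>\<^sub>Y y)"
      unfolding n using * by (simp add: F_diff F_of frag_of_FG X_smult_closed Y_smult_closed
          del: carrier_free_Abelian_group_iff)
    then show "F n = \<zero>\<^sub>P"
      using * middle_linearD(3,4)[OF f] by (simp add: Y_smult_closed P.diff_eq_zero_iff)
  qed
  interpret F: group_hom FG "add_monoid P" F by (rule F_group_hom)
  have "N \<subseteq> kernel FG (add_monoid P) F"
    unfolding tensor_kernel_def
    by (rule group.generate_subgroup_incl[OF group_free_Abelian_group _ F.subgroup_kernel])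
      (use rel relations_FG in \<open>auto simp: kernel_def simp del: carrier_free_Abelian_group_iff\<close>)
  then show ?thesis using assms by (auto simp: kernel_def)
qed

lemma tensor_lift_coset:
  assumes c: "c : FG"
  shows "tensor_lift P f (N #>\<^bsub>FG\<^esub> c) = F c"
proof -
  let ?d = "SOME d. d \<in> N #>\<^bsub>FG\<^esub> c"
  have "?d \<in> N #>\<^bsub>FG\<^esub> c" by (rule some_rep[OF coset_closed[OF c]])
  then obtain n where n: "n \<in> N" "?d = n + c" by (auto simp: r_coset_def)
  have "n : FG" using n(1) subgroup.subset[OF N_subgroup] by blast
  then show ?thesis
    using n c F_kernel[OF n(1)] F_closed[OF c]
    by (simp add: tensor_lift_eq_frag_sum F_add del: carrier_free_Abelian_group_iff)
qed

lemma tensor_lift_additive: "additive_map T P (tensor_lift P f)"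
proof (rule additive_mapI)
  fix s t assume "s : T" "t : T"
  then obtain c d where "c : FG" "s = N #>\<^bsub>FG\<^esub> c" "d : FG" "t = N #>\<^bsub>FG\<^esub> d"
    by (metis coset_cases)
  then show "tensor_lift P f (s \<oplus>\<^sub>T t) = tensor_lift P f s \<oplus>\<^sub>P tensor_lift P f t"
    using group.is_monoid[OF group_free_Abelian_group, THEN monoid.m_closed, of c "carrier X \<times> carrier Y" d]
    by (simp add: coset_add tensor_lift_coset F_add del: carrier_free_Abelian_group_iff)
qed (use middle_linearD(4)[OF f] in \<open>auto intro!: tensor_lift_closed P\<close>)

lemma tensor_lift_pure: "[|x : X; y : Y|] ==> tensor_lift P f (pure x y) = f x y"
  unfolding pure_tensor_def by (simp only: tensor_lift_coset[OF frag_of_FG] F_of)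

end

lemma additive_map_unique:
  assumes "additive_map T P \<phi>" "additive_map T P \<psi>" "abelian_group P"
    and "\<And>x y. [|x : X; y : Y|] ==> \<phi> (pure x y) = \<psi> (pure x y)"
    and t: "t : T"
  shows "\<phi> t = \<psi> t"
  using t
proof (induction t rule: tensor_induct)
  case zero
  then show ?case using assms(1-3) T_abelian by (simp add: additive_map_zero)
next
  case (add s t)
  then show ?case using assms(1,2) by (simp add: additive_mapD)
qed (use assms in auto)

end

text \<open>This is what permits sums over the coproducts of two elements to be interchanged.\<close>

lemma tensor_lift_swap:
  assumes P: "abelian_group P" and "tensor_pair R X Y" "tensor_pair R' X' Y'"
    and s: "s : (tensor_group R X Y)" and t: "t : (tensor_group R' X' Y')"
    and F: "\<And>x y u v. [|x : X; y : Y; u : X'; v : Y'|] ==>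
      F x y u v : P"
  shows "tensor_lift P (\<lambda>x y. tensor_lift P (F x y) t) s =
    tensor_lift P (\<lambda>u v. tensor_lift P (\<lambda>x y. F x y u v) s) t"
  unfolding tensor_lift_eq_frag_sum
  using tensor_pair.some_rep[OF assms(2) s] tensor_pair.some_rep[OF assms(3) t] F
  by (intro abelian_group.frag_sum_swap[OF P, of "carrier X \<times> carrier Y" "carrier X' \<times> carrier Y'"
      "\<lambda>p q. F (fst p) (snd p) (fst q) (snd q)", simplified]) auto

section \<open>Linear maps\<close>

lemma linear_mapI:
  assumes "\<And>x. x : X ==> f x : Y"
    and "\<And>x y. [|x : X; y : X|] ==> f (x \<oplus>\<^sub>X y) = f x \<oplus>\<^sub>Y f y"
    and "\<And>r x. [|r : R; x : X|] ==> f (r \<odot>\<^sub>X x) = r \<odot>\<^sub>Y f x"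
  shows "linear_map R X Y f"
  using assms by (auto simp: linear_map_def)

lemma linear_mapD:
  assumes "linear_map R X Y f"
  shows "x : X ==> f x : Y"
    and "[|x : X; y : X|] ==> f (x \<oplus>\<^sub>X y) = f x \<oplus>\<^sub>Y f y"
    and "[|r : R; x : X|] ==> f (r \<odot>\<^sub>X x) = r \<odot>\<^sub>Y f x"
  using assms by (auto simp: linear_map_def)

lemma linear_map_additive: "linear_map R X Y f ==> additive_map X Y f"
  by (auto simp: linear_map_def additive_map_def)

lemma linear_map_id: "linear_map R X X (\<lambda>x. x)"
  by (auto simp: linear_map_def)

lemma linear_map_comp:
  assumes "linear_map R Y Z g" "linear_map R X Y f"
  shows "linear_map R X Z (\<lambda>x. g (f x))"
  using assms by (auto simp: linear_map_def Pi_iff)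

lemma linear_map_cong:
  assumes "linear_map R X Y f" "\<And>x. x : X ==> f x = g x" "abelian_monoid X"
    "\<And>r x. [|r : R; x : X|] ==> r \<odot>\<^sub>X x : X"
  shows "linear_map R X Y g"
  using assms abelian_monoid.a_closed[OF assms(3)] by (auto simp: linear_map_def Pi_iff)

definition bilinear_map ::
    "('k, 's) ring_scheme \<Rightarrow> ('k, 'x, 't) module_scheme \<Rightarrow> ('k, 'y, 'u) module_scheme \<Rightarrow>
      ('k, 'p, 'v) module_scheme \<Rightarrow> ('x \<Rightarrow> 'y \<Rightarrow> 'p) \<Rightarrow> bool"
  where "bilinear_map K X Y P f \<longleftrightarrow>
    (\<forall>x\<in>carrier X. linear_map K Y P (f x)) \<and> (\<forall>y\<in>carrier Y. linear_map K X P (\<lambda>x. f x y))"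

lemma bilinear_mapI:
  assumes "\<And>x. x : X ==> linear_map K Y P (f x)"
    and "\<And>y. y : Y ==> linear_map K X P (\<lambda>x. f x y)"
  shows "bilinear_map K X Y P f"
  using assms by (auto simp: bilinear_map_def)

lemma bilinear_mapD:
  assumes "bilinear_map K X Y P f"
  shows "x : X ==> linear_map K Y P (f x)"
    and "y : Y ==> linear_map K X P (\<lambda>x. f x y)"
    and "[|x : X; y : Y|] ==> f x y : P"
  using assms linear_mapD(1) by (auto simp: bilinear_map_def) fast

lemma bilinear_middle_linear:
  assumes "bilinear_map K X Y P f" shows "middle_linear K X Y P f"
  by (rule middle_linearI)
    (auto intro: linear_map_additive bilinear_mapD(1,2)[OF assms]
      simp: linear_mapD(3)[OF bilinear_mapD(1)[OF assms]] linear_mapD(3)[OF bilinear_mapD(2)[OF assms]])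

lemma module_smult_linear:
  assumes "module K P" "k : K" shows "linear_map K P P (\<lambda>x. k \<odot>\<^sub>P x)"
proof -
  interpret module K P by fact
  show ?thesis
    using assms(2) by (intro linear_mapI)
      (auto simp: smult_r_distr smult_assoc1[symmetric] R.m_comm)
qed

lemma with_smult_simps [simp]:
  "carrier (with_smult X \<sigma>) = carrier X" "add (with_smult X \<sigma>) = add X"
  "zero (with_smult X \<sigma>) = zero X" "smult (with_smult X \<sigma>) = \<sigma>"
  "mult (with_smult X \<sigma>) = mult X" "one (with_smult X \<sigma>) = one X"
  by (simp_all add: with_smult_def)

lemma abelian_group_cong_record:
  assumes "abelian_group P" "carrier P = carrier Q" "add P = add Q" "zero P = zero Q"
  shows "abelian_group Q"
proof -
  interpret abelian_group P by fact
  show ?thesis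
  proof (rule abelian_groupI)
    fix x assume "x : Q"
    then show "\<exists>y\<in>carrier Q. y \<oplus>\<^sub>Q x = \<zero>\<^sub>Q"
      using l_neg[of x] a_inv_closed[of x] unfolding assms(2-4) by blast
  qed (use a_closed zero_closed a_assoc a_comm l_zero in \<open>simp_all add: assms(2-4)\<close>)
qed

lemma with_smult_abelian_group [simp]: "abelian_group (with_smult X \<sigma>) \<longleftrightarrow> abelian_group X"
  using abelian_group_cong_record[of X "with_smult X \<sigma>"]
    abelian_group_cong_record[of "with_smult X \<sigma>" X] by auto

text \<open>
  Sums only see the additive part of a record, whose extension field may have a different type.
\<close>

lemma finsum_cong_record:
  assumes "carrier P = carrier Q" "add P = add Q" "zero P = zero Q"
  shows "finsum P = finsum Q"
  using assms by (intro ext) (simp add: finsum_def finprod_def)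

lemma add_pow_cong_record:
  assumes "carrier P = carrier Q" "add P = add Q" "zero P = zero Q"
  shows "[(n::int)] \<cdot>\<^sub>P x = [n] \<cdot>\<^sub>Q x"
  using assms by (simp add: add_pow_def int_pow_def nat_pow_def m_inv_def Let_def)

lemma tensor_lift_cong_record:
  assumes "carrier P = carrier Q" "add P = add Q" "zero P = zero Q"
  shows "tensor_lift P f t = tensor_lift Q f t"
  using assms by (simp add: tensor_lift_def finsum_cong_record[OF assms] add_pow_cong_record[OF assms])

lemma sw_cong_record:
  assumes "carrier P = carrier Q" "add P = add Q" "zero P = zero Q"
  shows "sweedler H P f h = sweedler H Q f h"
  using tensor_lift_cong_record[OF assms] by (simp add: sweedler_def)

lemma sw_with_smult [simp]: "sweedler H (with_smult P \<sigma>) f h = sweedler H P f h"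
  by (rule sw_cong_record) simp_all

section \<open>Tensor products over a commutative ring\<close>

lemma module_tensor_pair: "module K X ==> module K Y ==> tensor_pair K X Y"
  by (auto simp: tensor_pair_def tensor_pair_axioms_def module.smult_closed intro: module.axioms)

locale module_pair = X: module K X + Y: module K Y
  for K :: "('k, 's) ring_scheme" and X :: "('k, 'x, 't) module_scheme"
    and Y :: "('k, 'y, 'u) module_scheme"
begin

sublocale tensor_pair K X Y
  by (rule module_tensor_pair) (rule X.module_axioms Y.module_axioms)+

abbreviation "TK \<equiv> tensor K X Y"

lemma tensor_simps [simp]:
  "carrier TK = carrier T" "add TK = add T" "zero TK = zero T"
  by (simp_all add: tensor_def)

lemma tensor_smult: "k \<odot>\<^bsub>TK\<^esub> t = tensor_lift T (\<lambda>x y. pure (k \<odot>\<^sub>X x) y) t"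
  by (simp add: tensor_def)

lemma smult_middle: "k : K ==> middle_linear K X Y T (\<lambda>x y. pure (k \<odot>\<^sub>X x) y)"
  by (rule middle_linearI)
    (auto intro!: additive_mapI
      simp: X.smult_r_distr Y.smult_r_distr pure_add_left pure_add_right pure_middle
        X.smult_assoc1[symmetric] X.R.m_comm Y.smult_assoc1[symmetric])

lemma smult_pure: "[|k : K; x : X; y : Y|] ==>
    k \<odot>\<^bsub>TK\<^esub> pure x y = pure (k \<odot>\<^sub>X x) y"
  by (simp add: tensor_smult tensor_lift_pure[OF T_abelian smult_middle])

lemma smult_additive: "k : K ==> additive_map T T (\<lambda>t. k \<odot>\<^bsub>TK\<^esub> t)"
  unfolding tensor_smult by (rule tensor_lift_additive[OF T_abelian smult_middle])

lemma tensor_module: "module K TK"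
proof (rule moduleI)
  show "cring K" by (rule X.R.is_cring)
  show "abelian_group TK" using T_abelian by (simp add: tensor_def)
  show "a \<odot>\<^bsub>TK\<^esub> x : TK" if "a : K" "x : TK" for a x
    using additive_mapD(1)[OF smult_additive] that by simp
  show "a \<odot>\<^bsub>TK\<^esub> (x \<oplus>\<^bsub>TK\<^esub> y) = (a \<odot>\<^bsub>TK\<^esub> x) \<oplus>\<^bsub>TK\<^esub> (a \<odot>\<^bsub>TK\<^esub> y)"
    if "a : K" "x : TK" "y : TK" for a x y
    using additive_mapD(2)[OF smult_additive] that by simp
  show "(a \<oplus>\<^sub>K b) \<odot>\<^bsub>TK\<^esub> x = (a \<odot>\<^bsub>TK\<^esub> x) \<oplus>\<^bsub>TK\<^esub> (b \<odot>\<^bsub>TK\<^esub> x)"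
    if ab: "a : K" "b : K" and x: "x : TK" for a b x
  proof -
    have "x : T" using x by simp
    then show ?thesis unfolding tensor_simps
    proof (rule additive_map_unique[rotated 4])
      show "additive_map T T (\<lambda>x. (a \<odot>\<^bsub>TK\<^esub> x) \<oplus>\<^sub>T (b \<odot>\<^bsub>TK\<^esub> x))"
        using additive_mapD[OF smult_additive[OF ab(1)]] additive_mapD[OF smult_additive[OF ab(2)]]
        by (intro additive_mapI) (auto simp: T.a_ac)
    qed (use ab in \<open>auto intro: smult_additive T_abelian simp: smult_pure X.smult_l_distr pure_add_left\<close>)
  qed
  show "(a \<otimes>\<^sub>K b) \<odot>\<^bsub>TK\<^esub> x = a \<odot>\<^bsub>TK\<^esub> (b \<odot>\<^bsub>TK\<^esub> x)"
    if ab: "a : K" "b : K" and x: "x : TK" for a b x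
  proof -
    have "x : T" using x by simp
    then show ?thesis
    proof (rule additive_map_unique[rotated 4])
      show "additive_map T T (\<lambda>x. a \<odot>\<^bsub>TK\<^esub> (b \<odot>\<^bsub>TK\<^esub> x))"
        by (rule additive_map_comp[OF smult_additive smult_additive]) fact+
    qed (use ab in \<open>auto intro: smult_additive T_abelian simp: smult_pure X.smult_assoc1\<close>)
  qed
  show "\<one>\<^sub>K \<odot>\<^bsub>TK\<^esub> x = x" if x: "x : TK" for x
  proof -
    have "x : T" using x by simp
    then show ?thesis
      by (rule additive_map_unique[where P=T, rotated 4])
        (auto intro: smult_additive T_abelian additive_mapI simp: smult_pure)
  qed
qed

lemma pure_bilinear: "bilinear_map K X Y TK pure"
  by (rule bilinear_mapI; rule linear_mapI)
    (auto simp: pure_add_left pure_add_right smult_pure pure_middle)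

lemma tensor_lift_linear:
  assumes P: "module K P" and f: "bilinear_map K X Y P f"
  shows "linear_map K TK P (tensor_lift P f)"
proof -
  interpret P: module K P by fact
  note ml = bilinear_middle_linear[OF f]
  note ag = P.abelian_group_axioms
  show ?thesis
  proof (rule linear_mapI)
    show "tensor_lift P f (k \<odot>\<^bsub>TK\<^esub> x) = k \<odot>\<^sub>P tensor_lift P f x"
      if k: "k : K" and x: "x : TK" for k x
    proof -
      have "x : T" using x by simp
      then show ?thesis
      proof (rule additive_map_unique[rotated 4])
        show "additive_map T P (\<lambda>x. tensor_lift P f (k \<odot>\<^bsub>TK\<^esub> x))"
          by (rule additive_map_comp[OF smult_additive[OF k] tensor_lift_additive[OF ag ml]])
        show "additive_map T P (\<lambda>x. k \<odot>\<^sub>P tensor_lift P f x)"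
          by (rule additive_map_comp[OF tensor_lift_additive[OF ag ml]
              linear_map_additive[OF module_smult_linear[OF P k]]])
        fix u v assume "u : X" "v : Y"
        then show "tensor_lift P f (k \<odot>\<^bsub>TK\<^esub> pure u v) = k \<odot>\<^sub>P tensor_lift P f (pure u v)"
          using k linear_mapD(3)[OF bilinear_mapD(2)[OF f]]
          by (simp add: smult_pure tensor_lift_pure[OF ag ml])
      qed (rule ag)
    qed
  qed (use additive_mapD[OF tensor_lift_additive[OF ag ml]] in auto)
qed

end

text \<open>
  Linearity in one variable of an expression built from linear operations is proved by descending
  to the variable; each operation introduced later contributes one rule per argument.
\<close>

named_theorems linear_intros

declare linear_map_id [linear_intros]

lemma smult_linear [linear_intros]:
  assumes "module K P" "k : K" "linear_map K D P f"
  shows "linear_map K D P (\<lambda>x. k \<odot>\<^sub>P f x)"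
  using linear_map_comp[OF module_smult_linear[OF assms(1,2)] assms(3)] .

lemma pure_linear_left [linear_intros]:
  assumes "module K X" "module K Y" "y : Y" "linear_map K D X f"
  shows "linear_map K D (tensor K X Y) (\<lambda>x. pure_tensor K X Y (f x) y)"
  using linear_map_comp[OF bilinear_mapD(2)[OF module_pair.pure_bilinear] assms(4)] assms
  by (auto simp: module_pair_def)

lemma pure_linear_right [linear_intros]:
  assumes "module K X" "module K Y" "x : X" "linear_map K D Y f"
  shows "linear_map K D (tensor K X Y) (\<lambda>y. pure_tensor K X Y x (f y))"
  using linear_map_comp[OF bilinear_mapD(1)[OF module_pair.pure_bilinear] assms(4)] assms
  by (auto simp: module_pair_def)

section \<open>Sweedler calculus\<close>

text \<open>
  A sum \<open>f(h\<^sub>(\<^sub>1\<^sub>), h\<^sub>(\<^sub>2\<^sub>))\<close> is the image of \<open>\<Delta>(h)\<close> under a linear map out of \<open>H \<otimes> H\<close>, so every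
  identity between elements of tensor powers of \<open>H\<close> becomes a rule for rewriting such sums, whose
  side condition is that the summand is linear in each variable.
\<close>

lemma sw_diag: "sweedler H P f h = tensor_lift P f (comult H h)"
  by (simp add: sweedler_def)

context hopf_algebra
begin

abbreviation "sw \<equiv> sweedler H"
abbreviation "\<S> \<equiv> antipode H"
abbreviation hopf_mult (infixl \<open>\<cdot>\<close> 70) where "x \<cdot> y \<equiv> x \<otimes>\<^sub>H y"

lemma H_module: "module K H" by (rule module_axioms)
lemma K_cring: "cring K" by (rule R.is_cring)

sublocale HH: module_pair K H H
  by (simp add: module_pair_def module_axioms)

lemma comult_closed: "h : H ==> comult H h : HH.T"
  using linear_mapD(1)[OF comult_linear] by simp

lemma counit_closed [simp, intro]: "h : H ==> counit H h : K"
  using counit_hom by (auto simp: ring_hom_def)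

lemma counit_mult: "[|h : H; k : H|] ==>
    counit H (h \<cdot> k) = counit H h \<otimes>\<^sub>K counit H k"
  using counit_hom by (auto simp: ring_hom_def)

lemma counit_add: "[|h : H; k : H|] ==>
    counit H (h \<oplus>\<^sub>H k) = counit H h \<oplus>\<^sub>K counit H k"
  using counit_hom by (auto simp: ring_hom_def)

lemma counit_one: "counit H \<one>\<^sub>H = \<one>\<^sub>K"
  using counit_hom by (auto simp: ring_hom_def)

lemma antipode_closed [simp, intro]: "h : H ==> \<S> h : H"
  using linear_mapD(1)[OF antipode_linear] .

lemma mult_left_linear: "x : H ==> linear_map K H H (\<lambda>y. x \<cdot> y)"
  by (rule linear_mapI) (auto simp: r_distr smult_mult_right)

lemma mult_right_linear: "y : H ==> linear_map K H H (\<lambda>x. x \<cdot> y)"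
  by (rule linear_mapI) (auto simp: l_distr smult_mult_left)

lemma linear_H_mult_left [linear_intros]:
  assumes "y : H" "linear_map K D H f" shows "linear_map K D H (\<lambda>x. f x \<cdot> y)"
  using linear_map_comp[OF mult_right_linear[OF assms(1)] assms(2)] .

lemma linear_H_mult_right [linear_intros]:
  assumes "x : H" "linear_map K D H f" shows "linear_map K D H (\<lambda>y. x \<cdot> f y)"
  using linear_map_comp[OF mult_left_linear[OF assms(1)] assms(2)] .

lemma linear_antipode [linear_intros]:
  assumes "linear_map K D H f" shows "linear_map K D H (\<lambda>x. \<S> (f x))"
  using linear_map_comp[OF antipode_linear assms] .

lemma linear_comult [linear_intros]:
  assumes "linear_map K D H f" shows "linear_map K D (tensor K H H) (\<lambda>x. comult H (f x))"
  using linear_map_comp[OF comult_linear assms] .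

lemma linear_counit [linear_intros]:
  assumes P: "module K P" and p: "p : P" and f: "linear_map K D H f"
  shows "linear_map K D P (\<lambda>x. counit H (f x) \<odot>\<^sub>P p)"
proof -
  interpret P: module K P by fact
  have "linear_map K H P (\<lambda>x. counit H x \<odot>\<^sub>P p)"
    using p by (intro linear_mapI) (auto simp: counit_add P.smult_l_distr counit_linear P.smult_assoc1)
  from linear_map_comp[OF this f] show ?thesis .
qed

lemma sw_closed [simp, intro]:
  assumes "abelian_group P" "h : H"
    and "\<And>x y. [|x : H; y : H|] ==> f x y : P"
  shows "sw P f h : P"
  unfolding sw_diag using assms by (intro HH.tensor_lift_closed comult_closed) auto

lemma sw_cong:
  assumes "abelian_group P" "h : H"
    and "\<And>x y. [|x : H; y : H|] ==> f x y = g x y"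
    and "\<And>x y. [|x : H; y : H|] ==> g x y : P"
  shows "sw P f h = sw P g h"
  unfolding sw_diag using assms by (intro HH.tensor_lift_cong comult_closed) auto

lemma sw_map:
  assumes "additive_map P Q \<phi>" "abelian_group P" "abelian_group Q" "h : H"
    and "\<And>x y. [|x : H; y : H|] ==> f x y : P"
  shows "\<phi> (sw P f h) = sw Q (\<lambda>x y. \<phi> (f x y)) h"
  unfolding sw_diag using assms by (intro HH.tensor_lift_map comult_closed) auto

lemma sw_linear_map:
  assumes "linear_map K P Q \<phi>" "module K P" "module K Q" "h : H"
    and "\<And>x y. [|x : H; y : H|] ==> f x y : P"
  shows "\<phi> (sw P f h) = sw Q (\<lambda>x y. \<phi> (f x y)) h"
  using assms by (intro sw_map linear_map_additive module.axioms) auto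

lemma sw_swap:
  assumes "abelian_group P" "h : H" "k : H"
    and "\<And>x y u v. [|x : H; y : H; u : H; v : H|] ==>
      F x y u v : P"
  shows "sw P (\<lambda>x y. sw P (F x y) k) h =
    sw P (\<lambda>u v. sw P (\<lambda>x y. F x y u v) h) k"
  unfolding sw_diag
  by (rule tensor_lift_swap[OF assms(1) HH.tensor_pair_axioms HH.tensor_pair_axioms
      comult_closed[OF assms(2)] comult_closed[OF assms(3)]]) (fact assms(4))

lemma linear_sw_arg [linear_intros]:
  assumes P: "module K P"
    and f1: "\<And>x. x : H ==> linear_map K H P (f x)"
    and f2: "\<And>y. y : H ==> linear_map K H P (\<lambda>x. f x y)"
    and g: "linear_map K D H g"
  shows "linear_map K D P (\<lambda>x. sw P f (g x))"
  unfolding sw_diag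
  by (rule linear_map_comp[OF HH.tensor_lift_linear[OF P bilinear_mapI] linear_comult[OF g]])
    (fact f1 f2)+

lemma linear_sw_fun [linear_intros]:
  assumes P: "module K P" and h: "h : H"
    and D: "\<And>r x. [|r : K; x : D|] ==> r \<odot>\<^sub>D x : D"
    and f: "\<And>u v. [|u : H; v : H|] ==> linear_map K D P (\<lambda>x. f x u v)"
  shows "linear_map K D P (\<lambda>x. sw P (f x) h)"
proof -
  interpret P: module K P by fact
  note ag = P.abelian_group_axioms
  have add: "additive_map D P (\<lambda>x. sw P (f x) h)"
    unfolding sw_diag
    by (rule HH.tensor_lift_additive_fun[OF ag comult_closed[OF h]])
      (rule linear_map_additive[OF f])
  show ?thesis
  proof (rule linear_mapI)
    fix r x assume r: "r : K" and x: "x : D"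
    have "sw P (f (r \<odot>\<^sub>D x)) h = sw P (\<lambda>u v. r \<odot>\<^sub>P f x u v) h"
      using r x by (intro sw_cong[OF ag h]) (auto simp: linear_mapD[OF f])
    also have "\<dots> = r \<odot>\<^sub>P sw P (f x) h"
      by (rule sw_linear_map[OF module_smult_linear[OF P r] P P h, symmetric])
        (use linear_mapD(1)[OF f] x in auto)
    finally show "sw P (f (r \<odot>\<^sub>D x)) h = r \<odot>\<^sub>P sw P (f x) h" .
  qed (use additive_mapD[OF add] in auto)
qed

lemma sw_one:
  assumes P: "module K P"
    and f1: "\<And>x. x : H ==> linear_map K H P (f x)"
    and f2: "\<And>y. y : H ==> linear_map K H P (\<lambda>x. f x y)"
  shows "sw P f \<one>\<^sub>H = f \<one>\<^sub>H \<one>\<^sub>H"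
proof -
  have "comult H \<one>\<^sub>H = HH.pure \<one>\<^sub>H \<one>\<^sub>H"
    using comult_hom by (simp add: ring_hom_def tensor_alg_def)
  then show ?thesis
    unfolding sw_diag
    using HH.tensor_lift_pure[OF abelian_group.intro[OF module.axioms(2)[OF P, THEN abelian_group.axioms(1)]
          module.axioms(2)[OF P, THEN abelian_group.axioms(2)]] bilinear_middle_linear[OF bilinear_mapI[OF f1 f2]]]
    by simp
qed

text \<open>
  \<open>\<Delta>(hk) = \<Delta>(h)\<Delta>(k)\<close>, read off through the linear map on \<open>H \<otimes> H\<close> induced by \<open>f\<close>.
\<close>

lemma sw_mult:
  assumes P: "module K P" and h: "h : H" and k: "k : H"
    and f1: "\<And>x. x : H ==> linear_map K H P (f x)"
    and f2: "\<And>y. y : H ==> linear_map K H P (\<lambda>x. f x y)"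
  shows "sw P f (h \<cdot> k) =
    sw P (\<lambda>x y. sw P (\<lambda>u v. f (x \<cdot> u) (y \<cdot> v)) k) h"
proof -
  have ag: "abelian_group P" by (rule module.axioms[OF P])
  note bl = bilinear_mapI[OF f1 f2, OF _ _]
  have lin: "linear_map K HH.TK P (tensor_lift P f)"
    by (rule HH.tensor_lift_linear[OF P bilinear_mapI]) (fact f1 f2)+
  have cl: "f x y : P" if "x : H" "y : H" for x y
    using linear_mapD(1)[OF f1] that by blast
  have "comult H (h \<cdot> k) = sw HH.TK (\<lambda>x y. sw HH.TK
      (\<lambda>u v. HH.pure (x \<cdot> u) (y \<cdot> v)) k) h"
    using comult_hom h k by (simp add: ring_hom_def tensor_alg_def sweedler_def)
  then have "sw P f (h \<cdot> k) = tensor_lift P f (sw HH.TK (\<lambda>x y. sw HH.TK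
      (\<lambda>u v. HH.pure (x \<cdot> u) (y \<cdot> v)) k) h)"
    by (simp add: sw_diag)
  also have "\<dots> = sw P (\<lambda>x y. tensor_lift P f (sw HH.TK
      (\<lambda>u v. HH.pure (x \<cdot> u) (y \<cdot> v)) k)) h"
    by (rule sw_linear_map[OF lin HH.tensor_module P h],
        rule sw_closed[OF module.axioms(2)[OF HH.tensor_module] k]) auto
  also have "\<dots> = sw P (\<lambda>x y. sw P
      (\<lambda>u v. tensor_lift P f (HH.pure (x \<cdot> u) (y \<cdot> v))) k) h"
    by (intro sw_cong[OF ag h] sw_linear_map[OF lin HH.tensor_module P k] sw_closed[OF ag k])
      (auto intro!: linear_mapD(1)[OF lin])
  also have "\<dots> = sw P (\<lambda>x y. sw P (\<lambda>u v. f (x \<cdot> u) (y \<cdot> v)) k) h"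
    by (intro sw_cong[OF ag h] sw_cong[OF ag k] sw_closed[OF ag k])
      (auto simp: HH.tensor_lift_pure[OF ag bilinear_middle_linear[OF bilinear_mapI[OF f1 f2]]] cl)
  finally show ?thesis .
qed

text \<open>
  The coassociativity axiom lives in \<open>(H \<otimes> H) \<otimes> H\<close>; a trilinear \<open>f\<close> induces a linear map on that module,
  which transports the axiom to the target of \<open>f\<close>.
\<close>

lemma sw_coassoc:
  assumes P: "module K P" and h: "h : H"
    and f1: "\<And>x y. [|x : H; y : H|] ==> linear_map K H P (\<lambda>z. f x y z)"
    and f2: "\<And>x z. [|x : H; z : H|] ==> linear_map K H P (\<lambda>y. f x y z)"
    and f3: "\<And>y z. [|y : H; z : H|] ==> linear_map K H P (\<lambda>x. f x y z)"
  shows "sw P (\<lambda>x y. sw P (\<lambda>u v. f u v y) x) h =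
    sw P (\<lambda>x y. sw P (\<lambda>u v. f x u v) y) h"
proof -
  interpret P: module K P by fact
  note ag = P.abelian_group_axioms
  interpret TH: module_pair K HH.TK H
    by (simp add: module_pair_def HH.tensor_module module_axioms)
  define g where "g = (\<lambda>t y. tensor_lift P (\<lambda>u v. f u v y) t)"
  have bl: "bilinear_map K H H P (\<lambda>u v. f u v y)" if "y : H" for y
    using that by (intro bilinear_mapI f2 f3)
  have cl: "f x y z : P" if "x : H" "y : H" "z : H" for x y z
    using linear_mapD(1)[OF f1] that by blast
  have g_pure: "g (HH.pure u v) y = f u v y" if "u : H" "v : H" "y : H" for u v y
    unfolding g_def using that by (intro HH.tensor_lift_pure[OF ag bilinear_middle_linear[OF bl]])
  have g1: "linear_map K HH.TK P (\<lambda>t. g t y)" if "y : H" for y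
    unfolding g_def by (rule HH.tensor_lift_linear[OF P bl[OF that]])
  have g2: "linear_map K H P (g t)" if t: "t : HH.TK" for t
  proof (rule linear_mapI)
    have "t : HH.T" using t by simp
    then have add: "additive_map H P (g t)"
      unfolding g_def by (intro HH.tensor_lift_additive_fun[OF ag] linear_map_additive[OF f1])
    show "g t y : P" if "y : H" for y using additive_mapD(1)[OF add that] .
    show "g t (y \<oplus>\<^sub>H y') = g t y \<oplus>\<^sub>P g t y'" if "y : H" "y' : H" for y y'
      using additive_mapD(2)[OF add that] .
    show "g t (k \<odot>\<^sub>H y) = k \<odot>\<^sub>P g t y" if k: "k : K" and y: "y : H" for k y
    proof -
      have "t : HH.T" using t by simp
      then show ?thesis
      proof (rule HH.additive_map_unique[where P=P, rotated 4])
        have "additive_map HH.TK P (\<lambda>t. g t (k \<odot>\<^sub>H y))"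
          "additive_map HH.TK P (\<lambda>t. k \<odot>\<^sub>P g t y)"
          using k y by (auto intro!: linear_map_additive smult_linear g1 P)
        then show "additive_map HH.T P (\<lambda>t. g t (k \<odot>\<^sub>H y))" 
          "additive_map HH.T P (\<lambda>t. k \<odot>\<^sub>P g t y)" by (simp_all add: additive_map_def)
      qed (use k y in \<open>auto simp: g_pure ag linear_mapD(3)[OF f1]\<close>)
    qed
  qed
  have bg: "bilinear_map K HH.TK H P g" by (intro bilinear_mapI g1 g2)
  let ?L = "tensor_lift P g"
  have L: "linear_map K TH.TK P ?L" by (rule TH.tensor_lift_linear[OF P bg])
  have Lp: "?L (TH.pure t y) = g t y" if "t : HH.TK" "y : H" for t y
    by (rule TH.tensor_lift_pure[OF ag bilinear_middle_linear[OF bg] that])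
  have tp: "HH.pure u v : HH.TK" if "u : H" "v : H" for u v
    using that by simp
  have cc: "comult H x : HH.TK" if "x : H" for x
    using comult_closed[OF that] by simp
  have Tag: "abelian_group TH.TK" by (rule module.axioms(2)[OF TH.tensor_module])
  have "sw P (\<lambda>x y. sw P (\<lambda>u v. f u v y) x) h = sw P (\<lambda>x y. ?L (TH.pure (comult H x) y)) h"
  proof (intro sw_cong[OF ag h])
    fix x y assume xy: "x : H" "y : H"
    show "sw P (\<lambda>u v. f u v y) x = ?L (TH.pure (comult H x) y)"
      unfolding Lp[OF cc[OF xy(1)] xy(2)] by (simp add: g_def sw_diag)
    show "?L (TH.pure (comult H x) y) : P"
      unfolding Lp[OF cc[OF xy(1)] xy(2)] by (rule linear_mapD(1)[OF g2[OF cc[OF xy(1)]] xy(2)])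
  qed
  also have "\<dots> = ?L (sw TH.TK (\<lambda>x y. TH.pure (comult H x) y) h)"
    using cc by (intro sw_linear_map[OF L TH.tensor_module P h, symmetric])
      (auto simp del: HH.tensor_simps)
  also have "\<dots> = ?L (sw TH.TK
        (\<lambda>x y. sw TH.TK (\<lambda>u v. TH.pure (HH.pure x u) v) y) h)"
    by (simp only: coassociative[OF h])
  also have "\<dots> = sw P (\<lambda>x y. ?L (sw TH.TK (\<lambda>u v. TH.pure (HH.pure x u) v) y)) h"
    using tp by (intro sw_linear_map[OF L TH.tensor_module P h] sw_closed Tag)
      (auto simp del: HH.tensor_simps)
  also have "\<dots> = sw P (\<lambda>x y. sw P (\<lambda>u v. f x u v) y) h"
  proof (intro sw_cong[OF ag h])
    fix x y assume xy: "x : H" "y : H"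
    have "?L (sw TH.TK (\<lambda>u v. TH.pure (HH.pure x u) v) y) =
      sw P (\<lambda>u v. ?L (TH.pure (HH.pure x u) v)) y"
      using tp xy by (intro sw_linear_map[OF L TH.tensor_module P]) (auto simp del: HH.tensor_simps)
    also have "\<dots> = sw P (\<lambda>u v. f x u v) y"
      using tp xy by (intro sw_cong[OF ag]) (auto simp: Lp g_pure cl simp del: HH.tensor_simps)
    finally show "?L (sw TH.TK (\<lambda>u v. TH.pure (HH.pure x u) v) y) = \<dots>" .
  qed (use cl in \<open>auto intro!: sw_closed ag\<close>)
  finally show ?thesis .
qed

lemma sw_counit_left:
  assumes P: "module K P" and h: "h : H" and f: "linear_map K H P f"
  shows "sw P (\<lambda>x y. counit H x \<odot>\<^sub>P f y) h = f h"
proof -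
  have "f h = f (sw H (\<lambda>x y. counit H x \<odot>\<^sub>H y) h)"
    using h by (simp add: counit_left)
  also have "\<dots> = sw P (\<lambda>x y. f (counit H x \<odot>\<^sub>H y)) h"
    by (rule sw_linear_map[OF f H_module P h]) auto
  also have "\<dots> = sw P (\<lambda>x y. counit H x \<odot>\<^sub>P f y) h"
    using linear_mapD[OF f] by (intro sw_cong h module.axioms[OF P]) 
      (auto intro!: module.smult_closed[OF P])
  finally show ?thesis ..
qed

lemma sw_counit_right:
  assumes P: "module K P" and h: "h : H" and f: "linear_map K H P f"
  shows "sw P (\<lambda>x y. counit H y \<odot>\<^sub>P f x) h = f h"
proof -
  have "f h = f (sw H (\<lambda>x y. counit H y \<odot>\<^sub>H x) h)"
    using h by (simp add: counit_right)
  also have "\<dots> = sw P (\<lambda>x y. f (counit H y \<odot>\<^sub>H x)) h"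
    by (rule sw_linear_map[OF f H_module P h]) auto
  also have "\<dots> = sw P (\<lambda>x y. counit H y \<odot>\<^sub>P f x) h"
    using linear_mapD[OF f] by (intro sw_cong h module.axioms[OF P]) 
      (auto intro!: module.smult_closed[OF P])
  finally show ?thesis ..
qed

lemma sw_antipode_right:
  assumes P: "module K P" and h: "h : H" and f: "linear_map K H P f"
  shows "sw P (\<lambda>x y. f (x \<cdot> \<S> y)) h = counit H h \<odot>\<^sub>P f \<one>\<^sub>H"
proof -
  have "sw P (\<lambda>x y. f (x \<cdot> \<S> y)) h = f (sw H (\<lambda>x y. x \<cdot> \<S> y) h)"
    by (rule sw_linear_map[OF f H_module P h, symmetric]) auto
  then show ?thesis using h by (simp add: antipode_right linear_mapD(3)[OF f])
qed

lemma sw_antipode_left: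
  assumes P: "module K P" and h: "h : H" and f: "linear_map K H P f"
  shows "sw P (\<lambda>x y. f (\<S> x \<cdot> y)) h = counit H h \<odot>\<^sub>P f \<one>\<^sub>H"
proof -
  have "sw P (\<lambda>x y. f (\<S> x \<cdot> y)) h = f (sw H (\<lambda>x y. \<S> x \<cdot> y) h)"
    by (rule sw_linear_map[OF f H_module P h, symmetric]) auto
  then show ?thesis using h by (simp add: antipode_left linear_mapD(3)[OF f])
qed

text \<open>
  Threefold sums.  Contracting two adjacent factors with the antipode leaves the third one.
\<close>

lemma sw3_antipode_right:
  assumes P: "module K P" and h: "h : H"
    and f1: "\<And>x. x : H ==> linear_map K H P (f x)"
    and f2: "\<And>y. y : H ==> linear_map K H P (\<lambda>x. f x y)"
  shows "sw P (\<lambda>x y. sw P (\<lambda>u v. f x (u \<cdot> \<S> v)) y) h = f h \<one>\<^sub>H"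
proof -
  have cl: "f x y : P" if "x : H" "y : H" for x y
    using linear_mapD(1)[OF f1] that by blast
  have "sw P (\<lambda>x y. sw P (\<lambda>u v. f x (u \<cdot> \<S> v)) y) h =
    sw P (\<lambda>x y. counit H y \<odot>\<^sub>P f x \<one>\<^sub>H) h"
    using cl by (intro sw_cong h module.axioms[OF P])
      (auto intro!: module.smult_closed[OF P] sw_antipode_right[OF P] f1)
  also have "\<dots> = f h \<one>\<^sub>H" by (rule sw_counit_right[OF P h f2]) simp
  finally show ?thesis .
qed

lemma sw3_antipode_left:
  assumes P: "module K P" and h: "h : H"
    and f1: "\<And>x. x : H ==> linear_map K H P (f x)"
    and f2: "\<And>y. y : H ==> linear_map K H P (\<lambda>x. f x y)"
  shows "sw P (\<lambda>x y. sw P (\<lambda>u v. f x (\<S> u \<cdot> v)) y) h = f h \<one>\<^sub>H"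
proof -
  have cl: "f x y : P" if "x : H" "y : H" for x y
    using linear_mapD(1)[OF f1] that by blast
  have "sw P (\<lambda>x y. sw P (\<lambda>u v. f x (\<S> u \<cdot> v)) y) h =
    sw P (\<lambda>x y. counit H y \<odot>\<^sub>P f x \<one>\<^sub>H) h"
    using cl by (intro sw_cong h module.axioms[OF P])
      (auto intro!: module.smult_closed[OF P] sw_antipode_left[OF P] f1)
  also have "\<dots> = f h \<one>\<^sub>H" by (rule sw_counit_right[OF P h f2]) simp
  finally show ?thesis .
qed

end

context cocommutative_hopf_algebra
begin

lemma sw_cocomm:
  assumes P: "module K P" and h: "h : H"
    and f1: "\<And>x. x : H ==> linear_map K H P (f x)"
    and f2: "\<And>y. y : H ==> linear_map K H P (\<lambda>x. f x y)"
  shows "sw P (\<lambda>x y. f y x) h = sw P f h"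
proof -
  have ag: "abelian_group P" by (rule module.axioms[OF P])
  have lin: "linear_map K HH.TK P (tensor_lift P f)"
    by (rule HH.tensor_lift_linear[OF P bilinear_mapI]) (fact f1 f2)+
  have cl: "f x y : P" if "x : H" "y : H" for x y
    using linear_mapD(1)[OF f1] that by blast
  have "sw P f h = tensor_lift P f (sw HH.TK (\<lambda>x y. HH.pure y x) h)"
    by (simp add: sw_diag cocommutative[OF h, unfolded sw_diag])
  also have "\<dots> = sw P (\<lambda>x y. tensor_lift P f (HH.pure y x)) h"
    by (rule sw_linear_map[OF lin HH.tensor_module P h]) simp
  also have "\<dots> = sw P (\<lambda>x y. f y x) h"
    by (intro sw_cong[OF ag h])
      (auto simp: HH.tensor_lift_pure[OF ag bilinear_middle_linear[OF bilinear_mapI[OF f1 f2]]] cl)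
  finally show ?thesis ..
qed

end

section \<open>The antipode of a cocommutative Hopf algebra\<close>

lemma module_abelian_group: "module K P ==> abelian_group P"
  by (rule module.axioms)

context hopf_algebra
begin

lemma H_abelian_group: "abelian_group H" by (rule module_abelian_group[OF H_module])

lemma antipode_one: "\<S> \<one>\<^sub>H = \<one>\<^sub>H"
proof -
  have "sw H (\<lambda>x y. x \<cdot> \<S> y) \<one>\<^sub>H = \<one>\<^sub>H \<cdot> \<S> \<one>\<^sub>H"
    by (rule sw_one[OF H_module]) (auto intro!: linear_intros)
  then show ?thesis by (simp add: antipode_right counit_one)
qed

text \<open>
  Both sides of the next identity are convolution inverse to the multiplication \<open>H \<otimes> H \<rightarrow> H\<close>, on
  the left and on the right respectively: they are the two ways to evaluate
  \<open>\<S>(h\<^sub>1k\<^sub>1) h\<^sub>2k\<^sub>2 \<S>(k\<^sub>3)\<S>(h\<^sub>3)\<close>.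
\<close>

lemma antipode_mult:
  assumes h: "h : H" and k: "k : H"
  shows "\<S> (h \<cdot> k) = \<S> k \<cdot> \<S> h"
proof -
  let ?sw = "sw H"
  note ag = H_abelian_group
  define \<Phi> where "\<Phi> = (\<lambda>h1 h2 h3 k1 k2 k3.
    \<S> (h1 \<cdot> k1) \<cdot> ((h2 \<cdot> k2) \<cdot> (\<S> k3 \<cdot> \<S> h3)))"
  have cl: "\<Phi> h1 h2 h3 k1 k2 k3 : H" if "h1 : H" "h2 : H" "h3 : H"
    "k1 : H" "k2 : H" "k3 : H" for h1 h2 h3 k1 k2 k3
    using that by (simp add: \<Phi>_def)
  define F where "F = (\<lambda>h1 h2 h3. ?sw (\<lambda>k1 y. ?sw (\<lambda>k2 k3. \<Phi> h1 h2 h3 k1 k2 k3) y) k)"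
  have F1: "F h1 h2 h3 = ?sw (\<lambda>z k3. ?sw (\<lambda>k1 k2. \<Phi> h1 h2 h3 k1 k2 k3) z) k"
    if "h1 : H" "h2 : H" "h3 : H" for h1 h2 h3
    unfolding F_def \<Phi>_def using that k
    by (intro sw_coassoc[OF H_module k, symmetric] linear_intros) auto
  have "?sw (\<lambda>x y. ?sw (\<lambda>h2 h3. F x h2 h3) y) h = \<S> (h \<cdot> k)"
  proof -
    have inner: "?sw (\<lambda>h2 h3. F x h2 h3) y = counit H y \<odot>\<^sub>H \<S> (x \<cdot> k)"
      if x: "x : H" and y: "y : H" for x y
    proof -
      have a: "F x h2 h3 = \<S> (x \<cdot> k) \<cdot> (h2 \<cdot> \<S> h3)"
        if h2: "h2 : H" and h3: "h3 : H" for h2 h3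
      proof -
        have "F x h2 h3 = ?sw (\<lambda>k1 y. ?sw (\<lambda>k2 k3. \<S> (x \<cdot> k1) \<otimes>\<^sub>H
            (h2 \<cdot> (k2 \<cdot> \<S> k3) \<cdot> \<S> h3)) y) k"
          unfolding F_def \<Phi>_def using x k h2 h3
          by (intro sw_cong[OF ag] sw_closed[OF ag]) (auto simp: m_assoc)
        also have "\<dots> = \<S> (x \<cdot> k) \<cdot> (h2 \<cdot> \<one>\<^sub>H \<cdot> \<S> h3)"
          using x k h2 h3
          by (intro sw3_antipode_right[OF H_module k, where f="\<lambda>k1 w. \<S> (x \<cdot> k1) \<otimes>\<^sub>H
            (h2 \<cdot> w \<cdot> \<S> h3)"] linear_intros) auto
        finally show ?thesis using h2 by simp
      qed
      have "?sw (\<lambda>h2 h3. F x h2 h3) y = ?sw (\<lambda>h2 h3. \<S> (x \<cdot> k) \<cdot> (h2 \<cdot> \<S> h3)) y"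
        using x y k by (intro sw_cong[OF ag y]) (auto simp: a)
      also have "\<dots> = counit H y \<odot>\<^sub>H (\<S> (x \<cdot> k) \<cdot> \<one>\<^sub>H)"
        using x k by (intro sw_antipode_right[OF H_module y, where f="\<lambda>w. \<S> (x \<cdot> k) \<cdot> w"]
            linear_intros) auto
      finally show ?thesis using x k by simp
    qed
    have "?sw (\<lambda>x y. ?sw (\<lambda>h2 h3. F x h2 h3) y) h = ?sw (\<lambda>x y. counit H y \<odot>\<^sub>H \<S> (x \<cdot> k)) h"
      using h k by (intro sw_cong[OF ag h]) (auto simp: inner)
    also have "\<dots> = \<S> (h \<cdot> k)"
      by (rule sw_counit_right[OF H_module h]) (use k in \<open>auto intro!: linear_intros\<close>)
    finally show ?thesis .
  qed
  moreover have "?sw (\<lambda>x y. ?sw (\<lambda>h2 h3. F x h2 h3) y) h = ?sw (\<lambda>y h3. ?sw (\<lambda>h1 h2. F h1 h2 h3) y) h"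
    unfolding F_def \<Phi>_def using h k
    by (intro sw_coassoc[OF H_module h, symmetric] linear_intros H_module) auto
  moreover have "?sw (\<lambda>y h3. ?sw (\<lambda>h1 h2. F h1 h2 h3) y) h = \<S> k \<cdot> \<S> h"
  proof -
    have inner: "?sw (\<lambda>h1 h2. F h1 h2 h3) y = counit H y \<odot>\<^sub>H (\<S> k \<cdot> \<S> h3)"
      if y: "y : H" and h3: "h3 : H" for y h3
    proof -
      have "?sw (\<lambda>h1 h2. F h1 h2 h3) y =
        ?sw (\<lambda>h1 h2. ?sw (\<lambda>z k3. ?sw (\<lambda>k1 k2. \<Phi> h1 h2 h3 k1 k2 k3) z) k) y"
        using y h3 k by (intro sw_cong[OF ag y]) (auto simp: F1 cl ag intro!: sw_closed[OF ag])
      also have "\<dots> = ?sw (\<lambda>z k3. ?sw (\<lambda>h1 h2. ?sw (\<lambda>k1 k2. \<Phi> h1 h2 h3 k1 k2 k3) z) y) k"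
        using y h3 k by (intro sw_swap[OF ag]) (auto intro!: sw_closed[OF ag] cl)
      also have "\<dots> = ?sw (\<lambda>z k3. counit H z \<odot>\<^sub>H (counit H y \<odot>\<^sub>H (\<S> k3 \<cdot> \<S> h3))) k"
      proof (intro sw_cong[OF ag k])
        fix z k3 assume z: "z : H" and k3: "k3 : H"
        have "?sw (\<lambda>h1 h2. ?sw (\<lambda>k1 k2. \<Phi> h1 h2 h3 k1 k2 k3) z) y =
          ?sw (\<lambda>a b. \<S> a \<cdot> (b \<cdot> (\<S> k3 \<cdot> \<S> h3))) (y \<cdot> z)"
          unfolding \<Phi>_def using y z h3 k3
          by (intro sw_mult[OF H_module y z, symmetric] linear_intros) auto
        also have "\<dots> = ?sw (\<lambda>a b. (\<S> a \<cdot> b) \<cdot> (\<S> k3 \<cdot> \<S> h3)) (y \<cdot> z)"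
          using y z h3 k3 by (intro sw_cong[OF ag]) (auto simp: m_assoc)
        also have "\<dots> = counit H (y \<cdot> z) \<odot>\<^sub>H (\<one>\<^sub>H \<cdot> (\<S> k3 \<cdot> \<S> h3))"
          using y z h3 k3
          by (intro sw_antipode_left[OF H_module, where f="\<lambda>w. w \<cdot> (\<S> k3 \<cdot> \<S> h3)"]
              linear_intros) auto
        finally show "?sw (\<lambda>h1 h2. ?sw (\<lambda>k1 k2. \<Phi> h1 h2 h3 k1 k2 k3) z) y =
          counit H z \<odot>\<^sub>H (counit H y \<odot>\<^sub>H (\<S> k3 \<cdot> \<S> h3))"
          using y z h3 k3 by (simp add: counit_mult smult_assoc1[symmetric] R.m_comm)
      qed (use y h3 in auto)
      also have "\<dots> = counit H y \<odot>\<^sub>H (\<S> k \<cdot> \<S> h3)"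
        by (rule sw_counit_left[OF H_module k]) (use y h3 in \<open>auto intro!: linear_intros H_module\<close>)
      finally show ?thesis .
    qed
    have "?sw (\<lambda>y h3. ?sw (\<lambda>h1 h2. F h1 h2 h3) y) h =
      ?sw (\<lambda>y h3. counit H y \<odot>\<^sub>H (\<S> k \<cdot> \<S> h3)) h"
      using h k by (intro sw_cong[OF ag h]) (auto simp: inner)
    also have "\<dots> = \<S> k \<cdot> \<S> h"
      by (rule sw_counit_left[OF H_module h]) (use k in \<open>auto intro!: linear_intros\<close>)
    finally show ?thesis .
  qed
  ultimately show ?thesis by simp
qed

end

context cocommutative_hopf_algebra
begin

lemma sw3_swap23:
  assumes P: "module K P" and h: "h : H"
    and f1: "\<And>x y. [|x : H; y : H|] ==> linear_map K H P (\<lambda>z. f x y z)"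
    and f2: "\<And>x z. [|x : H; z : H|] ==> linear_map K H P (\<lambda>y. f x y z)"
  shows "sw P (\<lambda>x y. sw P (\<lambda>u v. f x u v) y) h =
    sw P (\<lambda>x y. sw P (\<lambda>u v. f x v u) y) h"
proof -
  note ag = module_abelian_group[OF P]
  have cl: "f x y z : P" if "x : H" "y : H" "z : H" for x y z
    using linear_mapD(1)[OF f1] that by blast
  show ?thesis
    by (intro sw_cong[OF ag h] sw_cocomm[OF P, symmetric] sw_closed[OF ag])
      (auto intro: cl f1 f2)
qed

lemma sw3_swap12:
  assumes P: "module K P" and h: "h : H"
    and f1: "\<And>x y. [|x : H; y : H|] ==> linear_map K H P (\<lambda>z. f x y z)"
    and f2: "\<And>x z. [|x : H; z : H|] ==> linear_map K H P (\<lambda>y. f x y z)"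
    and f3: "\<And>y z. [|y : H; z : H|] ==> linear_map K H P (\<lambda>x. f x y z)"
  shows "sw P (\<lambda>x y. sw P (\<lambda>u v. f x u v) y) h =
    sw P (\<lambda>x y. sw P (\<lambda>u v. f u x v) y) h"
proof -
  note ag = module_abelian_group[OF P]
  have cl: "f x y z : P" if "x : H" "y : H" "z : H" for x y z
    using linear_mapD(1)[OF f1] that by blast
  have "sw P (\<lambda>x y. sw P (\<lambda>u v. f x u v) y) h =
    sw P (\<lambda>x y. sw P (\<lambda>u v. f u v y) x) h"
    by (rule sw_coassoc[OF P h, symmetric]) (auto intro: f1 f2 f3)
  also have "\<dots> = sw P (\<lambda>x y. sw P (\<lambda>u v. f v u y) x) h"
    by (intro sw_cong[OF ag h] sw_cocomm[OF P, symmetric] sw_closed[OF ag])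
      (auto intro: cl f2 f3)
  also have "\<dots> = sw P (\<lambda>x y. sw P (\<lambda>u v. f u x v) y) h"
    by (rule sw_coassoc[OF P h]) (auto intro: f1 f2 f3)
  finally show ?thesis .
qed

text \<open>
  Cocommutativity applied to the two inner factors of \<open>h\<^sub>1 \<otimes> h\<^sub>2 \<otimes> h\<^sub>3 \<otimes> h\<^sub>4\<close>.
\<close>

lemma sw4_exchange:
  assumes P: "module K P" and h: "h : H"
    and f1: "\<And>x y z. [|x : H; y : H; z : H|] ==> linear_map K H P (\<lambda>w. f x y z w)"
    and f2: "\<And>x y z. [|x : H; y : H; z : H|] ==> linear_map K H P (\<lambda>w. f x y w z)"
    and f3: "\<And>x y z. [|x : H; y : H; z : H|] ==> linear_map K H P (\<lambda>w. f x w y z)"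
    and f4: "\<And>x y z. [|x : H; y : H; z : H|] ==> linear_map K H P (\<lambda>w. f w x y z)"
  shows "sw P (\<lambda>x y. sw P (\<lambda>a b. sw P (\<lambda>c d. f a b c d) y) x) h =
    sw P (\<lambda>x y. sw P (\<lambda>a b. sw P (\<lambda>c d. f a c b d) y) x) h"
proof -
  note ag = module_abelian_group[OF P]
  have cl: "f x y z w : P" if "x : H" "y : H" "z : H" "w : H" for x y z w
    using linear_mapD(1)[OF f1] that by blast
  have "sw P (\<lambda>x y. sw P (\<lambda>a b. sw P (\<lambda>c d. f a b c d) y) x) h =
    sw P (\<lambda>x y. sw P (\<lambda>b y. sw P (\<lambda>c d. f x b c d) y) y) h"
    by (rule sw_coassoc[OF P h]) (auto intro!: linear_intros P f1 f2 f3 f4)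
  also have "\<dots> = sw P (\<lambda>x y. sw P (\<lambda>b y. sw P (\<lambda>c d. f x c b d) y) y) h"
    by (intro sw_cong[OF ag h] sw3_swap12[OF P] sw_closed[OF ag])
      (auto intro: cl f1 f2 f3 f4)
  also have "\<dots> = sw P (\<lambda>x y. sw P (\<lambda>a b. sw P (\<lambda>c d. f a c b d) y) x) h"
    by (rule sw_coassoc[OF P h, symmetric]) (auto intro!: linear_intros P f1 f2 f3 f4)
  finally show ?thesis .
qed

end

context cocommutative_hopf_algebra
begin

text \<open>
  By cocommutativity \<open>h\<^sub>1S(h\<^sub>2) = \<epsilon>(h)\<close> can also be read as \<open>h\<^sub>2S(h\<^sub>1) = \<epsilon>(h)\<close>; applying \<open>\<S>\<close> shows that \<open>\<S> \<circ> \<S>\<close>,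
  like the identity, is convolution inverse to \<open>\<S>\<close>.
\<close>

lemma antipode_antipode:
  assumes h: "h : H"
  shows "\<S> (\<S> h) = h"
proof -
  let ?sw = "sw H"
  note ag = H_abelian_group
  \<comment> \<open>Evaluate \<open>\<S>(\<S>(h\<^sub>1)) \<S>(h\<^sub>2) h\<^sub>3\<close> in two ways.\<close>
  have "?sw (\<lambda>x y. ?sw (\<lambda>u v. \<S> (\<S> x) \<cdot> (\<S> u \<cdot> v)) y) h = \<S> (\<S> h) \<cdot> \<one>\<^sub>H"
    by (rule sw3_antipode_left[OF H_module h, where f="\<lambda>x w. \<S> (\<S> x) \<cdot> w"])
      (auto intro!: linear_intros)
  moreover have "?sw (\<lambda>x y. ?sw (\<lambda>u v. \<S> (\<S> x) \<cdot> (\<S> u \<cdot> v)) y) h =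
    ?sw (\<lambda>y v. ?sw (\<lambda>x u. \<S> (\<S> x) \<cdot> (\<S> u \<cdot> v)) y) h"
    by (rule sw_coassoc[OF H_module h, symmetric]) (auto intro!: linear_intros)
  moreover have "\<dots> = ?sw (\<lambda>y v. counit H y \<odot>\<^sub>H v) h"
  proof (intro sw_cong[OF ag h])
    fix y v assume y: "y : H" and v: "v : H"
    have "?sw (\<lambda>x u. \<S> (\<S> x) \<cdot> (\<S> u \<cdot> v)) y = ?sw (\<lambda>x u. \<S> (u \<cdot> \<S> x) \<cdot> v) y"
      using y v by (intro sw_cong[OF ag y]) (auto simp: antipode_mult m_assoc)
    also have "\<dots> = ?sw (\<lambda>x u. \<S> (x \<cdot> \<S> u) \<cdot> v) y"
      using v by (intro sw_cocomm[OF H_module y]) (auto intro!: linear_intros)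
    also have "\<dots> = counit H y \<odot>\<^sub>H (\<S> \<one>\<^sub>H \<cdot> v)"
      using v by (intro sw_antipode_right[OF H_module y, where f="\<lambda>w. \<S> w \<cdot> v"])
        (auto intro!: linear_intros)
    finally show "?sw (\<lambda>x u. \<S> (\<S> x) \<cdot> (\<S> u \<cdot> v)) y = counit H y \<odot>\<^sub>H v"
      using v by (simp add: antipode_one)
  qed auto
  moreover have "\<dots> = h" by (rule counit_left[OF h])
  ultimately show ?thesis using h by simp
qed

text \<open>
  \<open>\<Delta>(h\<^sub>1)(\<S>(h\<^sub>2) \<otimes> \<S>(h\<^sub>3)) = \<epsilon>(h)(1 \<otimes> 1)\<close>, tested against a bilinear \<open>f\<close>: once the inner factors are
  exchanged, the antipode axiom applies in each tensor factor.
\<close>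

lemma sw_contract_product:
  assumes P: "module K P" and h: "h : H"
    and f1: "\<And>x. x : H ==> linear_map K H P (f x)"
    and f2: "\<And>y. y : H ==> linear_map K H P (\<lambda>x. f x y)"
  shows "sw P (\<lambda>y z. sw P (\<lambda>a b. sw P (\<lambda>c d.
      f (a \<cdot> \<S> c) (b \<cdot> \<S> d)) z) y) h = counit H h \<odot>\<^sub>P f \<one>\<^sub>H \<one>\<^sub>H"
proof -
  let ?sw = "sw P"
  note ag = module_abelian_group[OF P]
  have cl: "f x y : P" if "x : H" "y : H" for x y
    using linear_mapD(1)[OF f1] that by blast
  have f1': "linear_map K H P (\<lambda>w. f x (g w))" if "x : H" "linear_map K H H g" for x g
    using linear_map_comp[OF f1[OF that(1)] that(2)] .
  have f2': "linear_map K H P (\<lambda>w. f (g w) y)" if "y : H" "linear_map K H H g" for y g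
    using linear_map_comp[OF f2[OF that(1)] that(2)] .
  have "?sw (\<lambda>y z. ?sw (\<lambda>a b. ?sw (\<lambda>c d. f (a \<cdot> \<S> c) (b \<cdot> \<S> d)) z) y) h =
    ?sw (\<lambda>y z. ?sw (\<lambda>a b. ?sw (\<lambda>c d. f (a \<cdot> \<S> b) (c \<cdot> \<S> d)) z) y) h"
    by (rule sw4_exchange[OF P h]) (auto intro!: f1' f2' linear_intros)
  also have "\<dots> = ?sw (\<lambda>y z. counit H y \<odot>\<^sub>P (counit H z \<odot>\<^sub>P f \<one>\<^sub>H \<one>\<^sub>H)) h"
  proof (intro sw_cong[OF ag h])
    fix y z assume y: "y : H" and z: "z : H"
    have "?sw (\<lambda>a b. ?sw (\<lambda>c d. f (a \<cdot> \<S> b) (c \<cdot> \<S> d)) z) y =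
      ?sw (\<lambda>a b. counit H z \<odot>\<^sub>P f (a \<cdot> \<S> b) \<one>\<^sub>H) y"
      using y z by (intro sw_cong[OF ag] sw_antipode_right[OF P z])
        (auto intro!: f1 module.smult_closed[OF P] cl)
    also have "\<dots> = counit H y \<odot>\<^sub>P (counit H z \<odot>\<^sub>P f \<one>\<^sub>H \<one>\<^sub>H)"
      using y z by (intro sw_antipode_right[OF P y, where f="\<lambda>w. counit H z \<odot>\<^sub>P f w \<one>\<^sub>H"])
        (auto intro!: f2 linear_intros P)
    finally show "?sw (\<lambda>a b. ?sw (\<lambda>c d. f (a \<cdot> \<S> b) (c \<cdot> \<S> d)) z) y =
      counit H y \<odot>\<^sub>P (counit H z \<odot>\<^sub>P f \<one>\<^sub>H \<one>\<^sub>H)" .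
  qed (auto intro!: module.smult_closed[OF P] cl)
  also have "\<dots> = counit H h \<odot>\<^sub>P f \<one>\<^sub>H \<one>\<^sub>H"
    by (rule sw_counit_left[OF P h]) (auto intro!: linear_intros P cl)
  finally show ?thesis .
qed

text \<open>
  The antipode is a coalgebra map: \<open>\<Delta> \<circ> \<S>\<close> and \<open>(\<S> \<otimes> \<S>) \<circ> \<Delta>\<close> are a left and a right convolution
  inverse of \<open>\<Delta>\<close>.  Cocommutativity removes the flip that is there in general.
\<close>

lemma sw_antipode:
  assumes P: "module K P" and h: "h : H"
    and f1: "\<And>x. x : H ==> linear_map K H P (f x)"
    and f2: "\<And>y. y : H ==> linear_map K H P (\<lambda>x. f x y)"
  shows "sw P f (\<S> h) = sw P (\<lambda>x y. f (\<S> x) (\<S> y)) h"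
proof -
  let ?sw = "sw P"
  note ag = module_abelian_group[OF P]
  have cl: "f x y : P" if "x : H" "y : H" for x y
    using linear_mapD(1)[OF f1] that by blast
  have f1': "linear_map K D P (\<lambda>w. f x (g w))" if "x : H" "linear_map K D H g" for x g D
    using linear_map_comp[OF f1[OF that(1)] that(2)] .
  have f2': "linear_map K D P (\<lambda>w. f (g w) y)" if "y : H" "linear_map K D H g" for y g D
    using linear_map_comp[OF f2[OF that(1)] that(2)] .
  note li = linear_intros f1' f2'
  define G where "G = (\<lambda>z a b. ?sw (\<lambda>c d. f (a \<cdot> \<S> c) (b \<cdot> \<S> d)) z)"
  have G: "G z a b : P" if "z : H" "a : H" "b : H" for z a b
    unfolding G_def using that by (intro sw_closed[OF ag]) (auto intro!: cl)
  have G1: "linear_map K H P (\<lambda>w. G z a (g w))" if "z : H" "a : H" "linear_map K H H g" for z a g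
    unfolding G_def using that by (auto intro!: li P)
  have G2: "linear_map K H P (\<lambda>w. G z (g w) a)" if "z : H" "a : H" "linear_map K H H g" for z a g
    unfolding G_def using that by (auto intro!: li P)
  have G3: "linear_map K H P (\<lambda>w. G (g w) a b)" if "b : H" "a : H" "linear_map K H H g" for b a g
    unfolding G_def using that by (auto intro!: li P)
  note Gli = linear_intros G1 G2 G3
  define X where "X = (\<lambda>x y z. ?sw (\<lambda>g1 g2. ?sw (\<lambda>a b. G z (g1 \<cdot> a) (g2 \<cdot> b)) y) (\<S> x))"
  have "?sw (\<lambda>x w. ?sw (\<lambda>y z. X x y z) w) h = ?sw f (\<S> h)"
  proof -
    have inner: "?sw (\<lambda>y z. X x y z) w = counit H w \<odot>\<^sub>P ?sw f (\<S> x)"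
      if x: "x : H" and w: "w : H" for x w
    proof -
      have "?sw (\<lambda>y z. X x y z) w = ?sw (\<lambda>g1 g2. ?sw (\<lambda>y z. ?sw (\<lambda>a b. G z (g1 \<cdot> a) (g2 \<cdot> b)) y) w) (\<S> x)"
        unfolding X_def using x w by (intro sw_swap[OF ag]) (auto intro!: sw_closed[OF ag] G)
      also have "\<dots> = ?sw (\<lambda>g1 g2. counit H w \<odot>\<^sub>P f g1 g2) (\<S> x)"
      proof (intro sw_cong[OF ag])
        fix g1 g2 assume g: "g1 : H" "g2 : H"
        have "?sw (\<lambda>y z. ?sw (\<lambda>a b. G z (g1 \<cdot> a) (g2 \<cdot> b)) y) w =
          ?sw (\<lambda>y z. ?sw (\<lambda>a b. ?sw (\<lambda>c d. f (g1 \<cdot> (a \<cdot> \<S> c)) (g2 \<cdot> (b \<cdot> \<S> d))) z) y) w"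
          unfolding G_def using g w
          by (intro sw_cong[OF ag] sw_closed[OF ag]) (auto simp: m_assoc intro!: cl)
        also have "\<dots> = counit H w \<odot>\<^sub>P f (g1 \<cdot> \<one>\<^sub>H) (g2 \<cdot> \<one>\<^sub>H)"
          using g by (intro sw_contract_product[OF P w, where f="\<lambda>a b. f (g1 \<cdot> a) (g2 \<cdot> b)"])
            (auto intro!: li)
        finally show "?sw (\<lambda>y z. ?sw (\<lambda>a b. G z (g1 \<cdot> a) (g2 \<cdot> b)) y) w =
          counit H w \<odot>\<^sub>P f g1 g2" using g by simp
      qed (use x w in \<open>auto intro!: module.smult_closed[OF P] cl\<close>)
      also have "\<dots> = counit H w \<odot>\<^sub>P ?sw f (\<S> x)"
        using x w by (intro sw_linear_map[OF module_smult_linear[OF P] P P, symmetric]) (auto intro: cl)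
      finally show ?thesis .
    qed
    have "?sw (\<lambda>x w. ?sw (\<lambda>y z. X x y z) w) h = ?sw (\<lambda>x w. counit H w \<odot>\<^sub>P ?sw f (\<S> x)) h"
      by (intro sw_cong[OF ag h]) (auto simp: inner intro!: module.smult_closed[OF P] sw_closed[OF ag] cl)
    also have "\<dots> = ?sw f (\<S> h)"
      by (rule sw_counit_right[OF P h]) (auto intro!: li P)
    finally show ?thesis .
  qed
  moreover have "?sw (\<lambda>x w. ?sw (\<lambda>y z. X x y z) w) h = ?sw (\<lambda>w z. ?sw (\<lambda>x y. X x y z) w) h"
    unfolding X_def by (rule sw_coassoc[OF P h, symmetric]) (auto intro!: Gli P)
  moreover have "?sw (\<lambda>w z. ?sw (\<lambda>x y. X x y z) w) h = ?sw (\<lambda>x y. f (\<S> x) (\<S> y)) h"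
  proof -
    have inner: "?sw (\<lambda>x y. X x y z) w = counit H w \<odot>\<^sub>P ?sw (\<lambda>c d. f (\<S> c) (\<S> d)) z"
      if w: "w : H" and z: "z : H" for w z
    proof -
      have lin: "linear_map K H P (?sw (G z))"
        using z by (auto intro!: linear_sw_arg Gli P)
      have "?sw (\<lambda>x y. X x y z) w = ?sw (\<lambda>x y. ?sw (G z) (\<S> x \<cdot> y)) w"
      proof (intro sw_cong[OF ag w])
        fix x y assume "x : H" "y : H"
        then show "X x y z = ?sw (G z) (\<S> x \<cdot> y)"
          unfolding X_def using z
          by (intro sw_mult[OF P, symmetric]) (auto intro!: Gli)
      qed (use z in \<open>auto intro!: sw_closed[OF ag] G\<close>)
      also have "\<dots> = counit H w \<odot>\<^sub>P ?sw (G z) \<one>\<^sub>H"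
        by (rule sw_antipode_left[OF P w lin])
      also have "?sw (G z) \<one>\<^sub>H = G z \<one>\<^sub>H \<one>\<^sub>H"
        using z by (intro sw_one[OF P]) (auto intro!: Gli)
      also have "\<dots> = ?sw (\<lambda>c d. f (\<S> c) (\<S> d)) z"
        unfolding G_def by (intro sw_cong[OF ag z]) (auto intro: cl)
      finally show ?thesis .
    qed
    have "?sw (\<lambda>w z. ?sw (\<lambda>x y. X x y z) w) h = ?sw (\<lambda>w z. counit H w \<odot>\<^sub>P ?sw (\<lambda>c d. f (\<S> c) (\<S> d)) z) h"
      by (intro sw_cong[OF ag h]) (auto simp: inner intro!: module.smult_closed[OF P] sw_closed[OF ag] cl)
    also have "\<dots> = ?sw (\<lambda>c d. f (\<S> c) (\<S> d)) h"
      by (rule sw_counit_left[OF P h]) (auto intro!: linear_sw_arg li P)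
    finally show ?thesis .
  qed
  ultimately show ?thesis by simp
qed

end

section \<open>The partial smash product\<close>

lemma unital_algebra_module: "unital_algebra K E ==> module K E"
  by (rule unital_algebra.axioms)

lemma unital_algebra_ring: "unital_algebra K E ==> ring E"
  by (rule unital_algebra.axioms)

lemma linear_mult_left:
  assumes E: "unital_algebra K E" and y: "y : E" and f: "linear_map K D E f"
  shows "linear_map K D E (\<lambda>x. f x \<otimes>\<^sub>E y)"
proof -
  interpret E: unital_algebra K E by fact
  have "linear_map K E E (\<lambda>x. x \<otimes>\<^sub>E y)"
    using y by (intro linear_mapI) (auto simp: E.l_distr E.smult_mult_left)
  from linear_map_comp[OF this f] show ?thesis .
qed

lemma linear_mult_right:
  assumes E: "unital_algebra K E" and y: "y : E" and f: "linear_map K D E f"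
  shows "linear_map K D E (\<lambda>x. y \<otimes>\<^sub>E f x)"
proof -
  interpret E: unital_algebra K E by fact
  have "linear_map K E E (\<lambda>x. y \<otimes>\<^sub>E x)"
    using y by (intro linear_mapI) (auto simp: E.r_distr E.smult_mult_right)
  from linear_map_comp[OF this f] show ?thesis .
qed

lemma sum_of_linear:
  assumes P: "module K P" and f: "linear_map K D P f" and g: "linear_map K D P g"
  shows "linear_map K D P (\<lambda>x. f x \<oplus>\<^sub>P g x)"
proof -
  interpret P: module K P by fact
  show ?thesis using linear_mapD[OF f] linear_mapD[OF g]
    by (intro linear_mapI) (auto simp: P.M.a_ac P.smult_r_distr)
qed

context hopf_algebra
begin
lemmas H_m_assoc = m_assoc and H_l_one = l_one and H_r_one = r_one and H_m_closed = m_closed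
  and H_one_closed = one_closed
end

context symmetric_partial_action
begin

lemma A_algebra: "unital_algebra K A" by (rule A.unital_algebra_axioms)
lemma A_module: "module K A" by (rule unital_algebra_module[OF A_algebra])

lemma linear_A_left [linear_intros]:
  "[|b : A; linear_map K D A f|] ==> linear_map K D A (\<lambda>x. f x \<otimes>\<^sub>A b)"
  by (rule linear_mult_left[OF A_algebra])

lemma linear_A_right [linear_intros]:
  "[|b : A; linear_map K D A f|] ==> linear_map K D A (\<lambda>x. b \<otimes>\<^sub>A f x)"
  by (rule linear_mult_right[OF A_algebra])

lemma linear_act_left [linear_intros]:
  assumes "a : A" "linear_map K D H f" shows "linear_map K D A (\<lambda>x. act (f x) a)"
  using linear_map_comp[OF act_linear_left[OF assms(1)] assms(2)] .

lemma linear_act_right [linear_intros]: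
  assumes "h : H" "linear_map K D A f" shows "linear_map K D A (\<lambda>x. act h (f x))"
  using linear_map_comp[OF act_linear_right[OF assms(1)] assms(2)] .

lemma act_closed [simp, intro]: "[|h : H; a : A|] ==> act h a : A"
  using linear_mapD(1)[OF act_linear_right] .

sublocale AH: module_pair K A H
  by (simp add: module_pair_def A_module H_module)

abbreviation "TT \<equiv> tensor K A H"
abbreviation "pt \<equiv> pure_tensor K A H"
abbreviation "E \<equiv> pt \<one>\<^sub>A \<one>\<^sub>H"
abbreviation smult_smash (infixl \<open>\<star>\<close> 70) where "s \<star> t \<equiv> smash_mult K H A act s t"
abbreviation "S \<equiv> smash K H A act"
abbreviation smash_times (infixl \<open>\<bullet>\<close> 70) where "x \<bullet> y \<equiv> x \<otimes>\<^sub>S y"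

lemma TT_module: "module K TT" by (rule AH.tensor_module)
lemma TT_ag: "abelian_group TT" by (rule module_abelian_group[OF TT_module])
lemma A_ag: "abelian_group A" by (rule module_abelian_group[OF A_module])

lemma linear_pt_left [linear_intros]:
  "[|y : H; linear_map K D A f|] ==> linear_map K D TT (\<lambda>x. pt (f x) y)"
  by (rule pure_linear_left[OF A_module H_module])

lemma linear_pt_right [linear_intros]:
  "[|a : A; linear_map K D H f|] ==> linear_map K D TT (\<lambda>x. pt a (f x))"
  by (rule pure_linear_right[OF A_module H_module])

lemma pt_closed: "[|a : A; h : H|] ==> pt a h : TT"
  by simp

definition smash_pure where
  "smash_pure a h b k = sw TT (\<lambda>x y. pt (a \<otimes>\<^sub>A act x b) (y \<cdot> k)) h"

lemma smash_mult_eq: "s \<star> t = tensor_lift TT (\<lambda>a h. tensor_lift TT (smash_pure a h) t) s"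
  by (simp add: smash_mult_def smash_pure_def[abs_def])

lemma smash_pure_bilinear:
  assumes "a : A" "h : H" shows "bilinear_map K A H TT (smash_pure a h)"
  unfolding smash_pure_def[abs_def] using assms
  by (intro bilinear_mapI linear_intros TT_module) auto

lemma smash_pure_lift_bilinear:
  assumes t: "t : TT"
  shows "bilinear_map K A H TT (\<lambda>a h. tensor_lift TT (smash_pure a h) t)"
proof -
  have t': "t : AH.T" using t by simp
  have lin: "linear_map K D TT (\<lambda>x. tensor_lift TT (F x) t)"
    if F: "\<And>b k. b : A ==> k : H ==> linear_map K D TT (\<lambda>x. F x b k)" 
      and cl: "\<And>r x. [|r : K; x : D|] ==> r \<odot>\<^sub>D x : D"
    for F and D :: "('k, 'd, 'q) module_scheme"
  proof -
    have add: "additive_map D TT (\<lambda>x. tensor_lift TT (F x) t)"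
      by (intro AH.tensor_lift_additive_fun[OF TT_ag t'] linear_map_additive[OF F])
    show ?thesis
    proof (rule linear_mapI)
      fix r x assume r: "r : K" and x: "x : D"
      have Fc: "F x b k : TT" if "b : A" "k : H" for b k
        using linear_mapD(1)[OF F[OF that] x] .
      have "tensor_lift TT (F (r \<odot>\<^sub>D x)) t = tensor_lift TT (\<lambda>b k. r \<odot>\<^bsub>TT\<^esub> F x b k) t"
        using r x linear_mapD(3)[OF F] Fc
        by (intro AH.tensor_lift_cong[OF TT_ag t']) (auto simp del: AH.tensor_simps
            intro!: module.smult_closed[OF TT_module])
      also have "\<dots> = r \<odot>\<^bsub>TT\<^esub> tensor_lift TT (F x) t"
        by (intro AH.tensor_lift_map[OF linear_map_additive[OF module_smult_linear[OF TT_module r]]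
            TT_ag TT_ag t', symmetric] Fc)
      finally show "tensor_lift TT (F (r \<odot>\<^sub>D x)) t = r \<odot>\<^bsub>TT\<^esub> tensor_lift TT (F x) t" .
    qed (use additive_mapD[OF add] in auto)
  qed
  show ?thesis
  proof (rule bilinear_mapI)
    fix a assume a: "a : A"
    show "linear_map K H TT (\<lambda>h. tensor_lift TT (smash_pure a h) t)"
      using a by (intro lin) (auto simp: smash_pure_def intro!: linear_intros TT_module)
  next
    fix h assume h: "h : H"
    show "linear_map K A TT (\<lambda>a. tensor_lift TT (smash_pure a h) t)"
      using h by (intro lin) (auto simp: smash_pure_def intro!: linear_intros TT_module)
  qed
qed

lemma smash_mult_linear_left: "t : TT ==> linear_map K TT TT (\<lambda>s. s \<star> t)"
  unfolding smash_mult_eq by (rule AH.tensor_lift_linear[OF TT_module smash_pure_lift_bilinear])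

lemma smash_mult_closed: "[|s : TT; t : TT|] ==> s \<star> t : TT"
  by (rule linear_mapD(1)[OF smash_mult_linear_left])

lemma smash_mult_pure_left:
  assumes "a : A" "h : H" "t : TT"
  shows "pt a h \<star> t = tensor_lift TT (smash_pure a h) t"
  unfolding smash_mult_eq
  by (rule AH.tensor_lift_pure[OF TT_ag bilinear_middle_linear[OF smash_pure_lift_bilinear]]) fact+

lemma smash_mult_pure:
  assumes "a : A" "h : H" "b : A" "k : H"
  shows "pt a h \<star> pt b k = smash_pure a h b k"
  using assms AH.tensor_lift_pure[OF TT_ag bilinear_middle_linear[OF smash_pure_bilinear]]
  by (simp add: smash_mult_pure_left)

lemma TT_induct [consumes 1, case_names zero pure add]:
  assumes "t : TT" "Q \<zero>\<^bsub>TT\<^esub>" "\<And>a h. [|a : A; h : H|] ==> Q (pt a h)"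
    and "\<And>s t. [|s : TT; t : TT; Q s; Q t|] ==> Q (s \<oplus>\<^bsub>TT\<^esub> t)"
  shows "Q t"
  using AH.tensor_induct[of t Q] assms by simp

lemma smash_mult_linear_right:
  assumes s: "s : TT" shows "linear_map K TT TT (\<lambda>t. s \<star> t)"
  using s
proof (induction s rule: TT_induct)
  case zero
  interpret TT: module K TT by (rule TT_module)
  have z: "\<zero>\<^bsub>TT\<^esub> \<star> t = \<zero>\<^bsub>TT\<^esub>" if "t : TT" for t
    by (rule additive_map_zero[OF linear_map_additive[OF smash_mult_linear_left[OF that]] TT_ag TT_ag])
  show ?case
    by (rule linear_mapI)
      (simp_all add: z TT.smult_r_null del: AH.tensor_simps)
next
  case (pure a h)
  then have "linear_map K TT TT (tensor_lift TT (smash_pure a h))"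
    by (intro AH.tensor_lift_linear[OF TT_module smash_pure_bilinear])
  then show ?case
    using module.smult_closed[OF TT_module] abelian_group.axioms(1)[OF TT_ag] pure
    by (intro linear_map_cong[OF _ smash_mult_pure_left[symmetric]]) (simp_all del: AH.tensor_simps)
next
  case (add s t)
  have "linear_map K TT TT (\<lambda>u. s \<star> u \<oplus>\<^bsub>TT\<^esub> t \<star> u)"
    using add by (intro sum_of_linear TT_module)
  then show ?case
    using module.smult_closed[OF TT_module] abelian_group.axioms(1)[OF TT_ag] add
      linear_mapD(2)[OF smash_mult_linear_left]
    by (intro linear_map_cong[where g="\<lambda>u. (s \<oplus>\<^bsub>TT\<^esub> t) \<star> u"]) (auto simp del: AH.tensor_simps)
qed

lemma smash_mult_add_left:
  "[|s : TT; s' : TT; t : TT|] ==> (s \<oplus>\<^bsub>TT\<^esub> s') \<star> t = s \<star> t \<oplus>\<^bsub>TT\<^esub> s' \<star> t"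
  by (rule linear_mapD(2)[OF smash_mult_linear_left])

lemma smash_mult_add_right:
  "[|s : TT; t : TT; t' : TT|] ==> s \<star> (t \<oplus>\<^bsub>TT\<^esub> t') = s \<star> t \<oplus>\<^bsub>TT\<^esub> s \<star> t'"
  by (rule linear_mapD(2)[OF smash_mult_linear_right])

lemma smash_mult_zero_left: "t : TT ==> \<zero>\<^bsub>TT\<^esub> \<star> t = \<zero>\<^bsub>TT\<^esub>"
  by (rule additive_map_zero[OF linear_map_additive[OF smash_mult_linear_left] TT_ag TT_ag])

lemma smash_mult_zero_right: "s : TT ==> s \<star> \<zero>\<^bsub>TT\<^esub> = \<zero>\<^bsub>TT\<^esub>"
  by (rule additive_map_zero[OF linear_map_additive[OF smash_mult_linear_right] TT_ag TT_ag])

text \<open>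
  The factor \<open>h\<^sub>2\<cdot>1\<close> that the partial composition law puts before \<open>h\<^sub>3k\<cdot>c\<close> is absorbed by
  \<open>h\<^sub>1\<cdot>b\<close>, because \<open>(h\<^sub>1\<cdot>b)(h\<^sub>2\<cdot>1) = h\<cdot>(b1)\<close>.
\<close>

lemma act_mult_act:
  assumes h: "h : H" and k: "k : H" and b: "b : A" and c: "c : A"
  shows "act h (b \<otimes>\<^sub>A act k c) = sw A (\<lambda>x y. act x b \<otimes>\<^sub>A act (y \<cdot> k) c) h"
proof -
  have "act h (b \<otimes>\<^sub>A act k c) =
    sw A (\<lambda>x y. act x b \<otimes>\<^sub>A sw A (\<lambda>u v. act u \<one>\<^sub>A \<otimes>\<^sub>A act (v \<cdot> k) c) y) h"
    using h k b c by (simp add: act_mult)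
      (intro sw_cong[OF A_ag], auto simp: act_act intro!: sw_closed[OF A_ag])
  also have "\<dots> = sw A (\<lambda>x y. sw A
      (\<lambda>u v. (act x b \<otimes>\<^sub>A act u \<one>\<^sub>A) \<otimes>\<^sub>A act (v \<cdot> k) c) y) h"
  proof (intro sw_cong[OF A_ag h])
    fix x y assume x: "x : H" and y: "y : H"
    have "act x b \<otimes>\<^sub>A sw A (\<lambda>u v. act u \<one>\<^sub>A \<otimes>\<^sub>A act (v \<cdot> k) c) y =
      sw A (\<lambda>u v. act x b \<otimes>\<^sub>A (act u \<one>\<^sub>A \<otimes>\<^sub>A act (v \<cdot> k) c)) y"
      using x y k b c by (intro sw_linear_map[OF linear_A_right[OF _ linear_map_id] A_module A_module]) auto
    also have "\<dots> = sw A (\<lambda>u v. (act x b \<otimes>\<^sub>A act u \<one>\<^sub>A) \<otimes>\<^sub>A act (v \<cdot> k) c) y"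
      using x y k b c by (intro sw_cong[OF A_ag]) (auto simp: A.m_assoc)
    finally show "act x b \<otimes>\<^sub>A sw A (\<lambda>u v. act u \<one>\<^sub>A \<otimes>\<^sub>A act (v \<cdot> k) c) y = \<dots>" .
  qed (use k b c in \<open>auto intro!: sw_closed[OF A_ag]\<close>)
  also have "\<dots> = sw A (\<lambda>y v. sw A
      (\<lambda>x u. (act x b \<otimes>\<^sub>A act u \<one>\<^sub>A) \<otimes>\<^sub>A act (v \<cdot> k) c) y) h"
    using k b c by (intro sw_coassoc[OF A_module h, symmetric]) (auto intro!: linear_intros)
  also have "\<dots> = sw A (\<lambda>y v. act y b \<otimes>\<^sub>A act (v \<cdot> k) c) h"
  proof (intro sw_cong[OF A_ag h])
    fix y v assume y: "y : H" and v: "v : H"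
    have "sw A (\<lambda>x u. (act x b \<otimes>\<^sub>A act u \<one>\<^sub>A) \<otimes>\<^sub>A act (v \<cdot> k) c) y =
      sw A (\<lambda>x u. act x b \<otimes>\<^sub>A act u \<one>\<^sub>A) y \<otimes>\<^sub>A act (v \<cdot> k) c"
      using y v k b c
      by (intro sw_linear_map[OF linear_A_left[OF _ linear_map_id] A_module A_module, symmetric]) auto
    also have "sw A (\<lambda>x u. act x b \<otimes>\<^sub>A act u \<one>\<^sub>A) y = act y b"
      using act_mult[OF y b A.one_closed] b by simp
    finally show "sw A (\<lambda>x u. (act x b \<otimes>\<^sub>A act u \<one>\<^sub>A) \<otimes>\<^sub>A act (v \<cdot> k) c) y =
      act y b \<otimes>\<^sub>A act (v \<cdot> k) c" .
  qed (use k b c in auto)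
  finally show ?thesis .
qed

text \<open>
  Both sides are \<open>\<Sum> a(h\<^sub>1\<cdot>b)(h\<^sub>2k\<^sub>1\<cdot>c) \<otimes> h\<^sub>3k\<^sub>2l\<close>; on one side this takes the previous identity, on the other
  the multiplicativity of the coproduct.
\<close>

lemma smash_assoc_pure:
  assumes a: "a : A" and h: "h : H" and b: "b : A" and k: "k : H"
    and c: "c : A" and l: "l : H"
  shows "(pt a h \<star> pt b k) \<star> pt c l = pt a h \<star> (pt b k \<star> pt c l)"
proof -
  let ?sw = "sw TT"
  define \<Phi> where "\<Phi> = (\<lambda>u v y k1 k2. pt (a \<otimes>\<^sub>A (act u b \<otimes>\<^sub>A act (v \<cdot> k1) c)) (y \<cdot> (k2 \<cdot> l)))"
  have cl: "\<Phi> u v y k1 k2 : TT" if "u : H" "v : H" "y : H"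
    "k1 : H" "k2 : H" for u v y k1 k2
    unfolding \<Phi>_def using that a b c l by (intro pt_closed) auto
  have "(pt a h \<star> pt b k) \<star> pt c l = smash_pure a h b k \<star> pt c l"
    using assms by (simp add: smash_mult_pure)
  also have "\<dots> = ?sw (\<lambda>x y. pt (a \<otimes>\<^sub>A act x b) (y \<cdot> k) \<star> pt c l) h"
    unfolding smash_pure_def using assms
    by (intro sw_linear_map[OF smash_mult_linear_left TT_module TT_module]) auto
  also have "\<dots> = ?sw (\<lambda>x y. ?sw (\<lambda>v y. ?sw (\<lambda>k1 k2. \<Phi> x v y k1 k2) k) y) h"
  proof (intro sw_cong[OF TT_ag h])
    fix x y assume x: "x : H" and y: "y : H"
    have "pt (a \<otimes>\<^sub>A act x b) (y \<cdot> k) \<star> pt c l =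
      ?sw (\<lambda>u v. pt (a \<otimes>\<^sub>A act x b \<otimes>\<^sub>A act u c) (v \<cdot> l)) (y \<cdot> k)"
      using assms x y by (simp add: smash_mult_pure smash_pure_def)
    also have "\<dots> = ?sw (\<lambda>p q. ?sw (\<lambda>k1 k2. pt (a \<otimes>\<^sub>A act x b \<otimes>\<^sub>A act (p \<cdot> k1) c) ((q \<cdot> k2) \<cdot> l)) k) y"
      using assms x y by (intro sw_mult[OF TT_module]) (auto intro!: linear_intros)
    also have "\<dots> = ?sw (\<lambda>v y. ?sw (\<lambda>k1 k2. \<Phi> x v y k1 k2) k) y"
      using assms x y cl by (intro sw_cong[OF TT_ag] sw_closed[OF TT_ag])
        (auto simp: \<Phi>_def H_m_assoc A.m_assoc)
    finally show "pt (a \<otimes>\<^sub>A act x b) (y \<cdot> k) \<star> pt c l = \<dots>" .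
  qed (use k in \<open>auto intro!: sw_closed[OF TT_ag] cl simp del: AH.tensor_simps\<close>)
  also have "\<dots> = ?sw (\<lambda>x y. ?sw (\<lambda>u v. ?sw (\<lambda>k1 k2. \<Phi> u v y k1 k2) k) x) h"
    unfolding \<Phi>_def using assms
    by (intro sw_coassoc[OF TT_module h, symmetric]) (auto intro!: linear_intros TT_module)
  also have "\<dots> = ?sw (\<lambda>x y. ?sw (\<lambda>k1 k2. ?sw (\<lambda>u v. \<Phi> u v y k1 k2) x) k) h"
    using k cl by (intro sw_cong[OF TT_ag h] sw_swap[OF TT_ag] sw_closed[OF TT_ag]) auto
  also have "\<dots> = ?sw (\<lambda>k1 k2. ?sw (\<lambda>x y. ?sw (\<lambda>u v. \<Phi> u v y k1 k2) x) h) k"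
    using h k cl by (intro sw_swap[OF TT_ag] sw_closed[OF TT_ag]) auto
  also have "\<dots> = ?sw (\<lambda>k1 k2. pt a h \<star> pt (b \<otimes>\<^sub>A act k1 c) (k2 \<cdot> l)) k"
  proof (intro sw_cong[OF TT_ag k])
    fix k1 k2 assume k12: "k1 : H" "k2 : H"
    have "?sw (\<lambda>x y. ?sw (\<lambda>u v. \<Phi> u v y k1 k2) x) h =
      ?sw (\<lambda>x y. pt (a \<otimes>\<^sub>A act x (b \<otimes>\<^sub>A act k1 c)) (y \<cdot> (k2 \<cdot> l))) h"
    proof (intro sw_cong[OF TT_ag h])
      fix x y assume x: "x : H" and y: "y : H"
      show "?sw (\<lambda>u v. \<Phi> u v y k1 k2) x = pt (a \<otimes>\<^sub>A act x (b \<otimes>\<^sub>A act k1 c)) (y \<cdot> (k2 \<cdot> l))"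
        unfolding \<Phi>_def act_mult_act[OF x k12(1) b c] using x y k12 assms
        by (intro sw_linear_map[symmetric, where \<phi>="\<lambda>w. pt (a \<otimes>\<^sub>A w) (y \<cdot> (k2 \<cdot> l))"])
          (auto intro!: linear_intros TT_module A_module)
    qed (use assms k12 in auto)
    also have "\<dots> = pt a h \<star> pt (b \<otimes>\<^sub>A act k1 c) (k2 \<cdot> l)"
      using assms k12 by (simp add: smash_mult_pure smash_pure_def)
    finally show "?sw (\<lambda>x y. ?sw (\<lambda>u v. \<Phi> u v y k1 k2) x) h = \<dots>" .
  qed (use assms in \<open>auto intro!: smash_mult_closed pt_closed simp del: AH.tensor_simps\<close>)
  also have "\<dots> = pt a h \<star> ?sw (\<lambda>k1 k2. pt (b \<otimes>\<^sub>A act k1 c) (k2 \<cdot> l)) k"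
    using assms by (intro sw_linear_map[OF smash_mult_linear_right TT_module TT_module, symmetric]) auto
  also have "\<dots> = pt a h \<star> (pt b k \<star> pt c l)"
    using assms by (simp add: smash_mult_pure smash_pure_def)
  finally show ?thesis .
qed

lemma smash_mult_assoc:
  assumes s: "s : TT" and t: "t : TT" and u: "u : TT"
  shows "(s \<star> t) \<star> u = s \<star> (t \<star> u)"
proof -
  note cl = smash_mult_closed
  note li = smash_mult_add_left smash_mult_add_right smash_mult_zero_left smash_mult_zero_right
  have 1: "(pt a h \<star> pt b k) \<star> u = pt a h \<star> (pt b k \<star> u)"
    if abhk: "a : A" "h : H" "b : A" "k : H" for a h b k
    using u
  proof (induction u rule: TT_induct)
    case (add p q)
    then show ?case using abhk by (simp add: li cl pt_closed del: AH.tensor_simps)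
  qed (use abhk in \<open>simp_all add: smash_assoc_pure li cl pt_closed del: AH.tensor_simps\<close>)
  have 2: "(pt a h \<star> t) \<star> u = pt a h \<star> (t \<star> u)" if ah: "a : A" "h : H" for a h
    using t
  proof (induction t rule: TT_induct)
    case (add p q)
    then show ?case using ah u by (simp add: li cl pt_closed del: AH.tensor_simps)
  qed (use ah u in \<open>simp_all add: 1 li cl pt_closed del: AH.tensor_simps\<close>)
  show ?thesis
    using s
  proof (induction s rule: TT_induct)
    case (add p q)
    then show ?case using t u by (simp add: li cl pt_closed del: AH.tensor_simps)
  qed (use t u in \<open>simp_all add: 2 li cl pt_closed del: AH.tensor_simps\<close>)
qed

end

context symmetric_partial_action
begin

lemma smash_simps:
  "carrier S = (\<lambda>z. z \<star> E) ` carrier TT" "mult S = smash_mult K H A act" "one S = E"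
  "add S = add TT" "zero S = zero TT" "smult S = smult TT"
  by (simp_all add: smash_def Let_def)

lemma E_closed: "E : TT" by (rule pt_closed) auto

lemma E_mult: 
  assumes t: "t : TT" shows "E \<star> t = t"
  using t
proof (induction t rule: TT_induct)
  case (pure b k)
  have "E \<star> pt b k = pt (\<one>\<^sub>A \<otimes>\<^sub>A act \<one>\<^sub>H b) (\<one>\<^sub>H \<cdot> k)"
    unfolding smash_mult_pure[OF A.one_closed H_one_closed pure] smash_pure_def using pure
    by (intro sw_one[OF TT_module]) (auto intro!: linear_intros)
  then show ?case using pure by (simp add: act_one)
qed (simp_all add: smash_mult_add_right smash_mult_zero_right E_closed del: AH.tensor_simps)

text \<open>
  \<open>E = 1 \<otimes> 1\<close> is a left unit, hence idempotent, so the elements of \<open>(A \<otimes> H)E\<close> are those that \<open>E\<close> fixes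
  on the right.
\<close>

lemma S_iff: "z : S \<longleftrightarrow> z : TT \<and> z \<star> E = z"
proof
  assume "z : S"
  then obtain w where w: "w : TT" "z = w \<star> E" unfolding smash_simps by blast
  then show "z : TT \<and> z \<star> E = z"
    by (simp add: smash_mult_assoc smash_mult_closed E_closed E_mult del: AH.tensor_simps)
next
  assume "z : TT \<and> z \<star> E = z"
  then show "z : S" unfolding smash_simps by (metis image_eqI)
qed

lemma S_TT: "z : S ==> z : TT" by (simp only: S_iff)
lemma mult_E_S: "z : TT ==> z \<star> E : S" unfolding smash_simps by blast

lemma S_algebra: "unital_algebra K S"
proof -
  interpret TT: module K TT by (rule TT_module)
  note cl = smash_mult_closed E_closed S_TT
  note [simp del] = AH.tensor_simps
  have neg: "(\<ominus>\<^bsub>TT\<^esub> x) \<star> E = \<ominus>\<^bsub>TT\<^esub> (x \<star> E)" if "x : TT" for x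
    by (rule additive_map_minus[OF linear_map_additive[OF smash_mult_linear_left[OF E_closed]] TT_ag TT_ag that])
  have ag: "abelian_group S"
  proof (rule abelian_groupI)
    fix x assume x: "x : S"
    then have "\<ominus>\<^bsub>TT\<^esub> x : S"
      by (simp add: S_iff neg)
    then show "\<exists>y\<in>carrier S. y \<oplus>\<^sub>S x = \<zero>\<^sub>S"
      using S_TT[OF x] by (intro bexI[of _ "\<ominus>\<^bsub>TT\<^esub> x"]) (simp_all add: smash_simps(4,5) TT.l_neg)
  qed (simp_all add: S_iff smash_simps(4,5) smash_mult_add_left smash_mult_zero_left E_closed TT.M.a_ac)
  have r: "ring S"
    by (rule ringI[OF ag])
      (auto intro!: monoidI simp: smash_simps(2,3,4) S_iff smash_mult_assoc smash_mult_closed E_closed E_mult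
        smash_mult_add_left smash_mult_add_right)
  have m: "module K S"
    by (rule moduleI[OF K_cring ag])
      (simp_all add: smash_simps(4,6) S_iff linear_mapD(3)[OF smash_mult_linear_left[OF E_closed]]
        TT.smult_l_distr TT.smult_r_distr TT.smult_assoc1)
  show ?thesis
    by (intro unital_algebra.intro m r unital_algebra_axioms.intro)
      (simp_all add: smash_simps(2,6) S_iff linear_mapD(3)[OF smash_mult_linear_left]
        linear_mapD(3)[OF smash_mult_linear_right])
qed

lemma S_module: "module K S" by (rule unital_algebra_module[OF S_algebra])
lemma S_ag: "abelian_group S" by (rule module_abelian_group[OF S_module])

sublocale SS: ring S by (rule unital_algebra_ring[OF S_algebra])

lemma linear_S_left [linear_intros]:
  "[|b : S; linear_map K D S f|] ==> linear_map K D S (\<lambda>x. f x \<bullet> b)"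
  by (rule linear_mult_left[OF S_algebra])

lemma linear_S_right [linear_intros]:
  "[|b : S; linear_map K D S f|] ==> linear_map K D S (\<lambda>x. b \<bullet> f x)"
  by (rule linear_mult_right[OF S_algebra])

lemma sw_S:
  assumes h: "h : H" and f: "\<And>x y. [|x : H; y : H|] ==> f x y : S"
  shows "sw TT f h = sw S f h"
proof -
  have "additive_map S TT (\<lambda>x. x)"
    by (rule additive_mapI) (simp_all add: S_TT smash_simps(4) del: AH.tensor_simps)
  from sw_map[OF this S_ag TT_ag h f] show ?thesis by simp
qed

lemma linear_map_S:
  assumes "linear_map K D TT f" "\<And>x. x : D ==> f x : S"
  shows "linear_map K D S f"
  using assms(2) linear_mapD(2,3)[OF assms(1)] by (intro linear_mapI) (simp_all add: smash_simps)

abbreviation "smel \<equiv> smash_elem K H A act"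

lemma smel_eq:
  assumes "a : A" "h : H" shows "smel a h = pt a h \<star> E"
  unfolding smash_mult_pure[OF assms A.one_closed H_one_closed] smash_elem_def smash_pure_def
  using assms by (intro sw_cong[OF TT_ag]) auto

lemma smel_closed: "[|a : A; h : H|] ==> smel a h : S"
  by (simp add: smel_eq mult_E_S)

lemma S_induct [consumes 1, case_names zero smel add]:
  assumes p: "p : S" and "Q \<zero>\<^sub>S" "\<And>a h. [|a : A; h : H|] ==> Q (smel a h)"
    and "\<And>s t. [|s : S; t : S; Q s; Q t|] ==> Q (s \<oplus>\<^sub>S t)"
  shows "Q p"
proof -
  obtain z where z: "z : TT" "p = z \<star> E" using p unfolding smash_simps by blast
  have "Q (z \<star> E)" using z(1)
  proof (induction z rule: TT_induct)
    case zero
    then show ?case using assms(2) by (simp add: smash_mult_zero_left[OF E_closed] smash_simps(5) del: AH.tensor_simps)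
  next
    case (pure a h)
    then show ?case using assms(3) by (simp add: smel_eq)
  next
    case (add s t)
    then show ?case using assms(4)[OF mult_E_S mult_E_S]
      by (simp add: smash_mult_add_left E_closed smash_simps(4) del: AH.tensor_simps)
  qed
  then show ?thesis using z by simp
qed

text \<open>
  \<open>\<iota>\<close> is an algebra map and \<open>\<pi>\<close> a partial representation; their products \<open>\<iota>(a)\<pi>(h) = a#h\<close> span \<open>A#H\<close>.
  The elements \<open>\<delta> h = \<pi>(h\<^sub>1)\<pi>(\<S>(h\<^sub>2))\<close> are central in \<open>\<iota>(A)\<close> if \<open>H\<close> is cocommutative.
\<close>

definition \<iota> where "\<iota> a = smel a \<one>\<^sub>H"
definition \<pi> where "\<pi> h = smel \<one>\<^sub>A h"
abbreviation "\<delta> h \<equiv> \<iota> (act h \<one>\<^sub>A)"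

lemma \<iota>_closed [simp, intro]: "a : A ==> \<iota> a : S"
  by (simp add: \<iota>_def smel_closed)

lemma \<pi>_closed [simp, intro]: "h : H ==> \<pi> h : S"
  by (simp add: \<pi>_def smel_closed)

lemma \<iota>_pure: 
  assumes a: "a : A" shows "\<iota> a = pt a \<one>\<^sub>H"
proof -
  have "\<iota> a = pt (a \<otimes>\<^sub>A act \<one>\<^sub>H \<one>\<^sub>A) \<one>\<^sub>H"
    unfolding \<iota>_def smash_elem_def using a
    by (intro sw_one[OF TT_module]) (auto intro!: linear_intros)
  then show ?thesis using a by (simp add: act_one)
qed

lemma pure_one_mult:
  assumes "a : A" "b : A" "k : H"
  shows "pt a \<one>\<^sub>H \<star> pt b k = pt (a \<otimes>\<^sub>A b) k"
proof -
  have "pt a \<one>\<^sub>H \<star> pt b k = pt (a \<otimes>\<^sub>A act \<one>\<^sub>H b) (\<one>\<^sub>H \<cdot> k)"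
    unfolding smash_mult_pure[OF assms(1) H_one_closed assms(2,3)] smash_pure_def using assms
    by (intro sw_one[OF TT_module]) (auto intro!: linear_intros)
  then show ?thesis using assms by (simp add: act_one)
qed

lemma \<iota>_mult: "[|a : A; b : A|] ==> \<iota> a \<bullet> \<iota> b = \<iota> (a \<otimes>\<^sub>A b)"
  by (simp add: \<iota>_pure smash_simps(2) pure_one_mult)

lemma \<iota>_one: "\<iota> \<one>\<^sub>A = \<one>\<^sub>S"
  by (simp add: \<iota>_pure smash_simps)

lemma \<pi>_one: "\<pi> \<one>\<^sub>H = \<one>\<^sub>S"
  using \<iota>_one by (simp add: \<iota>_def \<pi>_def)

lemma smel_linear_left:
  assumes "h : H" shows "linear_map K A S (\<lambda>a. smel a h)"
  unfolding smash_elem_def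
  by (rule linear_map_S)
    (use assms smel_closed in \<open>auto intro!: linear_intros TT_module simp: smash_elem_def\<close>)

lemma smel_linear_right:
  assumes "a : A" shows "linear_map K H S (\<lambda>h. smel a h)"
  unfolding smash_elem_def
  by (rule linear_map_S)
    (use assms smel_closed in \<open>auto intro!: linear_intros TT_module simp: smash_elem_def\<close>)

lemma \<iota>_linear [linear_intros]: "linear_map K D A f ==> linear_map K D S (\<lambda>x. \<iota> (f x))"
  unfolding \<iota>_def by (rule linear_map_comp[OF smel_linear_left]) auto

lemma \<pi>_linear [linear_intros]: "linear_map K D H f ==> linear_map K D S (\<lambda>x. \<pi> (f x))"
  unfolding \<pi>_def by (rule linear_map_comp[OF smel_linear_right]) auto

lemma smel_factor:
  assumes a: "a : A" and h: "h : H"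
  shows "smel a h = \<iota> a \<bullet> \<pi> h"
  using assms by (simp add: \<pi>_def smel_eq \<iota>_pure smash_simps(2) smash_mult_assoc[symmetric] pt_closed
      E_closed pure_one_mult del: AH.tensor_simps)

lemma S_mult_eq: "s \<bullet> t = s \<star> t" by (simp add: smash_simps)

text \<open>
  The element \<open>(1 \<otimes> h)(b \<otimes> k)(1 \<otimes> 1)\<close>, of which the products \<open>\<pi>(h)\<iota>(b)\<close> and \<open>\<pi>(h)\<pi>(k)\<close> are
  special cases because \<open>1 \<otimes> 1\<close> is a left unit.
\<close>

lemma \<pi>_mult_smel:
  assumes h: "h : H" and b: "b : A" and k: "k : H"
  shows "\<pi> h \<bullet> smel b k = sw S (\<lambda>x y. \<iota> (act x b) \<bullet> \<pi> (y \<cdot> k)) h"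
proof -
  have "\<pi> h \<bullet> smel b k = (pt \<one>\<^sub>A h \<star> pt b k) \<star> E"
    using assms by (simp add: \<pi>_def smel_eq S_mult_eq smash_mult_assoc pt_closed E_closed E_mult
        smash_mult_closed del: AH.tensor_simps)
  also have "pt \<one>\<^sub>A h \<star> pt b k = sw TT (\<lambda>x y. pt (act x b) (y \<cdot> k)) h"
    unfolding smash_mult_pure[OF A.one_closed assms] smash_pure_def using assms
    by (intro sw_cong[OF TT_ag h]) auto
  also have "\<dots> \<star> E = sw TT (\<lambda>x y. pt (act x b) (y \<cdot> k) \<star> E) h"
    using assms by (intro sw_linear_map[OF smash_mult_linear_left[OF E_closed] TT_module TT_module]) auto
  also have "\<dots> = sw TT (\<lambda>x y. \<iota> (act x b) \<bullet> \<pi> (y \<cdot> k)) h"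
    using assms S_TT[OF smel_closed]
    by (intro sw_cong[OF TT_ag h]) (auto simp: smel_factor[symmetric] smel_eq[symmetric] simp del: AH.tensor_simps)
  also have "\<dots> = sw S (\<lambda>x y. \<iota> (act x b) \<bullet> \<pi> (y \<cdot> k)) h"
    using assms by (intro sw_S) auto
  finally show ?thesis .
qed

lemma \<pi>_\<iota>:
  assumes h: "h : H" and a: "a : A"
  shows "\<pi> h \<bullet> \<iota> a = sw S (\<lambda>x y. \<iota> (act x a) \<bullet> \<pi> y) h"
proof -
  have "\<pi> h \<bullet> \<iota> a = sw S (\<lambda>x y. \<iota> (act x a) \<bullet> \<pi> (y \<cdot> \<one>\<^sub>H)) h"
    unfolding \<iota>_def[of a] using assms by (intro \<pi>_mult_smel) auto
  also have "\<dots> = sw S (\<lambda>x y. \<iota> (act x a) \<bullet> \<pi> y) h"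
    using assms by (intro sw_cong[OF S_ag]) auto
  finally show ?thesis .
qed

lemma \<pi>_\<pi>:
  assumes h: "h : H" and k: "k : H"
  shows "\<pi> h \<bullet> \<pi> k = sw S (\<lambda>x y. \<delta> x \<bullet> \<pi> (y \<cdot> k)) h"
  unfolding \<pi>_def[of k] using assms by (intro \<pi>_mult_smel) auto

lemma \<pi>_absorb:
  assumes h: "h : H"
  shows "sw S (\<lambda>x y. \<delta> x \<bullet> \<pi> y) h = \<pi> h"
  using \<pi>_\<iota>[OF h A.one_closed] h by (simp add: \<iota>_one)

text \<open>
  \<open>\<pi>(h)\<iota>(k\<cdot>1) = \<iota>(h\<^sub>1\<cdot>(k\<cdot>1))\<pi>(h\<^sub>2)\<close>; the symmetric form of the composition law leaves the factor \<open>h\<^sub>2\<cdot>1\<close>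
  next to \<open>\<pi>(h\<^sub>3)\<close>, which absorbs it.
\<close>

lemma \<pi>_\<iota>_act_one:
  assumes h: "h : H" and k: "k : H"
  shows "\<pi> h \<bullet> \<delta> k = sw S (\<lambda>x y. \<delta> (x \<cdot> k) \<bullet> \<pi> y) h"
proof -
  let ?sw = "sw S"
  have "\<pi> h \<bullet> \<delta> k = ?sw (\<lambda>x y. \<iota> (act x (act k \<one>\<^sub>A)) \<bullet> \<pi> y) h"
    using assms by (intro \<pi>_\<iota>) auto
  also have "\<dots> = ?sw (\<lambda>x y. ?sw (\<lambda>u v. \<delta> (u \<cdot> k) \<bullet> (\<delta> v \<bullet> \<pi> y)) x) h"
  proof (intro sw_cong[OF S_ag h])
    fix x y assume x: "x : H" and y: "y : H"
    have "\<iota> (act x (act k \<one>\<^sub>A)) \<bullet> \<pi> y =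
      ?sw (\<lambda>u v. \<iota> (act (u \<cdot> k) \<one>\<^sub>A \<otimes>\<^sub>A act v \<one>\<^sub>A) \<bullet> \<pi> y) x"
      unfolding act_act_symmetric[OF x k A.one_closed] using x y k
      by (intro sw_linear_map[where \<phi>="\<lambda>w. \<iota> w \<bullet> \<pi> y"])
        (auto intro!: linear_intros S_module A_module)
    also have "\<dots> = ?sw (\<lambda>u v. \<delta> (u \<cdot> k) \<bullet> (\<delta> v \<bullet> \<pi> y)) x"
      using x y k by (intro sw_cong[OF S_ag]) (auto simp: \<iota>_mult[symmetric] SS.m_assoc)
    finally show "\<iota> (act x (act k \<one>\<^sub>A)) \<bullet> \<pi> y = \<dots>" .
  qed (use k in \<open>auto intro!: sw_closed[OF S_ag]\<close>)
  also have "\<dots> = ?sw (\<lambda>x y. ?sw (\<lambda>u v. \<delta> (x \<cdot> k) \<bullet> (\<delta> u \<bullet> \<pi> v)) y) h"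
    using k by (intro sw_coassoc[OF S_module h]) (auto intro!: linear_intros)
  also have "\<dots> = ?sw (\<lambda>x y. \<delta> (x \<cdot> k) \<bullet> \<pi> y) h"
  proof (intro sw_cong[OF S_ag h])
    fix x y assume x: "x : H" and y: "y : H"
    have "?sw (\<lambda>u v. \<delta> (x \<cdot> k) \<bullet> (\<delta> u \<bullet> \<pi> v)) y =
      \<delta> (x \<cdot> k) \<bullet> ?sw (\<lambda>u v. \<delta> u \<bullet> \<pi> v) y"
      using x y k by (intro sw_linear_map[OF linear_S_right[OF _ linear_map_id] S_module S_module, symmetric]) auto
    then show "?sw (\<lambda>u v. \<delta> (x \<cdot> k) \<bullet> (\<delta> u \<bullet> \<pi> v)) y =
      \<delta> (x \<cdot> k) \<bullet> \<pi> y" using y by (simp add: \<pi>_absorb)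
  qed (use k in auto)
  finally show ?thesis .
qed

lemma \<pi>_\<pi>_antipode:
  assumes h: "h : H" and k: "k : H"
  shows "sw S (\<lambda>x y. \<pi> x \<bullet> \<pi> (\<S> y \<cdot> k)) h = \<delta> h \<bullet> \<pi> k"
proof -
  let ?sw = "sw S"
  have "?sw (\<lambda>x y. \<pi> x \<bullet> \<pi> (\<S> y \<cdot> k)) h =
    ?sw (\<lambda>x y. ?sw (\<lambda>u v. \<delta> u \<bullet> \<pi> (v \<cdot> (\<S> y \<cdot> k))) x) h"
    using k by (intro sw_cong[OF S_ag h]) (auto simp: \<pi>_\<pi> intro!: sw_closed[OF S_ag])
  also have "\<dots> = ?sw (\<lambda>x y. ?sw (\<lambda>u v. \<delta> x \<bullet> \<pi> (u \<cdot> (\<S> v \<cdot> k))) y) h"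
    using k by (intro sw_coassoc[OF S_module h]) (auto intro!: linear_intros)
  also have "\<dots> = ?sw (\<lambda>x y. ?sw (\<lambda>u v. \<delta> x \<bullet> \<pi> ((u \<cdot> \<S> v) \<cdot> k)) y) h"
    using k by (intro sw_cong[OF S_ag] h sw_closed[OF S_ag]) (auto simp: H_m_assoc)
  also have "\<dots> = \<delta> h \<bullet> \<pi> (\<one>\<^sub>H \<cdot> k)"
    using k by (intro sw3_antipode_right[OF S_module h, where f="\<lambda>x w. \<delta> x \<bullet> \<pi> (w \<cdot> k)"])
      (auto intro!: linear_intros)
  finally show ?thesis using k by simp
qed

end

section \<open>Identities in the smash product of a cocommutative Hopf algebra\<close>

locale cocommutative_partial_action = cocommutative_hopf_algebra K H + symmetric_partial_action K H A act
  for K :: "('k, 's) ring_scheme" (structure) and H :: "('k, 'h, 'z) hopf_scheme" (structure)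
    and A :: "('k, 'a, 'w) module_scheme" (structure) and act :: "'h \<Rightarrow> 'a \<Rightarrow> 'a"
begin

lemma \<pi>_antipode_\<pi>:
  assumes h: "h : H"
  shows "sw S (\<lambda>x y. \<pi> (\<S> x) \<bullet> \<pi> y) h = \<delta> (\<S> h)"
proof -
  have "sw S (\<lambda>x y. \<pi> (\<S> x) \<bullet> \<pi> y) h =
    sw S (\<lambda>x y. \<pi> (\<S> x) \<bullet> \<pi> (\<S> (\<S> y) \<cdot> \<one>\<^sub>H)) h"
    by (intro sw_cong[OF S_ag h]) (auto simp: antipode_antipode)
  also have "\<dots> = sw S (\<lambda>x y. \<pi> x \<bullet> \<pi> (\<S> y \<cdot> \<one>\<^sub>H)) (\<S> h)"
    by (intro sw_antipode[OF S_module h, symmetric]) (auto intro!: linear_intros)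
  also have "\<dots> = \<delta> (\<S> h)"
    using h by (subst \<pi>_\<pi>_antipode) (auto simp: \<pi>_one)
  finally show ?thesis .
qed

lemma act_act_antipode_left:
  assumes h: "h : H" and a: "a : A"
  shows "sw A (\<lambda>x y. act x (act (\<S> y) a)) h = act h \<one>\<^sub>A \<otimes>\<^sub>A a"
proof -
  let ?sw = "sw A"
  have "?sw (\<lambda>x y. act x (act (\<S> y) a)) h = ?sw (\<lambda>x y. ?sw (\<lambda>u v. act u \<one>\<^sub>A \<otimes>\<^sub>A act (v \<cdot> \<S> y) a) x) h"
    using a by (intro sw_cong[OF A_ag h]) (auto simp: act_act intro!: sw_closed[OF A_ag])
  also have "\<dots> = ?sw (\<lambda>x y. ?sw (\<lambda>u v. act x \<one>\<^sub>A \<otimes>\<^sub>A act (u \<cdot> \<S> v) a) y) h"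
    using a by (intro sw_coassoc[OF A_module h]) (auto intro!: linear_intros)
  also have "\<dots> = act h \<one>\<^sub>A \<otimes>\<^sub>A act \<one>\<^sub>H a"
    using a by (intro sw3_antipode_right[OF A_module h, where f="\<lambda>x w. act x \<one>\<^sub>A \<otimes>\<^sub>A act w a"])
      (auto intro!: linear_intros)
  finally show ?thesis using a by (simp add: act_one)
qed

lemma act_act_antipode_right:
  assumes h: "h : H" and a: "a : A"
  shows "sw A (\<lambda>x y. act x (act (\<S> y) a)) h = a \<otimes>\<^sub>A act h \<one>\<^sub>A"
proof -
  let ?sw = "sw A"
  have "?sw (\<lambda>x y. act x (act (\<S> y) a)) h = ?sw (\<lambda>x y. ?sw (\<lambda>u v. act (u \<cdot> \<S> y) a \<otimes>\<^sub>A act v \<one>\<^sub>A) x) h"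
    using a by (intro sw_cong[OF A_ag h]) (auto simp: act_act_symmetric intro!: sw_closed[OF A_ag])
  also have "\<dots> = ?sw (\<lambda>x y. ?sw (\<lambda>u v. act (v \<cdot> \<S> y) a \<otimes>\<^sub>A act u \<one>\<^sub>A) x) h"
    using a by (intro sw_cong[OF A_ag h] sw_cocomm[OF A_module, symmetric] sw_closed[OF A_ag])
      (auto intro!: linear_intros)
  also have "\<dots> = ?sw (\<lambda>x y. ?sw (\<lambda>u v. act (u \<cdot> \<S> v) a \<otimes>\<^sub>A act x \<one>\<^sub>A) y) h"
    using a by (intro sw_coassoc[OF A_module h]) (auto intro!: linear_intros)
  also have "\<dots> = act \<one>\<^sub>H a \<otimes>\<^sub>A act h \<one>\<^sub>A"
    using a by (intro sw3_antipode_right[OF A_module h, where f="\<lambda>x w. act w a \<otimes>\<^sub>A act x \<one>\<^sub>A"])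
      (auto intro!: linear_intros)
  finally show ?thesis using a by (simp add: act_one)
qed

text \<open>
  The two forms of the partial composition law evaluate \<open>h\<^sub>1\<cdot>(\<S>(h\<^sub>2)\<cdot>a)\<close> to \<open>(h\<cdot>1)a\<close> and to \<open>a(h\<cdot>1)\<close>.
\<close>

lemma act_one_central:
  assumes "h : H" "a : A"
  shows "act h \<one>\<^sub>A \<otimes>\<^sub>A a = a \<otimes>\<^sub>A act h \<one>\<^sub>A"
  using act_act_antipode_left[OF assms] act_act_antipode_right[OF assms] by simp

lemma \<pi>_\<iota>_antipode:
  assumes h: "h : H" and a: "a : A"
  shows "sw S (\<lambda>x y. \<pi> x \<bullet> \<iota> (act (\<S> y) a)) h = \<iota> a \<bullet> \<pi> h"
proof -
  let ?sw = "sw S"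
  have "?sw (\<lambda>x y. \<pi> x \<bullet> \<iota> (act (\<S> y) a)) h =
    ?sw (\<lambda>x y. ?sw (\<lambda>u v. \<iota> (act u (act (\<S> y) a)) \<bullet> \<pi> v) x) h"
    using a by (intro sw_cong[OF S_ag h]) (auto simp: \<pi>_\<iota> intro!: sw_closed[OF S_ag])
  also have "\<dots> = ?sw (\<lambda>x y. ?sw (\<lambda>u v. \<iota> (act x (act (\<S> v) a)) \<bullet> \<pi> u) y) h"
    using a by (intro sw_coassoc[OF S_module h]) (auto intro!: linear_intros)
  also have "\<dots> = ?sw (\<lambda>x y. ?sw (\<lambda>u v. \<iota> (act x (act (\<S> u) a)) \<bullet> \<pi> v) y) h"
    using a by (intro sw3_swap23[OF S_module h]) (auto intro!: linear_intros)
  also have "\<dots> = ?sw (\<lambda>x y. ?sw (\<lambda>u v. \<iota> (act u (act (\<S> v) a)) \<bullet> \<pi> y) x) h"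
    using a by (intro sw_coassoc[OF S_module h, symmetric]) (auto intro!: linear_intros)
  also have "\<dots> = ?sw (\<lambda>x y. \<iota> a \<bullet> (\<delta> x \<bullet> \<pi> y)) h"
  proof (intro sw_cong[OF S_ag h])
    fix x y assume x: "x : H" and y: "y : H"
    have "?sw (\<lambda>u v. \<iota> (act u (act (\<S> v) a)) \<bullet> \<pi> y) x =
      \<iota> (sw A (\<lambda>u v. act u (act (\<S> v) a)) x) \<bullet> \<pi> y"
      using x y a by (intro sw_linear_map[where \<phi>="\<lambda>w. \<iota> w \<bullet> \<pi> y", symmetric])
        (auto intro!: linear_intros S_module A_module)
    then show "?sw (\<lambda>u v. \<iota> (act u (act (\<S> v) a)) \<bullet> \<pi> y) x = \<iota> a \<bullet> (\<delta> x \<bullet> \<pi> y)"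
      using x y a by (simp add: act_act_antipode_right \<iota>_mult[symmetric] SS.m_assoc)
  qed (use a in auto)
  also have "\<dots> = \<iota> a \<bullet> \<pi> h"
    unfolding \<pi>_absorb[OF h, symmetric] using a h
    by (intro sw_linear_map[OF linear_S_right[OF _ linear_map_id] S_module S_module, symmetric]) auto
  finally show ?thesis .
qed

lemma \<pi>_\<pi>_right:
  assumes k: "k : H" and h: "h : H"
  shows "\<pi> k \<bullet> \<pi> h = sw S (\<lambda>x y. \<pi> (k \<cdot> x) \<bullet> \<delta> (\<S> y)) h"
proof -
  let ?sw = "sw S"
  define \<Phi> where "\<Phi> = (\<lambda>k1 k2 p q y. \<delta> (k1 \<cdot> (p \<cdot> \<S> y)) \<bullet> \<pi> (k2 \<cdot> q))"
  have cl: "\<Phi> k1 k2 p q y : S" if "k1 : H" "k2 : H" "p : H" "q : H"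
    "y : H" for k1 k2 p q y unfolding \<Phi>_def using that by auto
  have "?sw (\<lambda>x y. \<pi> (k \<cdot> x) \<bullet> \<delta> (\<S> y)) h =
    ?sw (\<lambda>x y. ?sw (\<lambda>k1 k2. ?sw (\<lambda>p q. \<Phi> k1 k2 p q y) x) k) h"
  proof (intro sw_cong[OF S_ag h])
    fix x y assume x: "x : H" and y: "y : H"
    have "\<pi> (k \<cdot> x) \<bullet> \<delta> (\<S> y) =
      ?sw (\<lambda>u v. \<delta> (u \<cdot> \<S> y) \<bullet> \<pi> v) (k \<cdot> x)"
      using x y k by (intro \<pi>_\<iota>_act_one) auto
    also have "\<dots> = ?sw (\<lambda>k1 k2. ?sw (\<lambda>p q. \<delta> ((k1 \<cdot> p) \<cdot> \<S> y) \<bullet> \<pi> (k2 \<cdot> q)) x) k"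
      using x y k by (intro sw_mult[OF S_module]) (auto intro!: linear_intros)
    also have "\<dots> = ?sw (\<lambda>k1 k2. ?sw (\<lambda>p q. \<Phi> k1 k2 p q y) x) k"
      using x y k cl by (intro sw_cong[OF S_ag] sw_closed[OF S_ag]) (auto simp: \<Phi>_def H_m_assoc)
    finally show "\<pi> (k \<cdot> x) \<bullet> \<delta> (\<S> y) = \<dots>" .
  qed (use k in \<open>auto intro!: sw_closed[OF S_ag] cl\<close>)
  also have "\<dots> = ?sw (\<lambda>k1 k2. ?sw (\<lambda>x y. ?sw (\<lambda>p q. \<Phi> k1 k2 p q y) x) h) k"
    using h k cl by (intro sw_swap[OF S_ag] sw_closed[OF S_ag]) auto
  also have "\<dots> = ?sw (\<lambda>k1 k2. \<delta> k1 \<bullet> \<pi> (k2 \<cdot> h)) k"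
  proof (intro sw_cong[OF S_ag k])
    fix k1 k2 assume k12: "k1 : H" "k2 : H"
    have "?sw (\<lambda>x y. ?sw (\<lambda>p q. \<Phi> k1 k2 p q y) x) h = ?sw (\<lambda>p y. ?sw (\<lambda>q y. \<Phi> k1 k2 p q y) y) h"
      unfolding \<Phi>_def using k12 by (intro sw_coassoc[OF S_module h]) (auto intro!: linear_intros)
    also have "\<dots> = ?sw (\<lambda>p y. ?sw (\<lambda>q y. \<Phi> k1 k2 q p y) y) h"
      unfolding \<Phi>_def using k12 by (intro sw3_swap12[OF S_module h]) (auto intro!: linear_intros)
    also have "\<dots> = \<delta> (k1 \<cdot> \<one>\<^sub>H) \<bullet> \<pi> (k2 \<cdot> h)"
      unfolding \<Phi>_def using k12
      by (intro sw3_antipode_right[OF S_module h, where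
            f="\<lambda>q w. \<delta> (k1 \<cdot> w) \<bullet> \<pi> (k2 \<cdot> q)"]) (auto intro!: linear_intros)
    finally show "?sw (\<lambda>x y. ?sw (\<lambda>p q. \<Phi> k1 k2 p q y) x) h = \<delta> k1 \<bullet> \<pi> (k2 \<cdot> h)"
      using k12 by simp
  qed (use h in auto)
  also have "\<dots> = \<pi> k \<bullet> \<pi> h" using h k by (simp add: \<pi>_\<pi>)
  finally show ?thesis ..
qed

lemma \<pi>_antipode_mult:
  assumes q: "q : H" and y: "y : H"
  shows "\<pi> (\<S> q) \<bullet> \<pi> (\<S> y) =
    sw S (\<lambda>u v. \<pi> (\<S> (u \<cdot> q)) \<bullet> \<delta> v) y"
proof -
  let ?sw = "sw S"
  have "\<pi> (\<S> q) \<bullet> \<pi> (\<S> y) = ?sw (\<lambda>x y. \<pi> (\<S> q \<cdot> x) \<bullet> \<delta> (\<S> y)) (\<S> y)"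
    using q y by (intro \<pi>_\<pi>_right) auto
  also have "\<dots> = ?sw (\<lambda>u v. \<pi> (\<S> q \<cdot> \<S> u) \<bullet> \<delta> (\<S> (\<S> v))) y"
    using q by (intro sw_antipode[OF S_module y]) (auto intro!: linear_intros)
  also have "\<dots> = ?sw (\<lambda>u v. \<pi> (\<S> (u \<cdot> q)) \<bullet> \<delta> v) y"
    using q by (intro sw_cong[OF S_ag y]) (auto simp: antipode_mult antipode_antipode)
  finally show ?thesis .
qed

end

section \<open>Partial representations\<close>

context cocommutative_hopf_algebra
begin

text \<open>
  A partial representation of \<open>H\<close> by operators on a \<open>K\<close>-module; because \<open>H\<close> is cocommutative the
  remaining two defining relations of \<open>H\<^sub>p\<^sub>a\<^sub>r\<close> follow from these by applying the antipode.
\<close>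

definition partial_rep_on
  where "partial_rep_on P g \<longleftrightarrow>
    (\<forall>h\<in>carrier H. linear_map K P P (g h)) \<and>
    (\<forall>p\<in>carrier P. linear_map K H P (\<lambda>h. g h p)) \<and>
    (\<forall>p\<in>carrier P. g \<one>\<^sub>H p = p) \<and>
    (\<forall>h\<in>carrier H. \<forall>k\<in>carrier H. \<forall>p\<in>carrier P.
      sw P (\<lambda>x y. g h (g x (g (\<S> y) p))) k =
      sw P (\<lambda>x y. g (h \<cdot> x) (g (\<S> y) p)) k \<and>
      sw P (\<lambda>x y. g x (g (\<S> y) (g k p))) h =
      sw P (\<lambda>x y. g x (g (\<S> y \<cdot> k) p)) h)"

definition partial_antirep_on
  where "partial_antirep_on P g \<longleftrightarrow>
    (\<forall>h\<in>carrier H. linear_map K P P (g h)) \<and>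
    (\<forall>p\<in>carrier P. linear_map K H P (\<lambda>h. g h p)) \<and>
    (\<forall>p\<in>carrier P. g \<one>\<^sub>H p = p) \<and>
    (\<forall>h\<in>carrier H. \<forall>k\<in>carrier H. \<forall>p\<in>carrier P.
      sw P (\<lambda>x y. g (\<S> y) (g x (g h p))) k =
      sw P (\<lambda>x y. g (\<S> y) (g (h \<cdot> x) p)) k \<and>
      sw P (\<lambda>x y. g k (g (\<S> y) (g x p))) h =
      sw P (\<lambda>x y. g (\<S> y \<cdot> k) (g x p)) h)"

text \<open>
  The computation behind all partial representations below: operators \<open>\<rho>\<^sub>h\<close> that multiply, up to
  operators \<open>c\<^sub>h\<close>, as in \<open>\<rho>\<^sub>h\<rho>\<^sub>k = c(h\<^sub>1)\<rho>(h\<^sub>2k)\<close>.  The laws hold on \<open>Z\<close>,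
  which will be all of \<open>A#H\<close> or the set of central elements of a bimodule.
\<close>

lemma partial_rep_criterion:
  assumes P: "module K P" and Z: "Z \<subseteq> carrier P"
    and \<rho>1: "\<And>h. h : H ==> linear_map K P P (\<rho> h)"
    and \<rho>2: "\<And>p. p : P ==> linear_map K H P (\<lambda>h. \<rho> h p)"
    and c1: "\<And>h. h : H ==> linear_map K P P (c h)"
    and c2: "\<And>p. p : P ==> linear_map K H P (\<lambda>h. c h p)"
    and Z\<rho>: "\<And>h p. [|h : H; p \<in> Z|] ==> \<rho> h p \<in> Z"
    and one: "\<And>p. p \<in> Z ==> \<rho> \<one>\<^sub>H p = p"
    and \<rho>c: "\<And>h k p. [|h : H; k : H; p \<in> Z|] ==>
      \<rho> h (c k p) = sw P (\<lambda>x y. c (x \<cdot> k) (\<rho> y p)) h"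
    and \<rho>\<rho>: "\<And>h k p. [|h : H; k : H; p \<in> Z|] ==>
      \<rho> h (\<rho> k p) = sw P (\<lambda>x y. c x (\<rho> (y \<cdot> k) p)) h"
    and h: "h : H" and k: "k : H" and p: "p \<in> Z"
  shows "sw P (\<lambda>x y. \<rho> x (\<rho> (\<S> y) p)) h = c h p"
    and "sw P (\<lambda>x y. \<rho> h (\<rho> x (\<rho> (\<S> y) p))) k =
      sw P (\<lambda>x y. \<rho> (h \<cdot> x) (\<rho> (\<S> y) p)) k" (is ?R1)
    and "sw P (\<lambda>x y. \<rho> x (\<rho> (\<S> y) (\<rho> k p))) h =
      sw P (\<lambda>x y. \<rho> x (\<rho> (\<S> y \<cdot> k) p)) h" (is ?R2)
proof -
  let ?sw = "sw P"
  note ag = module_abelian_group[OF P]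
  have Zc: "q : P" if "q \<in> Z" for q using Z that by blast
  have \<rho>cl: "\<rho> h p : P" if "h : H" "p : P" for h p
    using linear_mapD(1)[OF \<rho>1] that by blast
  have ccl: "c h p : P" if "h : H" "p : P" for h p
    using linear_mapD(1)[OF c1] that by blast
  have \<rho>l1: "linear_map K D P (\<lambda>x. \<rho> h (f x))" if "h : H" "linear_map K D P f" for h f D
    using linear_map_comp[OF \<rho>1[OF that(1)] that(2)] .
  have \<rho>l2: "linear_map K D P (\<lambda>x. \<rho> (f x) p)" if "p : P" "linear_map K D H f" for p f D
    using linear_map_comp[OF \<rho>2[OF that(1)] that(2)] .
  have cl1: "linear_map K D P (\<lambda>x. c h (f x))" if "h : H" "linear_map K D P f" for h f D
    using linear_map_comp[OF c1[OF that(1)] that(2)] .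
  have cl2: "linear_map K D P (\<lambda>x. c (f x) p)" if "p : P" "linear_map K D H f" for p f D
    using linear_map_comp[OF c2[OF that(1)] that(2)] .
  note li = linear_intros \<rho>l1 \<rho>l2 cl1 cl2 P
  \<comment> \<open>\<open>\<rho>(h\<^sub>1)\<rho>(\<S>(h\<^sub>2)k) = c(h\<^sub>1)\<rho>(h\<^sub>2\<S>(h\<^sub>3)k)\<close>\<close>
  have contract: "?sw (\<lambda>x y. \<rho> x (\<rho> (\<S> y \<cdot> k) p)) h = c h (\<rho> k p)"
    if h: "h : H" and k: "k : H" and p: "p \<in> Z" for h k p
  proof -
    have "?sw (\<lambda>x y. \<rho> x (\<rho> (\<S> y \<cdot> k) p)) h =
      ?sw (\<lambda>x y. ?sw (\<lambda>u v. c u (\<rho> (v \<cdot> (\<S> y \<cdot> k)) p)) x) h"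
      using k p Zc by (intro sw_cong[OF ag h]) (auto simp: \<rho>\<rho> intro!: sw_closed[OF ag] ccl \<rho>cl)
    also have "\<dots> = ?sw (\<lambda>x y. ?sw (\<lambda>u v. c x (\<rho> (u \<cdot> (\<S> v \<cdot> k)) p)) y) h"
      using k Zc[OF p] by (intro sw_coassoc[OF P h]) (auto intro!: li \<rho>cl)
    also have "\<dots> = ?sw (\<lambda>x y. ?sw (\<lambda>u v. c x (\<rho> ((u \<cdot> \<S> v) \<cdot> k) p)) y) h"
      using k Zc[OF p] by (intro sw_cong[OF ag] h sw_closed[OF ag]) (auto simp: H_m_assoc intro!: ccl \<rho>cl)
    also have "\<dots> = c h (\<rho> (\<one>\<^sub>H \<cdot> k) p)"
      using k Zc[OF p] by (intro sw3_antipode_right[OF P h, where f="\<lambda>x w. c x (\<rho> (w \<cdot> k) p)"])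
        (auto intro!: li \<rho>cl)
    finally show ?thesis using k by simp
  qed
  have contract1: "?sw (\<lambda>x y. \<rho> x (\<rho> (\<S> y) p)) h = c h p"
    if h: "h : H" and p: "p \<in> Z" for h p
  proof -
    have "?sw (\<lambda>x y. \<rho> x (\<rho> (\<S> y) p)) h = ?sw (\<lambda>x y. \<rho> x (\<rho> (\<S> y \<cdot> \<one>\<^sub>H) p)) h"
      using Zc[OF p] by (intro sw_cong[OF ag h]) (auto intro!: \<rho>cl)
    then show ?thesis using contract[OF h H_one_closed p] one[OF p] by simp
  qed
  show "?sw (\<lambda>x y. \<rho> x (\<rho> (\<S> y) p)) h = c h p" by (rule contract1[OF h p])
  show ?R2 using contract1[OF h Z\<rho>[OF k p]] contract[OF h k p] by simp
  have "?sw (\<lambda>x y. \<rho> h (\<rho> x (\<rho> (\<S> y) p))) k = \<rho> h (?sw (\<lambda>x y. \<rho> x (\<rho> (\<S> y) p)) k)"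
    using Zc[OF p] by (intro sw_linear_map[OF \<rho>1[OF h] P P k, symmetric]) (auto intro!: \<rho>cl)
  also have "\<dots> = ?sw (\<lambda>x y. c (x \<cdot> k) (\<rho> y p)) h"
    by (simp add: contract1 k p h \<rho>c)
  also have "\<dots> = ?sw (\<lambda>a b. ?sw (\<lambda>x y. ?sw (\<lambda>u v. c (a \<cdot> u) (\<rho> (b \<cdot> (v \<cdot> \<S> y)) p)) x) k) h"
  proof (intro sw_cong[OF ag h])
    fix a b assume a: "a : H" and b: "b : H"
    have "?sw (\<lambda>x y. ?sw (\<lambda>u v. c (a \<cdot> u) (\<rho> (b \<cdot> (v \<cdot> \<S> y)) p)) x) k =
      ?sw (\<lambda>x y. ?sw (\<lambda>u v. c (a \<cdot> x) (\<rho> (b \<cdot> (u \<cdot> \<S> v)) p)) y) k"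
      using a b Zc[OF p] by (intro sw_coassoc[OF P k]) (auto intro!: li \<rho>cl)
    also have "\<dots> = c (a \<cdot> k) (\<rho> (b \<cdot> \<one>\<^sub>H) p)"
      using a b Zc[OF p] by (intro sw3_antipode_right[OF P k, where
            f="\<lambda>x w. c (a \<cdot> x) (\<rho> (b \<cdot> w) p)"]) (auto intro!: li \<rho>cl)
    finally show "c (a \<cdot> k) (\<rho> b p) = ?sw (\<lambda>x y. ?sw (\<lambda>u v. c (a \<cdot> u) (\<rho> (b \<cdot> (v \<cdot> \<S> y)) p)) x) k"
      using b by simp
  qed (use k Zc[OF p] in \<open>auto intro!: sw_closed[OF ag] ccl \<rho>cl\<close>)
  also have "\<dots> = ?sw (\<lambda>x y. ?sw (\<lambda>a b. ?sw (\<lambda>u v. c (a \<cdot> u) (\<rho> (b \<cdot> (v \<cdot> \<S> y)) p)) x) h) k"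
    using h k Zc[OF p] by (intro sw_swap[OF ag] sw_closed[OF ag] ccl \<rho>cl) auto
  also have "\<dots> = ?sw (\<lambda>x y. \<rho> (h \<cdot> x) (\<rho> (\<S> y) p)) k"
  proof (intro sw_cong[OF ag k])
    fix x y assume x: "x : H" and y: "y : H"
    have "\<rho> (h \<cdot> x) (\<rho> (\<S> y) p) = ?sw (\<lambda>u v. c u (\<rho> (v \<cdot> \<S> y) p)) (h \<cdot> x)"
      using h x y p by (intro \<rho>\<rho>) auto
    also have "\<dots> = ?sw (\<lambda>a b. ?sw (\<lambda>u v. c (a \<cdot> u) (\<rho> ((b \<cdot> v) \<cdot> \<S> y) p)) x) h"
      using h x y Zc[OF p] by (intro sw_mult[OF P]) (auto intro!: li \<rho>cl)
    also have "\<dots> = ?sw (\<lambda>a b. ?sw (\<lambda>u v. c (a \<cdot> u) (\<rho> (b \<cdot> (v \<cdot> \<S> y)) p)) x) h"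
      using h x y Zc[OF p] by (intro sw_cong[OF ag] sw_closed[OF ag]) (auto simp: H_m_assoc intro!: ccl \<rho>cl)
    finally show "?sw (\<lambda>a b. ?sw (\<lambda>u v. c (a \<cdot> u) (\<rho> (b \<cdot> (v \<cdot> \<S> y)) p)) x) h = 
      \<rho> (h \<cdot> x) (\<rho> (\<S> y) p)" ..
  qed (use h Zc[OF p] in \<open>auto intro!: \<rho>cl\<close>)
  finally show ?R1 .
qed

end

section \<open>Bimodules over the smash product\<close>

locale smash_bimodule = cocommutative_partial_action K H A act
  for K :: "('k, 's) ring_scheme" (structure) and H :: "('k, 'h, 'z) hopf_scheme" (structure)
    and A :: "('k, 'a, 'w) module_scheme" (structure) and act :: "'h \<Rightarrow> 'a \<Rightarrow> 'a" +
  fixes P :: "('k, 'm, 'v) module_scheme" and L :: "('a, 'h) tensor \<Rightarrow> 'm \<Rightarrow> 'm"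
    and R :: "'m \<Rightarrow> ('a, 'h) tensor \<Rightarrow> 'm"
  assumes P_module: "module K P"
    and L_linear1: "p : P ==> linear_map K S P (\<lambda>s. L s p)"
    and L_linear2: "s : S ==> linear_map K P P (L s)"
    and R_linear1: "p : P ==> linear_map K S P (R p)"
    and R_linear2: "s : S ==> linear_map K P P (\<lambda>p. R p s)"
    and L_mult: "[|s : S; t : S; p : P|] ==> L (s \<otimes>\<^sub>S t) p = L s (L t p)"
    and R_mult: "[|s : S; t : S; p : P|] ==> R p (s \<otimes>\<^sub>S t) = R (R p s) t"
    and L_one: "p : P ==> L \<one>\<^sub>S p = p"
    and R_one: "p : P ==> R p \<one>\<^sub>S = p"
    and L_R: "[|s : S; t : S; p : P|] ==> L s (R p t) = R (L s p) t"
begin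

lemma P_ag: "abelian_group P" by (rule module_abelian_group[OF P_module])

lemma L_closed [simp, intro]: "[|s : S; p : P|] ==> L s p : P"
  by (rule linear_mapD(1)[OF L_linear2])

lemma R_closed [simp, intro]: "[|s : S; p : P|] ==> R p s : P"
  by (rule linear_mapD(1)[OF R_linear2])

lemma linear_L1 [linear_intros]: "[|p : P; linear_map K D S f|] ==> linear_map K D P (\<lambda>x. L (f x) p)"
  by (rule linear_map_comp[OF L_linear1])

lemma linear_L2 [linear_intros]: "[|s : S; linear_map K D P f|] ==> linear_map K D P (\<lambda>x. L s (f x))"
  by (rule linear_map_comp[OF L_linear2])

lemma linear_R1 [linear_intros]: "[|p : P; linear_map K D S f|] ==> linear_map K D P (\<lambda>x. R p (f x))"
  by (rule linear_map_comp[OF R_linear1])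

lemma linear_R2 [linear_intros]: "[|s : S; linear_map K D P f|] ==> linear_map K D P (\<lambda>x. R (f x) s)"
  by (rule linear_map_comp[OF R_linear2])

lemma L_sw:
  assumes "h : H" "s : S" "\<And>x y. [|x : H; y : H|] ==> f x y : P"
  shows "L s (sw P f h) = sw P (\<lambda>x y. L s (f x y)) h"
  by (rule sw_linear_map[OF L_linear2[OF assms(2)] P_module P_module assms(1,3)])

lemma R_sw:
  assumes "h : H" "s : S" "\<And>x y. [|x : H; y : H|] ==> f x y : P"
  shows "R (sw P f h) s = sw P (\<lambda>x y. R (f x y) s) h"
  by (rule sw_linear_map[OF R_linear2[OF assms(2)] P_module P_module assms(1,3)])

lemma sw_L:
  assumes "h : H" "p : P" "\<And>x y. [|x : H; y : H|] ==> f x y : S"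
  shows "L (sw S f h) p = sw P (\<lambda>x y. L (f x y) p) h"
  by (rule sw_linear_map[OF L_linear1[OF assms(2)] S_module P_module assms(1,3)])

lemma sw_R:
  assumes "h : H" "p : P" "\<And>x y. [|x : H; y : H|] ==> f x y : S"
  shows "R p (sw S f h) = sw P (\<lambda>x y. R p (f x y)) h"
  by (rule sw_linear_map[OF R_linear1[OF assms(2)] S_module P_module assms(1,3)])

text \<open>
  \<open>twist h m\<close> is \<open>[h] \<triangleright> m\<close>, and the central elements are the values at \<open>1\<close> of the \<open>A\<close>-bimodule maps out of
  \<open>A\<close>.
\<close>

definition twist where
  "twist h p = sw P (\<lambda>x y. R (L (\<pi> x) p) (\<pi> (\<S> y))) h"

definition central where
  "central p \<longleftrightarrow> p : P \<and> (\<forall>a\<in>carrier A. L (\<iota> a) p = R p (\<iota> a))"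

lemma central_closed: "central p ==> p : P" by (simp add: central_def)
lemma centralD: "[|central p; a : A|] ==> L (\<iota> a) p = R p (\<iota> a)" by (simp add: central_def)

lemma twist_closed [simp, intro]: "[|h : H; p : P|] ==> twist h p : P"
  unfolding twist_def by (rule sw_closed[OF P_ag]) auto

lemma linear_twist1 [linear_intros]:
  assumes "p : P" "linear_map K D H f" shows "linear_map K D P (\<lambda>x. twist (f x) p)"
  unfolding twist_def using assms by (auto intro!: linear_intros P_module)

lemma linear_twist2 [linear_intros]:
  assumes "h : H" "linear_map K D P f" shows "linear_map K D P (\<lambda>x. twist h (f x))"
proof -
  have "linear_map K P P (twist h)"
    unfolding twist_def using assms(1) by (auto intro!: linear_intros P_module module.smult_closed[OF P_module])
  from linear_map_comp[OF this assms(2)] show ?thesis .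
qed

lemma twist_one: "p : P ==> twist \<one>\<^sub>H p = p"
  unfolding twist_def
  by (subst sw_one[OF P_module]) (auto intro!: linear_intros simp: antipode_one \<pi>_one L_one R_one)

text \<open>
  On central elements, left multiplication by \<open>\<iota>(a)\<close> can be moved through \<open>\<pi>(h\<^sub>1) _ \<pi>(\<S>(h\<^sub>2))\<close> to
  the right: \<open>a\<pi>(h\<^sub>1) = \<pi>(h\<^sub>1)(\<S>(h\<^sub>2)\<cdot>a)\<close>, and \<open>(\<S>(h\<^sub>2)\<cdot>a)\<pi>(\<S>(h\<^sub>3)) = \<pi>(\<S>(h\<^sub>2))a\<close>.
\<close>

lemma central_twist:
  assumes h: "h : H" and p: "central p"
  shows "central (twist h p)"
proof -
  let ?sw = "sw P"
  have pc: "p : P" by (rule central_closed[OF p])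
  have "L (\<iota> a) (twist h p) = R (twist h p) (\<iota> a)" if a: "a : A" for a
  proof -
    have "L (\<iota> a) (twist h p) = ?sw (\<lambda>x y. R (L (\<iota> a \<bullet> \<pi> x) p) (\<pi> (\<S> y))) h"
    proof -
      have "L (\<iota> a) (twist h p) = ?sw (\<lambda>x y. L (\<iota> a) (R (L (\<pi> x) p) (\<pi> (\<S> y)))) h"
        unfolding twist_def using h a pc by (intro L_sw) auto
      also have "\<dots> = ?sw (\<lambda>x y. R (L (\<iota> a \<bullet> \<pi> x) p) (\<pi> (\<S> y))) h"
        using h a pc by (intro sw_cong[OF P_ag]) (auto simp: L_R L_mult)
      finally show ?thesis .
    qed
    also have "\<dots> = ?sw (\<lambda>x y. ?sw (\<lambda>u v. R (L (\<pi> u) p) (\<iota> (act (\<S> v) a) \<bullet> \<pi> (\<S> y))) x) h"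
    proof (intro sw_cong[OF P_ag h])
      fix x y assume x: "x : H" and y: "y : H"
      have "R (L (\<iota> a \<bullet> \<pi> x) p) (\<pi> (\<S> y)) =
        ?sw (\<lambda>u v. R (L (\<pi> u \<bullet> \<iota> (act (\<S> v) a)) p) (\<pi> (\<S> y))) x"
        unfolding \<pi>_\<iota>_antipode[OF x a, symmetric] using x y a pc
        by (intro sw_linear_map[where \<phi>="\<lambda>w. R (L w p) (\<pi> (\<S> y))"])
          (auto intro!: linear_intros P_module S_module)
      also have "\<dots> = ?sw (\<lambda>u v. R (L (\<pi> u) p) (\<iota> (act (\<S> v) a) \<bullet> \<pi> (\<S> y))) x"
        using x y a pc centralD[OF p]
        by (intro sw_cong[OF P_ag]) (auto simp: L_mult R_mult L_R)
      finally show "R (L (\<iota> a \<bullet> \<pi> x) p) (\<pi> (\<S> y)) = \<dots>" .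
    qed (use a pc in \<open>auto intro!: sw_closed[OF P_ag]\<close>)
    also have "\<dots> = ?sw (\<lambda>x y. ?sw (\<lambda>u v. R (L (\<pi> x) p) (\<iota> (act (\<S> u) a) \<bullet> \<pi> (\<S> v))) y) h"
      using a pc by (intro sw_coassoc[OF P_module h]) (auto intro!: linear_intros)
    also have "\<dots> = ?sw (\<lambda>x y. R (R (L (\<pi> x) p) (\<pi> (\<S> y))) (\<iota> a)) h"
    proof (intro sw_cong[OF P_ag h])
      fix x y assume x: "x : H" and y: "y : H"
      have "?sw (\<lambda>u v. R (L (\<pi> x) p) (\<iota> (act (\<S> u) a) \<bullet> \<pi> (\<S> v))) y =
        R (L (\<pi> x) p) (sw S (\<lambda>u v. \<iota> (act (\<S> u) a) \<bullet> \<pi> (\<S> v)) y)"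
        using x y a pc by (intro sw_R[symmetric]) auto
      also have "sw S (\<lambda>u v. \<iota> (act (\<S> u) a) \<bullet> \<pi> (\<S> v)) y =
        sw S (\<lambda>u v. \<iota> (act u a) \<bullet> \<pi> v) (\<S> y)"
        using y a by (intro sw_antipode[OF S_module, symmetric]) (auto intro!: linear_intros)
      also have "\<dots> = \<pi> (\<S> y) \<bullet> \<iota> a" using y a by (simp add: \<pi>_\<iota>)
      finally show "?sw (\<lambda>u v. R (L (\<pi> x) p) (\<iota> (act (\<S> u) a) \<bullet> \<pi> (\<S> v))) y =
        R (R (L (\<pi> x) p) (\<pi> (\<S> y))) (\<iota> a)" using x y a pc by (simp add: R_mult)
    qed (use a pc in auto)
    also have "\<dots> = R (twist h p) (\<iota> a)"
      unfolding twist_def using h a pc by (intro R_sw[symmetric]) auto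
    finally show ?thesis .
  qed
  then show ?thesis using h pc by (simp add: central_def)
qed

lemma twist_L_antipode:
  assumes h: "h : H" and p: "p : P" and a: "a : A"
  shows "sw P (\<lambda>x y. twist x (L (\<iota> (act (\<S> y) a)) p)) h = L (\<iota> a) (twist h p)"
proof -
  let ?sw = "sw P"
  have "?sw (\<lambda>x y. twist x (L (\<iota> (act (\<S> y) a)) p)) h =
    ?sw (\<lambda>x y. ?sw (\<lambda>u v. R (L (\<pi> u \<bullet> \<iota> (act (\<S> y) a)) p) (\<pi> (\<S> v))) x) h"
    unfolding twist_def using a p
    by (intro sw_cong[OF P_ag] h sw_closed[OF P_ag]) (auto simp: L_mult)
  also have "\<dots> = ?sw (\<lambda>x y. ?sw (\<lambda>u v. R (L (\<pi> x \<bullet> \<iota> (act (\<S> v) a)) p) (\<pi> (\<S> u))) y) h"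
    using a p by (intro sw_coassoc[OF P_module h]) (auto intro!: linear_intros)
  also have "\<dots> = ?sw (\<lambda>x y. ?sw (\<lambda>u v. R (L (\<pi> x \<bullet> \<iota> (act (\<S> u) a)) p) (\<pi> (\<S> v))) y) h"
    using a p by (intro sw3_swap23[OF P_module h]) (auto intro!: linear_intros)
  also have "\<dots> = ?sw (\<lambda>x y. ?sw (\<lambda>u v. R (L (\<pi> u \<bullet> \<iota> (act (\<S> v) a)) p) (\<pi> (\<S> y))) x) h"
    using a p by (intro sw_coassoc[OF P_module h, symmetric]) (auto intro!: linear_intros)
  also have "\<dots> = ?sw (\<lambda>x y. L (\<iota> a) (R (L (\<pi> x) p) (\<pi> (\<S> y)))) h"
  proof (intro sw_cong[OF P_ag h])
    fix x y assume x: "x : H" and y: "y : H"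
    have "?sw (\<lambda>u v. R (L (\<pi> u \<bullet> \<iota> (act (\<S> v) a)) p) (\<pi> (\<S> y))) x =
      R (L (\<iota> a \<bullet> \<pi> x) p) (\<pi> (\<S> y))"
      unfolding \<pi>_\<iota>_antipode[OF x a, symmetric] using x y a p
      by (intro sw_linear_map[where \<phi>="\<lambda>w. R (L w p) (\<pi> (\<S> y))", symmetric])
        (auto intro!: linear_intros P_module S_module)
    then show "?sw (\<lambda>u v. R (L (\<pi> u \<bullet> \<iota> (act (\<S> v) a)) p) (\<pi> (\<S> y))) x =
      L (\<iota> a) (R (L (\<pi> x) p) (\<pi> (\<S> y)))" using x y a p by (simp add: L_mult L_R)
  qed (use a p in auto)
  also have "\<dots> = L (\<iota> a) (twist h p)"
    unfolding twist_def using h a p by (intro L_sw[symmetric]) auto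
  finally show ?thesis .
qed

lemma twist_L_act_one:
  assumes h: "h : H" and k: "k : H" and p: "p : P"
  shows "twist h (L (\<delta> k) p) =
    sw P (\<lambda>x y. L (\<delta> (x \<cdot> k)) (twist y p)) h"
proof -
  let ?sw = "sw P"
  have "twist h (L (\<delta> k) p) = ?sw (\<lambda>x y. ?sw (\<lambda>u v. 
      R (L (\<delta> (u \<cdot> k) \<bullet> \<pi> v) p) (\<pi> (\<S> y))) x) h"
    unfolding twist_def
  proof (intro sw_cong[OF P_ag h])
    fix x y assume x: "x : H" and y: "y : H"
    have "R (L (\<pi> x) (L (\<delta> k) p)) (\<pi> (\<S> y)) = R (L (\<pi> x \<bullet> \<delta> k) p) (\<pi> (\<S> y))"
      using x y k p by (simp add: L_mult)
    also have "\<dots> = ?sw (\<lambda>u v. R (L (\<delta> (u \<cdot> k) \<bullet> \<pi> v) p) (\<pi> (\<S> y))) x"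
      unfolding \<pi>_\<iota>_act_one[OF x k] using x y k p
      by (intro sw_linear_map[where \<phi>="\<lambda>w. R (L w p) (\<pi> (\<S> y))"])
        (auto intro!: linear_intros P_module S_module)
    finally show "R (L (\<pi> x) (L (\<delta> k) p)) (\<pi> (\<S> y)) = \<dots>" .
  qed (use k p in \<open>auto intro!: sw_closed[OF P_ag]\<close>)
  also have "\<dots> = ?sw (\<lambda>x y. ?sw (\<lambda>u v. 
      R (L (\<delta> (x \<cdot> k) \<bullet> \<pi> u) p) (\<pi> (\<S> v))) y) h"
    using k p by (intro sw_coassoc[OF P_module h]) (auto intro!: linear_intros)
  also have "\<dots> = ?sw (\<lambda>x y. L (\<delta> (x \<cdot> k)) (twist y p)) h"
  proof (intro sw_cong[OF P_ag h])
    fix x y assume x: "x : H" and y: "y : H"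
    have "L (\<delta> (x \<cdot> k)) (twist y p) =
      ?sw (\<lambda>u v. L (\<delta> (x \<cdot> k)) (R (L (\<pi> u) p) (\<pi> (\<S> v)))) y"
      unfolding twist_def using x y k p by (intro L_sw) auto
    also have "\<dots> = ?sw (\<lambda>u v. R (L (\<delta> (x \<cdot> k) \<bullet> \<pi> u) p) (\<pi> (\<S> v))) y"
      using x y k p by (intro sw_cong[OF P_ag]) (auto simp: L_mult L_R)
    finally show "?sw (\<lambda>u v. R (L (\<delta> (x \<cdot> k) \<bullet> \<pi> u) p) (\<pi> (\<S> v))) y =
      L (\<delta> (x \<cdot> k)) (twist y p)" ..
  qed (use k p in auto)
  finally show ?thesis .
qed

text \<open>
  Expanding \<open>\<pi>(h\<^sub>1)\<pi>(k\<^sub>1)\<close> and \<open>\<pi>(\<S>(k\<^sub>2))\<pi>(\<S>(h\<^sub>2))\<close> gives \<open>\<delta>(h\<^sub>1)([h\<^sub>2k] \<triangleright> p)\<delta>(h\<^sub>3)\<close>.  As \<open>[h\<^sub>2k] \<triangleright> p\<close> is central, the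
  last factor moves to the front, where \<open>(h\<^sub>1\<cdot>1)(h\<^sub>2\<cdot>1) = h\<cdot>1\<close>.
\<close>

lemma twist_twist:
  assumes h: "h : H" and k: "k : H" and p: "central p"
  shows "twist h (twist k p) = sw P (\<lambda>x y. L (\<delta> x) (twist (y \<cdot> k) p)) h"
proof -
  let ?sw = "sw P"
  have pc: "p : P" by (rule central_closed[OF p])
  \<comment> \<open>\<open>x1\<close>, \<open>x2\<close>, \<open>y1\<close>, \<open>y2\<close> are the coproduct factors of \<open>h\<close>, and \<open>u\<close>, \<open>v\<close> those of \<open>k\<close>.\<close>
  define \<Phi> where "\<Phi> = (\<lambda>x1 x2 y1 y2 u v.
    R (R (L (\<delta> x1) (L (\<pi> (x2 \<cdot> u)) p)) (\<pi> (\<S> (y1 \<cdot> v)))) (\<delta> y2))"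
  have cl: "\<Phi> x1 x2 y1 y2 u v : P" if "x1 : H" "x2 : H" "y1 : H"
    "y2 : H" "u : H" "v : H" for x1 x2 y1 y2 u v
    unfolding \<Phi>_def using that pc by auto
  define G where "G = (\<lambda>x1 x2 y1 y2. ?sw (\<Phi> x1 x2 y1 y2) k)"
  have Gcl: "G x1 x2 y1 y2 : P" if "x1 : H" "x2 : H" "y1 : H"
    "y2 : H" for x1 x2 y1 y2
    unfolding G_def using that k by (intro sw_closed[OF P_ag] cl) auto
  have "twist h (twist k p) = ?sw (\<lambda>x y. ?sw (\<lambda>x1 x2. ?sw (\<lambda>y1 y2. G x1 x2 y1 y2) y) x) h"
    unfolding twist_def[of h]
  proof (intro sw_cong[OF P_ag h])
    fix x y assume x: "x : H" and y: "y : H"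
    have "R (L (\<pi> x) (twist k p)) (\<pi> (\<S> y)) =
      ?sw (\<lambda>u v. R (L (\<pi> x) (R (L (\<pi> u) p) (\<pi> (\<S> v)))) (\<pi> (\<S> y))) k"
      unfolding twist_def using x y k pc
      by (intro sw_linear_map[where \<phi>="\<lambda>w. R (L (\<pi> x) w) (\<pi> (\<S> y))"])
        (auto intro!: linear_intros P_module)
    also have "\<dots> = ?sw (\<lambda>u v. ?sw (\<lambda>x1 x2. ?sw (\<lambda>y1 y2. \<Phi> x1 x2 y1 y2 u v) y) x) k"
    proof (intro sw_cong[OF P_ag k])
      fix u v assume u: "u : H" and v: "v : H"
      have "R (L (\<pi> x) (R (L (\<pi> u) p) (\<pi> (\<S> v)))) (\<pi> (\<S> y)) =
        R (L (\<pi> x \<bullet> \<pi> u) p) (\<pi> (\<S> v) \<bullet> \<pi> (\<S> y))"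
        using x y u v pc by (simp add: L_mult R_mult L_R)
      also have "\<dots> = ?sw (\<lambda>x1 x2. R (L (\<delta> x1 \<bullet> \<pi> (x2 \<cdot> u)) p) (\<pi> (\<S> v) \<bullet> \<pi> (\<S> y))) x"
        unfolding \<pi>_\<pi>[OF x u] using x y u v pc
        by (intro sw_linear_map[where \<phi>="\<lambda>w. R (L w p) (\<pi> (\<S> v) \<bullet> \<pi> (\<S> y))"])
          (auto intro!: linear_intros P_module S_module)
      also have "\<dots> = ?sw (\<lambda>x1 x2. ?sw (\<lambda>y1 y2. \<Phi> x1 x2 y1 y2 u v) y) x"
      proof (intro sw_cong[OF P_ag x])
        fix x1 x2 assume x12: "x1 : H" "x2 : H"
        have "R (L (\<delta> x1 \<bullet> \<pi> (x2 \<cdot> u)) p) (\<pi> (\<S> v) \<bullet> \<pi> (\<S> y)) =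
          ?sw (\<lambda>y1 y2. R (L (\<delta> x1 \<bullet> \<pi> (x2 \<cdot> u)) p) (\<pi> (\<S> (y1 \<cdot> v)) \<bullet> \<delta> y2)) y"
          unfolding \<pi>_antipode_mult[OF v y] using x12 u v y pc by (intro sw_R) auto
        also have "\<dots> = ?sw (\<lambda>y1 y2. \<Phi> x1 x2 y1 y2 u v) y"
          unfolding \<Phi>_def using x12 u v y pc by (intro sw_cong[OF P_ag]) (auto simp: L_mult R_mult)
        finally show "R (L (\<delta> x1 \<bullet> \<pi> (x2 \<cdot> u)) p) (\<pi> (\<S> v) \<bullet> \<pi> (\<S> y)) = \<dots>" .
      qed (use u v y in \<open>auto intro!: sw_closed[OF P_ag] cl\<close>)
      finally show "R (L (\<pi> x) (R (L (\<pi> u) p) (\<pi> (\<S> v)))) (\<pi> (\<S> y)) = \<dots>" .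
    qed (use x y in \<open>auto intro!: sw_closed[OF P_ag] cl\<close>)
    also have "\<dots> = ?sw (\<lambda>x1 x2. ?sw (\<lambda>u v. ?sw (\<lambda>y1 y2. \<Phi> x1 x2 y1 y2 u v) y) k) x"
      using x y k cl by (intro sw_swap[OF P_ag] sw_closed[OF P_ag]) auto
    also have "\<dots> = ?sw (\<lambda>x1 x2. ?sw (\<lambda>y1 y2. G x1 x2 y1 y2) y) x"
      unfolding G_def using x y k cl
      by (intro sw_cong[OF P_ag] sw_swap[OF P_ag] sw_closed[OF P_ag]) auto
    finally show "R (L (\<pi> x) (twist k p)) (\<pi> (\<S> y)) = \<dots>" .
  qed (auto intro!: sw_closed[OF P_ag] Gcl)
  also have "\<dots> = ?sw (\<lambda>x1 w. ?sw (\<lambda>x2 y. ?sw (\<lambda>y1 y2. G x1 x2 y1 y2) y) w) h"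
    unfolding G_def \<Phi>_def using k pc
    by (intro sw_coassoc[OF P_module h]) (auto intro!: linear_intros P_module)
  also have "\<dots> = ?sw (\<lambda>x w. ?sw (\<lambda>z y. L (\<delta> x) (L (\<delta> y) (twist (z \<cdot> k) p))) w) h"
  proof (intro sw_cong[OF P_ag h])
    fix x1 w assume x1: "x1 : H" and w: "w : H"
    have "?sw (\<lambda>x2 y. ?sw (\<lambda>y1 y2. G x1 x2 y1 y2) y) w = ?sw (\<lambda>z y2. ?sw (\<lambda>x2 y1. G x1 x2 y1 y2) z) w"
      unfolding G_def \<Phi>_def using x1 k pc
      by (intro sw_coassoc[OF P_module w, symmetric]) (auto intro!: linear_intros P_module)
    also have "\<dots> = ?sw (\<lambda>z y. L (\<delta> x1) (L (\<delta> y) (twist (z \<cdot> k) p))) w"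
    proof (intro sw_cong[OF P_ag w])
      fix z y assume z: "z : H" and y: "y : H"
      have "twist (z \<cdot> k) p = ?sw (\<lambda>x2 y1. ?sw (\<lambda>u v.
          R (L (\<pi> (x2 \<cdot> u)) p) (\<pi> (\<S> (y1 \<cdot> v)))) k) z"
        unfolding twist_def using z k pc by (intro sw_mult[OF P_module]) (auto intro!: linear_intros)
      then have "R (L (\<delta> x1) (twist (z \<cdot> k) p)) (\<delta> y) = R (L (\<delta> x1) (?sw (\<lambda>x2 y1. ?sw (\<lambda>u v.
          R (L (\<pi> (x2 \<cdot> u)) p) (\<pi> (\<S> (y1 \<cdot> v)))) k) z)) (\<delta> y)" by simp
      also have "\<dots> = ?sw (\<lambda>x2 y1. R (L (\<delta> x1) (?sw (\<lambda>u v.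
          R (L (\<pi> (x2 \<cdot> u)) p) (\<pi> (\<S> (y1 \<cdot> v)))) k)) (\<delta> y)) z"
        using x1 y z k pc
        by (intro sw_linear_map[where \<phi>="\<lambda>w. R (L (\<delta> x1) w) (\<delta> y)"] sw_closed[OF P_ag])
          (auto intro!: linear_intros P_module)
      also have "\<dots> = ?sw (\<lambda>x2 y1. G x1 x2 y1 y) z"
      proof (intro sw_cong[OF P_ag z])
        fix x2 y1 assume xy: "x2 : H" "y1 : H"
        have "R (L (\<delta> x1) (?sw (\<lambda>u v. R (L (\<pi> (x2 \<cdot> u)) p) (\<pi> (\<S> (y1 \<cdot> v)))) k)) (\<delta> y) =
          ?sw (\<lambda>u v. R (L (\<delta> x1) (R (L (\<pi> (x2 \<cdot> u)) p) (\<pi> (\<S> (y1 \<cdot> v))))) (\<delta> y)) k"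
          using x1 y xy k pc
          by (intro sw_linear_map[where \<phi>="\<lambda>w. R (L (\<delta> x1) w) (\<delta> y)"])
            (auto intro!: linear_intros P_module)
        also have "\<dots> = G x1 x2 y1 y"
          unfolding G_def \<Phi>_def using x1 y xy k pc by (intro sw_cong[OF P_ag]) (auto simp: L_R)
        finally show "R (L (\<delta> x1) (?sw (\<lambda>u v. R (L (\<pi> (x2 \<cdot> u)) p) (\<pi> (\<S> (y1 \<cdot> v)))) k)) (\<delta> y) = \<dots>" .
      qed (use x1 y in \<open>auto intro!: Gcl\<close>)
      finally show "?sw (\<lambda>x2 y1. G x1 x2 y1 y) z = L (\<delta> x1) (L (\<delta> y) (twist (z \<cdot> k) p))"
        using x1 y z k pc centralD[OF central_twist[OF H_m_closed[OF z k] p], of "act y \<one>\<^sub>A"]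
        by (simp add: L_R)
    qed (use x1 k pc in auto)
    finally show "?sw (\<lambda>x2 y. ?sw (\<lambda>y1 y2. G x1 x2 y1 y2) y) w = \<dots>" .
  qed (use k pc in \<open>auto intro!: sw_closed[OF P_ag]\<close>)
  also have "\<dots> = ?sw (\<lambda>x w. ?sw (\<lambda>y z. L (\<delta> x) (L (\<delta> y) (twist (z \<cdot> k) p))) w) h"
    using k pc by (intro sw3_swap23[OF P_module h]) (auto intro!: linear_intros)
  also have "\<dots> = ?sw (\<lambda>w z. ?sw (\<lambda>x y. L (\<delta> x) (L (\<delta> y) (twist (z \<cdot> k) p))) w) h"
    using k pc by (intro sw_coassoc[OF P_module h, symmetric]) (auto intro!: linear_intros)
  also have "\<dots> = ?sw (\<lambda>w z. L (\<delta> w) (twist (z \<cdot> k) p)) h"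
  proof (intro sw_cong[OF P_ag h])
    fix w z assume w: "w : H" and z: "z : H"
    have "?sw (\<lambda>x y. L (\<delta> x) (L (\<delta> y) (twist (z \<cdot> k) p))) w =
      ?sw (\<lambda>x y. L (\<iota> (act x \<one>\<^sub>A \<otimes>\<^sub>A act y \<one>\<^sub>A)) (twist (z \<cdot> k) p)) w"
      using w z k pc by (intro sw_cong[OF P_ag]) (auto simp: \<iota>_mult[symmetric] L_mult)
    also have "\<dots> = L (\<iota> (sw A (\<lambda>x y. act x \<one>\<^sub>A \<otimes>\<^sub>A act y \<one>\<^sub>A) w)) (twist (z \<cdot> k) p)"
      using w z k pc by (intro sw_linear_map[where \<phi>="\<lambda>w. L (\<iota> w) (twist (z \<cdot> k) p)", symmetric])
        (auto intro!: linear_intros P_module A_module)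
    also have "sw A (\<lambda>x y. act x \<one>\<^sub>A \<otimes>\<^sub>A act y \<one>\<^sub>A) w = act w \<one>\<^sub>A"
      using act_mult[OF w A.one_closed A.one_closed] by simp
    finally show "?sw (\<lambda>x y. L (\<delta> x) (L (\<delta> y) (twist (z \<cdot> k) p))) w =
      L (\<delta> w) (twist (z \<cdot> k) p)" .
  qed (use k pc in auto)
  finally show ?thesis .
qed

lemma twist_partial_rep:
  assumes h: "h : H" and k: "k : H" and p: "central p"
  shows "sw P (\<lambda>x y. twist x (twist (\<S> y) p)) h = L (\<delta> h) p"
    and "sw P (\<lambda>x y. twist h (twist x (twist (\<S> y) p))) k =
      sw P (\<lambda>x y. twist (h \<cdot> x) (twist (\<S> y) p)) k"
    and "sw P (\<lambda>x y. twist x (twist (\<S> y) (twist k p))) h =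
      sw P (\<lambda>x y. twist x (twist (\<S> y \<cdot> k) p)) h"
  by (rule partial_rep_criterion[OF P_module, of "{p. central p}" twist "\<lambda>h. L (\<delta> h)"];
      (use h k p in \<open>auto intro!: linear_intros central_twist simp: twist_one central_closed twist_L_act_one twist_twist\<close>))+

text \<open>
  In \<open>\<pi>(h\<^sub>1)p\<pi>(\<S>(h\<^sub>2))\<pi>(h\<^sub>3)\<close> the last two factors contract to \<open>\<iota>(\<S>(h\<^sub>2)\<cdot>1)\<close>, which commutes with \<open>p\<close> and is
  then absorbed by \<open>\<pi>(h\<^sub>1)\<close>.
\<close>

lemma twist_\<pi>:
  assumes h: "h : H" and p: "central p"
  shows "sw P (\<lambda>x y. R (twist x p) (\<pi> y)) h = L (\<pi> h) p"
proof -
  let ?sw = "sw P"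
  have pc: "p : P" by (rule central_closed[OF p])
  have "?sw (\<lambda>x y. R (twist x p) (\<pi> y)) h =
    ?sw (\<lambda>x y. ?sw (\<lambda>u v. R (L (\<pi> u) p) (\<pi> (\<S> v) \<bullet> \<pi> y)) x) h"
  proof (intro sw_cong[OF P_ag h])
    fix x y assume x: "x : H" and y: "y : H"
    have "R (twist x p) (\<pi> y) = ?sw (\<lambda>u v. R (R (L (\<pi> u) p) (\<pi> (\<S> v))) (\<pi> y)) x"
      unfolding twist_def using x y pc by (intro R_sw) auto
    also have "\<dots> = ?sw (\<lambda>u v. R (L (\<pi> u) p) (\<pi> (\<S> v) \<bullet> \<pi> y)) x"
      using x y pc by (intro sw_cong[OF P_ag]) (auto simp: R_mult)
    finally show "R (twist x p) (\<pi> y) = \<dots>" .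
  qed (use pc in \<open>auto intro!: sw_closed[OF P_ag]\<close>)
  also have "\<dots> = ?sw (\<lambda>x y. ?sw (\<lambda>u v. R (L (\<pi> x) p) (\<pi> (\<S> u) \<bullet> \<pi> v)) y) h"
    using pc by (intro sw_coassoc[OF P_module h]) (auto intro!: linear_intros)
  also have "\<dots> = ?sw (\<lambda>x y. L (\<pi> x \<bullet> \<delta> (\<S> y)) p) h"
  proof (intro sw_cong[OF P_ag h])
    fix x y assume x: "x : H" and y: "y : H"
    have "?sw (\<lambda>u v. R (L (\<pi> x) p) (\<pi> (\<S> u) \<bullet> \<pi> v)) y = R (L (\<pi> x) p) (\<delta> (\<S> y))"
      unfolding \<pi>_antipode_\<pi>[OF y, symmetric] using x y pc by (intro sw_R[symmetric]) auto
    then show "?sw (\<lambda>u v. R (L (\<pi> x) p) (\<pi> (\<S> u) \<bullet> \<pi> v)) y = L (\<pi> x \<bullet> \<delta> (\<S> y)) p"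
      using x y pc by (simp add: L_mult centralD[OF p] L_R)
  qed (use pc in auto)
  also have "\<dots> = L (\<iota> \<one>\<^sub>A \<bullet> \<pi> h) p"
    unfolding \<pi>_\<iota>_antipode[OF h A.one_closed, symmetric] using h pc by (intro sw_L[symmetric]) auto
  finally show ?thesis using h by (simp add: \<iota>_one)
qed

end

section \<open>The algebra generated by a partial representation\<close>

text \<open>
  The induced map is given by its value on an arbitrary representative, the form in which the action of
  \<open>H\<^sub>p\<^sub>a\<^sub>r\<close> on a module is defined.
\<close>

lemma quotient_map:
  assumes "ring_hom_ring R E \<phi>" "ideal I R" "I \<subseteq> a_kernel R E \<phi>"
  defines "\<psi> \<equiv> \<lambda>t. \<phi> (SOME c. c \<in> t)"
  shows "\<psi> \<in> ring_hom (R Quot I) E"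
    and "\<And>c. c : R ==> \<psi> (I +>\<^sub>R c) = \<phi> c"
    and "\<And>t c. [|t : (R Quot I); c \<in> t|] ==> c : R \<and> \<psi> t = \<phi> c"
    and "\<And>t. t : (R Quot I) ==> \<exists>c. c \<in> t"
proof -
  interpret ring_hom_ring R E \<phi> by fact
  interpret I: ideal I R by fact
  have ker: "\<phi> i = \<zero>\<^sub>E" if "i \<in> I" for i using subsetD[OF assms(3) that] unfolding a_kernel_def' by blast
  have ex: "\<exists>d\<in>carrier R. t = I +>\<^sub>R d" if "t : (R Quot I)" for t
    using that by (auto simp: FactRing_simps)
  have coset: "c : R \<and> \<phi> c = \<phi> d" if "d : R" "c \<in> I +>\<^sub>R d" for c d
  proof -
    obtain i where i: "i \<in> I" "c = i \<oplus>\<^sub>R d" using \<open>c \<in> I +>\<^sub>R d\<close> by (auto simp: a_r_coset_def')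
    then show ?thesis using that ker[OF i(1)] I.Icarr[OF i(1)] by simp
  qed
  show val: "\<psi> (I +>\<^sub>R c) = \<phi> c" if c: "c : R" for c
    unfolding \<psi>_def using coset[OF c someI[of "\<lambda>d. d \<in> I +>\<^sub>R c", OF I.a_rcos_self[OF c]]] by simp
  show "c : R \<and> \<psi> t = \<phi> c" if "t : (R Quot I)" "c \<in> t" for t c
    using ex[OF that(1)] that(2) coset val by metis
  show "\<exists>c. c \<in> t" if "t : (R Quot I)" for t
    using ex[OF that] I.a_rcos_self by blast
  show "\<psi> \<in> ring_hom (R Quot I) E"
  proof (rule ring_hom_memI)
    fix s t assume "s : (R Quot I)" "t : (R Quot I)"
    then obtain c d where cd: "c : R" "s = I +>\<^sub>R c" "d : R" "t = I +>\<^sub>R d" using ex by metis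
    show "\<psi> (s \<otimes>\<^bsub>R Quot I\<^esub> t) = \<psi> s \<otimes>\<^sub>E \<psi> t"
      using cd by (simp add: FactRing_def I.rcoset_mult_add val)
    show "\<psi> (s \<oplus>\<^bsub>R Quot I\<^esub> t) = \<psi> s \<oplus>\<^sub>E \<psi> t"
      using cd by (simp add: FactRing_def I.a_rcos_sum val)
  next
    fix t assume "t : (R Quot I)"
    then obtain c where "c : R" "t = I +>\<^sub>R c" using ex by metis
    then show "\<psi> t : E" by (simp add: val)
  next
    show "\<psi> \<one>\<^bsub>R Quot I\<^esub> = \<one>\<^sub>E" by (simp add: FactRing_def val)
  qed
qed

lemma quotient_cases:
  assumes "t : (R Quot I)"
  obtains c where "c : R" "t = I +>\<^sub>R c"
  using assms by (auto simp: FactRing_simps)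

lemma genideal_kernel:
  assumes "ring_hom_ring R E \<phi>" "\<And>r. r \<in> X ==> r : R \<and> \<phi> r = \<zero>\<^sub>E"
  shows "Idl\<^bsub>R\<^esub> X \<subseteq> a_kernel R E \<phi>"
proof -
  interpret ring_hom_ring R E \<phi> by fact
  show ?thesis
    by (rule R.genideal_minimal[OF kernel_is_ideal]) (use assms(2) in \<open>unfold a_kernel_def', blast\<close>)
qed

lemma with_smult_ring:
  assumes "ring R" shows "ring (with_smult R \<sigma>)"
proof -
  interpret ring R by fact
  show ?thesis
    by (rule ringI)
      (auto intro!: monoidI simp: abelian_group_axioms m_assoc l_distr r_distr)
qed

lemma central_hom_algebra:
  assumes K: "cring K" and Q: "ring Q" and \<kappa>: "\<kappa> \<in> ring_hom K Q"
    and comm: "\<And>k q. [|k : K; q : Q|] ==> \<kappa> k \<otimes>\<^sub>Q q = q \<otimes>\<^sub>Q \<kappa> k"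
  shows "unital_algebra K (with_smult Q (\<lambda>k q. \<kappa> k \<otimes>\<^sub>Q q))" (is "unital_algebra K ?Q")
proof -
  interpret Q: ring Q by fact
  have cl: "\<kappa> k : Q" if "k : K" for k using \<kappa> that by (rule ring_hom_closed)
  have "module K ?Q"
    by (rule moduleI[OF K])
      (simp_all add: Q.abelian_group_axioms cl ring_hom_add[OF \<kappa>] ring_hom_mult[OF \<kappa>] ring_hom_one[OF \<kappa>]
        Q.l_distr Q.r_distr Q.m_assoc)
  moreover have "ring ?Q" by (rule with_smult_ring[OF Q])
  moreover have "x \<otimes>\<^sub>Q (\<kappa> k \<otimes>\<^sub>Q y) = \<kappa> k \<otimes>\<^sub>Q (x \<otimes>\<^sub>Q y)"
    if "k : K" "x : Q" "y : Q" for k x y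
    using that cl comm[of k x] Q.m_assoc[of x "\<kappa> k" y] Q.m_assoc[of "\<kappa> k" x y] by simp
  ultimately show ?thesis
    by (intro unital_algebra.intro unital_algebra_axioms.intro) (simp_all add: cl Q.m_assoc)
qed

subsection \<open>Words\<close>

lemma frag_extend_add_fun: "frag_extend (\<lambda>x. f x + g x) c = frag_extend f c + frag_extend g c"
  by (simp add: frag_extend_def frag_cmul_distrib2 sum.distrib)

lemma frag_extend_diff_fun: "frag_extend (\<lambda>x. f x - g x) c = frag_extend f c - frag_extend g c"
  using frag_extend_add_fun[of "\<lambda>x. f x - g x" g c] by simp

definition word_val :: "('k, 'e, 'w) module_scheme \<Rightarrow> ('v \<Rightarrow> 'e) \<Rightarrow> 'v list \<Rightarrow> 'e"
  where "word_val E \<rho> w = foldr (\<lambda>v e. \<rho> v \<otimes>\<^sub>E e) w \<one>\<^sub>E"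

definition words_val :: "('k, 'e, 'w) module_scheme \<Rightarrow> ('v \<Rightarrow> 'e) \<Rightarrow> ('k, 'v) words \<Rightarrow> 'e"
  where "words_val E \<rho> = frag_sum E (\<lambda>m. fst m \<odot>\<^sub>E word_val E \<rho> (snd m))"

definition TA_val :: "('k, 'e, 'w) module_scheme \<Rightarrow> ('v \<Rightarrow> 'e) \<Rightarrow> ('k, 'v) words set \<Rightarrow> 'e"
  where "TA_val E \<rho> t = words_val E \<rho> (SOME c. c \<in> t)"

locale words = module K V
  for K :: "('k, 's) ring_scheme" (structure) and V :: "('k, 'v, 't) module_scheme" (structure)
begin

abbreviation "W \<equiv> word_ring K V"
abbreviation "WU \<equiv> carrier K \<times> lists (carrier V)"

lemma W_simps:
  "carrier W = {c. Poly_Mapping.keys c \<subseteq> WU}" "zero W = 0" "add W = (+)" "one W = frag_of (\<one>\<^sub>K, [])"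
  by (simp_all add: word_ring_def free_Abelian_group_def)

lemma W_mult_of: "frag_of (k, u) \<otimes>\<^sub>W frag_of (l, v) = frag_of (k \<otimes>\<^sub>K l, u @ v)"
  by (simp add: word_ring_def)

lemma W_mult_diff_left: "(c - c') \<otimes>\<^sub>W d = c \<otimes>\<^sub>W d - c' \<otimes>\<^sub>W d"
  by (simp add: word_ring_def frag_extend_diff)

lemma W_mult_diff_right: "c \<otimes>\<^sub>W (d - d') = c \<otimes>\<^sub>W d - c \<otimes>\<^sub>W d'"
  by (simp add: word_ring_def frag_extend_diff split_def frag_extend_diff_fun)

lemma W_mult_add_left: "(c + c') \<otimes>\<^sub>W d = c \<otimes>\<^sub>W d + c' \<otimes>\<^sub>W d"
  by (simp add: word_ring_def frag_extend_add)

lemma W_mult_add_right: "c \<otimes>\<^sub>W (d + d') = c \<otimes>\<^sub>W d + c \<otimes>\<^sub>W d'"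
  by (simp add: word_ring_def frag_extend_add split_def frag_extend_add_fun)

lemma W_mult_zero [simp]: "0 \<otimes>\<^sub>W d = 0" "c \<otimes>\<^sub>W 0 = 0"
  using W_mult_diff_left[of 0 0 d] W_mult_diff_right[of c 0 0] by simp_all

lemma W_induct [consumes 1, case_names zero of diff]:
  assumes c: "c : W" and "Q 0" "\<And>k w. [|k : K; w \<in> lists (carrier V)|] ==> Q (frag_of (k, w))"
    and d: "\<And>a b. [|a : W; b : W; Q a; Q b|] ==> Q (a - b)"
  shows "Q c"
proof -
  have "Poly_Mapping.keys c \<subseteq> WU" using c by (simp add: W_simps)
  then have "c : W \<and> Q c"
  proof (induction c rule: frag_induction)
    case (diff a b)
    then have "Poly_Mapping.keys (a - b) \<subseteq> WU" using keys_diff[of a b] unfolding W_simps by blast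
    then show ?case using d diff by (simp add: W_simps)
  qed (use assms in \<open>auto simp: W_simps keys_frag_of\<close>)
  then show ?thesis ..
qed

lemma W_of_closed: "[|k : K; w \<in> lists (carrier V)|] ==> frag_of (k, w) : W"
  by (simp add: W_simps keys_frag_of)

lemma W_diff_closed: "[|c : W; d : W|] ==> c - d : W"
  using keys_diff[of c d] unfolding W_simps by blast

lemma W_mult_closed:
  assumes c: "c : W" and d: "d : W" shows "c \<otimes>\<^sub>W d : W"
proof -
  have 1: "frag_of (k, w) \<otimes>\<^sub>W d : W" if "k : K" "w \<in> lists (carrier V)" for k w
    using d that
  proof (induction d rule: W_induct)
    case (diff a b)
    then show ?case by (simp add: W_mult_diff_right W_diff_closed)
  qed (auto simp: W_mult_of intro!: W_of_closed, simp add: W_simps)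
  show ?thesis using c
    by (induction c rule: W_induct) (auto simp: W_mult_diff_left W_diff_closed 1, simp add: W_simps)
qed

lemma W_ring: "ring W"
proof (rule ringI)
  show "abelian_group W"
  proof (rule abelian_groupI)
    show "x \<oplus>\<^sub>W y : W" if "x : W" "y : W" for x y
      using that Poly_Mapping.keys_add[of x y] unfolding W_simps by blast
    show "\<exists>y\<in>carrier W. y \<oplus>\<^sub>W x = \<zero>\<^sub>W" if "x : W" for x
      using that by (intro bexI[of _ "- x"]) (auto simp: W_simps)
  qed (auto simp: W_simps)
  have assoc2: "(frag_of (k, u) \<otimes>\<^sub>W frag_of (l, v)) \<otimes>\<^sub>W z = frag_of (k, u) \<otimes>\<^sub>W (frag_of (l, v) \<otimes>\<^sub>W z)"
    if "k : K" "l : K" "z : W" for k u l v z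
    using that(3)
    by (induction z rule: W_induct) (use that in \<open>auto simp: W_mult_of W_mult_diff_right R.m_assoc\<close>)
  have assoc1: "(frag_of (k, u) \<otimes>\<^sub>W y) \<otimes>\<^sub>W z = frag_of (k, u) \<otimes>\<^sub>W (y \<otimes>\<^sub>W z)"
    if "k : K" "y : W" "z : W" for k u y z
    using that(2)
    by (induction y rule: W_induct) (use that in \<open>auto simp: assoc2 W_mult_diff_right W_mult_diff_left\<close>)
  show "monoid W"
  proof (rule monoidI)
    show "x \<otimes>\<^sub>W y \<otimes>\<^sub>W z = x \<otimes>\<^sub>W (y \<otimes>\<^sub>W z)" if "x : W" "y : W" "z : W" for x y z
      using that(1) by (induction x rule: W_induct) (use that in \<open>auto simp: assoc1 W_mult_diff_left\<close>)
    show "\<one>\<^sub>W \<otimes>\<^sub>W x = x" if "x : W" for x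
      using that by (induction x rule: W_induct) (auto simp: W_simps(4) W_mult_of W_mult_diff_right)
    show "x \<otimes>\<^sub>W \<one>\<^sub>W = x" if "x : W" for x
      using that by (induction x rule: W_induct) (auto simp: W_simps(4) W_mult_of W_mult_diff_left)
    show "\<one>\<^sub>W : W" by (simp add: W_simps keys_frag_of)
  qed (rule W_mult_closed)
qed (auto simp: W_simps W_mult_add_left W_mult_add_right)

sublocale W: ring W by (rule W_ring)

lemma W_minus: "[|c : W; d : W|] ==> c \<ominus>\<^sub>W d = c - d"
proof -
  assume "c : W" "d : W"
  moreover have "- d : W" using \<open>d : W\<close> by (simp add: W_simps)
  ultimately have "\<ominus>\<^sub>W d = - d" by (intro W.minus_equality) (auto simp: W_simps)
  then show ?thesis by (simp add: a_minus_def W_simps)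
qed

lemma relations_closed: "word_relations K V \<subseteq> carrier W"
  unfolding word_relations_def by (auto intro!: W_diff_closed W_of_closed)

abbreviation "I1 \<equiv> Idl\<^bsub>W\<^esub> (word_relations K V)"
abbreviation "TA \<equiv> tensor_algebra K V"

lemma I1_ideal: "ideal I1 W" by (rule W.genideal_ideal[OF relations_closed])

lemma TA_simps: "carrier TA = carrier (W Quot I1)" "mult TA = mult (W Quot I1)" "one TA = one (W Quot I1)"
  "add TA = add (W Quot I1)" "zero TA = zero (W Quot I1)"
  by (simp_all add: tensor_algebra_def Let_def)

lemma TA_ring: "ring TA"
  unfolding tensor_algebra_def Let_def by (rule with_smult_ring[OF ideal.quotient_is_ring[OF I1_ideal]])

lemma W_TA_hom: "(\<lambda>c. I1 +>\<^sub>W c) \<in> ring_hom W TA"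
  using ideal.rcos_ring_hom[OF I1_ideal] by (simp add: ring_hom_def TA_simps)

lemma tensor_word_eq: "tensor_word K V k w = I1 +>\<^sub>W frag_of (k, w)"
  by (simp add: tensor_word_def)

lemma relation_TA: "r \<in> word_relations K V ==> I1 +>\<^sub>W r = \<zero>\<^bsub>TA\<^esub>"
  using abelian_subgroup.a_rcos_const[OF abelian_subgroupI3[OF ideal.axioms(1)[OF I1_ideal] W.abelian_group_axioms], of r]
    W.genideal_self[OF relations_closed] unfolding TA_simps FactRing_def by auto

subsection \<open>Evaluation of words in an algebra\<close>

context
  fixes E :: "('k, 'e, 'w) module_scheme" and \<rho> :: "'v \<Rightarrow> 'e"
  assumes E: "unital_algebra K E" and \<rho>: "linear_map K V E \<rho>"
begin

interpretation E: unital_algebra K E by (rule E)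

lemma word_val_simps [simp]: "word_val E \<rho> [] = \<one>\<^sub>E" "word_val E \<rho> (v # w) = \<rho> v \<otimes>\<^sub>E word_val E \<rho> w"
  by (simp_all add: word_val_def)

lemma word_val_closed [simp]: "w \<in> lists (carrier V) ==> word_val E \<rho> w : E"
  by (induction w) (auto simp: linear_mapD(1)[OF \<rho>])

lemma word_val_append: "[|u \<in> lists (carrier V); w \<in> lists (carrier V)|] ==> word_val E \<rho> (u @ w) = word_val E \<rho> u \<otimes>\<^sub>E word_val E \<rho> w"
  by (induction u) (auto simp: linear_mapD(1)[OF \<rho>] E.m_assoc)

lemma word_term_closed: "m \<in> WU ==> fst m \<odot>\<^sub>E word_val E \<rho> (snd m) : E"
  by (intro E.smult_closed word_val_closed) (simp_all only: mem_Times_iff)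

lemma words_val_of: "[|k : K; w \<in> lists (carrier V)|] ==> words_val E \<rho> (frag_of (k, w)) = k \<odot>\<^sub>E word_val E \<rho> w"
  unfolding words_val_def by (subst E.frag_sum_of) auto

lemma words_val_diff:
  "[|c : W; d : W|] ==> words_val E \<rho> (c - d) = words_val E \<rho> c \<ominus>\<^sub>E words_val E \<rho> d"
  unfolding words_val_def by (rule E.frag_sum_diff[where U=WU]) (simp_all add: W_simps word_term_closed del: mem_Times_iff)

lemma words_val_add:
  "[|c : W; d : W|] ==> words_val E \<rho> (c + d) = words_val E \<rho> c \<oplus>\<^sub>E words_val E \<rho> d"
  unfolding words_val_def by (rule E.frag_sum_add[where U=WU]) (simp_all add: W_simps word_term_closed del: mem_Times_iff)

lemma words_val_closed [simp]: "c : W ==> words_val E \<rho> c : E"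
  unfolding words_val_def by (rule E.frag_sum_closed[where U=WU]) (simp_all add: W_simps word_term_closed del: mem_Times_iff)

lemma words_val_zero [simp]: "words_val E \<rho> 0 = \<zero>\<^sub>E"
  by (simp add: words_val_def)

lemma E_diff_distr: "[|x : E; y : E; z : E|] ==> (x \<ominus>\<^sub>E y) \<otimes>\<^sub>E z = x \<otimes>\<^sub>E z \<ominus>\<^sub>E y \<otimes>\<^sub>E z"
  "[|x : E; y : E; z : E|] ==> z \<otimes>\<^sub>E (x \<ominus>\<^sub>E y) = z \<otimes>\<^sub>E x \<ominus>\<^sub>E z \<otimes>\<^sub>E y"
  by (simp_all add: a_minus_def E.l_distr E.r_distr E.l_minus E.r_minus)

lemma words_val_mult:
  assumes c: "c : W" and d: "d : W"
  shows "words_val E \<rho> (c \<otimes>\<^sub>W d) = words_val E \<rho> c \<otimes>\<^sub>E words_val E \<rho> d"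
proof -
  have 1: "words_val E \<rho> (frag_of (k, w) \<otimes>\<^sub>W d) = words_val E \<rho> (frag_of (k, w)) \<otimes>\<^sub>E words_val E \<rho> d"
    if kw: "k : K" "w \<in> lists (carrier V)" for k w
    using d
  proof (induction d rule: W_induct)
    case (of l v)
    then show ?case using kw
      by (simp add: W_mult_of words_val_of word_val_append E.smult_mult_left E.smult_mult_right
          E.smult_assoc1[symmetric] R.m_comm)
  next
    case (diff a b)
    then show ?case using kw
      by (simp add: W_mult_diff_right words_val_diff W_of_closed E_diff_distr)
  qed (use kw in \<open>simp add: W_of_closed\<close>)
  show ?thesis using c
  proof (induction c rule: W_induct)
    case (diff a b)
    then show ?case using d by (simp add: W_mult_diff_left words_val_diff E_diff_distr)
  qed (use d 1 in simp_all)
qed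

lemma words_val_hom: "ring_hom_ring W E (words_val E \<rho>)"
  by (rule ring_hom_ringI[OF W_ring E.ring_axioms])
    (simp_all add: words_val_mult words_val_add W_simps(3,4) words_val_of)

lemma words_val_relation: "r \<in> word_relations K V ==> words_val E \<rho> r = \<zero>\<^sub>E"
  unfolding word_relations_def
proof (elim UnE CollectE exE conjE)
  fix k l w assume r: "r = frag_of (k \<oplus>\<^sub>K l, w) - frag_of (k, w) - frag_of (l, w)"
    and *: "k : K" "l : K" "w \<in> lists (carrier V)"
  then show "words_val E \<rho> r = \<zero>\<^sub>E"
    by (simp add: words_val_diff W_diff_closed W_of_closed words_val_of E.smult_l_distr E.diff_diff_eq_zero_iff del: E.r_right_minus_eq)
next
  fix k u x y v assume r: "r = frag_of (k, u @ [x \<oplus>\<^sub>V y] @ v) - frag_of (k, u @ [x] @ v) - frag_of (k, u @ [y] @ v)"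
    and *: "k : K" "u \<in> lists (carrier V)" "x : V" "y : V" "v \<in> lists (carrier V)"
  then show "words_val E \<rho> r = \<zero>\<^sub>E"
    by (simp add: words_val_diff W_diff_closed W_of_closed words_val_of word_val_append linear_mapD[OF \<rho>]
        E.smult_r_distr E.l_distr E.r_distr E.diff_diff_eq_zero_iff del: E.r_right_minus_eq)
next
  fix k l u x v assume r: "r = frag_of (k, u @ [l \<odot>\<^sub>V x] @ v) - frag_of (k \<otimes>\<^sub>K l, u @ [x] @ v)"
    and *: "k : K" "l : K" "u \<in> lists (carrier V)" "x : V" "v \<in> lists (carrier V)"
  then show "words_val E \<rho> r = \<zero>\<^sub>E"
    by (simp add: words_val_diff W_diff_closed W_of_closed words_val_of word_val_append linear_mapD[OF \<rho>]
        E.smult_mult_left E.smult_mult_right E.smult_assoc1 E.diff_eq_zero_iff)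
qed

lemma I1_kernel: "I1 \<subseteq> a_kernel W E (words_val E \<rho>)"
  by (rule genideal_kernel[OF words_val_hom]) (use words_val_relation relations_closed in auto)

lemma TA_val_hom: "ring_hom_ring TA E (TA_val E \<rho>)"
  using quotient_map(1)[OF words_val_hom I1_ideal I1_kernel]
  by (intro ring_hom_ringI2 TA_ring E.ring_axioms) (simp add: ring_hom_def TA_simps TA_val_def[abs_def])

lemma TA_val_coset: "c : W ==> TA_val E \<rho> (I1 +>\<^sub>W c) = words_val E \<rho> c"
  using quotient_map(2)[OF words_val_hom I1_ideal I1_kernel] by (simp add: TA_val_def)

lemma TA_val_rep: "[|t : TA; c \<in> t|] ==> c : W \<and> TA_val E \<rho> t = words_val E \<rho> c"
  using quotient_map(3)[OF words_val_hom I1_ideal I1_kernel] by (simp add: TA_val_def TA_simps)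

lemma TA_rep: "t : TA ==> \<exists>c. c \<in> t"
  using quotient_map(4)[OF words_val_hom I1_ideal I1_kernel] by (simp add: TA_simps)

end

end

context hopf_algebra
begin

sublocale HW: words K H by (simp add: words_def H_module)

abbreviation "WH \<equiv> word_ring K H"
abbreviation "TH \<equiv> tensor_algebra K H"
abbreviation "J1 \<equiv> Idl\<^bsub>WH\<^esub> (word_relations K H)"
abbreviation "J2 \<equiv> Idl\<^bsub>TH\<^esub> (hpar_relations K H)"
abbreviation "QH \<equiv> TH Quot J2"
abbreviation "\<H> \<equiv> Hpar K H"
abbreviation "br \<equiv> bracket K H"
abbreviation "brs w \<equiv> foldr (\<lambda>h t. br h \<otimes>\<^sub>\<H> t) w \<one>\<^sub>\<H>"
abbreviation "tw \<equiv> tensor_word K H \<one>\<^sub>K"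

lemma TH_ring: "ring TH" by (rule HW.TA_ring)
lemma TH_ag: "abelian_group TH" by (rule ring.is_abelian_group[OF TH_ring])

lemma tensor_word_closed:
  "[|k : K; w \<in> lists (carrier H)|] ==> tensor_word K H k w : TH"
  unfolding HW.tensor_word_eq using ring_hom_closed[OF HW.W_TA_hom] HW.W_of_closed by blast

lemma hpar_relations_closed: "hpar_relations K H \<subseteq> carrier TH"
proof -
  interpret TH: ring TH by (rule TH_ring)
  show ?thesis
    unfolding hpar_relations_def Let_def
    by (auto intro!: TH.minus_closed sw_closed[OF TH_ag] tensor_word_closed)
qed

lemma J2_ideal: "ideal J2 TH" by (rule ring.genideal_ideal[OF TH_ring hpar_relations_closed])

lemma QH_ring: "ring QH" by (rule ideal.quotient_is_ring[OF J2_ideal])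

lemma Hp_simps: "carrier \<H> = carrier QH" "mult \<H> = mult QH" "one \<H> = one QH" "add \<H> = add QH" "zero \<H> = zero QH"
  by (simp_all add: Hpar_def Let_def)

lemma Hp_ring: "ring \<H>"
  unfolding Hpar_def Let_def by (rule with_smult_ring[OF QH_ring])

sublocale \<H>: ring \<H> by (rule Hp_ring)

lemma TH_Hp_hom: "hpar_class K H \<in> ring_hom TH \<H>"
  using ideal.rcos_ring_hom[OF J2_ideal] by (simp add: ring_hom_def Hp_simps hpar_class_def[abs_def])

definition cls where "cls c = hpar_class K H (J1 +>\<^bsub>WH\<^esub> c)"

lemma cls_hom: "cls \<in> ring_hom WH \<H>"
  using ring_hom_trans[OF HW.W_TA_hom TH_Hp_hom] by (simp add: comp_def cls_def[abs_def])

lemma cls_tensor_word: "hpar_class K H (tensor_word K H k w) = cls (frag_of (k, w))"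
  by (simp add: cls_def HW.tensor_word_eq)

lemma bracket_cls: "br h = cls (frag_of (\<one>\<^sub>K, [h]))"
  by (simp add: bracket_def cls_tensor_word)

lemma cls_closed: "c : WH ==> cls c : \<H>"
  by (rule ring_hom_closed[OF cls_hom])

lemma cls_of_closed [simp]: "[|k : K; w \<in> lists (carrier H)|] ==> cls (frag_of (k, w)) : \<H>"
  by (intro cls_closed HW.W_of_closed)

lemma cls_additive: "additive_map WH \<H> cls"
  by (intro additive_mapI cls_closed ring_hom_add[OF cls_hom])

lemma cls_diff:
  assumes "c : WH" "d : WH" shows "cls (c - d) = cls c \<ominus>\<^sub>\<H> cls d"
proof -
  have "cls (c - d) = cls (c \<ominus>\<^bsub>WH\<^esub> d)" using HW.W_minus[OF assms] by simp
  also have "\<dots> = cls c \<ominus>\<^sub>\<H> cls d"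
    using assms additive_map_minus[OF cls_additive HW.W.abelian_group_axioms \<H>.abelian_group_axioms]
    unfolding a_minus_def by (simp add: ring_hom_add[OF cls_hom])
  finally show ?thesis .
qed

lemma Hp_cases:
  assumes "t : \<H>" obtains c where "c : WH" "t = cls c"
proof -
  obtain s where s: "s : TH" "t = J2 +>\<^bsub>TH\<^esub> s"
    using assms unfolding Hp_simps by (rule quotient_cases)
  obtain c where "c : WH" "s = J1 +>\<^bsub>WH\<^esub> c"
    using s(1) unfolding HW.TA_simps by (rule quotient_cases)
  then show thesis using that s(2) by (simp add: cls_def hpar_class_def)
qed

lemma cls_relation: "r \<in> word_relations K H ==> cls r = \<zero>\<^sub>\<H>"
  using additive_map_zero[of TH \<H> "hpar_class K H"] TH_ag \<H>.abelian_group_axioms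
    ring_hom_closed[OF TH_Hp_hom] ring_hom_add[OF TH_Hp_hom]
  by (simp add: cls_def HW.relation_TA additive_map_def)

lemma cls_mult_of:
  "[|k : K; l : K; u \<in> lists (carrier H); v \<in> lists (carrier H)|] ==>
    cls (frag_of (k, u)) \<otimes>\<^sub>\<H> cls (frag_of (l, v)) = cls (frag_of (k \<otimes>\<^sub>K l, u @ v))"
  by (simp add: ring_hom_mult[OF cls_hom, symmetric] HW.W_of_closed HW.W_mult_of)

definition scal where "scal k = cls (frag_of (k, []))"

lemma scal_hom: "scal \<in> ring_hom K \<H>"
proof (rule ring_hom_memI)
  fix k l assume kl: "k : K" "l : K"
  show "scal (k \<otimes>\<^sub>K l) = scal k \<otimes>\<^sub>\<H> scal l" using kl by (simp add: scal_def cls_mult_of)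
  have "cls (frag_of (k \<oplus>\<^sub>K l, []) - frag_of (k, []) - frag_of (l, [])) = \<zero>\<^sub>\<H>"
    by (rule cls_relation) (use kl lists.Nil in \<open>unfold word_relations_def, blast\<close>)
  then show "scal (k \<oplus>\<^sub>K l) = scal k \<oplus>\<^sub>\<H> scal l"
    using kl by (simp add: scal_def cls_diff HW.W_diff_closed HW.W_of_closed \<H>.diff_diff_eq_zero_iff
        del: \<H>.r_right_minus_eq)
next
  show "scal \<one>\<^sub>K = \<one>\<^sub>\<H>"
    using ring_hom_one[OF cls_hom] by (simp add: scal_def HW.W_simps)
qed (simp add: scal_def)

lemma scal_central:
  assumes k: "k : K" and q: "q : \<H>" shows "scal k \<otimes>\<^sub>\<H> q = q \<otimes>\<^sub>\<H> scal k"
proof -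
  obtain c where c: "c : WH" "q = cls c" using q by (rule Hp_cases)
  have "frag_of (k, []) \<otimes>\<^bsub>WH\<^esub> c = c \<otimes>\<^bsub>WH\<^esub> frag_of (k, [])"
    using c(1)
    by (induction c rule: HW.W_induct)
      (use k in \<open>auto simp: HW.W_mult_of HW.W_mult_diff_left HW.W_mult_diff_right R.m_comm\<close>)
  then show ?thesis
    using k c by (simp add: scal_def ring_hom_mult[OF cls_hom, symmetric] HW.W_of_closed)
qed

abbreviation "sc k \<equiv> k \<odot>\<^sub>\<H> \<one>\<^sub>\<H>"

lemma Hp_algebra: "unital_algebra K \<H>"
proof -
  have "\<H> = with_smult QH (\<lambda>k q. scal k \<otimes>\<^bsub>QH\<^esub> q)"
    unfolding scal_def cls_tensor_word[symmetric] by (simp add: Hpar_def Let_def)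
  moreover have "unital_algebra K (with_smult QH (\<lambda>k q. scal k \<otimes>\<^bsub>QH\<^esub> q))"
    by (rule central_hom_algebra[OF K_cring QH_ring])
      (use scal_hom scal_central in \<open>auto simp: ring_hom_def Hp_simps\<close>)
  ultimately show ?thesis by simp
qed

lemma Hp_module: "module K \<H>" by (rule unital_algebra_module[OF Hp_algebra])
lemma Hp_ag: "abelian_group \<H>" by (rule module_abelian_group[OF Hp_module])

lemma Hp_smult: "k \<odot>\<^sub>\<H> t = scal k \<otimes>\<^sub>\<H> t"
  unfolding scal_def cls_tensor_word[symmetric] by (simp add: Hpar_def Let_def)

lemma br_closed [simp, intro]: "h : H ==> br h : \<H>"
  by (simp add: bracket_cls)

lemma br_linear: "linear_map K H \<H> br"
proof (rule linear_mapI)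
  fix x y assume xy: "x : H" "y : H"
  have "frag_of (\<one>\<^sub>K, [] @ [x \<oplus>\<^sub>H y] @ []) - frag_of (\<one>\<^sub>K, [] @ [x] @ []) - frag_of (\<one>\<^sub>K, [] @ [y] @ [])
    \<in> word_relations K H"
    unfolding word_relations_def using xy R.one_closed by blast
  from cls_relation[OF this]
  show "br (x \<oplus>\<^sub>H y) = br x \<oplus>\<^sub>\<H> br y"
    using xy by (simp add: bracket_cls cls_diff HW.W_diff_closed HW.W_of_closed \<H>.diff_diff_eq_zero_iff
        del: \<H>.r_right_minus_eq)
next
  fix k x assume kx: "k : K" "x : H"
  have "frag_of (\<one>\<^sub>K, [] @ [k \<odot>\<^sub>H x] @ []) - frag_of (\<one>\<^sub>K \<otimes>\<^sub>K k, [] @ [x] @ []) \<in> word_relations K H"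
    unfolding word_relations_def using kx R.one_closed by blast
  from cls_relation[OF this]
  show "br (k \<odot>\<^sub>H x) = k \<odot>\<^sub>\<H> br x"
    using kx by (simp add: bracket_cls Hp_smult scal_def cls_mult_of cls_diff HW.W_of_closed \<H>.diff_eq_zero_iff)
qed simp

lemma linear_br [linear_intros]: "linear_map K D H f ==> linear_map K D \<H> (\<lambda>x. br (f x))"
  by (rule linear_map_comp[OF br_linear])

lemma linear_Hp_left [linear_intros]:
  "[|b : \<H>; linear_map K D \<H> f|] ==> linear_map K D \<H> (\<lambda>x. f x \<otimes>\<^sub>\<H> b)"
  by (rule linear_mult_left[OF Hp_algebra])

lemma linear_Hp_right [linear_intros]:
  "[|b : \<H>; linear_map K D \<H> f|] ==> linear_map K D \<H> (\<lambda>x. b \<otimes>\<^sub>\<H> f x)"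
  by (rule linear_mult_right[OF Hp_algebra])

lemma cls_word:
  "[|k : K; w \<in> lists (carrier H)|] ==>
    cls (frag_of (k, w)) = k \<odot>\<^sub>\<H> brs w"
proof (induction w arbitrary: k)
  case Nil
  then show ?case using ring_hom_closed[OF scal_hom] by (simp add: Hp_smult scal_def)
next
  case (Cons h w)
  then have hw: "h : H" "w \<in> lists (carrier H)" by auto
  have "cls (frag_of (k, h # w)) = k \<odot>\<^sub>\<H> (br h \<otimes>\<^sub>\<H> cls (frag_of (\<one>\<^sub>K, w)))"
    using hw Cons.prems(1) by (simp add: bracket_cls Hp_smult scal_def cls_mult_of)
  moreover have "brs w : \<H>"
    using hw(2) by (induction w) auto
  ultimately show ?case
    using Cons.IH[OF R.one_closed hw(2)] module.smult_one[OF Hp_module] by simp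
qed

lemma Hp_induct [consumes 1, case_names one br smult add mult]:
  assumes t: "t : \<H>" and 1: "Q \<one>\<^sub>\<H>" and b: "\<And>h. h : H ==> Q (br h)"
    and s: "\<And>k t. [|k : K; t : \<H>; Q t|] ==> Q (k \<odot>\<^sub>\<H> t)"
    and a: "\<And>s t. [|s : \<H>; t : \<H>; Q s; Q t|] ==> Q (s \<oplus>\<^sub>\<H> t)"
    and m: "\<And>s t. [|s : \<H>; t : \<H>; Q s; Q t|] ==> Q (s \<otimes>\<^sub>\<H> t)"
  shows "Q t"
proof -
  interpret HM: module K \<H> by (rule Hp_module)
  have word: "brs w : \<H> \<and> Q (brs w)"
    if "w \<in> lists (carrier H)" for w
    using that by (induction w) (auto intro: 1 m b)
  have neg: "\<ominus>\<^sub>\<H> t = (\<ominus>\<^sub>K \<one>\<^sub>K) \<odot>\<^sub>\<H> t" if "t : \<H>" for t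
    using that by (simp add: HM.smult_l_minus)
  obtain c where c: "c : WH" "t = cls c" using t by (rule Hp_cases)
  have "Q (cls c)" using c(1)
  proof (induction c rule: HW.W_induct)
    case zero
    have "cls 0 = \<zero>\<^sub>\<H>"
      using additive_map_zero[OF cls_additive HW.W.abelian_group_axioms Hp_ag] by (simp add: HW.W_simps)
    moreover have "Q (\<zero>\<^sub>K \<odot>\<^sub>\<H> \<one>\<^sub>\<H>)" by (rule s) (simp_all add: 1)
    ultimately show ?case by (simp add: HM.smult_l_null)
  next
    case (of k w)
    then show ?case using word[of w] by (simp add: cls_word s)
  next
    case (diff a b)
    then show ?case
      by (simp add: cls_diff a_minus_def neg cls_closed a s)
  qed
  then show ?thesis using c by simp
qed

end

definition Hp_val :: "('k, 'e, 'w) module_scheme \<Rightarrow> ('h \<Rightarrow> 'e) \<Rightarrow> ('k, 'h) words set set \<Rightarrow> 'e"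
  where "Hp_val E \<rho> t = TA_val E \<rho> (SOME s. s \<in> t)"

context hopf_algebra
begin

lemma relation_Hp:
  assumes "a \<ominus>\<^bsub>TH\<^esub> b \<in> hpar_relations K H" "a : TH" "b : TH"
  shows "hpar_class K H a = hpar_class K H b"
proof -
  interpret TH: ring TH by (rule TH_ring)
  have add: "additive_map TH \<H> (hpar_class K H)"
    by (intro additive_mapI ring_hom_closed[OF TH_Hp_hom] ring_hom_add[OF TH_Hp_hom])
  have "a \<ominus>\<^bsub>TH\<^esub> b \<in> J2" using TH.genideal_self[OF hpar_relations_closed] assms(1) by blast
  then have "hpar_class K H (a \<ominus>\<^bsub>TH\<^esub> b) = \<zero>\<^sub>\<H>"
    using abelian_subgroup.a_rcos_const[OF abelian_subgroupI3[OF ideal.axioms(1)[OF J2_ideal] TH.abelian_group_axioms]]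
    by (simp add: hpar_class_def Hp_simps FactRing_def)
  then have "hpar_class K H a \<ominus>\<^sub>\<H> hpar_class K H b = \<zero>\<^sub>\<H>"
    using assms additive_mapD[OF add] additive_map_minus[OF add TH_ag Hp_ag] by (simp add: a_minus_def)
  then show ?thesis using assms additive_mapD[OF add] by (simp add: \<H>.diff_eq_zero_iff del: \<H>.r_right_minus_eq)
qed

lemma class_sw:
  assumes "h : H" "\<And>x y. [|x : H; y : H|] ==> w x y \<in> lists (carrier H)"
  shows "hpar_class K H (sw TH (\<lambda>x y. tw (w x y)) h) =
    sw \<H> (\<lambda>x y. brs (w x y)) h"
proof -
  have add: "additive_map TH \<H> (hpar_class K H)"
    by (intro additive_mapI ring_hom_closed[OF TH_Hp_hom] ring_hom_add[OF TH_Hp_hom])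
  have word: "brs w : \<H>" if "w \<in> lists (carrier H)" for w
    using that by (induction w) auto
  have "hpar_class K H (sw TH (\<lambda>x y. tw (w x y)) h) =
    sw \<H> (\<lambda>x y. hpar_class K H (tw (w x y))) h"
    using assms by (intro sw_map[OF add TH_ag Hp_ag] tensor_word_closed) auto
  also have "\<dots> = sw \<H> (\<lambda>x y. brs (w x y)) h"
    using assms(2) word by (intro sw_cong[OF Hp_ag assms(1)])
      (auto simp: cls_tensor_word cls_word module.smult_one[OF Hp_module] simp del: in_lists_conv_set)
  finally show ?thesis .
qed

lemma br_one: "br \<one>\<^sub>H = \<one>\<^sub>\<H>"
proof -
  interpret TH: ring TH by (rule TH_ring)
  have "tw [\<one>\<^sub>H] \<ominus>\<^bsub>TH\<^esub> \<one>\<^bsub>TH\<^esub> \<in> hpar_relations K H"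
    by (simp add: hpar_relations_def Let_def)
  then have "hpar_class K H (tw [\<one>\<^sub>H]) = hpar_class K H \<one>\<^bsub>TH\<^esub>"
    by (rule relation_Hp) (auto intro!: tensor_word_closed)
  then show ?thesis by (simp add: bracket_def ring_hom_one[OF TH_Hp_hom])
qed

text \<open>
  A defining relation of \<open>H\<^sub>p\<^sub>a\<^sub>r\<close> equates two Sweedler sums of words; in \<open>H\<^sub>p\<^sub>a\<^sub>r\<close> the words become products of
  brackets.
\<close>

lemma br_words:
  assumes h: "h : H"
    and w: "\<And>x y. [|x : H; y : H|] ==> w x y \<in> lists (carrier H)"
    and w': "\<And>x y. [|x : H; y : H|] ==> w' x y \<in> lists (carrier H)"
    and rel: "sw TH (\<lambda>x y. tw (w x y)) h \<ominus>\<^bsub>TH\<^esub>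
      sw TH (\<lambda>x y. tw (w' x y)) h \<in> hpar_relations K H"
    and f: "\<And>x y. [|x : H; y : H|] ==> brs (w x y) = f x y"
    and f': "\<And>x y. [|x : H; y : H|] ==> brs (w' x y) = f' x y"
  shows "sw \<H> f h = sw \<H> f' h"
proof -
  have word: "brs w : \<H>" if "w \<in> lists (carrier H)" for w
    using that by (induction w) auto
  have "hpar_class K H (sw TH (\<lambda>x y. tw (w x y)) h) =
    hpar_class K H (sw TH (\<lambda>x y. tw (w' x y)) h)"
    using h w w' by (intro relation_Hp[OF rel] sw_closed[OF TH_ag] tensor_word_closed) auto
  then have "sw \<H> (\<lambda>x y. brs (w x y)) h =
    sw \<H> (\<lambda>x y. brs (w' x y)) h"
    by (simp only: class_sw[OF h w] class_sw[OF h w'])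
  moreover have "sw \<H> (\<lambda>x y. brs (w x y)) h = sw \<H> f h"
    using word[OF w] by (intro sw_cong[OF Hp_ag h]) (simp_all add: f)
  moreover have "sw \<H> (\<lambda>x y. brs (w' x y)) h = sw \<H> f' h"
    using word[OF w'] by (intro sw_cong[OF Hp_ag h]) (simp_all add: f')
  ultimately show ?thesis by simp
qed

lemma br_relation1:
  assumes h: "h : H" and k: "k : H"
  shows "sw \<H> (\<lambda>x y. br h \<otimes>\<^sub>\<H> (br x \<otimes>\<^sub>\<H> br (\<S> y))) k = sw \<H> (\<lambda>x y. br (h \<cdot> x) \<otimes>\<^sub>\<H> br (\<S> y)) k"
proof (rule br_words[OF k, where w="\<lambda>x y. [h, x, \<S> y]" and w'="\<lambda>x y. [h \<cdot> x, \<S> y]"])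
  show "sw TH (\<lambda>x y. tw [h, x, \<S> y]) k \<ominus>\<^bsub>TH\<^esub>
    sw TH (\<lambda>x y. tw [h \<cdot> x, \<S> y]) k \<in> hpar_relations K H"
    using h k unfolding hpar_relations_def Let_def by blast
qed (use h in auto)

lemma br_relation2:
  assumes h: "h : H" and k: "k : H"
  shows "sw \<H> (\<lambda>x y. br x \<otimes>\<^sub>\<H> (br (\<S> y) \<otimes>\<^sub>\<H> br k)) h = sw \<H> (\<lambda>x y. br x \<otimes>\<^sub>\<H> br (\<S> y \<cdot> k)) h"
proof (rule br_words[OF h, where w="\<lambda>x y. [x, \<S> y, k]" and w'="\<lambda>x y. [x, \<S> y \<cdot> k]"])
  show "sw TH (\<lambda>x y. tw [x, \<S> y, k]) h \<ominus>\<^bsub>TH\<^esub>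
    sw TH (\<lambda>x y. tw [x, \<S> y \<cdot> k]) h \<in> hpar_relations K H"
    using h k unfolding hpar_relations_def Let_def by blast
qed (use k in auto)

abbreviation "eH \<equiv> hpar_e K H"

lemma eH_closed [simp, intro]: "h : H ==> eH h : \<H>"
  unfolding hpar_e_def by (rule sw_closed[OF Hp_ag]) auto

lemma linear_eH [linear_intros]: "linear_map K D H f ==> linear_map K D \<H> (\<lambda>x. eH (f x))"
  unfolding hpar_e_def by (auto intro!: linear_intros Hp_module)

lemma eH_br:
  assumes h: "h : H" and k: "k : H"
  shows "eH h \<otimes>\<^sub>\<H> br k = sw \<H> (\<lambda>x y. br x \<otimes>\<^sub>\<H> br (\<S> y \<cdot> k)) h"
proof -
  have "eH h \<otimes>\<^sub>\<H> br k = sw \<H> (\<lambda>x y. (br x \<otimes>\<^sub>\<H> br (\<S> y)) \<otimes>\<^sub>\<H> br k) h"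
    unfolding hpar_e_def using h k
    by (intro sw_linear_map[OF linear_Hp_left[OF _ linear_map_id] Hp_module Hp_module]) auto
  also have "\<dots> = sw \<H> (\<lambda>x y. br x \<otimes>\<^sub>\<H> (br (\<S> y) \<otimes>\<^sub>\<H> br k)) h"
    using h k by (intro sw_cong[OF Hp_ag]) (auto simp: \<H>.m_assoc)
  finally show ?thesis using br_relation2[OF h k] by simp
qed

text \<open>
  By the defining relations \<open>e(h\<^sub>1k)[h\<^sub>2] = [h\<^sub>1k\<^sub>1][\<S>(h\<^sub>2k\<^sub>2)h\<^sub>3] = [hk\<^sub>1][\<S>(k\<^sub>2)] = [h][k\<^sub>1][\<S>(k\<^sub>2)]\<close>.
\<close>

lemma br_eH:
  assumes h: "h : H" and k: "k : H"
  shows "br h \<otimes>\<^sub>\<H> eH k = sw \<H> (\<lambda>x y. eH (x \<cdot> k) \<otimes>\<^sub>\<H> br y) h"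
proof -
  let ?sw = "sw \<H>"
  define \<Phi> where "\<Phi> = (\<lambda>x z u v. br (x \<cdot> u) \<otimes>\<^sub>\<H> br (\<S> v \<cdot> z))"
  have cl: "\<Phi> x z u v : \<H>" if "x : H" "z : H" "u : H" "v : H" for x z u v
    using that by (simp add: \<Phi>_def)
  have "?sw (\<lambda>x y. eH (x \<cdot> k) \<otimes>\<^sub>\<H> br y) h =
    ?sw (\<lambda>x y. ?sw (\<lambda>a b. ?sw (\<lambda>u v. \<Phi> a (\<S> b \<cdot> y) u v) k) x) h"
  proof (intro sw_cong[OF Hp_ag h])
    fix x y assume x: "x : H" and y: "y : H"
    have "eH (x \<cdot> k) \<otimes>\<^sub>\<H> br y = ?sw (\<lambda>a b. br a \<otimes>\<^sub>\<H> br (\<S> b \<cdot> y)) (x \<cdot> k)"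
      using x y k by (intro eH_br) auto
    also have "\<dots> = ?sw (\<lambda>a b. ?sw (\<lambda>u v. br (a \<cdot> u) \<otimes>\<^sub>\<H> br (\<S> (b \<cdot> v) \<cdot> y)) k) x"
      using x y k by (intro sw_mult[OF Hp_module]) (auto intro!: linear_intros)
    also have "\<dots> = ?sw (\<lambda>a b. ?sw (\<lambda>u v. \<Phi> a (\<S> b \<cdot> y) u v) k) x"
      using x y k cl by (intro sw_cong[OF Hp_ag] sw_closed[OF Hp_ag])
        (auto simp: \<Phi>_def antipode_mult m_assoc)
    finally show "eH (x \<cdot> k) \<otimes>\<^sub>\<H> br y = \<dots>" .
  qed (use k in \<open>auto intro!: sw_closed[OF Hp_ag] cl\<close>)
  also have "\<dots> = ?sw (\<lambda>x y. ?sw (\<lambda>a b. ?sw (\<lambda>u v. \<Phi> x (\<S> a \<cdot> b) u v) k) y) h"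
    unfolding \<Phi>_def using k by (intro sw_coassoc[OF Hp_module h]) (auto intro!: linear_intros Hp_module)
  also have "\<dots> = ?sw (\<lambda>u v. \<Phi> h \<one>\<^sub>H u v) k"
    unfolding \<Phi>_def using k
    by (intro sw3_antipode_left[OF Hp_module h, where
          f="\<lambda>x w. ?sw (\<lambda>u v. br (x \<cdot> u) \<otimes>\<^sub>\<H> br (\<S> v \<cdot> w)) k"])
      (auto intro!: linear_intros Hp_module)
  also have "\<dots> = ?sw (\<lambda>x y. br (h \<cdot> x) \<otimes>\<^sub>\<H> br (\<S> y)) k"
    unfolding \<Phi>_def using h k by (intro sw_cong[OF Hp_ag]) auto
  also have "\<dots> = br h \<otimes>\<^sub>\<H> eH k"
    unfolding br_relation1[OF h k, symmetric] hpar_e_def using h k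
    by (intro sw_linear_map[OF linear_Hp_right[OF _ linear_map_id] Hp_module Hp_module, symmetric]) auto
  finally show ?thesis ..
qed

end

context cocommutative_hopf_algebra
begin

text \<open>
  The previous identity for \<open>k = 1\<close>, where \<open>e\<^sub>1 = 1\<close>, with the two factors of \<open>h\<close> exchanged.
\<close>

lemma eH_br_sum:
  assumes h: "h : H"
  shows "sw \<H> (\<lambda>x y. eH y \<otimes>\<^sub>\<H> br x) h = br h"
proof -
  have e1: "eH \<one>\<^sub>H = \<one>\<^sub>\<H>"
    unfolding hpar_e_def
    by (subst sw_one[OF Hp_module]) (auto intro!: linear_intros simp: br_one antipode_one)
  have "sw \<H> (\<lambda>x y. eH y \<otimes>\<^sub>\<H> br x) h = sw \<H> (\<lambda>x y. eH x \<otimes>\<^sub>\<H> br y) h"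
    by (intro sw_cocomm[OF Hp_module h]) (auto intro!: linear_intros)
  also have "\<dots> = sw \<H> (\<lambda>x y. eH (x \<cdot> \<one>\<^sub>H) \<otimes>\<^sub>\<H> br y) h"
    by (intro sw_cong[OF Hp_ag h]) auto
  also have "\<dots> = br h" using br_eH[OF h one_closed] h by (simp add: e1)
  finally show ?thesis .
qed

subsection \<open>Universal property\<close>

definition partial_rep where
  "partial_rep E \<rho> \<longleftrightarrow> linear_map K H E \<rho> \<and> \<rho> \<one>\<^sub>H = \<one>\<^sub>E \<and>
    (\<forall>h\<in>carrier H. \<forall>k\<in>carrier H.
      sw E (\<lambda>x y. \<rho> h \<otimes>\<^sub>E (\<rho> x \<otimes>\<^sub>E \<rho> (\<S> y))) k =
      sw E (\<lambda>x y. \<rho> (h \<cdot> x) \<otimes>\<^sub>E \<rho> (\<S> y)) k \<and>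
      sw E (\<lambda>x y. \<rho> x \<otimes>\<^sub>E (\<rho> (\<S> y) \<otimes>\<^sub>E \<rho> k)) h =
      sw E (\<lambda>x y. \<rho> x \<otimes>\<^sub>E \<rho> (\<S> y \<cdot> k)) h)"

context
  fixes E :: "('a, 'e, 'w) module_scheme" and \<rho> :: "'c \<Rightarrow> 'e"
  assumes E: "unital_algebra K E" and \<rho>: "partial_rep E \<rho>"
begin

interpretation E: unital_algebra K E by (rule E)

lemma \<rho>_linear: "linear_map K H E \<rho>" using \<rho> by (simp add: partial_rep_def)
lemma \<rho>_closed [simp]: "h : H ==> \<rho> h : E" by (rule linear_mapD(1)[OF \<rho>_linear])

lemma TA_val_word: "w \<in> lists (carrier H) ==>
    TA_val E \<rho> (tw w) = foldr (\<lambda>h e. \<rho> h \<otimes>\<^sub>E e) w \<one>\<^sub>E"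
  using HW.word_val_closed[OF E \<rho>_linear]
  by (simp add: HW.tensor_word_eq HW.TA_val_coset[OF E \<rho>_linear] HW.words_val_of[OF E \<rho>_linear]
      word_val_def HW.W_of_closed)

lemma TA_val_sw:
  assumes "h : H" "\<And>x y. [|x : H; y : H|] ==> w x y \<in> lists (carrier H)"
  shows "TA_val E \<rho> (sw TH (\<lambda>x y. tw (w x y)) h) =
    sw E (\<lambda>x y. foldr (\<lambda>h e. \<rho> h \<otimes>\<^sub>E e) (w x y) \<one>\<^sub>E) h"
proof -
  interpret v: ring_hom_ring TH E "TA_val E \<rho>" by (rule HW.TA_val_hom[OF E \<rho>_linear])
  have word: "foldr (\<lambda>h e. \<rho> h \<otimes>\<^sub>E e) w \<one>\<^sub>E : E" if "w \<in> lists (carrier H)" for w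
    using that by (induction w) auto
  have "TA_val E \<rho> (sw TH (\<lambda>x y. tw (w x y)) h) =
    sw E (\<lambda>x y. TA_val E \<rho> (tw (w x y))) h"
    using assms by (intro sw_map additive_mapI v.hom_closed v.hom_add TH_ag E.abelian_group_axioms tensor_word_closed) auto
  also have "\<dots> = sw E (\<lambda>x y. foldr (\<lambda>h e. \<rho> h \<otimes>\<^sub>E e) (w x y) \<one>\<^sub>E) h"
    using assms(2) word by (intro sw_cong[OF E.abelian_group_axioms assms(1)])
      (auto simp: TA_val_word simp del: in_lists_conv_set)
  finally show ?thesis .
qed

text \<open>
  The last two relations are the first two at \<open>\<S>(k)\<close> and at \<open>\<S>(h)\<close>: the coproduct of \<open>\<S>(k)\<close> is
  \<open>\<S>(k\<^sub>1) \<otimes> \<S>(k\<^sub>2)\<close>, and \<open>\<S> \<circ> \<S>\<close> is the identity.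
\<close>

lemma \<rho>_relations:
  assumes h: "h : H" and k: "k : H"
  shows "sw E (\<lambda>x y. \<rho> h \<otimes>\<^sub>E (\<rho> x \<otimes>\<^sub>E \<rho> (\<S> y))) k =
      sw E (\<lambda>x y. \<rho> (h \<cdot> x) \<otimes>\<^sub>E \<rho> (\<S> y)) k" (is ?r1)
    and "sw E (\<lambda>x y. \<rho> x \<otimes>\<^sub>E (\<rho> (\<S> y) \<otimes>\<^sub>E \<rho> k)) h =
      sw E (\<lambda>x y. \<rho> x \<otimes>\<^sub>E \<rho> (\<S> y \<cdot> k)) h" (is ?r2)
    and "sw E (\<lambda>x y. \<rho> h \<otimes>\<^sub>E (\<rho> (\<S> x) \<otimes>\<^sub>E \<rho> y)) k =
      sw E (\<lambda>x y. \<rho> (h \<cdot> \<S> x) \<otimes>\<^sub>E \<rho> y) k" (is ?r3)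
    and "sw E (\<lambda>x y. \<rho> (\<S> x) \<otimes>\<^sub>E (\<rho> y \<otimes>\<^sub>E \<rho> k)) h =
      sw E (\<lambda>x y. \<rho> (\<S> x) \<otimes>\<^sub>E \<rho> (y \<cdot> k)) h" (is ?r4)
proof -
  have 1: "\<And>h k. [|h : H; k : H|] ==>
      sw E (\<lambda>x y. \<rho> h \<otimes>\<^sub>E (\<rho> x \<otimes>\<^sub>E \<rho> (\<S> y))) k =
      sw E (\<lambda>x y. \<rho> (h \<cdot> x) \<otimes>\<^sub>E \<rho> (\<S> y)) k"
    and 2: "\<And>h k. [|h : H; k : H|] ==>
      sw E (\<lambda>x y. \<rho> x \<otimes>\<^sub>E (\<rho> (\<S> y) \<otimes>\<^sub>E \<rho> k)) h =
      sw E (\<lambda>x y. \<rho> x \<otimes>\<^sub>E \<rho> (\<S> y \<cdot> k)) h"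
    using \<rho> unfolding partial_rep_def by blast+
  note Em = unital_algebra_module[OF E]
  have \<rho>l: "linear_map K D E (\<lambda>x. \<rho> (f x))" if "linear_map K D H f" for D f
    by (rule linear_map_comp[OF \<rho>_linear that])
  note li = linear_intros \<rho>l linear_mult_left[OF E] linear_mult_right[OF E]
  show ?r1 ?r2
    by (fact 1[OF h k] 2[OF h k])+
  have "sw E (\<lambda>x y. \<rho> h \<otimes>\<^sub>E (\<rho> (\<S> x) \<otimes>\<^sub>E \<rho> y)) k =
    sw E (\<lambda>x y. \<rho> h \<otimes>\<^sub>E (\<rho> (\<S> x) \<otimes>\<^sub>E \<rho> (\<S> (\<S> y)))) k"
    using h by (intro sw_cong[OF E.abelian_group_axioms k]) (auto simp: antipode_antipode)
  also have "\<dots> = sw E (\<lambda>x y. \<rho> h \<otimes>\<^sub>E (\<rho> x \<otimes>\<^sub>E \<rho> (\<S> y))) (\<S> k)"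
    using h by (intro sw_antipode[OF Em k, symmetric]) (auto intro!: li)
  also have "\<dots> = sw E (\<lambda>x y. \<rho> (h \<cdot> x) \<otimes>\<^sub>E \<rho> (\<S> y)) (\<S> k)"
    using h k by (simp add: 1)
  also have "\<dots> = sw E (\<lambda>x y. \<rho> (h \<cdot> \<S> x) \<otimes>\<^sub>E \<rho> (\<S> (\<S> y))) k"
    using h by (intro sw_antipode[OF Em k]) (auto intro!: li)
  also have "\<dots> = sw E (\<lambda>x y. \<rho> (h \<cdot> \<S> x) \<otimes>\<^sub>E \<rho> y) k"
    using h by (intro sw_cong[OF E.abelian_group_axioms k]) (auto simp: antipode_antipode)
  finally show ?r3 .
  have "sw E (\<lambda>x y. \<rho> (\<S> x) \<otimes>\<^sub>E (\<rho> y \<otimes>\<^sub>E \<rho> k)) h =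
    sw E (\<lambda>x y. \<rho> (\<S> x) \<otimes>\<^sub>E (\<rho> (\<S> (\<S> y)) \<otimes>\<^sub>E \<rho> k)) h"
    using k by (intro sw_cong[OF E.abelian_group_axioms h]) (auto simp: antipode_antipode)
  also have "\<dots> = sw E (\<lambda>x y. \<rho> x \<otimes>\<^sub>E (\<rho> (\<S> y) \<otimes>\<^sub>E \<rho> k)) (\<S> h)"
    using k by (intro sw_antipode[OF Em h, symmetric]) (auto intro!: li)
  also have "\<dots> = sw E (\<lambda>x y. \<rho> x \<otimes>\<^sub>E \<rho> (\<S> y \<cdot> k)) (\<S> h)"
    using h k by (simp add: 2)
  also have "\<dots> = sw E (\<lambda>x y. \<rho> (\<S> x) \<otimes>\<^sub>E \<rho> (\<S> (\<S> y) \<cdot> k)) h"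
    using k by (intro sw_antipode[OF Em h]) (auto intro!: li)
  also have "\<dots> = sw E (\<lambda>x y. \<rho> (\<S> x) \<otimes>\<^sub>E \<rho> (y \<cdot> k)) h"
    using k by (intro sw_cong[OF E.abelian_group_axioms h]) (auto simp: antipode_antipode)
  finally show ?r4 .
qed

lemma TA_val_relation: "r \<in> hpar_relations K H ==> TA_val E \<rho> r = \<zero>\<^sub>E"
proof -
  interpret v: ring_hom_ring TH E "TA_val E \<rho>" by (rule HW.TA_val_hom[OF E \<rho>_linear])
  let ?v = "TA_val E \<rho>" and ?\<tau> = tw
  have diff: "?v (a \<ominus>\<^bsub>TH\<^esub> b) = \<zero>\<^sub>E" if "a : TH" "b : TH" "?v a = ?v b" for a b
    using that by (simp add: a_minus_def E.r_neg)
  have sum_eq: "?v (sw TH (\<lambda>x y. ?\<tau> (w x y)) h \<ominus>\<^bsub>TH\<^esub> sw TH (\<lambda>x y. ?\<tau> (w' x y)) h) = \<zero>\<^sub>E"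
    if h: "h : H"
      and w: "\<And>x y. [|x : H; y : H|] ==> w x y \<in> lists (carrier H)"
      and w': "\<And>x y. [|x : H; y : H|] ==> w' x y \<in> lists (carrier H)"
      and f: "\<And>x y. [|x : H; y : H|] ==> foldr (\<lambda>h e. \<rho> h \<otimes>\<^sub>E e) (w x y) \<one>\<^sub>E = f x y"
      and f': "\<And>x y. [|x : H; y : H|] ==> foldr (\<lambda>h e. \<rho> h \<otimes>\<^sub>E e) (w' x y) \<one>\<^sub>E = f' x y"
      and e: "sw E f h = sw E f' h" for h w w' f f'
  proof -
    have word: "foldr (\<lambda>h e. \<rho> h \<otimes>\<^sub>E e) w \<one>\<^sub>E : E" if "w \<in> lists (carrier H)" for w
      using that by (induction w) auto
    have "sw E (\<lambda>x y. foldr (\<lambda>h e. \<rho> h \<otimes>\<^sub>E e) (w x y) \<one>\<^sub>E) h = sw E f h"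
      using word[OF w] by (intro sw_cong[OF E.abelian_group_axioms h]) (simp_all add: f)
    moreover have "sw E (\<lambda>x y. foldr (\<lambda>h e. \<rho> h \<otimes>\<^sub>E e) (w' x y) \<one>\<^sub>E) h = sw E f' h"
      using word[OF w'] by (intro sw_cong[OF E.abelian_group_axioms h]) (simp_all add: f')
    ultimately show ?thesis
      using e by (intro diff sw_closed[OF TH_ag h] tensor_word_closed R.one_closed w w')
        (simp_all add: TA_val_sw[OF h w] TA_val_sw[OF h w'] )
  qed
  have 0: "?v (?\<tau> [\<one>\<^sub>H] \<ominus>\<^bsub>TH\<^esub> \<one>\<^bsub>TH\<^esub>) = \<zero>\<^sub>E"
  proof (rule diff)
    show "?v (?\<tau> [\<one>\<^sub>H]) = ?v \<one>\<^bsub>TH\<^esub>"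
      using \<rho> by (simp add: TA_val_word partial_rep_def)
  qed (auto intro: tensor_word_closed)
  have 1: "?v (sw TH (\<lambda>x y. ?\<tau> [h, x, \<S> y]) k \<ominus>\<^bsub>TH\<^esub> sw TH (\<lambda>x y. ?\<tau> [h \<cdot> x, \<S> y]) k) = \<zero>\<^sub>E"
    if "h : H" "k : H" for h k
    by (rule sum_eq[OF _ _ _ _ _ \<rho>_relations(1)[OF that]]) (use that in auto)
  have 2: "?v (sw TH (\<lambda>x y. ?\<tau> [x, \<S> y, k]) h \<ominus>\<^bsub>TH\<^esub> sw TH (\<lambda>x y. ?\<tau> [x, \<S> y \<cdot> k]) h) = \<zero>\<^sub>E"
    if "h : H" "k : H" for h k
    by (rule sum_eq[OF _ _ _ _ _ \<rho>_relations(2)[OF that]]) (use that in auto)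
  have 3: "?v (sw TH (\<lambda>x y. ?\<tau> [h, \<S> x, y]) k \<ominus>\<^bsub>TH\<^esub> sw TH (\<lambda>x y. ?\<tau> [h \<cdot> \<S> x, y]) k) = \<zero>\<^sub>E"
    if "h : H" "k : H" for h k
    by (rule sum_eq[OF _ _ _ _ _ \<rho>_relations(3)[OF that]]) (use that in auto)
  have 4: "?v (sw TH (\<lambda>x y. ?\<tau> [\<S> x, y, k]) h \<ominus>\<^bsub>TH\<^esub> sw TH (\<lambda>x y. ?\<tau> [\<S> x, y \<cdot> k]) h) = \<zero>\<^sub>E"
    if "h : H" "k : H" for h k
    by (rule sum_eq[OF _ _ _ _ _ \<rho>_relations(4)[OF that]]) (use that in auto)
  assume "r \<in> hpar_relations K H"
  then show "?v r = \<zero>\<^sub>E"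
    unfolding hpar_relations_def Let_def
    by (elim UnE UN_E insertE emptyE) (simp_all only: 0 1 2 3 4)
qed

lemma J2_kernel: "J2 \<subseteq> a_kernel TH E (TA_val E \<rho>)"
  by (rule genideal_kernel[OF HW.TA_val_hom[OF E \<rho>_linear]])
    (use TA_val_relation hpar_relations_closed in blast)

lemmas Hp_quotient = quotient_map[OF HW.TA_val_hom[OF E \<rho>_linear] J2_ideal J2_kernel, folded Hp_val_def]

lemma Hp_val_hom: "Hp_val E \<rho> \<in> ring_hom \<H> E"
  using Hp_quotient(1) by (simp add: ring_hom_def Hp_simps Hp_val_def[abs_def])

lemma Hp_val_cls: "c : WH ==> Hp_val E \<rho> (cls c) = words_val E \<rho> c"
  using Hp_quotient(2)[of "J1 +>\<^bsub>WH\<^esub> c"] ring_hom_closed[OF HW.W_TA_hom]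
  by (simp add: cls_def hpar_class_def HW.TA_val_coset[OF E \<rho>_linear])

lemma Hp_val_br: "h : H ==> Hp_val E \<rho> (br h) = \<rho> h"
  by (simp add: bracket_cls Hp_val_cls HW.W_of_closed HW.words_val_of[OF E \<rho>_linear]
      HW.word_val_simps[OF E \<rho>_linear])

lemma Hp_val_smult:
  assumes k: "k : K" and t: "t : \<H>"
  shows "Hp_val E \<rho> (k \<odot>\<^sub>\<H> t) = k \<odot>\<^sub>E Hp_val E \<rho> t"
proof -
  have "Hp_val E \<rho> (scal k) = k \<odot>\<^sub>E \<one>\<^sub>E"
    using k by (simp add: scal_def Hp_val_cls HW.W_of_closed HW.words_val_of[OF E \<rho>_linear]
      HW.word_val_simps[OF E \<rho>_linear])
  then show ?thesis
    using k t ring_hom_closed[OF scal_hom k] ring_hom_closed[OF Hp_val_hom t]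
    by (simp add: Hp_smult ring_hom_mult[OF Hp_val_hom] E.smult_mult_left)
qed

lemma Hp_val_rep:
  assumes t: "t : \<H>"
  shows "(SOME c. c \<in> \<Union>t) : WH" "Hp_val E \<rho> t = words_val E \<rho> (SOME c. c \<in> \<Union>t)"
proof -
  have t': "t : QH" using t by (simp add: Hp_simps)
  have rep: "c : WH \<and> Hp_val E \<rho> t = words_val E \<rho> c" if c: "c \<in> \<Union>t" for c
  proof -
    obtain s where s: "s \<in> t" "c \<in> s" using c by blast
    then show ?thesis using Hp_quotient(3)[OF t' s(1)] HW.TA_val_rep[OF E \<rho>_linear _ s(2)] by simp
  qed
  obtain s where s: "s \<in> t" using Hp_quotient(4)[OF t'] by blast
  then have "s : TH" using Hp_quotient(3)[OF t' s] by simp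
  then obtain c where "c \<in> s" using HW.TA_rep[OF E \<rho>_linear] by blast
  then have "(SOME c. c \<in> \<Union>t) \<in> \<Union>t" using s by (intro someI[of "\<lambda>c. c \<in> \<Union>t"]) blast
  from rep[OF this] show "(SOME c. c \<in> \<Union>t) : WH" "Hp_val E \<rho> t = words_val E \<rho> (SOME c. c \<in> \<Union>t)"
    by auto
qed

end

end

section \<open>Modules of functions\<close>

lemma pointwise_module:
  fixes F :: "('k, 'd \<Rightarrow> 'p, 'v) module_scheme"
  assumes P: "module K P"
    and ext: "carrier F \<subseteq> extensional D" and val: "\<And>f x. [|f : F; x \<in> D|] ==> f x : P"
    and zero: "zero F = (\<lambda>x\<in>D. \<zero>\<^sub>P)" and add: "\<And>f g. f \<oplus>\<^sub>F g = (\<lambda>x\<in>D. f x \<oplus>\<^sub>P g x)"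
    and smult: "\<And>k f. [|k : K; f : F|] ==> k \<odot>\<^sub>F f = (\<lambda>x\<in>D. k \<odot>\<^sub>P f x)"
    and zero_closed: "zero F : F"
    and add_closed: "\<And>f g. [|f : F; g : F|] ==> f \<oplus>\<^sub>F g : F"
    and smult_closed: "\<And>k f. [|k : K; f : F|] ==> k \<odot>\<^sub>F f : F"
  shows "module K F"
proof -
  interpret P: module K P by fact
  have eqI: "f = g" if "f : F" "g : F" "\<And>x. x \<in> D ==> f x = g x" for f g
    using extensionalityI[of f D g] that ext by blast
  note cl = zero_closed add_closed smult_closed
  have ap: "\<And>x. x \<in> D ==> (zero F) x = \<zero>\<^sub>P" "\<And>f g x. x \<in> D ==> (f \<oplus>\<^sub>F g) x = f x \<oplus>\<^sub>P g x"
    "\<And>k f x. [|k : K; f : F; x \<in> D|] ==> (k \<odot>\<^sub>F f) x = k \<odot>\<^sub>P f x"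
    by (simp_all add: zero add smult)
  have "abelian_group F"
  proof (rule abelian_groupI)
    fix f assume f: "f : F"
    show "\<exists>g\<in>carrier F. g \<oplus>\<^sub>F f = \<zero>\<^sub>F"
    proof (rule bexI)
      show "((\<ominus>\<^sub>K \<one>\<^sub>K) \<odot>\<^sub>F f) \<oplus>\<^sub>F f = \<zero>\<^sub>F"
        by (rule eqI) (use f in \<open>auto intro!: cl simp: ap val P.smult_l_minus P.M.l_neg\<close>)
    qed (use f in \<open>auto intro: cl\<close>)
  next
    fix f g h assume fgh: "f : F" "g : F" "h : F"
    show "f \<oplus>\<^sub>F g \<oplus>\<^sub>F h = f \<oplus>\<^sub>F (g \<oplus>\<^sub>F h)"
      by (rule eqI) (use fgh in \<open>auto intro!: cl simp: ap val P.M.a_assoc\<close>)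
  next
    fix f g assume fg: "f : F" "g : F"
    show "f \<oplus>\<^sub>F g = g \<oplus>\<^sub>F f"
      by (rule eqI) (use fg in \<open>auto intro!: cl simp: ap val P.M.a_comm\<close>)
  next
    fix f assume f: "f : F"
    show "\<zero>\<^sub>F \<oplus>\<^sub>F f = f"
      by (rule eqI) (use f in \<open>auto intro!: cl simp: ap val\<close>)
  qed (auto intro: cl)
  then show ?thesis
    by (rule moduleI[OF P.R.is_cring])
      ((rule smult_closed; assumption),
       (rule eqI; auto intro!: cl simp: ap val cl P.smult_l_distr P.smult_r_distr P.smult_assoc1)+)
qed

text \<open>
  A module over \<open>H\<^sub>p\<^sub>a\<^sub>r\<close> is obtained from an algebra map into these endomorphisms.
\<close>

definition end_alg :: "('k, 's) ring_scheme \<Rightarrow> ('k, 'p, 't) module_scheme \<Rightarrow> ('k, 'p \<Rightarrow> 'p) module"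
  where "end_alg K P =
    \<lparr>carrier = mod_hom K P P, mult = (\<lambda>f g. \<lambda>p\<in>carrier P. f (g p)), one = (\<lambda>p\<in>carrier P. p),
     zero = (\<lambda>p\<in>carrier P. \<zero>\<^sub>P), add = (\<lambda>f g. \<lambda>p\<in>carrier P. f p \<oplus>\<^sub>P g p),
     smult = (\<lambda>k f. \<lambda>p\<in>carrier P. k \<odot>\<^sub>P f p)\<rparr>"

lemma end_alg_simps [simp]:
  "carrier (end_alg K P) = mod_hom K P P" "f \<otimes>\<^bsub>end_alg K P\<^esub> g = (\<lambda>p\<in>carrier P. f (g p))"
  "one (end_alg K P) = (\<lambda>p\<in>carrier P. p)" "zero (end_alg K P) = (\<lambda>p\<in>carrier P. \<zero>\<^sub>P)"
  "f \<oplus>\<^bsub>end_alg K P\<^esub> g = (\<lambda>p\<in>carrier P. f p \<oplus>\<^sub>P g p)"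
  "k \<odot>\<^bsub>end_alg K P\<^esub> f = (\<lambda>p\<in>carrier P. k \<odot>\<^sub>P f p)"
  by (simp_all add: end_alg_def)

lemma mod_homI:
  "[|f \<in> extensional (carrier X); linear_map R X Y f|] ==> f \<in> mod_hom R X Y"
  by (simp add: mod_hom_def)

lemma mod_homD:
  assumes "f \<in> mod_hom R X Y" shows "linear_map R X Y f" "f \<in> extensional (carrier X)"
  using assms by (simp_all add: mod_hom_def)

lemma mod_hom_restrictI:
  assumes "linear_map R X Y f" "\<And>x y. [|x : X; y : X|] ==> x \<oplus>\<^sub>X y : X"
    "\<And>r x. [|r : R; x : X|] ==> r \<odot>\<^sub>X x : X"
  shows "(\<lambda>x\<in>carrier X. f x) \<in> mod_hom R X Y"
  using assms linear_mapD[OF assms(1)] by (intro mod_homI linear_mapI) auto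

lemma mod_hom_eqI:
  assumes "f \<in> mod_hom R X Y" "g \<in> mod_hom R X Y" "\<And>x. x : X ==> f x = g x"
  shows "f = g"
  using assms by (intro extensionalityI[of f "carrier X" g]) (auto simp: mod_hom_def)

lemma end_alg_algebra:
  assumes P: "module K P" shows "unital_algebra K (end_alg K P)"
proof -
  interpret P: module K P by fact
  let ?E = "end_alg K P"
  have res: "(\<lambda>p\<in>carrier P. f p) \<in> mod_hom K P P" if "linear_map K P P f" for f
    by (rule mod_hom_restrictI[OF that]) auto
  have cl: "f \<in> mod_hom K P P ==> p : P ==> f p : P" for f p
    by (rule linear_mapD(1)[OF mod_homD(1)])
  have lz: "linear_map K P P (\<lambda>p. \<zero>\<^sub>P)" by (rule linear_mapI) auto
  note c = linear_map_comp[OF mod_homD(1) mod_homD(1)]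
  note a = sum_of_linear[OF P mod_homD(1) mod_homD(1)]
  note s = smult_linear[OF P _ mod_homD(1)]
  have m: "module K ?E"
  proof (rule pointwise_module[OF P, where D="carrier P"])
    show "carrier ?E \<subseteq> extensional (carrier P)" by (auto simp: mod_hom_def)
    show "\<zero>\<^bsub>?E\<^esub> : ?E" using res[OF lz] by simp
    show "f \<oplus>\<^bsub>?E\<^esub> g : ?E" if "f : ?E" "g : ?E" for f g
      using res[OF a] that by simp
    show "k \<odot>\<^bsub>?E\<^esub> f : ?E" if "k : K" "f : ?E" for k f
      using res[OF s] that by simp
  qed (simp_all add: cl)
  interpret E: module K ?E by (rule m)
  have mul: "(\<lambda>p\<in>carrier P. f (g p)) \<in> mod_hom K P P" if "f \<in> mod_hom K P P" "g \<in> mod_hom K P P" for f g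
    by (rule res[OF c[OF that]])
  have one: "(\<lambda>p\<in>carrier P. p) \<in> mod_hom K P P" by (rule res[OF linear_map_id])
  note lin = linear_mapD(2,3)[OF mod_homD(1)[where R=K and X=P and Y=P]]
  have r: "ring ?E"
  proof (rule ringI[OF E.abelian_group_axioms])
    show "monoid ?E"
    proof (rule monoidI)
      show "\<one>\<^bsub>?E\<^esub> \<otimes>\<^bsub>?E\<^esub> x = x" "x \<otimes>\<^bsub>?E\<^esub> \<one>\<^bsub>?E\<^esub> = x" if "x : ?E" for x
        using that extensional_restrict[OF mod_homD(2)[of x K P P]] by (simp_all add: cl cong: restrict_cong)
      show "x \<otimes>\<^bsub>?E\<^esub> y \<otimes>\<^bsub>?E\<^esub> z = x \<otimes>\<^bsub>?E\<^esub> (y \<otimes>\<^bsub>?E\<^esub> z)"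
        if "x : ?E" "y : ?E" "z : ?E" for x y z
        using that by (simp add: cl cong: restrict_cong)
    qed (simp_all add: mul one)
    show "(x \<oplus>\<^bsub>?E\<^esub> y) \<otimes>\<^bsub>?E\<^esub> z = x \<otimes>\<^bsub>?E\<^esub> z \<oplus>\<^bsub>?E\<^esub> y \<otimes>\<^bsub>?E\<^esub> z"
      "z \<otimes>\<^bsub>?E\<^esub> (x \<oplus>\<^bsub>?E\<^esub> y) = z \<otimes>\<^bsub>?E\<^esub> x \<oplus>\<^bsub>?E\<^esub> z \<otimes>\<^bsub>?E\<^esub> y"
      if "x : ?E" "y : ?E" "z : ?E" for x y z
      using that by (simp_all add: cl lin cong: restrict_cong)
  qed
  show ?thesis
    by (intro unital_algebra.intro m r unital_algebra_axioms.intro)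
      (simp_all add: cl lin cong: restrict_cong)
qed

lemma opp_simps [simp]:
  "carrier (opp R) = carrier R" "x \<otimes>\<^bsub>opp R\<^esub> y = y \<otimes>\<^sub>R x" "one (opp R) = one R" "add (opp R) = add R" "zero (opp R) = zero R"
  by (simp_all add: opp_def)

lemma opp_algebra:
  fixes E :: "('k, 'e, 'w) module_scheme"
  assumes E: "unital_algebra K E" shows "unital_algebra K (opp E)"
proof -
  interpret E: unital_algebra K E by fact
  have sm: "smult (opp E) = smult E" by (simp add: opp_def)
  have ag: "abelian_group (opp E)"
    by (rule abelian_group_cong_record[OF E.abelian_group_axioms]) simp_all
  have m: "module K (opp E)"
    by (rule moduleI[OF E.R.is_cring ag])
      (simp_all add: sm E.smult_l_distr E.smult_r_distr E.smult_assoc1)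
  have r: "ring (opp E)"
    by (rule ringI[OF ag]) (auto intro!: monoidI simp: E.m_assoc E.l_distr E.r_distr)
  show ?thesis
    by (intro unital_algebra.intro m r unital_algebra_axioms.intro)
      (simp_all add: sm E.smult_mult_left E.smult_mult_right)
qed

lemma opp_smult [simp]: "smult (opp E) = smult (E :: ('k, 'e, 'w) module_scheme)"
  by (simp add: opp_def)

lemma left_module_smult_linear:
  assumes "left_module R X" "r : R" shows "additive_map X X (\<lambda>x. r \<odot>\<^sub>X x)"
  using assms by (intro additive_mapI) (auto intro: left_module.smult_closed simp: left_module.smult_r_distr)

lemma restrict_K_module:
  assumes R: "unital_algebra K R" and X: "left_module R X"
  shows "module K (restrict_K R X)"
proof -
  interpret R: unital_algebra K R by fact
  interpret X: left_module R X by fact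
  have mm: "(a \<otimes>\<^sub>K b) \<odot>\<^sub>R \<one>\<^sub>R = (a \<odot>\<^sub>R \<one>\<^sub>R) \<otimes>\<^sub>R (b \<odot>\<^sub>R \<one>\<^sub>R)" if "a : K" "b : K" for a b
    using that by (simp add: R.smult_mult_left R.smult_assoc1)
  show ?thesis
    unfolding restrict_K_def
    by (rule moduleI[OF R.R.is_cring])
      (simp_all add: X.M.abelian_group_axioms X.smult_closed R.smult_l_distr X.smult_l_distr X.smult_r_distr mm X.smult_assoc X.smult_one)
qed

lemma restrict_K_simps [simp]:
  "carrier (restrict_K R X) = carrier X" "add (restrict_K R X) = add X" "zero (restrict_K R X) = zero X"
  "k \<odot>\<^bsub>restrict_K R X\<^esub> x = (k \<odot>\<^sub>R \<one>\<^sub>R) \<odot>\<^sub>X x"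
  by (simp_all add: restrict_K_def)

lemma hom_module_simps [simp]:
  "carrier (hom_module R X Y) = mod_hom R X Y" "zero (hom_module R X Y) = (\<lambda>x\<in>carrier X. \<zero>\<^sub>Y)"
  "f \<oplus>\<^bsub>hom_module R X Y\<^esub> g = (\<lambda>x\<in>carrier X. f x \<oplus>\<^sub>Y g x)"
  "k \<odot>\<^bsub>hom_module R X Y\<^esub> f = (\<lambda>x\<in>carrier X. (k \<odot>\<^sub>R \<one>\<^sub>R) \<odot>\<^sub>Y f x)"
  by (simp_all add: hom_module_def)

text \<open>
  Sums and multiples of homomorphisms are formed in the target, whose scalars therefore have to act
  \<open>K\<close>-linearly; of the source only the closedness of its operations enters.
\<close>

lemma hom_module_module:
  assumes Y: "module K (restrict_K R Y)"
    and Xadd: "\<And>x y. [|x : X; y : X|] ==> x \<oplus>\<^sub>X y : X"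
    and Xsmult: "\<And>r x. [|r : R; x : X|] ==> r \<odot>\<^sub>X x : X"
    and lin: "\<And>r. r : R ==> linear_map K (restrict_K R Y) (restrict_K R Y) (\<lambda>y. r \<odot>\<^sub>Y y)"
  shows "module K (hom_module R X Y)"
proof -
  interpret Y: module K "restrict_K R Y" by fact
  note l = linear_mapD[OF lin, simplified]
  have res: "(\<lambda>p\<in>carrier X. f p) \<in> mod_hom R X Y" if "linear_map R X Y f" for f
    by (rule mod_hom_restrictI[OF that Xadd Xsmult])
  note h = linear_mapD[OF mod_homD(1)]
  note acl = Y.a_closed[simplified] note aac = Y.M.a_ac[simplified] note sc = Y.smult_closed[simplified]
  note sr = Y.smult_r_distr[simplified]
  have z: "r \<odot>\<^sub>Y \<zero>\<^sub>Y = \<zero>\<^sub>Y" if "r : R" for r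
    using additive_map_zero[OF linear_map_additive[OF lin[OF that]] Y.abelian_group_axioms Y.abelian_group_axioms] by simp
  have "linear_map R X Y (\<lambda>p. \<zero>\<^sub>Y)"
    using Y.M.zero_closed by (intro linear_mapI) (auto simp: z Y.M.l_zero[simplified])
  note zero = res[OF this]
  have "linear_map R X Y (\<lambda>x. f x \<oplus>\<^sub>Y g x)" if "f \<in> mod_hom R X Y" "g \<in> mod_hom R X Y" for f g
    using h[OF that(1)] h[OF that(2)] by (intro linear_mapI) (auto simp: acl aac l)
  note add = res[OF this]
  have "linear_map R X Y (\<lambda>x. (k \<odot>\<^sub>R \<one>\<^sub>R) \<odot>\<^sub>Y f x)" if "k : K" "f \<in> mod_hom R X Y" for f k
    using h[OF that(2)] that(1) by (intro linear_mapI) (auto simp: sc sr l(3))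
  note smult = res[OF this]
  show ?thesis
  proof (rule pointwise_module[OF Y, where D="carrier X"])
    show "carrier (hom_module R X Y) \<subseteq> extensional (carrier X)" by (auto simp: mod_hom_def)
  qed (simp_all add: zero add smult h(1))
qed

section \<open>Modules over the algebra \<open>H\<^sub>p\<^sub>a\<^sub>r\<close>\<close>

lemma scalar_commute:
  assumes R: "unital_algebra K R" and "k : K" "r : R"
  shows "(k \<odot>\<^sub>R \<one>\<^sub>R) \<otimes>\<^sub>R r = k \<odot>\<^sub>R r" "r \<otimes>\<^sub>R (k \<odot>\<^sub>R \<one>\<^sub>R) = k \<odot>\<^sub>R r"
proof -
  interpret R: unital_algebra K R by fact
  show "(k \<odot>\<^sub>R \<one>\<^sub>R) \<otimes>\<^sub>R r = k \<odot>\<^sub>R r" "r \<otimes>\<^sub>R (k \<odot>\<^sub>R \<one>\<^sub>R) = k \<odot>\<^sub>R r"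
    using assms(2,3) by (simp_all add: R.smult_mult_left R.smult_mult_right)
qed

lemma linear_act_scalar:
  assumes R: "unital_algebra K R" and X: "left_module R X" and p: "p : X" and f: "linear_map K D R f"
  shows "linear_map K D (restrict_K R X) (\<lambda>x. f x \<odot>\<^sub>X p)"
proof -
  interpret R: unital_algebra K R by fact
  interpret X: left_module R X by fact
  have "linear_map K R (restrict_K R X) (\<lambda>r. r \<odot>\<^sub>X p)"
  proof (rule linear_mapI)
    fix k r assume "k : K" "r : R"
    then show "(k \<odot>\<^sub>R r) \<odot>\<^sub>X p = k \<odot>\<^bsub>restrict_K R X\<^esub> (r \<odot>\<^sub>X p)"
      using p by (simp add: X.smult_assoc[symmetric] scalar_commute[OF R])
  qed (use p in \<open>auto simp: X.smult_closed X.smult_l_distr\<close>)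
  from linear_map_comp[OF this f] show ?thesis .
qed

lemma linear_act_vector:
  assumes R: "unital_algebra K R" and X: "left_module R X" and r: "r : R"
    and f: "linear_map K D (restrict_K R X) f"
  shows "linear_map K D (restrict_K R X) (\<lambda>x. r \<odot>\<^sub>X f x)"
proof -
  interpret R: unital_algebra K R by fact
  interpret X: left_module R X by fact
  have "linear_map K (restrict_K R X) (restrict_K R X) (\<lambda>p. r \<odot>\<^sub>X p)"
  proof (rule linear_mapI)
    fix k p assume "k : K" "p : (restrict_K R X)"
    then show "r \<odot>\<^sub>X (k \<odot>\<^bsub>restrict_K R X\<^esub> p) = k \<odot>\<^bsub>restrict_K R X\<^esub> (r \<odot>\<^sub>X p)"
      using r by (simp add: X.smult_assoc[symmetric] scalar_commute[OF R])
  qed (use r in \<open>auto simp: X.smult_closed X.smult_r_distr\<close>)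
  from linear_map_comp[OF this f] show ?thesis .
qed

lemma sw_restrict_K [simp]: "sweedler H (restrict_K R X) f h = sweedler H X f h"
  by (simp add: restrict_K_def)

lemma hpar_eval_eq_frag_sum:
  "hpar_eval P f t = frag_sum P (\<lambda>m. fst m \<odot>\<^sub>P f (snd m)) (SOME c. c \<in> \<Union>t)"
  by (simp add: hpar_eval_def frag_sum_def Let_def)

context cocommutative_hopf_algebra
begin

text \<open>
  Both sides are sums over the words of one and the same representative of \<open>t\<close>.
\<close>

lemma hpar_eval_val:
  assumes E: "unital_algebra K E" and \<rho>: "partial_rep E \<rho>" and P: "abelian_group P"
    and ev: "additive_map E P ev"
    and evk: "\<And>k e. [|k : K; e : E|] ==> ev (k \<odot>\<^sub>E e) = k \<odot>\<^sub>P ev e"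
    and w: "\<And>w. w \<in> lists (carrier H) ==> ev (word_val E \<rho> w) = f w"
    and t: "t : \<H>"
  shows "hpar_eval P f t = ev (Hp_val E \<rho> t)"
proof -
  interpret E: unital_algebra K E by fact
  note rep = Hp_val_rep[OF E \<rho> t]
  note lin = \<rho>_linear[OF E \<rho>]
  let ?c = "SOME c. c \<in> \<Union>t"
  have keys: "Poly_Mapping.keys ?c \<subseteq> HW.WU" using rep(1) by (simp add: HW.W_simps)
  have term_cl: "fst m \<odot>\<^sub>E word_val E \<rho> (snd m) : E" if "m \<in> HW.WU" for m
    by (rule HW.word_term_closed[OF E lin that])
  have ev_term: "ev (fst m \<odot>\<^sub>E word_val E \<rho> (snd m)) = fst m \<odot>\<^sub>P f (snd m)" if "m \<in> HW.WU" for m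
    using that w[of "snd m"] evk[of "fst m" "word_val E \<rho> (snd m)"] HW.word_val_closed[OF E lin, of "snd m"]
    by (simp add: mem_Times_iff)
  have "ev (Hp_val E \<rho> t) = ev (frag_sum E (\<lambda>m. fst m \<odot>\<^sub>E word_val E \<rho> (snd m)) ?c)"
    by (simp add: rep(2) words_val_def)
  also have "\<dots> = frag_sum P (\<lambda>m. ev (fst m \<odot>\<^sub>E word_val E \<rho> (snd m))) ?c"
    by (rule E.frag_sum_map[OF ev P term_cl keys])
  also have "\<dots> = frag_sum P (\<lambda>m. fst m \<odot>\<^sub>P f (snd m)) ?c"
    by (rule abelian_group.frag_sum_cong[OF P, where U=HW.WU])
      (use ev_term keys additive_mapD(1)[OF ev term_cl] in \<open>simp_all del: mem_Times_iff\<close>)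
  finally show ?thesis by (simp add: hpar_eval_eq_frag_sum)
qed

context
  fixes P :: "('a, 'p, 't) module_scheme" and g :: "'c \<Rightarrow> 'p \<Rightarrow> 'p"
  assumes P: "module K P"
    and g1: "\<And>h. h : H ==> linear_map K P P (g h)"
    and g2: "\<And>p. p : P ==> linear_map K H P (\<lambda>h. g h p)"
    and g_one: "\<And>p. p : P ==> g \<one>\<^sub>H p = p"
begin

interpretation P: module K P by (rule P)

abbreviation (input) "EP \<equiv> end_alg K P"
abbreviation (input) "gE \<equiv> \<lambda>h. \<lambda>p\<in>carrier P. g h p"

lemma g_closed: "[|h : H; p : P|] ==> g h p : P"
  by (rule linear_mapD(1)[OF g1])

lemma EP_algebra: "unital_algebra K EP" by (rule end_alg_algebra[OF P])
lemma EP_ag: "abelian_group EP" by (rule module_abelian_group[OF unital_algebra_module[OF EP_algebra]])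
lemma EP_val: "[|e \<in> mod_hom K P P; p : P|] ==> e p : P"
  by (rule linear_mapD(1)[OF mod_homD(1)])

lemma gE_closed: "h : H ==> gE h \<in> mod_hom K P P"
  by (rule mod_hom_restrictI[OF g1]) auto

lemma gE_linear: "linear_map K H EP gE"
  using linear_mapD[OF g2] by (intro linear_mapI) (auto simp: gE_closed intro!: restrict_ext)

lemma ev_additive: "p : P ==> additive_map EP P (\<lambda>e. e p)"
  by (rule additive_mapI) (simp_all add: EP_val)

lemma EP_sw:
  assumes h: "h : H" and p: "p : P"
    and F: "\<And>x y. [|x : H; y : H|] ==> F x y \<in> mod_hom K P P"
  shows "sw EP F h p = sw P (\<lambda>x y. F x y p) h"
  using sw_map[OF ev_additive[OF p] EP_ag P.abelian_group_axioms h, of F] F by simp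

lemma EP_mult_closed: "[|e \<in> mod_hom K P P; f \<in> mod_hom K P P|] ==> e \<otimes>\<^bsub>EP\<^esub> f \<in> mod_hom K P P"
  using ring.ring_simprules(5)[OF unital_algebra_ring[OF EP_algebra]] by simp

lemma EP_sw_eqI:
  assumes h: "h : H" 
    and F: "\<And>x y. [|x : H; y : H|] ==> F x y \<in> mod_hom K P P"
    and G: "\<And>x y. [|x : H; y : H|] ==> G x y \<in> mod_hom K P P"
    and eq: "\<And>p. p : P ==> sw P (\<lambda>x y. F x y p) h = sw P (\<lambda>x y. G x y p) h"
  shows "sw EP F h = sw EP G h"
proof (rule mod_hom_eqI)
  show "sw EP F h \<in> mod_hom K P P" "sw EP G h \<in> mod_hom K P P"
    using sw_closed[OF EP_ag h, of F] sw_closed[OF EP_ag h, of G] F G by auto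
  fix p assume "p : P"
  then show "sw EP F h p = sw EP G h p"
    using EP_sw[OF h _ F] EP_sw[OF h _ G] eq by simp
qed

lemma sw_opp: "sw (opp EP) F h = sw EP F h"
  by (rule sw_cong_record) simp_all

lemma gg_eqI:
  assumes h: "h : H"
    and F: "\<And>x y. [|x : H; y : H|] ==> F x y \<in> mod_hom K P P"
    and G: "\<And>x y. [|x : H; y : H|] ==> G x y \<in> mod_hom K P P"
    and F': "\<And>x y p. [|x : H; y : H; p : P|] ==> F x y p = F' x y p"
    and G': "\<And>x y p. [|x : H; y : H; p : P|] ==> G x y p = G' x y p"
    and eq: "\<And>p. p : P ==> sw P (\<lambda>x y. F' x y p) h = sw P (\<lambda>x y. G' x y p) h"
  shows "sw EP F h = sw EP G h"
proof (rule EP_sw_eqI[OF h F G])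
  fix p assume p: "p : P"
  have "sw P (\<lambda>x y. F x y p) h = sw P (\<lambda>x y. F' x y p) h"
    using F p EP_val by (intro sw_cong[OF P.abelian_group_axioms h]) (auto simp: F'[symmetric])
  moreover have "sw P (\<lambda>x y. G x y p) h = sw P (\<lambda>x y. G' x y p) h"
    using G p EP_val by (intro sw_cong[OF P.abelian_group_axioms h]) (auto simp: G'[symmetric])
  ultimately show "sw P (\<lambda>x y. F x y p) h = sw P (\<lambda>x y. G x y p) h"
    using eq[OF p] by simp
qed

lemma gE_partial_rep:
  assumes "partial_rep_on P g" shows "partial_rep EP gE"
  unfolding partial_rep_def
proof (intro conjI ballI)
  show "gE \<one>\<^sub>H = \<one>\<^bsub>EP\<^esub>" by (auto simp: g_one intro!: restrict_ext)
  fix h k assume hk: "h : H" "k : H"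
  show "sw EP (\<lambda>x y. gE h \<otimes>\<^bsub>EP\<^esub> (gE x \<otimes>\<^bsub>EP\<^esub> gE (\<S> y))) k =
      sw EP (\<lambda>x y. gE (h \<cdot> x) \<otimes>\<^bsub>EP\<^esub> gE (\<S> y)) k"
    by (rule gg_eqI[where F'="\<lambda>x y p. g h (g x (g (\<S> y) p))" and G'="\<lambda>x y p. g (h \<cdot> x) (g (\<S> y) p)"])
      (use hk assms in \<open>simp_all add: EP_mult_closed gE_closed g_closed partial_rep_on_def del: end_alg_simps(2)\<close>,
       simp_all add: g_closed hk)
  show "sw EP (\<lambda>x y. gE x \<otimes>\<^bsub>EP\<^esub> (gE (\<S> y) \<otimes>\<^bsub>EP\<^esub> gE k)) h =
      sw EP (\<lambda>x y. gE x \<otimes>\<^bsub>EP\<^esub> gE (\<S> y \<cdot> k)) h"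
    by (rule gg_eqI[where F'="\<lambda>x y p. g x (g (\<S> y) (g k p))" and G'="\<lambda>x y p. g x (g (\<S> y \<cdot> k) p)"])
      (use hk assms in \<open>simp_all add: EP_mult_closed gE_closed g_closed partial_rep_on_def del: end_alg_simps(2)\<close>,
       simp_all add: g_closed hk)
qed (rule gE_linear)

lemma gE_partial_antirep:
  assumes "partial_antirep_on P g" shows "partial_rep (opp EP) gE"
  unfolding partial_rep_def sw_opp
proof (intro conjI ballI)
  show "linear_map K H (opp EP) gE" using gE_linear by (simp add: linear_map_def)
  show "gE \<one>\<^sub>H = \<one>\<^bsub>opp EP\<^esub>" by (auto simp: g_one intro!: restrict_ext)
  fix h k assume hk: "h : H" "k : H"
  show "sw EP (\<lambda>x y. gE h \<otimes>\<^bsub>opp EP\<^esub> (gE x \<otimes>\<^bsub>opp EP\<^esub> gE (\<S> y))) k =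
      sw EP (\<lambda>x y. gE (h \<cdot> x) \<otimes>\<^bsub>opp EP\<^esub> gE (\<S> y)) k"
    by (rule gg_eqI[where F'="\<lambda>x y p. g (\<S> y) (g x (g h p))" and G'="\<lambda>x y p. g (\<S> y) (g (h \<cdot> x) p)"])
      (use hk assms in \<open>simp_all add: EP_mult_closed gE_closed g_closed partial_antirep_on_def del: end_alg_simps(2)\<close>,
       simp_all add: g_closed hk)
  show "sw EP (\<lambda>x y. gE x \<otimes>\<^bsub>opp EP\<^esub> (gE (\<S> y) \<otimes>\<^bsub>opp EP\<^esub> gE k)) h =
      sw EP (\<lambda>x y. gE x \<otimes>\<^bsub>opp EP\<^esub> gE (\<S> y \<cdot> k)) h"
    by (rule gg_eqI[where F'="\<lambda>x y p. g k (g (\<S> y) (g x p))" and G'="\<lambda>x y p. g (\<S> y \<cdot> k) (g x p)"])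
      (use hk assms in \<open>simp_all add: EP_mult_closed gE_closed g_closed partial_antirep_on_def del: end_alg_simps(2)\<close>,
       simp_all add: g_closed hk)
qed

lemma foldr_val:
  assumes p: "p : P" and w: "w \<in> lists (carrier H)"
  shows "word_val EP gE w p = foldr g w p \<and> foldr g w p : P"
  using w by (induction w) (use p in \<open>auto simp: word_val_def g_closed\<close>)

lemma fold_val:
  assumes w: "w \<in> lists (carrier H)" and p: "p : P"
  shows "word_val (opp EP) gE w p = fold g w p"
  using w p by (induction w arbitrary: p) (auto simp: word_val_def g_closed)

lemma left_smult_val:
  assumes g: "partial_rep_on P g" and t: "t : \<H>" and p: "p : P"
  shows "t \<odot>\<^bsub>hpar_left_module P g\<^esub> p = Hp_val EP gE t p"
proof -
  have "hpar_eval P (\<lambda>w. foldr g w p) t = (\<lambda>e. e p) (Hp_val EP gE t)"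
    by (rule hpar_eval_val[OF EP_algebra gE_partial_rep[OF g] P.abelian_group_axioms ev_additive[OF p]])
      (use p t foldr_val in auto)
  then show ?thesis by (simp add: hpar_left_module_def)
qed

lemma right_smult_val:
  assumes g: "partial_antirep_on P g" and t: "t : \<H>" and p: "p : P"
  shows "t \<odot>\<^bsub>hpar_right_module P g\<^esub> p = Hp_val (opp EP) gE t p"
proof -
  have ev: "additive_map (opp EP) P (\<lambda>e. e p)" using ev_additive[OF p] by (simp add: additive_map_def)
  have "hpar_eval P (\<lambda>w. fold g w p) t = (\<lambda>e. e p) (Hp_val (opp EP) gE t)"
    by (rule hpar_eval_val[OF opp_algebra[OF EP_algebra] gE_partial_antirep[OF g] P.abelian_group_axioms ev])
      (use p t fold_val in auto)
  then show ?thesis by (simp add: hpar_right_module_def)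
qed

lemma end_hom_module:
  fixes R :: "('r, 'q) ring_scheme" and M :: "('r, 'p) module"
  assumes R: "ring R" and v: "v \<in> ring_hom R EP"
    and sel: "carrier M = carrier P" "add M = add P" "zero M = zero P"
    and sv: "\<And>t p. [|t : R; p : P|] ==> t \<odot>\<^sub>M p = v t p"
  shows "left_module R M"
proof -
  have vc: "v t \<in> mod_hom K P P" if "t : R" for t using ring_hom_closed[OF v that] by simp
  have vp: "v t p : P" if "t : R" "p : P" for t p using EP_val[OF vc] that by blast
  have ag: "abelian_group M" by (rule abelian_group_cong_record[OF P.abelian_group_axioms]) (simp_all add: sel)
  interpret Q: ring R by (rule R)
  show ?thesis
  proof (rule left_module.intro[OF R ag], unfold_locales)
    fix r s x y assume r: "r : R" and s: "s : R" and "x : M"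
    then have x: "x : P" by (simp add: sel)
    show "r \<odot>\<^sub>M x : M" using r x by (simp add: sv sel vp)
    show "(r \<oplus>\<^sub>R s) \<odot>\<^sub>M x = r \<odot>\<^sub>M x \<oplus>\<^sub>M s \<odot>\<^sub>M x"
      using r s x by (simp add: sv sel ring_hom_add[OF v])
    show "(r \<otimes>\<^sub>R s) \<odot>\<^sub>M x = r \<odot>\<^sub>M (s \<odot>\<^sub>M x)"
      using r s x by (simp add: sv vp ring_hom_mult[OF v])
  next
    fix r x y assume "r : R" "x : M" "y : M"
    then show "r \<odot>\<^sub>M (x \<oplus>\<^sub>M y) = r \<odot>\<^sub>M x \<oplus>\<^sub>M r \<odot>\<^sub>M y"
      by (simp add: sv sel linear_mapD(2)[OF mod_homD(1)[OF vc]])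
  next
    fix x assume "x : M"
    then show "\<one>\<^sub>R \<odot>\<^sub>M x = x" by (simp add: sv sel ring_hom_one[OF v])
  qed
qed

lemma hpar_left_module:
  assumes g: "partial_rep_on P g"
  shows "left_module \<H> (hpar_left_module P g)"
    and "[|h : H; p : P|] ==> br h \<odot>\<^bsub>hpar_left_module P g\<^esub> p = g h p"
    and "[|k : K; p : P|] ==> sc k \<odot>\<^bsub>hpar_left_module P g\<^esub> p = k \<odot>\<^sub>P p"
proof -
  note sv = left_smult_val[OF g] and rep = EP_algebra gE_partial_rep[OF g]
  note hom = Hp_val_hom[OF rep]
  show "left_module \<H> (hpar_left_module P g)"
    by (rule end_hom_module[OF Hp_ring hom _ _ _ sv]) (simp_all add: hpar_left_module_def)
  show "br h \<odot>\<^bsub>hpar_left_module P g\<^esub> p = g h p" if "h : H" "p : P"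
    using that by (simp add: sv Hp_val_br[OF rep])
  show "sc k \<odot>\<^bsub>hpar_left_module P g\<^esub> p = k \<odot>\<^sub>P p" if "k : K" "p : P"
    using that by (simp add: sv Hp_val_smult[OF rep] ring_hom_one[OF hom] module.smult_closed[OF Hp_module])
qed

lemma hpar_right_module:
  assumes g: "partial_antirep_on P g"
  shows "left_module (opp \<H>) (hpar_right_module P g)"
    and "[|h : H; p : P|] ==> br h \<odot>\<^bsub>hpar_right_module P g\<^esub> p = g h p"
    and "[|k : K; p : P|] ==> sc k \<odot>\<^bsub>hpar_right_module P g\<^esub> p = k \<odot>\<^sub>P p"
proof -
  note sv = right_smult_val[OF g] and rep = opp_algebra[OF EP_algebra] gE_partial_antirep[OF g]
  note hom = Hp_val_hom[OF rep]
  have hom': "Hp_val (opp EP) gE \<in> ring_hom (opp \<H>) EP" using hom by (auto simp: ring_hom_def)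
  show "left_module (opp \<H>) (hpar_right_module P g)"
    by (rule end_hom_module[OF unital_algebra_ring[OF opp_algebra[OF Hp_algebra]] hom' _ _ _ sv])
      (simp_all add: hpar_right_module_def)
  show "br h \<odot>\<^bsub>hpar_right_module P g\<^esub> p = g h p" if "h : H" "p : P"
    using that by (simp add: sv Hp_val_br[OF rep])
  show "sc k \<odot>\<^bsub>hpar_right_module P g\<^esub> p = k \<odot>\<^sub>P p" if "k : K" "p : P"
    using that by (simp add: sv Hp_val_smult[OF rep] ring_hom_one[OF hom] module.smult_closed[OF Hp_module])
qed

end

end

context cocommutative_hopf_algebra
begin

lemma module_sw:
  assumes X: "left_module \<H> X" and h: "h : H" and p: "p : X"
    and F: "\<And>x y. [|x : H; y : H|] ==> F x y : \<H>"
  shows "(sw \<H> F h) \<odot>\<^sub>X p = sw X (\<lambda>x y. F x y \<odot>\<^sub>X p) h"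
  using sw_linear_map[OF linear_act_scalar[OF Hp_algebra X p linear_map_id] Hp_module
      restrict_K_module[OF Hp_algebra X] h F] by simp

text \<open>
  The antipode reverses products, \<open>\<S> \<circ> \<S>\<close> is the identity, and cocommutativity exchanges \<open>x\<close> and \<open>y\<close>; so each relation
  for the right action turns into the other relation of \<open>H\<^sub>p\<^sub>a\<^sub>r\<close> for the left action.
\<close>

lemma right_twist_antirep:
  assumes X: "left_module \<H> X"
  shows "partial_antirep_on (restrict_K \<H> X) (\<lambda>h x. br (\<S> h) \<odot>\<^sub>X x)"
proof -
  interpret X: left_module \<H> X by fact
  let ?P = "restrict_K \<H> X"
  have Pm: "module K ?P" by (rule restrict_K_module[OF Hp_algebra X])
  have Pag: "abelian_group X" by (rule X.M.abelian_group_axioms)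
  note li = linear_intros linear_act_scalar[OF Hp_algebra X] linear_act_vector[OF Hp_algebra X]
  have flip: "sw X (\<lambda>x y. F x y \<odot>\<^sub>X p) k = sw \<H> (\<lambda>x y. F y x) k \<odot>\<^sub>X p"
    if "p : X" "k : H" "\<And>x. x : H ==> linear_map K H \<H> (F x)"
      "\<And>y. y : H ==> linear_map K H \<H> (\<lambda>x. F x y)" for F p k
    using module_sw[OF X that(2,1), of F] linear_mapD(1)[OF that(3)] sw_cocomm[OF Hp_module that(2), of F] that(3,4)
    by simp
  show ?thesis
    unfolding partial_antirep_on_def
  proof (intro conjI ballI)
    fix h assume "h : H"
    then show "linear_map K ?P ?P (\<lambda>x. br (\<S> h) \<odot>\<^sub>X x)" by (auto intro!: linear_act_vector[OF Hp_algebra X] linear_map_id)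
  next
    fix p assume "p : ?P"
    then show "linear_map K H ?P (\<lambda>h. br (\<S> h) \<odot>\<^sub>X p)" by (auto intro!: linear_act_scalar[OF Hp_algebra X] linear_intros)
    show "br (\<S> \<one>\<^sub>H) \<odot>\<^sub>X p = p" using \<open>p : ?P\<close> by (simp add: antipode_one br_one X.smult_one)
  next
    fix h k p assume h: "h : H" and k: "k : H" and "p : ?P"
    then have p: "p : X" by simp
    have "sw X (\<lambda>x y. br (\<S> (\<S> y)) \<odot>\<^sub>X (br (\<S> x) \<odot>\<^sub>X (br (\<S> h) \<odot>\<^sub>X p))) k =
      sw X (\<lambda>x y. (br y \<otimes>\<^sub>\<H> (br (\<S> x) \<otimes>\<^sub>\<H> br (\<S> h))) \<odot>\<^sub>X p) k"
      using h p by (intro sw_cong[OF Pag k]) (auto simp: antipode_antipode X.smult_assoc intro!: X.smult_closed)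
    also have "\<dots> = sw \<H> (\<lambda>x y. br x \<otimes>\<^sub>\<H> (br (\<S> y) \<otimes>\<^sub>\<H> br (\<S> h))) k \<odot>\<^sub>X p"
      using h k p by (intro flip) (auto intro!: linear_intros)
    also have "\<dots> = sw \<H> (\<lambda>x y. br x \<otimes>\<^sub>\<H> br (\<S> y \<cdot> \<S> h)) k \<odot>\<^sub>X p"
      using h k by (simp add: br_relation2)
    also have "\<dots> = sw X (\<lambda>x y. (br y \<otimes>\<^sub>\<H> br (\<S> x \<cdot> \<S> h)) \<odot>\<^sub>X p) k"
      using h k p by (intro flip[symmetric]) (auto intro!: linear_intros)
    also have "\<dots> = sw X (\<lambda>x y. br (\<S> (\<S> y)) \<odot>\<^sub>X (br (\<S> (h \<cdot> x)) \<odot>\<^sub>X p)) k"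
      using h p by (intro sw_cong[OF Pag k]) (auto simp: antipode_antipode antipode_mult X.smult_assoc intro!: X.smult_closed)
    finally show "sw ?P (\<lambda>x y. br (\<S> (\<S> y)) \<odot>\<^sub>X (br (\<S> x) \<odot>\<^sub>X (br (\<S> h) \<odot>\<^sub>X p))) k =
      sw ?P (\<lambda>x y. br (\<S> (\<S> y)) \<odot>\<^sub>X (br (\<S> (h \<cdot> x)) \<odot>\<^sub>X p)) k" by simp
    have "sw X (\<lambda>x y. br (\<S> k) \<odot>\<^sub>X (br (\<S> (\<S> y)) \<odot>\<^sub>X (br (\<S> x) \<odot>\<^sub>X p))) h =
      sw X (\<lambda>x y. (br (\<S> k) \<otimes>\<^sub>\<H> (br y \<otimes>\<^sub>\<H> br (\<S> x))) \<odot>\<^sub>X p) h"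
      using k p by (intro sw_cong[OF Pag h]) (auto simp: antipode_antipode X.smult_assoc intro!: X.smult_closed)
    also have "\<dots> = sw \<H> (\<lambda>x y. br (\<S> k) \<otimes>\<^sub>\<H> (br x \<otimes>\<^sub>\<H> br (\<S> y))) h \<odot>\<^sub>X p"
      using h k p by (intro flip) (auto intro!: linear_intros)
    also have "\<dots> = sw \<H> (\<lambda>x y. br (\<S> k \<cdot> x) \<otimes>\<^sub>\<H> br (\<S> y)) h \<odot>\<^sub>X p"
      using h k by (simp add: br_relation1)
    also have "\<dots> = sw X (\<lambda>x y. (br (\<S> k \<cdot> y) \<otimes>\<^sub>\<H> br (\<S> x)) \<odot>\<^sub>X p) h"
      using h k p by (intro flip[symmetric]) (auto intro!: linear_intros)
    also have "\<dots> = sw X (\<lambda>x y. br (\<S> (\<S> y \<cdot> k)) \<odot>\<^sub>X (br (\<S> x) \<odot>\<^sub>X p)) h"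
      using k p by (intro sw_cong[OF Pag h]) (auto simp: antipode_antipode antipode_mult X.smult_assoc intro!: X.smult_closed)
    finally show "sw ?P (\<lambda>x y. br (\<S> k) \<odot>\<^sub>X (br (\<S> (\<S> y)) \<odot>\<^sub>X (br (\<S> x) \<odot>\<^sub>X p))) h =
      sw ?P (\<lambda>x y. br (\<S> (\<S> y \<cdot> k)) \<odot>\<^sub>X (br (\<S> x) \<odot>\<^sub>X p)) h" by simp
  qed
qed

lemma antirep_linear:
  assumes "partial_antirep_on P g"
  shows "\<And>h. h : H ==> linear_map K P P (g h)" "\<And>p. p : P ==> linear_map K H P (\<lambda>h. g h p)"
    "\<And>p. p : P ==> g \<one>\<^sub>H p = p"
  using assms by (simp_all add: partial_antirep_on_def)

lemma rep_linear:
  assumes "partial_rep_on P g"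
  shows "\<And>h. h : H ==> linear_map K P P (g h)" "\<And>p. p : P ==> linear_map K H P (\<lambda>h. g h p)"
    "\<And>p. p : P ==> g \<one>\<^sub>H p = p"
  using assms by (simp_all add: partial_rep_on_def)

lemma right_twist:
  assumes X: "left_module \<H> X"
  shows "left_module (opp \<H>) (right_twist K H X)"
    and "[|h : H; p : X|] ==> br h \<odot>\<^bsub>right_twist K H X\<^esub> p = br (\<S> h) \<odot>\<^sub>X p"
    and "[|k : K; p : X|] ==> (sc k) \<odot>\<^bsub>right_twist K H X\<^esub> p = (sc k) \<odot>\<^sub>X p"
  unfolding right_twist_def
  using hpar_right_module[OF restrict_K_module[OF Hp_algebra X] antirep_linear[OF right_twist_antirep[OF X]] right_twist_antirep[OF X]]
  by simp_all

lemma right_twist_simps [simp]: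
  "carrier (right_twist K H X) = carrier X" "add (right_twist K H X) = add X" "zero (right_twist K H X) = zero X"
  by (simp_all add: right_twist_def hpar_right_module_def)

text \<open>
  \<open>x \<cdot> [h\<^sub>1][\<S>(h\<^sub>2)] = [\<S>(\<S>(h\<^sub>2))][\<S>(h\<^sub>1)]x = [h\<^sub>2][\<S>(h\<^sub>1)]x\<close>, which is \<open>e\<^sub>h x\<close> by cocommutativity.
\<close>

lemma right_twist_eH:
  assumes X: "left_module \<H> X" and h: "h : H" and p: "p : X"
  shows "eH h \<odot>\<^bsub>right_twist K H X\<^esub> p = eH h \<odot>\<^sub>X p"
proof -
  interpret X: left_module \<H> X by fact
  interpret RT: left_module "opp \<H>" "right_twist K H X" by (rule right_twist(1)[OF X])
  have "additive_map \<H> X (\<lambda>r. r \<odot>\<^bsub>right_twist K H X\<^esub> p)"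
    using p RT.smult_closed RT.smult_l_distr by (intro additive_mapI) auto
  then have "eH h \<odot>\<^bsub>right_twist K H X\<^esub> p =
    sw X (\<lambda>x y. (br x \<otimes>\<^sub>\<H> br (\<S> y)) \<odot>\<^bsub>right_twist K H X\<^esub> p) h"
    unfolding hpar_e_def by (rule sw_map[OF _ Hp_ag X.M.abelian_group_axioms h]) auto
  also have "\<dots> = sw X (\<lambda>x y. (br y \<otimes>\<^sub>\<H> br (\<S> x)) \<odot>\<^sub>X p) h"
    using p RT.smult_assoc[of "br (\<S> _)" "br _" p]
    by (intro sw_cong[OF X.M.abelian_group_axioms h])
      (auto simp: right_twist(2)[OF X] X.smult_closed antipode_antipode X.smult_assoc)
  also have "\<dots> = sw X (\<lambda>x y. (br x \<otimes>\<^sub>\<H> br (\<S> y)) \<odot>\<^sub>X p) h"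
  proof -
    have "sw (restrict_K \<H> X) (\<lambda>x y. (br y \<otimes>\<^sub>\<H> br (\<S> x)) \<odot>\<^sub>X p) h =
      sw (restrict_K \<H> X) (\<lambda>x y. (br x \<otimes>\<^sub>\<H> br (\<S> y)) \<odot>\<^sub>X p) h"
      using p by (intro sw_cocomm[OF restrict_K_module[OF Hp_algebra X] h])
        (auto intro!: linear_intros linear_act_scalar[OF Hp_algebra X])
    then show ?thesis by simp
  qed
  also have "\<dots> = eH h \<odot>\<^sub>X p"
    unfolding hpar_e_def using h p by (intro module_sw[OF X, symmetric]) auto
  finally show ?thesis .
qed

end

context cocommutative_partial_action
begin

abbreviation "SP \<equiv> smash_par_module K H A act"

lemma \<pi>_partial_rep_on:
  shows "partial_rep_on S (\<lambda>h c. \<pi> h \<bullet> c)"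
    and "[|h : H; c : S|] ==>
      sw S (\<lambda>x y. \<pi> x \<bullet> (\<pi> (\<S> y) \<bullet> c)) h = \<delta> h \<bullet> c"
proof -
  have 1: "\<pi> h \<bullet> (\<delta> k \<bullet> p) = sw S (\<lambda>x y. \<delta> (x \<cdot> k) \<bullet> (\<pi> y \<bullet> p)) h"
    if "h : H" "k : H" "p : S" for h k p
  proof -
    have "\<pi> h \<bullet> (\<delta> k \<bullet> p) = (\<pi> h \<bullet> \<delta> k) \<bullet> p"
      using that by (simp add: SS.m_assoc)
    also have "\<dots> = sw S (\<lambda>x y. (\<delta> (x \<cdot> k) \<bullet> \<pi> y) \<bullet> p) h"
      unfolding \<pi>_\<iota>_act_one[OF that(1,2)] using that
      by (intro sw_linear_map[OF linear_S_left[OF _ linear_map_id] S_module S_module]) auto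
    also have "\<dots> = sw S (\<lambda>x y. \<delta> (x \<cdot> k) \<bullet> (\<pi> y \<bullet> p)) h"
      using that by (intro sw_cong[OF S_ag]) (auto simp: SS.m_assoc)
    finally show ?thesis .
  qed
  have 2: "\<pi> h \<bullet> (\<pi> k \<bullet> p) = sw S (\<lambda>x y. \<delta> x \<bullet> (\<pi> (y \<cdot> k) \<bullet> p)) h"
    if "h : H" "k : H" "p : S" for h k p
  proof -
    have "\<pi> h \<bullet> (\<pi> k \<bullet> p) = (\<pi> h \<bullet> \<pi> k) \<bullet> p"
      using that by (simp add: SS.m_assoc)
    also have "\<dots> = sw S (\<lambda>x y. (\<delta> x \<bullet> \<pi> (y \<cdot> k)) \<bullet> p) h"
      unfolding \<pi>_\<pi>[OF that(1,2)] using that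
      by (intro sw_linear_map[OF linear_S_left[OF _ linear_map_id] S_module S_module]) auto
    also have "\<dots> = sw S (\<lambda>x y. \<delta> x \<bullet> (\<pi> (y \<cdot> k) \<bullet> p)) h"
      using that by (intro sw_cong[OF S_ag]) (auto simp: SS.m_assoc)
    finally show ?thesis .
  qed
  note crit = partial_rep_criterion[OF S_module subset_refl, where \<rho>="\<lambda>h c. \<pi> h \<bullet> c" and c="\<lambda>h c. \<delta> h \<bullet> c"]
  show "sw S (\<lambda>x y. \<pi> x \<bullet> (\<pi> (\<S> y) \<bullet> c)) h = \<delta> h \<bullet> c"
    if "h : H" "c : S"
    by (rule crit(1)) (use that 1 2 in \<open>auto intro!: linear_intros simp: \<pi>_one\<close>)
  show "partial_rep_on S (\<lambda>h c. \<pi> h \<bullet> c)"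
    unfolding partial_rep_on_def
  proof (intro conjI ballI)
    fix h k p assume hkp: "h : H" "k : H" "p : S"
    show "sw S (\<lambda>x y. \<pi> h \<bullet> (\<pi> x \<bullet> (\<pi> (\<S> y) \<bullet> p))) k =
      sw S (\<lambda>x y. \<pi> (h \<cdot> x) \<bullet> (\<pi> (\<S> y) \<bullet> p)) k"
      by (rule crit(2)) (use hkp 1 2 in \<open>auto intro!: linear_intros simp: \<pi>_one\<close>)
    show "sw S (\<lambda>x y. \<pi> x \<bullet> (\<pi> (\<S> y) \<bullet> (\<pi> k \<bullet> p))) h =
      sw S (\<lambda>x y. \<pi> x \<bullet> (\<pi> (\<S> y \<cdot> k) \<bullet> p)) h"
      by (rule crit(3)) (use hkp 1 2 in \<open>auto intro!: linear_intros simp: \<pi>_one\<close>)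
  qed (auto intro!: linear_intros simp: \<pi>_one)
qed

lemma SP_eq: "SP = hpar_left_module S (\<lambda>h c. \<pi> h \<bullet> c)"
  by (simp add: smash_par_module_def S_mult_eq \<pi>_def)

lemma SP_module:
  shows "left_module \<H> SP"
    and "[|h : H; c : S|] ==> br h \<odot>\<^bsub>SP\<^esub> c = \<pi> h \<bullet> c"
    and "[|k : K; c : S|] ==> (sc k) \<odot>\<^bsub>SP\<^esub> c = k \<odot>\<^sub>S c"
  unfolding SP_eq
  using hpar_left_module[OF S_module rep_linear[OF \<pi>_partial_rep_on(1)] \<pi>_partial_rep_on(1)] by simp_all

lemma SP_simps [simp]: "carrier SP = carrier S" "add SP = add S" "zero SP = zero S"
  by (simp_all add: SP_eq hpar_left_module_def)

lemma SP_eH: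
  assumes h: "h : H" and c: "c : S"
  shows "eH h \<odot>\<^bsub>SP\<^esub> c = \<delta> h \<bullet> c"
proof -
  interpret SP: left_module \<H> SP by (rule SP_module)
  have "eH h \<odot>\<^bsub>SP\<^esub> c = sw SP (\<lambda>x y. (br x \<otimes>\<^sub>\<H> br (\<S> y)) \<odot>\<^bsub>SP\<^esub> c) h"
    unfolding hpar_e_def using c by (intro module_sw[OF SP_module(1) h]) auto
  also have "\<dots> = sw S (\<lambda>x y. (br x \<otimes>\<^sub>\<H> br (\<S> y)) \<odot>\<^bsub>SP\<^esub> c) h"
    by (rule sw_cong_record) simp_all
  also have "\<dots> = sw S (\<lambda>x y. \<pi> x \<bullet> (\<pi> (\<S> y) \<bullet> c)) h"
    using c by (intro sw_cong[OF S_ag h]) (auto simp: SP.smult_assoc SP_module(2))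
  finally show ?thesis using h c by (simp add: \<pi>_partial_rep_on(2))
qed

end

section \<open>Enveloping algebras\<close>

locale enveloping = unital_algebra K B
  for K :: "('k, 's) ring_scheme" (structure) and B :: "('k, 'b, 't) module_scheme" (structure)
begin

lemma B_module: "module K B" by (rule module_axioms)
lemma OB_algebra: "unital_algebra K (opp B)" by (rule opp_algebra[OF unital_algebra_axioms])
lemma OB_module: "module K (opp B)" by (rule unital_algebra_module[OF OB_algebra])

sublocale BB: module_pair K B "opp B"
  by (simp add: module_pair_def B_module OB_module)

abbreviation "eb \<equiv> pure_tensor K B (opp B)"
abbreviation "EB \<equiv> env K B"

lemma EB_simps: "carrier EB = carrier BB.T" "add EB = add BB.T" "zero EB = zero BB.T"
  "one EB = eb \<one>\<^sub>B \<one>\<^sub>B" "smult EB = smult BB.TK"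
  by (simp_all add: env_def tensor_alg_def)

lemma BT_ag: "abelian_group BB.T" by (rule BB.T_abelian)

lemma eb_closed: "[|a : B; b : B|] ==> eb a b : BB.T"
  by (rule BB.pure_closed) simp_all

lemma eb_add: "[|a : B; a' : B; b : B|] ==> eb (a \<oplus>\<^sub>B a') b = eb a b \<oplus>\<^bsub>BB.T\<^esub> eb a' b"
  "[|a : B; b : B; b' : B|] ==> eb a (b \<oplus>\<^sub>B b') = eb a b \<oplus>\<^bsub>BB.T\<^esub> eb a b'"
  using BB.pure_add_left BB.pure_add_right by auto

lemma eb_middle: "[|k : K; a : B; b : B|] ==> eb (k \<odot>\<^sub>B a) b = eb a (k \<odot>\<^sub>B b)"
  using BB.pure_middle by auto

lemma EB_scalar: "k : K ==> k \<odot>\<^bsub>EB\<^esub> \<one>\<^bsub>EB\<^esub> = eb (k \<odot>\<^sub>B \<one>\<^sub>B) \<one>\<^sub>B"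
  unfolding EB_simps by (rule BB.smult_pure) simp_all

lemma EB_mult:
  assumes "a : B" "b : B" "a' : B" "b' : B"
  shows "eb a b \<otimes>\<^bsub>EB\<^esub> eb a' b' = eb (a \<otimes>\<^sub>B a') (b' \<otimes>\<^sub>B b)"
proof -
  have ml: "middle_linear K B (opp B) BB.T (\<lambda>x y. eb (x \<otimes>\<^sub>B a') (b' \<otimes>\<^sub>B y))" if "a' : B" "b' : B" for a' b'
    using that by (intro middle_linearI additive_mapI)
      (auto simp: eb_add l_distr r_distr eb_middle smult_mult_left smult_mult_right)
  have ml': "middle_linear K B (opp B) BB.T (\<lambda>x y. eb (a \<otimes>\<^sub>B x) (y \<otimes>\<^sub>B b))" if "a : B" "b : B" for a b
    using that by (intro middle_linearI additive_mapI)
      (auto simp: eb_add l_distr r_distr eb_middle smult_mult_left smult_mult_right)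
  have rec: "tensor_lift BB.TK f t = tensor_lift BB.T f t" for f :: "'b \<Rightarrow> 'b \<Rightarrow> ('b, 'b) tensor" and t :: "('b, 'b) tensor"
    by (rule tensor_lift_cong_record) simp_all
  have "eb a b \<otimes>\<^bsub>EB\<^esub> eb a' b' = tensor_lift BB.T (\<lambda>a b. tensor_lift BB.T (\<lambda>a' b'.
      eb (a \<otimes>\<^sub>B a') (b' \<otimes>\<^sub>B b)) (eb a' b')) (eb a b)"
    by (simp add: env_def tensor_alg_def rec)
  also have "\<dots> = tensor_lift BB.T (\<lambda>a b. eb (a \<otimes>\<^sub>B a') (b' \<otimes>\<^sub>B b)) (eb a b)"
    by (rule BB.tensor_lift_cong[OF BT_ag])
      (use assms BB.tensor_lift_pure[OF BT_ag ml'] in \<open>auto intro!: eb_closed\<close>)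
  also have "\<dots> = eb (a \<otimes>\<^sub>B a') (b' \<otimes>\<^sub>B b)"
    by (rule BB.tensor_lift_pure[OF BT_ag ml]) (use assms in auto)
  finally show ?thesis .
qed

text \<open>
  The tensors \<open>a \<otimes> b\<close> generate the enveloping algebra additively.
\<close>

lemma env_linearI:
  assumes X: "abelian_group X" and Y: "abelian_group Y" and f: "additive_map X Y f"
    and sX: "\<And>x. x : X ==> additive_map BB.T X (\<lambda>r. r \<odot>\<^sub>X x)"
    and sY: "\<And>y. y : Y ==> additive_map BB.T Y (\<lambda>r. r \<odot>\<^sub>Y y)"
    and eq: "\<And>a b x. [|a : B; b : B; x : X|] ==> f (eb a b \<odot>\<^sub>X x) = eb a b \<odot>\<^sub>Y f x"
  shows "linear_map EB X Y f"
proof (rule linear_mapI)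
  fix r x assume r: "r : EB" and x: "x : X"
  have "r : BB.T" using r by (simp add: EB_simps)
  then show "f (r \<odot>\<^sub>X x) = r \<odot>\<^sub>Y f x"
    by (rule BB.additive_map_unique[OF additive_map_comp[OF sX[OF x] f] sY[OF additive_mapD(1)[OF f x]] Y, rotated])
      (use eq x in auto)
qed (use additive_mapD[OF f] in auto)

lemma left_module_env:
  assumes M: "left_module EB M"
  shows "\<And>x. x : M ==> additive_map BB.T M (\<lambda>r. r \<odot>\<^sub>M x)" and "abelian_group M"
  using left_module.smult_closed[OF M] left_module.smult_l_distr[OF M]
  by (auto intro!: additive_mapI simp: EB_simps left_module_def[of EB M] M[unfolded left_module_def])

lemma bimodule_smult:
  assumes P: "abelian_group P"
    and ml: "\<And>x. x : P ==> middle_linear K B (opp B) P (\<lambda>a b. r (l a x) b)"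
  shows "\<And>x. x : P ==> additive_map BB.T (bimodule P l r) (\<lambda>t. t \<odot>\<^bsub>bimodule P l r\<^esub> x)"
    and "\<And>a b x. [|a : B; b : B; x : P|] ==> eb a b \<odot>\<^bsub>bimodule P l r\<^esub> x = r (l a x) b"
  using BB.tensor_lift_additive[OF P ml] BB.tensor_lift_pure[OF P ml]
  by (auto simp: bimodule_def additive_map_def)

end

lemma bimodule_simps [simp]:
  "carrier (bimodule P l r) = carrier P" "add (bimodule P l r) = add P" "zero (bimodule P l r) = zero P"
  by (simp_all add: bimodule_def)

context enveloping
begin

context
  fixes M :: "(('b, 'b) tensor, 'm) module"
  assumes M: "left_module EB M"
begin

interpretation M: left_module EB M by (rule M)

abbreviation (input) "l \<equiv> left_act K B M"
abbreviation (input) "r \<equiv> right_act K B M"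

lemma eb_in: "[|a : B; b : B|] ==> eb a b : EB"
  by (simp add: EB_simps eb_closed)

lemma l_closed: "[|s : B; m : M|] ==> l s m : M"
  unfolding left_act_def by (intro M.smult_closed eb_in) auto

lemma r_closed: "[|s : B; m : M|] ==> r m s : M"
  unfolding right_act_def by (intro M.smult_closed eb_in) auto

lemma l_mult: "[|s : B; t : B; m : M|] ==> l (s \<otimes>\<^sub>B t) m = l s (l t m)"
  unfolding left_act_def by (simp add: M.smult_assoc[symmetric] eb_in EB_mult)

lemma r_mult: "[|s : B; t : B; m : M|] ==> r m (s \<otimes>\<^sub>B t) = r (r m s) t"
  unfolding right_act_def by (simp add: M.smult_assoc[symmetric] eb_in EB_mult)

lemma l_r: "[|s : B; t : B; m : M|] ==> l s (r m t) = r (l s m) t"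
  unfolding left_act_def right_act_def by (simp add: M.smult_assoc[symmetric] eb_in EB_mult)

lemma eb_act: "[|s : B; t : B; m : M|] ==> eb s t \<odot>\<^sub>M m = r (l s m) t"
  unfolding left_act_def right_act_def by (simp add: M.smult_assoc[symmetric] eb_in EB_mult)

lemma l_one: "m : M ==> l \<one>\<^sub>B m = m"
  unfolding left_act_def by (simp add: M.smult_one[unfolded EB_simps])

lemma r_one: "m : M ==> r m \<one>\<^sub>B = m"
  unfolding right_act_def by (simp add: M.smult_one[unfolded EB_simps])

lemma l_add: "[|s : B; t : B; m : M|] ==> l (s \<oplus>\<^sub>B t) m = l s m \<oplus>\<^sub>M l t m"
  unfolding left_act_def using M.smult_l_distr[of "eb s \<one>\<^sub>B" "eb t \<one>\<^sub>B" m] eb_in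
  by (simp add: eb_add EB_simps(2))

lemma r_add: "[|s : B; t : B; m : M|] ==> r m (s \<oplus>\<^sub>B t) = r m s \<oplus>\<^sub>M r m t"
  unfolding right_act_def using M.smult_l_distr[of "eb \<one>\<^sub>B s" "eb \<one>\<^sub>B t" m] eb_in
  by (simp add: eb_add EB_simps(2))

lemma l_add2: "[|s : B; m : M; m' : M|] ==> l s (m \<oplus>\<^sub>M m') = l s m \<oplus>\<^sub>M l s m'"
  unfolding left_act_def by (simp add: M.smult_r_distr eb_in)

lemma r_add2: "[|s : B; m : M; m' : M|] ==> r (m \<oplus>\<^sub>M m') s = r m s \<oplus>\<^sub>M r m' s"
  unfolding right_act_def by (simp add: M.smult_r_distr eb_in)

lemma scalar_l: "k : K ==> k \<odot>\<^bsub>restrict_K EB M\<^esub> m = l (k \<odot>\<^sub>B \<one>\<^sub>B) m"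
  by (simp add: left_act_def EB_scalar)

lemma scalar_r: "k : K ==> k \<odot>\<^bsub>restrict_K EB M\<^esub> m = r m (k \<odot>\<^sub>B \<one>\<^sub>B)"
  by (simp add: right_act_def EB_scalar eb_middle)

lemma restrict_EB_module: "module K (restrict_K EB M)"
proof (rule moduleI[OF R.is_cring])
  show "abelian_group (restrict_K EB M)" by (simp add: restrict_K_def M.M.abelian_group_axioms)
  fix a b x assume ab: "a : K" "b : K" and x: "x : (restrict_K EB M)"
  show "(a \<otimes>\<^sub>K b) \<odot>\<^bsub>restrict_K EB M\<^esub> x = a \<odot>\<^bsub>restrict_K EB M\<^esub> (b \<odot>\<^bsub>restrict_K EB M\<^esub> x)"
    using ab x l_mult[of "a \<odot>\<^sub>B \<one>\<^sub>B" "b \<odot>\<^sub>B \<one>\<^sub>B" x]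
    by (simp only: scalar_l R.m_closed) (simp add: smult_mult_left smult_assoc1)
  show "(a \<oplus>\<^sub>K b) \<odot>\<^bsub>restrict_K EB M\<^esub> x = a \<odot>\<^bsub>restrict_K EB M\<^esub> x \<oplus>\<^bsub>restrict_K EB M\<^esub> b \<odot>\<^bsub>restrict_K EB M\<^esub> x"
    using ab x by (simp only: scalar_l R.a_closed) (simp add: smult_l_distr l_add)
qed (simp_all add: scalar_l l_closed l_add2 l_one del: restrict_K_simps(4))

lemma l_linear1: "m : M ==> linear_map K B (restrict_K EB M) (\<lambda>s. l s m)"
  by (rule linear_mapI)
    (simp_all add: l_closed l_add scalar_l l_mult[symmetric] smult_mult_left del: restrict_K_simps(4))

lemma l_linear2: "s : B ==> linear_map K (restrict_K EB M) (restrict_K EB M) (l s)"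
  by (rule linear_mapI)
    (simp_all add: l_closed l_add2 scalar_l l_mult[symmetric] smult_mult_left smult_mult_right del: restrict_K_simps(4))

lemma r_linear1: "m : M ==> linear_map K B (restrict_K EB M) (r m)"
  by (rule linear_mapI)
    (simp_all add: r_closed r_add scalar_r r_mult[symmetric] smult_mult_right del: restrict_K_simps(4))

lemma r_linear2: "s : B ==> linear_map K (restrict_K EB M) (restrict_K EB M) (\<lambda>m. r m s)"
  by (rule linear_mapI)
    (simp_all add: r_closed r_add2 scalar_r r_mult[symmetric] smult_mult_left smult_mult_right del: restrict_K_simps(4))

end

end

lemma (in hopf_algebra) Hp_linearI:
  assumes X: "left_module \<H> X" and Y: "left_module \<H> Y" and f: "additive_map X Y f"
    and b: "\<And>h x. [|h : H; x : X|] ==> f (br h \<odot>\<^sub>X x) = br h \<odot>\<^sub>Y f x"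
    and s: "\<And>k x. [|k : K; x : X|] ==>
      f ((sc k) \<odot>\<^sub>X x) = (sc k) \<odot>\<^sub>Y f x"
  shows "linear_map \<H> X Y f"
proof -
  interpret X: left_module \<H> X by fact
  interpret Y: left_module \<H> Y by fact
  interpret HM: module K \<H> by (rule Hp_module)
  note fD = additive_mapD[OF f]
  have "\<forall>x\<in>carrier X. f (t \<odot>\<^sub>X x) = t \<odot>\<^sub>Y f x" if "t : \<H>" for t
    using that
  proof (induction t rule: Hp_induct)
    case (smult k t)
    have k: "k \<odot>\<^sub>\<H> t = (sc k) \<otimes>\<^sub>\<H> t" and 1: "sc k : \<H>"
      using smult(1,2) by (simp_all add: scalar_commute(1)[OF Hp_algebra])
    show ?case
      unfolding k using smult s 1 by (simp add: X.smult_assoc Y.smult_assoc fD X.smult_closed)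
  qed (auto simp: b fD X.smult_one Y.smult_one X.smult_l_distr Y.smult_l_distr X.smult_closed
      X.smult_assoc Y.smult_assoc)
  then show ?thesis using fD by (intro linear_mapI) auto
qed

context cocommutative_partial_action
begin

sublocale ES: enveloping K S by (rule enveloping.intro[OF S_algebra])
sublocale EA: enveloping K A by (rule enveloping.intro[OF A_algebra])

end

lemma linear_map_opp [simp]:
  "linear_map K (opp B) P f \<longleftrightarrow> linear_map K (B :: ('k, 'b, 't) module_scheme) P f"
  by (simp add: linear_map_def)

locale env_module = cocommutative_partial_action K H A act
  for K :: "('k, 's) ring_scheme" (structure) and H :: "('k, 'h, 'z) hopf_scheme" (structure)
    and A :: "('k, 'a, 'w) module_scheme" (structure) and act :: "'h \<Rightarrow> 'a \<Rightarrow> 'a" +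
  fixes M :: "('a, 'h, 'm) smash_env_module"
  assumes M: "left_module (env K (smash K H A act)) M"
begin

abbreviation "MK \<equiv> restrict_K (env K S) M"

sublocale smash_bimodule K H A act MK "left_act K S M" "right_act K S M"
proof (intro smash_bimodule.intro smash_bimodule_axioms.intro cocommutative_partial_action_axioms)
  show "left_act K S M \<one>\<^sub>S p = p" "right_act K S M p \<one>\<^sub>S = p" if "p : MK" for p
    using that ES.l_one[OF M] ES.r_one[OF M] by simp_all
qed (simp_all add: ES.restrict_EB_module[OF M] ES.l_linear1[OF M] ES.l_linear2[OF M] ES.r_linear1[OF M]
    ES.r_linear2[OF M] ES.l_mult[OF M] ES.r_mult[OF M] ES.l_r[OF M])

lemmas [simp] = L_closed[simplified] R_closed[simplified] twist_closed[simplified]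

abbreviation "L \<equiv> left_act K S M"
abbreviation "R \<equiv> right_act K S M"
abbreviation "RA \<equiv> regular_bimodule A"
abbreviation "RM \<equiv> restrict_bimodule K H A act M"
abbreviation "HM \<equiv> hom_module (env K A) RA RM"

lemma M_ag: "abelian_group M"
  using M by (simp add: left_module_def)

lemma RM_eq: "RM = bimodule M (\<lambda>a m. L (\<iota> a) m) (\<lambda>m b. R m (\<iota> b))"
  by (simp add: restrict_bimodule_def Let_def \<iota>_def)

lemma RM_simps [simp]: "carrier RM = carrier M" "add RM = add M" "zero RM = zero M"
  by (simp_all add: RM_eq)

lemma RA_simps [simp]: "carrier RA = carrier A" "add RA = add A" "zero RA = zero A"
  by (simp_all add: regular_bimodule_def)

lemma middle_linear_MK: "middle_linear K X Y MK f \<longleftrightarrow> middle_linear K X Y M f"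
  by (simp add: middle_linear_def additive_map_def)

lemma RM_smult:
  shows "\<And>x. x : M ==> additive_map EA.BB.T RM (\<lambda>t. t \<odot>\<^bsub>RM\<^esub> x)"
    and "\<And>a b x. [|a : A; b : A; x : M|] ==> EA.eb a b \<odot>\<^bsub>RM\<^esub> x = R (L (\<iota> a) x) (\<iota> b)"
proof -
  have ml: "middle_linear K A (opp A) M (\<lambda>a b. R (L (\<iota> a) x) (\<iota> b))" if "x : M" for x
    unfolding middle_linear_MK[symmetric] using that
    by (intro bilinear_middle_linear bilinear_mapI) (auto intro!: linear_intros)
  show "\<And>x. x : M ==> additive_map EA.BB.T RM (\<lambda>t. t \<odot>\<^bsub>RM\<^esub> x)"
    "\<And>a b x. [|a : A; b : A; x : M|] ==> EA.eb a b \<odot>\<^bsub>RM\<^esub> x = R (L (\<iota> a) x) (\<iota> b)"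
    unfolding RM_eq using EA.bimodule_smult[where P=M and l="\<lambda>a m. L (\<iota> a) m" and r="\<lambda>m b. R m (\<iota> b)", OF M_ag ml] by auto
qed

lemma RA_smult:
  shows "\<And>x. x : A ==> additive_map EA.BB.T RA (\<lambda>t. t \<odot>\<^bsub>RA\<^esub> x)"
    and "\<And>a b x. [|a : A; b : A; x : A|] ==> EA.eb a b \<odot>\<^bsub>RA\<^esub> x = (a \<otimes>\<^sub>A x) \<otimes>\<^sub>A b"
proof -
  have ml: "middle_linear K A (opp A) A (\<lambda>a b. (a \<otimes>\<^sub>A x) \<otimes>\<^sub>A b)" if "x : A" for x
    using that by (intro bilinear_middle_linear bilinear_mapI) (auto intro!: linear_intros)
  show "\<And>x. x : A ==> additive_map EA.BB.T RA (\<lambda>t. t \<odot>\<^bsub>RA\<^esub> x)"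
    "\<And>a b x. [|a : A; b : A; x : A|] ==> EA.eb a b \<odot>\<^bsub>RA\<^esub> x = (a \<otimes>\<^sub>A x) \<otimes>\<^sub>A b"
    unfolding regular_bimodule_def using EA.bimodule_smult[where P=A and l="mult A" and r="mult A", OF A_ag ml] by auto
qed

text \<open>The bimodule map out of \<open>A\<close> whose value at \<open>1\<close> is the central element \<open>m\<close>.\<close>

definition cfun where "cfun m = (\<lambda>a\<in>carrier A. L (\<iota> a) m)"

lemma cfun_one: "central m ==> cfun m \<one>\<^sub>A = m"
  using L_one central_closed by (simp add: cfun_def \<iota>_one)

lemma cfun_hom:
  assumes m: "central m" shows "cfun m \<in> mod_hom (env K A) RA RM"
proof (rule mod_homI)
  have mc: "m : M" using central_closed[OF m] by simp
  have Lc: "L (\<iota> a) m : M" if "a : A" for a using L_closed[of "\<iota> a" m] that mc by simp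
  have lin: "linear_map K A MK (\<lambda>a. L (\<iota> a) m)" using mc by (auto intro!: linear_intros)
  show "cfun m \<in> extensional (carrier RA)" by (simp add: cfun_def)
  show "linear_map (env K A) RA RM (cfun m)"
  proof (rule EA.env_linearI)
    show "abelian_group RA" unfolding regular_bimodule_def bimodule_def using A_ag by simp
    show "abelian_group RM" unfolding RM_eq bimodule_def using M_ag by simp
    show "additive_map RA RM (cfun m)"
      using linear_mapD(2)[OF lin] Lc by (intro additive_mapI) (simp_all add: cfun_def)
    show "cfun m (EA.eb a b \<odot>\<^bsub>RA\<^esub> x) = EA.eb a b \<odot>\<^bsub>RM\<^esub> cfun m x"
      if "a : A" "b : A" "x : RA" for a b x
    proof -
      have "L (\<iota> ((a \<otimes>\<^sub>A x) \<otimes>\<^sub>A b)) m = L (\<iota> a) (L (\<iota> x) (L (\<iota> b) m))"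
        using that mc by (simp add: \<iota>_mult[symmetric] L_mult)
      also have "\<dots> = R (L (\<iota> a) (L (\<iota> x) m)) (\<iota> b)"
        using that mc Lc by (simp add: centralD[OF m] L_R)
      finally show ?thesis using that Lc by (simp add: RA_smult(2) RM_smult(2) cfun_def)
    qed
  qed (use RA_smult(1) RM_smult(1) in auto)
qed

lemma hom_cfun:
  assumes f: "f \<in> mod_hom (env K A) RA RM"
  shows "central (f \<one>\<^sub>A)" "f = cfun (f \<one>\<^sub>A)"
proof -
  note fl = mod_homD(1)[OF f]
  have fc: "f a : M" if "a : A" for a using linear_mapD(1)[OF fl] that by simp
  have eq: "f ((a \<otimes>\<^sub>A x) \<otimes>\<^sub>A b) = R (L (\<iota> a) (f x)) (\<iota> b)" if "a : A" "b : A" "x : A" for a b x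
    using linear_mapD(3)[OF fl, of "EA.eb a b" x] that fc EA.eb_closed
    by (simp add: EA.EB_simps(1) RA_smult(2) RM_smult(2))
  have Lc: "L (\<iota> a) (f \<one>\<^sub>A) : M" if "a : A" for a
    using L_closed[of "\<iota> a" "f \<one>\<^sub>A"] that fc by simp
  have l: "f a = L (\<iota> a) (f \<one>\<^sub>A)" if "a : A" for a
    using eq[of a "\<one>\<^sub>A" "\<one>\<^sub>A"] that Lc R_one[of "L (\<iota> a) (f \<one>\<^sub>A)"] by (simp add: \<iota>_one)
  have r: "f a = R (f \<one>\<^sub>A) (\<iota> a)" if "a : A" for a
    using eq[of "\<one>\<^sub>A" a "\<one>\<^sub>A"] that fc L_one[of "f \<one>\<^sub>A"] by (simp add: \<iota>_one)
  have "L (\<iota> a) (f \<one>\<^sub>A) = R (f \<one>\<^sub>A) (\<iota> a)" if "a : A" for a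
    using l[OF that] r[OF that] by metis
  then show "central (f \<one>\<^sub>A)" using fc[OF A.one_closed] by (simp add: central_def)
  show "f = cfun (f \<one>\<^sub>A)"
  proof (rule extensionalityI[of _ "carrier A"])
    show "f \<in> extensional (carrier A)" using mod_homD(2)[OF f] by simp
    show "cfun (f \<one>\<^sub>A) \<in> extensional (carrier A)" by (simp add: cfun_def)
    show "f a = cfun (f \<one>\<^sub>A) a" if "a : A" for a
      unfolding cfun_def restrict_apply'[OF that] by (rule l[OF that])
  qed
qed

lemma HM_val: "[|f \<in> mod_hom (env K A) RA RM; a : A|] ==> f a : M"
  using linear_mapD(1)[OF mod_homD(1), of f "env K A" RA RM a] by simp

lemma central_zero: "central \<zero>\<^sub>M"
proof -
  have "L (\<iota> a) \<zero>\<^sub>M = \<zero>\<^sub>M" "R \<zero>\<^sub>M (\<iota> a) = \<zero>\<^sub>M" if "a : A" for a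
    using additive_map_zero[OF linear_map_additive[OF L_linear2[of "\<iota> a"]] P_ag P_ag]
      additive_map_zero[OF linear_map_additive[OF R_linear2[of "\<iota> a"]] P_ag P_ag] that by simp_all
  then show ?thesis using abelian_monoid.zero_closed[OF abelian_group.axioms(1)[OF M_ag]] by (simp add: central_def)
qed

lemma L_scalar: "[|k : K; s : S; m : M|] ==> L s (k \<odot>\<^bsub>MK\<^esub> m) = k \<odot>\<^bsub>MK\<^esub> L s m"
  by (rule linear_mapD(3)[OF L_linear2]) simp_all

lemma R_scalar: "[|k : K; s : S; m : M|] ==> R (k \<odot>\<^bsub>MK\<^esub> m) s = k \<odot>\<^bsub>MK\<^esub> R m s"
  by (rule linear_mapD(3)[OF R_linear2]) simp_all

lemma MK_scalar_closed: "[|k : K; m : M|] ==> k \<odot>\<^bsub>MK\<^esub> m : M"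
  using module.smult_closed[OF P_module, of k m] by simp

lemma M_add_closed: "[|m : M; m' : M|] ==> m \<oplus>\<^sub>M m' : M"
  by (rule abelian_monoid.a_closed[OF abelian_group.axioms(1)[OF M_ag]])

lemma centralM: "central m ==> m : M"
  using central_closed[of m] by simp

lemma central_iff: "central m \<longleftrightarrow> m : M \<and> (\<forall>a\<in>carrier A. L (\<iota> a) m = R m (\<iota> a))"
  by (simp add: central_def)

lemma central_add: "[|central m; central m'|] ==> central (m \<oplus>\<^sub>M m')"
  by (simp add: central_iff ES.l_add2[OF M] ES.r_add2[OF M] M_add_closed)

lemma central_smult: "[|k : K; central m|] ==> central (k \<odot>\<^bsub>MK\<^esub> m)"
  by (simp add: central_iff L_scalar R_scalar MK_scalar_closed del: restrict_K_simps(4))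

lemma cfun_add: "[|central m; central m'|] ==> cfun m \<oplus>\<^bsub>HM\<^esub> cfun m' = cfun (m \<oplus>\<^sub>M m')"
  unfolding cfun_def hom_module_simps(3) RA_simps RM_simps
  by (rule restrict_ext) (simp add: ES.l_add2[OF M] centralM)

lemma HM_smult:
  assumes k: "k : K" and f: "f : HM"
  shows "k \<odot>\<^bsub>HM\<^esub> f = (\<lambda>a\<in>carrier A. k \<odot>\<^bsub>MK\<^esub> f a)"
proof -
  have fc: "f a : M" if "a : A" for a using HM_val[of f a] f that by simp
  have "(k \<odot>\<^bsub>env K A\<^esub> \<one>\<^bsub>env K A\<^esub>) \<odot>\<^bsub>RM\<^esub> m = k \<odot>\<^bsub>MK\<^esub> m" if m: "m : M" for m
  proof -
    have "L (\<iota> (k \<odot>\<^sub>A \<one>\<^sub>A)) m = k \<odot>\<^bsub>MK\<^esub> L (\<iota> \<one>\<^sub>A) m"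
      using k m by (intro linear_mapD(3)[of _ A]) (auto intro!: linear_intros)
    then show ?thesis
      using k m L_one[of m] R_one L_closed[of "\<iota> (k \<odot>\<^sub>A \<one>\<^sub>A)" m] 
      by (simp add: EA.EB_scalar RM_smult(2) \<iota>_one del: restrict_K_simps(4))
  qed
  then have "(k \<odot>\<^bsub>env K A\<^esub> \<one>\<^bsub>env K A\<^esub>) \<odot>\<^bsub>RM\<^esub> f a = k \<odot>\<^bsub>MK\<^esub> f a" if "a : A" for a
    using fc[OF that] by blast
  then show ?thesis unfolding hom_module_simps(4) RA_simps by (rule restrict_ext)
qed

lemma cfun_smult: 
  assumes k: "k : K" and m: "central m"
  shows "k \<odot>\<^bsub>HM\<^esub> cfun m = cfun (k \<odot>\<^bsub>MK\<^esub> m)"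
proof -
  have "cfun m : HM" using cfun_hom[OF m] by simp
  from HM_smult[OF k this] show ?thesis
    unfolding cfun_def by (simp add: L_scalar k centralM[OF m] del: restrict_K_simps(4) cong: restrict_cong)
qed

lemma L_zero: "s : S ==> L s \<zero>\<^sub>M = \<zero>\<^sub>M"
  using additive_map_zero[OF linear_map_additive[OF L_linear2] P_ag P_ag, of s] by simp

lemma cfun_zero: "cfun \<zero>\<^sub>M = \<zero>\<^bsub>HM\<^esub>"
  unfolding cfun_def hom_module_simps(2) RA_simps RM_simps
  by (rule restrict_ext) (simp add: L_zero)

lemma HM_module: "module K HM"
proof (rule pointwise_module[OF P_module, where D="carrier A"])
  show "carrier HM \<subseteq> extensional (carrier A)" by (auto simp: mod_hom_def)
  show "f x : MK" if "f : HM" "x : A" for f x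
    using HM_val[of f x] that by simp
  show "\<zero>\<^bsub>HM\<^esub> : HM" using cfun_hom[OF central_zero] cfun_zero by simp
  show "f \<oplus>\<^bsub>HM\<^esub> g : HM" if "f : HM" "g : HM" for f g
    using cfun_add[of "f \<one>\<^sub>A" "g \<one>\<^sub>A"] hom_cfun[of f] hom_cfun[of g] that central_add cfun_hom
    by (metis hom_module_simps(1))
  show "k \<odot>\<^bsub>HM\<^esub> f : HM" if "k : K" "f : HM" for f k
    using cfun_smult[of k "f \<one>\<^sub>A"] hom_cfun[of f] that central_smult cfun_hom
    by (metis hom_module_simps(1))
  show "k \<odot>\<^bsub>HM\<^esub> f = (\<lambda>x\<in>carrier A. k \<odot>\<^bsub>MK\<^esub> f x)" if "k : K" "f : HM" for f k
    by (rule HM_smult[OF that])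
qed simp_all

lemma HM_ag: "abelian_group HM" by (rule module_abelian_group[OF HM_module])

lemma HM_cases:
  assumes "f : HM" obtains m where "central m" "f = cfun m"
  using hom_cfun[of f] assms by auto

abbreviation "g \<equiv> hom_par_act K H A act M"

lemma par_act_twist: "bimodule_par_act K H A act M h m = twist h m"
  by (simp add: bimodule_par_act_def twist_def Let_def \<pi>_def)

text \<open>
  \<open>[h\<^sub>1] \<triangleright> ((\<S>(h\<^sub>2)\<cdot>a)m) = a([h] \<triangleright> m)\<close>, since \<open>\<pi>(h\<^sub>1)\<iota>(\<S>(h\<^sub>2)\<cdot>a) = \<iota>(a)\<pi>(h)\<close>.
\<close>

lemma hom_par_act_cfun:
  assumes h: "h : H" and m: "central m"
  shows "g h (cfun m) = cfun (twist h m)"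
proof -
  have mc: "m : M" using central_closed[OF m] by simp
  have "sw M (\<lambda>x y. twist x (cfun m (act (\<S> y) a))) h = L (\<iota> a) (twist h m)" if a: "a : A" for a
  proof -
    have "sw MK (\<lambda>x y. twist x (cfun m (act (\<S> y) a))) h =
      sw MK (\<lambda>x y. twist x (L (\<iota> (act (\<S> y) a)) m)) h"
      using a mc by (intro sw_cong[OF P_ag h] twist_closed L_closed) (auto simp: cfun_def)
    also have "\<dots> = L (\<iota> a) (twist h m)" using h mc a by (intro twist_L_antipode) auto
    finally show ?thesis by simp
  qed
  then show ?thesis by (auto simp: hom_par_act_def par_act_twist cfun_def intro!: restrict_ext)
qed

lemma HM_eval_additive: "a : A ==> additive_map HM MK (\<lambda>f. f a)"
  using HM_val by (intro additive_mapI) simp_all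

lemma HM_sw:
  assumes h: "h : H"
    and F: "\<And>x y. [|x : H; y : H|] ==> central (F x y)"
    and G: "\<And>x y. [|x : H; y : H|] ==> central (G x y)"
    and eq: "sw MK F h = sw MK G h"
  shows "sw HM (\<lambda>x y. cfun (F x y)) h = sw HM (\<lambda>x y. cfun (G x y)) h"
proof -
  have val: "sw HM (\<lambda>x y. cfun (F x y)) h a = L (\<iota> a) (sw MK F h)"
    if F: "\<And>x y. [|x : H; y : H|] ==> central (F x y)" and a: "a : A" for F a
  proof -
    have "sw HM (\<lambda>x y. cfun (F x y)) h a = sw MK (\<lambda>x y. cfun (F x y) a) h"
      by (rule sw_map[OF HM_eval_additive[OF a] HM_ag P_ag h]) (simp add: cfun_hom F)
    also have "\<dots> = sw MK (\<lambda>x y. L (\<iota> a) (F x y)) h"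
      using a central_closed[OF F] by (intro sw_cong[OF P_ag h] L_closed) (simp_all add: cfun_def)
    also have "\<dots> = L (\<iota> a) (sw MK F h)"
      using a central_closed[OF F] by (intro L_sw[OF h, symmetric]) auto
    finally show ?thesis .
  qed
  have cl: "sw HM (\<lambda>x y. cfun (F x y)) h : HM" if "\<And>x y. [|x : H; y : H|] ==> central (F x y)" for F
    by (rule sw_closed[OF HM_ag h]) (simp add: cfun_hom that)
  show ?thesis
  proof (rule mod_hom_eqI)
    show "sw HM (\<lambda>x y. cfun (F x y)) h \<in> mod_hom (env K A) RA RM"
      "sw HM (\<lambda>x y. cfun (G x y)) h \<in> mod_hom (env K A) RA RM"
      using cl[of F] cl[of G] F G by simp_all
    show "sw HM (\<lambda>x y. cfun (F x y)) h a = sw HM (\<lambda>x y. cfun (G x y)) h a" if "a : RA" for a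
      using val[of F a] val[of G a] F G eq that by simp
  qed
qed

lemma HM_partial_rep: "partial_rep_on HM g"
  unfolding partial_rep_on_def
proof (intro conjI ballI)
  fix h assume h: "h : H"
  note tl = linear_mapD[OF linear_twist2[OF h linear_map_id]]
  show "linear_map K HM HM (g h)"
  proof (rule linear_mapI)
    fix f assume "f : HM" then show "g h f : HM"
      using h by (elim HM_cases) (simp add: hom_par_act_cfun cfun_hom central_twist)
  next
    fix f f' assume "f : HM" "f' : HM"
    then show "g h (f \<oplus>\<^bsub>HM\<^esub> f') = g h f \<oplus>\<^bsub>HM\<^esub> g h f'"
      using h tl(2) central_closed by (elim HM_cases) (simp add: hom_par_act_cfun cfun_add central_add central_twist del: hom_module_simps(3))
  next
    fix k f assume "k : K" "f : HM"
    then show "g h (k \<odot>\<^bsub>HM\<^esub> f) = k \<odot>\<^bsub>HM\<^esub> g h f"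
      using h tl(3) central_closed
      by (elim HM_cases) (simp add: hom_par_act_cfun cfun_smult central_smult central_twist
          del: hom_module_simps(4) restrict_K_simps(4))
  qed
next
  fix f assume f: "f : HM"
  then obtain m where m: "central m" "f = cfun m" by (rule HM_cases)
  note tl = linear_mapD[OF linear_twist1[OF central_closed[OF m(1)] linear_map_id]]
  show "linear_map K H HM (\<lambda>h. g h f)"
    using tl by (intro linear_mapI)
      (simp_all add: m hom_par_act_cfun cfun_hom central_twist cfun_add cfun_smult
        del: hom_module_simps(3,4) restrict_K_simps(4))
  show "g \<one>\<^sub>H f = f" using m central_closed[OF m(1)] by (simp add: hom_par_act_cfun twist_one)
next
  fix h k f assume h: "h : H" and k: "k : H" and f: "f : HM"
  obtain m where m: "central m" "f = cfun m" using f by (rule HM_cases)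
  have sc: "sw HM (\<lambda>x y. F x y) h = sw HM (\<lambda>x y. cfun (F' x y)) h"
    if "h : H" "\<And>x y. [|x : H; y : H|] ==> F x y = cfun (F' x y)"
      "\<And>x y. [|x : H; y : H|] ==> central (F' x y)" for F F' h
    by (rule sw_cong[OF HM_ag that(1,2)]) (auto simp: cfun_hom that(3))
  note cs = hom_par_act_cfun central_twist
  have "sw HM (\<lambda>x y. g h (g x (g (\<S> y) f))) k = 
      sw HM (\<lambda>x y. cfun (twist h (twist x (twist (\<S> y) m)))) k"
    by (rule sc) (simp_all add: m h k cs)
  also have "\<dots> = sw HM (\<lambda>x y. cfun (twist (h \<cdot> x) (twist (\<S> y) m))) k"
    by (rule HM_sw[OF k]) (simp_all add: m h k cs twist_partial_rep(2) del: sw_restrict_K)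
  also have "\<dots> = sw HM (\<lambda>x y. g (h \<cdot> x) (g (\<S> y) f)) k"
    by (rule sc[symmetric]) (simp_all add: m h k cs)
  finally show "sw HM (\<lambda>x y. g h (g x (g (\<S> y) f))) k =
    sw HM (\<lambda>x y. g (h \<cdot> x) (g (\<S> y) f)) k" .
  have "sw HM (\<lambda>x y. g x (g (\<S> y) (g k f))) h = 
      sw HM (\<lambda>x y. cfun (twist x (twist (\<S> y) (twist k m)))) h"
    by (rule sc) (simp_all add: m h k cs)
  also have "\<dots> = sw HM (\<lambda>x y. cfun (twist x (twist (\<S> y \<cdot> k) m))) h"
    by (rule HM_sw[OF h]) (simp_all add: m h k cs twist_partial_rep(3) del: sw_restrict_K)
  also have "\<dots> = sw HM (\<lambda>x y. g x (g (\<S> y \<cdot> k) f)) h"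
    by (rule sc[symmetric]) (simp_all add: m h k cs)
  finally show "sw HM (\<lambda>x y. g x (g (\<S> y) (g k f))) h =
    sw HM (\<lambda>x y. g x (g (\<S> y \<cdot> k) f)) h" .
qed

abbreviation "HomA \<equiv> Hom_A K H A act M"

lemma HomA_eq: "HomA = hpar_left_module HM g"
  by (simp add: Hom_A_def)

lemma HomA_simps [simp]: "carrier HomA = mod_hom (env K A) RA RM" "add HomA = add HM" "zero HomA = zero HM"
  by (simp_all add: HomA_eq hpar_left_module_def)

lemma HomA_module:
  shows "left_module \<H> HomA"
    and "[|h : H; central m|] ==> br h \<odot>\<^bsub>HomA\<^esub> cfun m = cfun (twist h m)"
    and "[|k : K; central m|] ==> (sc k) \<odot>\<^bsub>HomA\<^esub> cfun m = cfun (k \<odot>\<^bsub>MK\<^esub> m)"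
  unfolding HomA_eq
  using hpar_left_module[OF HM_module rep_linear[OF HM_partial_rep] HM_partial_rep] cfun_hom[of m]
  by (simp_all add: hom_par_act_cfun cfun_smult del: hom_module_simps(4) restrict_K_simps(4))

end

section \<open>The bimodule \<open>X \<otimes>\<^sub>B A#H\<close>\<close>

context cocommutative_hopf_algebra
begin

abbreviation "Bp \<equiv> Bpar K H"

lemma Bp_carrier: "carrier Bp = subalgebra_gen K \<H> (eH ` carrier H)"
  by (simp add: Bpar_def)

lemma Bp_induct [consumes 1, case_names eH one minus add mult smult]:
  assumes r: "r : Bp" and e: "\<And>h. h : H ==> Q (eH h)" and 1: "Q \<one>\<^sub>\<H>"
    and n: "\<And>r. [|r : \<H>; Q r|] ==> Q (\<ominus>\<^sub>\<H> r)"
    and a: "\<And>r s. [|r : \<H>; s : \<H>; Q r; Q s|] ==> Q (r \<oplus>\<^sub>\<H> s)"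
    and m: "\<And>r s. [|r : \<H>; s : \<H>; Q r; Q s|] ==> Q (r \<otimes>\<^sub>\<H> s)"
    and k: "\<And>k r. [|k : K; r : \<H>; Q r|] ==> Q (k \<odot>\<^sub>\<H> r)"
  shows "r : \<H> \<and> Q r"
proof -
  let ?C = "{r \<in> carrier \<H>. Q r}"
  have "subring ?C \<H>" by (rule \<H>.subringI) (use 1 n a m in auto)
  moreover have "\<forall>k\<in>carrier K. \<forall>c\<in>?C. k \<odot>\<^sub>\<H> c \<in> ?C"
    using k module.smult_closed[OF Hp_module] by auto
  moreover have "eH ` carrier H \<subseteq> ?C" using e by auto
  ultimately have "carrier Bp \<subseteq> ?C" unfolding Bp_carrier subalgebra_gen_def by blast
  then show ?thesis using r by auto
qed

lemma Bp_Hp: "r : Bp ==> r : \<H>"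
  using Bp_induct[where Q="\<lambda>_. True"] by blast

lemma eH_Bp: "h : H ==> eH h : Bp"
  unfolding Bp_carrier subalgebra_gen_def by auto

lemma scalar_Bp:
  assumes "k : K" shows "sc k : Bp"
  unfolding Bp_carrier subalgebra_gen_def
proof (rule InterI, elim CollectE conjE)
  fix C assume C: "subring C \<H>" "\<forall>k\<in>carrier K. \<forall>c\<in>C. k \<odot>\<^sub>\<H> c \<in> C"
  have "\<one>\<^sub>\<H> \<in> C" using subringE(3)[OF C(1)] .
  then show "sc k \<in> C" using C(2) assms by blast
qed

end

locale tensor_mod = cocommutative_partial_action K H A act
  for K :: "('k, 's) ring_scheme" (structure) and H :: "('k, 'h, 'z) hopf_scheme" (structure)
    and A :: "('k, 'a, 'w) module_scheme" (structure) and act :: "'h \<Rightarrow> 'a \<Rightarrow> 'a" +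
  fixes X :: "('k, 'h, 'x) par_module"
  assumes X: "left_module (Hpar K H) X"
begin

sublocale X: left_module \<H> X by (rule X)
sublocale RT: left_module "opp \<H>" "right_twist K H X" by (rule right_twist(1)[OF X])
sublocale SP: left_module \<H> SP by (rule SP_module(1))

abbreviation "RT \<equiv> right_twist K H X"
abbreviation "XK \<equiv> restrict_K \<H> X"

lemma XK_module: "module K XK" by (rule restrict_K_module[OF Hp_algebra X])
lemma X_ag: "abelian_group X" by (rule X.M.abelian_group_axioms)

lemma linear_X1 [linear_intros]: "[|p : X; linear_map K D \<H> f|] ==> linear_map K D XK (\<lambda>x. f x \<odot>\<^sub>X p)"
  by (rule linear_act_scalar[OF Hp_algebra X])

lemma linear_X2 [linear_intros]: "[|r : \<H>; linear_map K D XK f|] ==> linear_map K D XK (\<lambda>x. r \<odot>\<^sub>X f x)"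
  by (rule linear_act_vector[OF Hp_algebra X])

sublocale BT: tensor_pair Bp RT SP
proof (intro tensor_pair.intro tensor_pair_axioms.intro)
  show "abelian_group RT" by (rule RT.M.abelian_group_axioms)
  show "abelian_group SP" by (rule SP.M.abelian_group_axioms)
qed (use RT.smult_closed SP.smult_closed Bp_Hp in auto)

abbreviation "T \<equiv> balanced K H A act X"
abbreviation "\<tau> \<equiv> balanced_pure K H A act X"

lemma T_eq: "BT.T = T" by (simp add: balanced_def)
lemma \<tau>_eq: "BT.pure = \<tau>" by (simp add: balanced_pure_def)

lemma T_ag: "abelian_group T" using BT.T_abelian by (simp add: T_eq)

lemma \<tau>_closed [simp, intro]: "[|x : X; c : S|] ==> \<tau> x c : T"
  using BT.pure_closed by (simp add: T_eq \<tau>_eq)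

lemma \<tau>_add1: "[|x : X; y : X; c : S|] ==> \<tau> (x \<oplus>\<^sub>X y) c = \<tau> x c \<oplus>\<^sub>T \<tau> y c"
  using BT.pure_add_left by (simp add: T_eq \<tau>_eq)

lemma \<tau>_add2: "[|x : X; c : S; d : S|] ==> \<tau> x (c \<oplus>\<^sub>S d) = \<tau> x c \<oplus>\<^sub>T \<tau> x d"
  using BT.pure_add_right by (simp add: T_eq \<tau>_eq)

lemma \<tau>_eH:
  assumes "h : H" "x : X" "c : S"
  shows "\<tau> (eH h \<odot>\<^sub>X x) c = \<tau> x (\<delta> h \<bullet> c)"
  using BT.pure_middle[of "eH h" x c] assms by (simp add: \<tau>_eq eH_Bp right_twist_eH[OF X] SP_eH)

lemma \<tau>_scalar:
  assumes "k : K" "x : X" "c : S"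
  shows "\<tau> ((sc k) \<odot>\<^sub>X x) c = \<tau> x (k \<odot>\<^sub>S c)"
  using BT.pure_middle[of "sc k" x c] assms
  by (simp add: \<tau>_eq scalar_Bp right_twist(3)[OF X] SP_module(3))

text \<open>
  The elements of \<open>B\<close> at which a biadditive map is balanced form a subring, and a subalgebra if they include
  the scalars.  On the generators \<open>e\<^sub>h\<close> the two actions of \<open>B\<close> are explicit.
\<close>

lemma balancedI:
  assumes P: "abelian_group P"
    and 1: "\<And>x. x : X ==> additive_map S P (f x)"
    and 2: "\<And>c. c : S ==> additive_map X P (\<lambda>x. f x c)"
    and k: "\<And>k x c. [|k : K; x : X; c : S|] ==>
      f ((sc k) \<odot>\<^sub>X x) c = f x (k \<odot>\<^sub>S c)"
    and e: "\<And>h x c. [|h : H; x : X; c : S|] ==>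
      f (eH h \<odot>\<^sub>X x) c = f x (\<delta> h \<bullet> c)"
  shows "middle_linear Bp RT SP P f"
proof (rule middle_linearI)
  show "additive_map SP P (f x)" if "x : RT" for x
    using 1[of x] that by (simp add: additive_map_def)
  show "additive_map RT P (\<lambda>x. f x c)" if "c : SP" for c
    using 2[of c] that by (simp add: additive_map_def)
  note a1 = additive_mapD[OF 1] note a2 = additive_mapD[OF 2]
  have Xn: "(\<ominus>\<^sub>\<H> r) \<odot>\<^bsub>RT\<^esub> x = \<ominus>\<^sub>X (r \<odot>\<^bsub>RT\<^esub> x)" if "r : \<H>" "x : X" for r x
    using additive_map_minus[of \<H> X "\<lambda>r. r \<odot>\<^bsub>RT\<^esub> x" r] that RT.smult_closed RT.smult_l_distr Hp_ag X_ag
    by (simp add: additive_map_def)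
  have Sn: "(\<ominus>\<^sub>\<H> r) \<odot>\<^bsub>SP\<^esub> c = \<ominus>\<^sub>S (r \<odot>\<^bsub>SP\<^esub> c)" if "r : \<H>" "c : S" for r c
    using additive_map_minus[of \<H> S "\<lambda>r. r \<odot>\<^bsub>SP\<^esub> c" r] that SP.smult_closed SP.smult_l_distr Hp_ag S_ag
    by (simp add: additive_map_def)
  have Rc: "r \<odot>\<^bsub>RT\<^esub> x : X" if "r : \<H>" "x : X" for r x using RT.smult_closed[of r x] that by simp
  have Sc: "r \<odot>\<^bsub>SP\<^esub> c : S" if "r : \<H>" "c : S" for r c using SP.smult_closed[of r c] that by simp
  \<comment> \<open>\<open>B\<close> acts on \<open>X\<close> from the right, so \<open>r\<close> passes to the second factor after \<open>s\<close>.\<close>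
  have mul: "f ((r \<otimes>\<^sub>\<H> s) \<odot>\<^bsub>RT\<^esub> x) c = f x ((r \<otimes>\<^sub>\<H> s) \<odot>\<^bsub>SP\<^esub> c)"
    if r: "r : \<H>" and s: "s : \<H>"
      and fr: "\<And>x c. x : X ==> c : S ==> f (r \<odot>\<^bsub>RT\<^esub> x) c = f x (r \<odot>\<^bsub>SP\<^esub> c)"
      and fs: "\<And>x c. x : X ==> c : S ==> f (s \<odot>\<^bsub>RT\<^esub> x) c = f x (s \<odot>\<^bsub>SP\<^esub> c)"
      and x: "x : X" and c: "c : S" for r s x c
  proof -
    have "f ((r \<otimes>\<^sub>\<H> s) \<odot>\<^bsub>RT\<^esub> x) c = f (s \<odot>\<^bsub>RT\<^esub> (r \<odot>\<^bsub>RT\<^esub> x)) c"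
      using RT.smult_assoc[of s r x] r s x by simp
    also have "\<dots> = f x (r \<odot>\<^bsub>SP\<^esub> (s \<odot>\<^bsub>SP\<^esub> c))" using r s x c by (simp add: fr fs Rc Sc)
    also have "\<dots> = f x ((r \<otimes>\<^sub>\<H> s) \<odot>\<^bsub>SP\<^esub> c)" using SP.smult_assoc[of r s c] r s c by simp
    finally show ?thesis .
  qed
  fix r x c assume r: "r : Bp" and x: "x : RT" and c: "c : SP"
  have "r : \<H> \<and> (\<forall>x\<in>carrier X. \<forall>c\<in>carrier S. f (r \<odot>\<^bsub>RT\<^esub> x) c = f x (r \<odot>\<^bsub>SP\<^esub> c))"
    using r
  proof (induction r rule: Bp_induct)
    case (eH h)
    then show ?case by (simp add: right_twist_eH[OF X] SP_eH e)
  next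
    case one
    then show ?case using RT.smult_one SP.smult_one by simp
  next
    case (minus r)
    then show ?case
      using additive_map_minus[OF 1 S_ag P] additive_map_minus[OF 2 X_ag P] by (simp add: Xn Sn Rc Sc)
  next
    case (add r s)
    then show ?case using RT.smult_l_distr SP.smult_l_distr by (simp add: a1 a2 Rc Sc)
  next
    case (mult r s)
    then show ?case using mul by blast
  next
    case (smult k r)
    have 1: "sc k : \<H>" using smult(1) module.smult_closed[OF Hp_module] by simp
    have "k \<odot>\<^sub>\<H> r = (sc k) \<otimes>\<^sub>\<H> r" using smult by (simp add: scalar_commute[OF Hp_algebra])
    moreover have "f ((sc k) \<odot>\<^bsub>RT\<^esub> x) c = f x ((sc k) \<odot>\<^bsub>SP\<^esub> c)" if "x : X" "c : S" for x c
      using k smult(1) that by (simp add: right_twist(3)[OF X] SP_module(3))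
    ultimately show ?case using mul[OF 1 smult(2)] smult(3) by simp
  qed
  then show "f (r \<odot>\<^bsub>RT\<^esub> x) c = f x (r \<odot>\<^bsub>SP\<^esub> c)" using x c by simp
qed

lemmas lift_additive = BT.tensor_lift_additive[unfolded T_eq]
lemmas lift_pure = BT.tensor_lift_pure[unfolded \<tau>_eq right_twist_simps SP_simps]
lemmas T_unique = BT.additive_map_unique[unfolded \<tau>_eq T_eq right_twist_simps SP_simps]
lemmas T_lift_cong = BT.tensor_lift_cong[unfolded T_eq right_twist_simps SP_simps]
lemmas T_lift_additive_fun = BT.tensor_lift_additive_fun[unfolded T_eq right_twist_simps SP_simps]

text \<open>The target of the Sweedler sums in \<open>X \<otimes>\<^sub>B A#H\<close>, whose linearity conditions call for a \<open>K\<close>-module.\<close>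

definition TB where
  "TB = with_smult T (\<lambda>k. tensor_lift T (\<lambda>x c. \<tau> ((sc k) \<odot>\<^sub>X x) c))"

lemma TB_simps [simp]: "carrier TB = carrier T" "add TB = add T" "zero TB = zero T"
  by (simp_all add: TB_def)

lemma sw_TB: "sw TB f h = sw T f h"
  by (simp add: TB_def)

lemma scalar_Hp: "k : K ==> sc k : \<H>"
  by (rule module.smult_closed[OF Hp_module]) simp_all

lemma scalar_X: "[|k : K; x : X|] ==> (sc k) \<odot>\<^sub>X x : X"
  by (rule X.smult_closed[OF scalar_Hp])

lemma smult_S_closed [simp, intro]: "[|k : K; c : S|] ==> k \<odot>\<^sub>S c : S"
  by (rule module.smult_closed[OF S_module])

lemma scalar_X_commute:
  assumes k: "k : K" and r: "r : \<H>" and x: "x : X"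
  shows "(sc k) \<odot>\<^sub>X (r \<odot>\<^sub>X x) = r \<odot>\<^sub>X ((sc k) \<odot>\<^sub>X x)"
proof -
  have "(sc k) \<otimes>\<^sub>\<H> r = r \<otimes>\<^sub>\<H> (sc k)"
    using scalar_commute[OF Hp_algebra k r] by simp
  then show ?thesis using X.smult_assoc[of "sc k" r x] X.smult_assoc[of r "sc k" x] scalar_Hp[OF k] r x
    by simp
qed

lemma TB_ml:
  assumes k: "k : K"
  shows "middle_linear Bp RT SP T (\<lambda>x c. \<tau> ((sc k) \<odot>\<^sub>X x) c)"
proof (rule balancedI[OF T_ag])
  fix l x c assume lxc: "l : K" "x : X" "c : S"
  have "(sc k) \<odot>\<^sub>X ((sc l) \<odot>\<^sub>X x) = (sc l) \<odot>\<^sub>X ((sc k) \<odot>\<^sub>X x)"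
    by (rule scalar_X_commute) (use k lxc scalar_Hp in auto)
  then show "\<tau> ((sc k) \<odot>\<^sub>X ((sc l) \<odot>\<^sub>X x)) c = \<tau> ((sc k) \<odot>\<^sub>X x) (l \<odot>\<^sub>S c)"
    using k lxc by (simp add: \<tau>_scalar scalar_X module.smult_closed[OF S_module])
next
  fix h x c assume hxc: "h : H" "x : X" "c : S"
  have "(sc k) \<odot>\<^sub>X (eH h \<odot>\<^sub>X x) = eH h \<odot>\<^sub>X ((sc k) \<odot>\<^sub>X x)"
    by (rule scalar_X_commute) (use k hxc in auto)
  then show "\<tau> ((sc k) \<odot>\<^sub>X (eH h \<odot>\<^sub>X x)) c = \<tau> ((sc k) \<odot>\<^sub>X x) (\<delta> h \<bullet> c)"
    using k hxc by (simp add: \<tau>_eH scalar_X)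
qed (use k in \<open>auto intro!: additive_mapI simp: \<tau>_add1 \<tau>_add2 X.smult_r_distr scalar_Hp scalar_X\<close>)

lemma TB_smult_additive: "k : K ==> additive_map T T (\<lambda>z. k \<odot>\<^bsub>TB\<^esub> z)"
  unfolding TB_def using lift_additive[OF T_ag TB_ml] by simp

lemma TB_smult_pure:
  "[|k : K; x : X; c : S|] ==> k \<odot>\<^bsub>TB\<^esub> \<tau> x c = \<tau> x (k \<odot>\<^sub>S c)"
  unfolding TB_def using lift_pure[OF T_ag TB_ml] by (simp add: \<tau>_scalar)

lemma TB_module: "module K TB"
proof -
  interpret TT: abelian_group T by (rule T_ag)
  show ?thesis
  proof (rule moduleI[OF K_cring])
    show "abelian_group TB" using T_ag by (simp add: TB_def)
    fix a b z assume ab: "a : K" "b : K" and z': "z : TB"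
    then have z: "z : T" by simp
    note addi = TB_smult_additive
    show "(a \<oplus>\<^sub>K b) \<odot>\<^bsub>TB\<^esub> z = a \<odot>\<^bsub>TB\<^esub> z \<oplus>\<^bsub>TB\<^esub> b \<odot>\<^bsub>TB\<^esub> z"
    proof (rule T_unique[OF _ _ T_ag _ z])
      show "additive_map T T (\<lambda>z. a \<odot>\<^bsub>TB\<^esub> z \<oplus>\<^bsub>TB\<^esub> b \<odot>\<^bsub>TB\<^esub> z)"
        using additive_mapD[OF addi[OF ab(1)]] additive_mapD[OF addi[OF ab(2)]]
        by (intro additive_mapI) (simp_all add: TT.a_ac)
    qed (use ab in \<open>auto intro!: addi simp: TB_smult_pure module.smult_l_distr[OF S_module] module.smult_closed[OF S_module] \<tau>_add2\<close>)
    show "(a \<otimes>\<^sub>K b) \<odot>\<^bsub>TB\<^esub> z = a \<odot>\<^bsub>TB\<^esub> (b \<odot>\<^bsub>TB\<^esub> z)"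
    proof (rule T_unique[OF _ _ T_ag _ z])
      show "additive_map T T (\<lambda>z. a \<odot>\<^bsub>TB\<^esub> (b \<odot>\<^bsub>TB\<^esub> z))"
        by (rule additive_map_comp[OF addi addi]) fact+
    qed (use ab in \<open>auto intro!: addi simp: TB_smult_pure module.smult_assoc1[OF S_module] module.smult_closed[OF S_module]\<close>)
  next
    fix z assume "z : TB"
    then have z: "z : T" by simp
    show "\<one>\<^sub>K \<odot>\<^bsub>TB\<^esub> z = z"
      by (rule T_unique[OF _ _ T_ag _ z, where \<psi>="\<lambda>z. z"])
        (auto intro!: TB_smult_additive additive_mapI simp: TB_smult_pure module.smult_one[OF S_module])
  qed (use additive_mapD[OF TB_smult_additive] in auto)
qed

lemma TB_ag: "abelian_group TB" by (rule module_abelian_group[OF TB_module])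

lemma linear_\<tau>1 [linear_intros]:
  assumes c: "c : S" and f: "linear_map K D XK f" shows "linear_map K D TB (\<lambda>x. \<tau> (f x) c)"
proof -
  have "linear_map K XK TB (\<lambda>x. \<tau> x c)"
    using c by (intro linear_mapI) (auto simp: \<tau>_add1 \<tau>_scalar TB_smult_pure)
  from linear_map_comp[OF this f] show ?thesis .
qed

lemma linear_\<tau>2 [linear_intros]:
  assumes x: "x : X" and f: "linear_map K D S f" shows "linear_map K D TB (\<lambda>d. \<tau> x (f d))"
proof -
  have "linear_map K S TB (\<lambda>c. \<tau> x c)"
    using x by (intro linear_mapI) (auto simp: \<tau>_add2 TB_smult_pure)
  from linear_map_comp[OF this f] show ?thesis .
qed

text \<open>The left action on generators; it extends to \<open>X \<otimes>\<^sub>B A#H\<close> once it is balanced in \<open>x\<close> and \<open>c\<close>.\<close>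

definition lact where
  "lact a h x c = sw T (\<lambda>u v. \<tau> (br u \<odot>\<^sub>X x) (smel a v \<bullet> c)) h"

lemma X_act_closed [simp, intro]: "[|r : \<H>; x : X|] ==> r \<odot>\<^sub>X x : X"
  by (rule X.smult_closed)

declare smel_closed [simp, intro]

lemma lact_closed: "[|a : A; h : H; x : X; c : S|] ==> lact a h x c : T"
  unfolding lact_def by (rule sw_closed[OF T_ag]) auto

lemma linear_smel_left [linear_intros]:
  "[|h : H; linear_map K D A f|] ==> linear_map K D S (\<lambda>x. smel (f x) h)"
  by (rule linear_map_comp[OF smel_linear_left])

lemma linear_smel_right [linear_intros]:
  "[|a : A; linear_map K D H f|] ==> linear_map K D S (\<lambda>x. smel a (f x))"
  by (rule linear_map_comp[OF smel_linear_right])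

lemma lact_TB: "lact a h x c = sw TB (\<lambda>u v. \<tau> (br u \<odot>\<^sub>X x) (smel a v \<bullet> c)) h"
  by (simp add: lact_def sw_TB)

lemma lact_linear_h: "[|a : A; x : X; c : S|] ==> linear_map K H TB (\<lambda>h. lact a h x c)"
  unfolding lact_TB by (auto intro!: linear_intros TB_module)

lemma lact_linear_a: "[|h : H; x : X; c : S|] ==> linear_map K A TB (\<lambda>a. lact a h x c)"
  unfolding lact_TB by (auto intro!: linear_intros TB_module)

lemma lact_linear_x: "[|a : A; h : H; c : S|] ==> linear_map K XK TB (\<lambda>x. lact a h x c)"
  unfolding lact_TB using module.smult_closed[OF XK_module] by (auto intro!: linear_intros TB_module)

lemma lact_linear_c: "[|a : A; h : H; x : X|] ==> linear_map K S TB (lact a h x)"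
  unfolding lact_TB[abs_def] using module.smult_closed[OF S_module] by (auto intro!: linear_intros TB_module)

text \<open>
  Balancedness of the left action: \<open>[h\<^sub>1]e\<^sub>k x \<otimes> (a#h\<^sub>2)c = e(h\<^sub>1k)[h\<^sub>2]x \<otimes> (a#h\<^sub>3)c\<close>, and \<open>e(h\<^sub>1k)\<close>
  moves across the tensor sign to \<open>\<iota>(h\<^sub>1k\<cdot>1)\<close>, which commutes with \<open>\<iota>(a)\<close> because it is central.
\<close>

lemma lact_eH:
  assumes a: "a : A" and h: "h : H" and k: "k : H" and x: "x : X" and c: "c : S"
  shows "lact a h (eH k \<odot>\<^sub>X x) c = lact a h x (\<delta> k \<bullet> c)"
proof -
  let ?sw = "sw TB"
  have "lact a h (eH k \<odot>\<^sub>X x) c = ?sw (\<lambda>u v. ?sw (\<lambda>p q. \<tau> (br q \<odot>\<^sub>X x) (\<delta> (p \<cdot> k) \<bullet> (smel a v \<bullet> c))) u) h"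
    unfolding lact_TB
  proof (intro sw_cong[OF TB_ag h])
    fix u v assume u: "u : H" and v: "v : H"
    have "\<tau> (br u \<odot>\<^sub>X (eH k \<odot>\<^sub>X x)) (smel a v \<bullet> c) = \<tau> ((br u \<otimes>\<^sub>\<H> eH k) \<odot>\<^sub>X x) (smel a v \<bullet> c)"
      using u k x by (simp add: X.smult_assoc)
    also have "\<dots> = ?sw (\<lambda>p q. \<tau> ((eH (p \<cdot> k) \<otimes>\<^sub>\<H> br q) \<odot>\<^sub>X x) (smel a v \<bullet> c)) u"
      unfolding br_eH[OF u k] using u v k x a c
      by (intro sw_linear_map[where \<phi>="\<lambda>r. \<tau> (r \<odot>\<^sub>X x) (smel a v \<bullet> c)"])
        (auto intro!: linear_intros TB_module Hp_module)
    also have "\<dots> = ?sw (\<lambda>p q. \<tau> (br q \<odot>\<^sub>X x) (\<delta> (p \<cdot> k) \<bullet> (smel a v \<bullet> c))) u"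
      using v k x a c by (intro sw_cong[OF TB_ag u]) (auto simp: X.smult_assoc \<tau>_eH)
    finally show "\<tau> (br u \<odot>\<^sub>X (eH k \<odot>\<^sub>X x)) (smel a v \<bullet> c) = \<dots>" .
  qed (use k x a c in \<open>auto intro!: sw_closed[OF TB_ag, unfolded TB_simps]\<close>)
  also have "\<dots> = ?sw (\<lambda>p w. ?sw (\<lambda>q v. \<tau> (br q \<odot>\<^sub>X x) (\<delta> (p \<cdot> k) \<bullet> (smel a v \<bullet> c))) w) h"
    using k x a c by (intro sw_coassoc[OF TB_module h]) (auto intro!: linear_intros)
  also have "\<dots> = ?sw (\<lambda>q w. ?sw (\<lambda>p v. \<tau> (br q \<odot>\<^sub>X x) (\<delta> (p \<cdot> k) \<bullet> (smel a v \<bullet> c))) w) h"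
    using k x a c by (intro sw3_swap12[OF TB_module h]) (auto intro!: linear_intros)
  also have "\<dots> = ?sw (\<lambda>q w. \<tau> (br q \<odot>\<^sub>X x) (smel a w \<bullet> (\<delta> k \<bullet> c))) h"
  proof (intro sw_cong[OF TB_ag h])
    fix q w assume q: "q : H" and w: "w : H"
    have "smel a w \<bullet> (\<delta> k \<bullet> c) = \<iota> a \<bullet> (\<pi> w \<bullet> \<delta> k) \<bullet> c"
      using a w k c by (simp add: smel_factor SS.m_assoc)
    also have "\<dots> = sw S (\<lambda>p v. \<iota> a \<bullet> (\<delta> (p \<cdot> k) \<bullet> \<pi> v) \<bullet> c) w"
      unfolding \<pi>_\<iota>_act_one[OF w k] using a w k c
      by (intro sw_linear_map[where \<phi>="\<lambda>r. \<iota> a \<bullet> r \<bullet> c"]) (auto intro!: linear_intros S_module)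
    also have "\<dots> = sw S (\<lambda>p v. \<delta> (p \<cdot> k) \<bullet> (smel a v \<bullet> c)) w"
    proof (intro sw_cong[OF S_ag w])
      fix p v assume pv: "p : H" "v : H"
      have "\<iota> a \<bullet> \<delta> (p \<cdot> k) = \<delta> (p \<cdot> k) \<bullet> \<iota> a"
        using a pv k act_one_central[of "p \<cdot> k" a] by (simp add: \<iota>_mult)
      then have "\<iota> a \<bullet> \<delta> (p \<cdot> k) \<bullet> (\<pi> v \<bullet> c) = \<delta> (p \<cdot> k) \<bullet> \<iota> a \<bullet> (\<pi> v \<bullet> c)" by simp
      then show "\<iota> a \<bullet> (\<delta> (p \<cdot> k) \<bullet> \<pi> v) \<bullet> c = \<delta> (p \<cdot> k) \<bullet> (smel a v \<bullet> c)"
        using a pv k c by (simp add: smel_factor SS.m_assoc)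
    qed (use a k c in auto)
    finally have eq: "smel a w \<bullet> (\<delta> k \<bullet> c) = \<dots>" .
    show "?sw (\<lambda>p v. \<tau> (br q \<odot>\<^sub>X x) (\<delta> (p \<cdot> k) \<bullet> (smel a v \<bullet> c))) w =
      \<tau> (br q \<odot>\<^sub>X x) (smel a w \<bullet> (\<delta> k \<bullet> c))"
      unfolding eq using q w a k c x
      by (intro sw_linear_map[symmetric]) (auto intro!: linear_intros TB_module S_module)
  qed (use a k c x in auto)
  finally show ?thesis by (simp add: lact_TB)
qed

lemma lact_balanced:
  assumes a: "a : A" and h: "h : H"
  shows "middle_linear Bp RT SP T (lact a h)"
proof (rule balancedI[OF T_ag])
  show "additive_map S T (lact a h x)" if "x : X" for x
    using linear_map_additive[OF lact_linear_c[OF a h that]] by (simp add: additive_map_def)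
  show "additive_map X T (\<lambda>x. lact a h x c)" if "c : S" for c
    using linear_map_additive[OF lact_linear_x[OF a h that]] by (simp add: additive_map_def)
  show "lact a h ((sc k) \<odot>\<^sub>X x) c = lact a h x (k \<odot>\<^sub>S c)"
    if "k : K" "x : X" "c : S" for k x c
    using linear_mapD(3)[OF lact_linear_x[OF a h that(3)], of k x] linear_mapD(3)[OF lact_linear_c[OF a h that(2)], of k c] that
    by simp
qed (use lact_eH a h in auto)

abbreviation "bl \<equiv> balanced_left K H A act X"
abbreviation "br_act \<equiv> balanced_right K H A act X"

definition lact' where "lact' a h z = tensor_lift T (lact a h) z"

lemma lact'_pure: "[|a : A; h : H; x : X; c : S|] ==> lact' a h (\<tau> x c) = lact a h x c"
  unfolding lact'_def by (rule lift_pure[OF T_ag lact_balanced])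

lemma lact'_additive: "[|a : A; h : H|] ==> additive_map T T (lact' a h)"
  unfolding lact'_def[abs_def] by (rule lift_additive[OF T_ag lact_balanced])

lemma bl_eq: "bl p z = tensor_lift T (\<lambda>a h. lact' a h z) p"
  by (simp add: balanced_left_def lact'_def lact_def[abs_def] S_mult_eq)

lemma lact'_middle:
  assumes z: "z : T" shows "middle_linear K A H T (\<lambda>a h. lact' a h z)"
proof (rule middle_linearI)
  show "additive_map H T (\<lambda>h. lact' a h z)" if "a : A" for a
    unfolding lact'_def using that linear_map_additive[OF lact_linear_h]
    by (intro T_lift_additive_fun[OF T_ag z]) (simp add: additive_map_def)
  show "additive_map A T (\<lambda>a. lact' a h z)" if "h : H" for h
    unfolding lact'_def using that linear_map_additive[OF lact_linear_a]
    by (intro T_lift_additive_fun[OF T_ag z]) (simp add: additive_map_def)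
  show "lact' (k \<odot>\<^sub>A a) h z = lact' a (k \<odot>\<^sub>H h) z" if "k : K" "a : A" "h : H" for k a h
    unfolding lact'_def
  proof (rule T_lift_cong[OF T_ag z])
    fix x c assume xc: "x : X" "c : S"
    show "lact (k \<odot>\<^sub>A a) h x c = lact a (k \<odot>\<^sub>H h) x c"
      using linear_mapD(3)[OF lact_linear_a[OF that(3) xc], of k a] linear_mapD(3)[OF lact_linear_h[OF that(2) xc], of k h] that
      by simp
    show "lact a (k \<odot>\<^sub>H h) x c : T" using that xc by (intro lact_closed) (auto intro: module.smult_closed[OF H_module])
  qed
qed

lemma bl_pure: "[|a : A; h : H; z : T|] ==> bl (pt a h) z = lact' a h z"
  unfolding bl_eq by (rule AH.tensor_lift_pure[OF T_ag lact'_middle])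

lemma bl_additive1: "z : T ==> additive_map TT T (\<lambda>p. bl p z)"
  using AH.tensor_lift_additive[OF T_ag lact'_middle] by (simp add: additive_map_def bl_eq)

lemma bl_additive2: "p : TT ==> additive_map T T (bl p)"
  unfolding bl_eq[abs_def] by (rule AH.tensor_lift_additive_fun[OF T_ag]) (use lact'_additive in auto)

lemma bl_closed: "[|p : TT; z : T|] ==> bl p z : T"
  by (rule additive_mapD(1)[OF bl_additive2])

lemma lact'_smult:
  assumes "k : K" "a : A" "h : H" and z: "z : T"
  shows "lact' (k \<odot>\<^sub>A a) h z = k \<odot>\<^bsub>TB\<^esub> lact' a h z"
proof (rule T_unique[OF _ _ T_ag _ z])
  show "additive_map T T (lact' (k \<odot>\<^sub>A a) h)" using assms by (intro lact'_additive) auto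
  show "additive_map T T (\<lambda>z. k \<odot>\<^bsub>TB\<^esub> lact' a h z)"
    by (rule additive_map_comp[OF lact'_additive TB_smult_additive]) fact+
  show "lact' (k \<odot>\<^sub>A a) h (\<tau> x c) = k \<odot>\<^bsub>TB\<^esub> lact' a h (\<tau> x c)" if "x : X" "c : S" for x c
    using assms that linear_mapD(3)[OF lact_linear_a[OF assms(3) that]] by (simp add: lact'_pure)
qed

lemma bl_smult:
  assumes k: "k : K" and p: "p : TT" and z: "z : T"
  shows "bl (k \<odot>\<^bsub>TT\<^esub> p) z = k \<odot>\<^bsub>TB\<^esub> bl p z"
proof -
  have p': "p : AH.T" using p by simp
  have eq: "additive_map TT T F \<longleftrightarrow> additive_map AH.T T F" for F by (simp add: additive_map_def)
  have s: "additive_map TT TT (\<lambda>p. k \<odot>\<^bsub>TT\<^esub> p)" by (rule linear_map_additive[OF module_smult_linear[OF TT_module k]])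
  show ?thesis
  proof (rule AH.additive_map_unique[OF _ _ T_ag _ p'])
    show "additive_map AH.T T (\<lambda>p. bl (k \<odot>\<^bsub>TT\<^esub> p) z)"
      unfolding eq[symmetric] by (rule additive_map_comp[OF s bl_additive1[OF z]])
    show "additive_map AH.T T (\<lambda>p. k \<odot>\<^bsub>TB\<^esub> bl p z)"
      unfolding eq[symmetric] by (rule additive_map_comp[OF bl_additive1[OF z] TB_smult_additive[OF k]])
    show "bl (k \<odot>\<^bsub>TT\<^esub> pt a h) z = k \<odot>\<^bsub>TB\<^esub> bl (pt a h) z" if "a : A" "h : H" for a h
      using that k z by (simp add: AH.smult_pure bl_pure lact'_smult A.smult_closed)
  qed
qed

text \<open>
  \<open>a#h\<close> is the tensor \<open>a(h\<^sub>1\<cdot>1) \<otimes> h\<^sub>2\<close>; in the action of this tensor the factor \<open>h\<^sub>1\<cdot>1\<close> is absorbed by the \<open>\<pi>\<close>-factor of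
  \<open>smel\<close>, since the coproduct factors of \<open>h\<close> may be permuted.
\<close>

lemma bl_smel:
  assumes a: "a : A" and h: "h : H" and x: "x : X" and c: "c : S"
  shows "bl (smel a h) (\<tau> x c) = lact a h x c"
proof -
  let ?sw = "sw TB"
  have z: "\<tau> x c : T" using x c by simp
  have "bl (smel a h) (\<tau> x c) = sw T (\<lambda>u v. bl (pt (a \<otimes>\<^sub>A act u \<one>\<^sub>A) v) (\<tau> x c)) h"
    unfolding smash_elem_def using a by (intro sw_map[OF bl_additive1[OF z] TT_ag T_ag h]) simp
  also have "\<dots> = ?sw (\<lambda>u v. bl (pt (a \<otimes>\<^sub>A act u \<one>\<^sub>A) v) (\<tau> x c)) h" by (simp add: sw_TB)
  also have "\<dots> = ?sw (\<lambda>u v. ?sw (\<lambda>p q. \<tau> (br p \<odot>\<^sub>X x) (smel (a \<otimes>\<^sub>A act u \<one>\<^sub>A) q \<bullet> c)) v) h"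
    using a x c by (intro sw_cong[OF TB_ag h])
      (auto simp: bl_pure lact'_pure lact_TB intro!: sw_closed[OF TB_ag, unfolded TB_simps])
  also have "\<dots> = ?sw (\<lambda>p v. ?sw (\<lambda>u q. \<tau> (br p \<odot>\<^sub>X x) (smel (a \<otimes>\<^sub>A act u \<one>\<^sub>A) q \<bullet> c)) v) h"
    using a x c by (intro sw3_swap12[OF TB_module h]) (auto intro!: linear_intros)
  also have "\<dots> = ?sw (\<lambda>p v. \<tau> (br p \<odot>\<^sub>X x) (smel a v \<bullet> c)) h"
  proof (intro sw_cong[OF TB_ag h])
    fix p v assume p: "p : H" and v: "v : H"
    have "smel a v \<bullet> c = \<iota> a \<bullet> sw S (\<lambda>u q. \<delta> u \<bullet> \<pi> q) v \<bullet> c"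
      using a v by (simp add: \<pi>_absorb smel_factor)
    also have "\<dots> = sw S (\<lambda>u q. \<iota> a \<bullet> (\<delta> u \<bullet> \<pi> q) \<bullet> c) v"
      using a v c by (intro sw_linear_map[where \<phi>="\<lambda>r. \<iota> a \<bullet> r \<bullet> c"]) (auto intro!: linear_intros S_module)
    also have "\<dots> = sw S (\<lambda>u q. smel (a \<otimes>\<^sub>A act u \<one>\<^sub>A) q \<bullet> c) v"
      using a c by (intro sw_cong[OF S_ag v]) (auto simp: smel_factor \<iota>_mult[symmetric] SS.m_assoc)
    finally have eq: "smel a v \<bullet> c = \<dots>" .
    show "?sw (\<lambda>u q. \<tau> (br p \<odot>\<^sub>X x) (smel (a \<otimes>\<^sub>A act u \<one>\<^sub>A) q \<bullet> c)) v = \<tau> (br p \<odot>\<^sub>X x) (smel a v \<bullet> c)"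
      unfolding eq using p v a c x
      by (intro sw_linear_map[symmetric]) (auto intro!: linear_intros TB_module S_module)
  qed (use a c x in auto)
  finally show ?thesis by (simp add: lact_TB)
qed

lemma ract_balanced: "q : S ==> middle_linear Bp RT SP T (\<lambda>x c. \<tau> x (c \<bullet> q))"
  using unital_algebra.smult_mult_left[OF S_algebra] module.smult_closed[OF S_module]
  by (intro balancedI[OF T_ag] additive_mapI)
    (simp_all add: \<tau>_add1 \<tau>_add2 SS.l_distr \<tau>_scalar \<tau>_eH SS.m_assoc)

lemma ract_eq: "br_act z q = tensor_lift T (\<lambda>x c. \<tau> x (c \<bullet> q)) z"
  by (simp add: balanced_right_def S_mult_eq)

lemma ract_pure: "[|x : X; c : S; q : S|] ==> br_act (\<tau> x c) q = \<tau> x (c \<bullet> q)"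
  unfolding ract_eq by (rule lift_pure[OF T_ag ract_balanced])

lemma ract_additive: "q : S ==> additive_map T T (\<lambda>z. br_act z q)"
  unfolding ract_eq using lift_additive[OF T_ag ract_balanced] by (simp add: additive_map_def)

lemma ract_additive2: "z : T ==> additive_map S T (br_act z)"
  unfolding ract_eq[abs_def]
  by (rule T_lift_additive_fun[OF T_ag]) (auto intro!: additive_mapI simp: SS.r_distr \<tau>_add2)

lemma ract_closed: "[|z : T; q : S|] ==> br_act z q : T"
  by (rule additive_mapD(1)[OF ract_additive])

lemma ract_scalar:
  assumes k: "k : K" and q: "q : S" and z: "z : T"
  shows "br_act (k \<odot>\<^bsub>TB\<^esub> z) q = br_act z (k \<odot>\<^sub>S q)"
proof (rule T_unique[OF _ _ T_ag _ z])
  show "additive_map T T (\<lambda>z. br_act (k \<odot>\<^bsub>TB\<^esub> z) q)"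
    by (rule additive_map_comp[OF TB_smult_additive[OF k] ract_additive[OF q]])
  show "additive_map T T (\<lambda>z. br_act z (k \<odot>\<^sub>S q))" using k q module.smult_closed[OF S_module] by (intro ract_additive) simp
  show "br_act (k \<odot>\<^bsub>TB\<^esub> \<tau> x c) q = br_act (\<tau> x c) (k \<odot>\<^sub>S q)" if "x : X" "c : S" for x c
    using that k q by (simp add: TB_smult_pure ract_pure unital_algebra.smult_mult_left[OF S_algebra] unital_algebra.smult_mult_right[OF S_algebra] module.smult_closed[OF S_module])
qed

lemma ract_one:
  assumes z: "z : T" shows "br_act z \<one>\<^sub>S = z"
  by (rule T_unique[OF _ _ T_ag _ z, where \<psi>="\<lambda>z. z"])
    (auto intro!: ract_additive additive_mapI simp: ract_pure)

lemma lact_one_left: 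
  assumes a: "a : A" and x: "x : X" and c: "c : S"
  shows "lact a \<one>\<^sub>H x c = \<tau> x (\<iota> a \<bullet> c)"
proof -
  have "lact a \<one>\<^sub>H x c = \<tau> (br \<one>\<^sub>H \<odot>\<^sub>X x) (smel a \<one>\<^sub>H \<bullet> c)"
    unfolding lact_TB using assms by (intro sw_one[OF TB_module]) (auto intro!: linear_intros)
  then show ?thesis using x by (simp add: br_one X.smult_one \<iota>_def)
qed

lemma bl_one:
  assumes z: "z : T" shows "bl \<one>\<^sub>S z = z"
proof (rule T_unique[OF _ _ T_ag _ z, where \<psi>="\<lambda>z. z"])
  show "additive_map T T (bl \<one>\<^sub>S)" by (rule bl_additive2[OF S_TT[OF SS.one_closed]])
  show "bl \<one>\<^sub>S (\<tau> x c) = \<tau> x c" if "x : X" "c : S" for x c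
    using bl_smel[of "\<one>\<^sub>A" "\<one>\<^sub>H" x c] that by (simp add: \<iota>_def[symmetric] \<iota>_one lact_one_left)
qed (auto intro: additive_mapI)

abbreviation "TS \<equiv> tensor_smash K H A act X"

lemma TS_simps [simp]: "carrier TS = carrier T" "add TS = add T" "zero TS = zero T"
  by (simp_all add: tensor_smash_def)

lemma TS_middle: "z : T ==> middle_linear K S (opp S) T (\<lambda>p q. br_act (bl p z) q)"
proof (rule middle_linearI)
  assume z: "z : T"
  show "additive_map (opp S) T (br_act (bl p z))" if "p : S" for p
    using ract_additive2[OF bl_closed[OF S_TT[OF that] z]] by (simp add: additive_map_def)
  show "additive_map S T (\<lambda>p. br_act (bl p z) q)" if "q : (opp S)" for q
  proof -
    have "additive_map S T (\<lambda>p. bl p z)" using bl_additive1[OF z] S_TT by (simp add: additive_map_def smash_simps(4) Pi_iff del: AH.tensor_simps)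
    from additive_map_comp[OF this ract_additive[of q]] show ?thesis using that by simp
  qed
  show "br_act (bl (k \<odot>\<^sub>S p) z) q = br_act (bl p z) (k \<odot>\<^bsub>opp S\<^esub> q)"
    if "k : K" "p : S" "q : (opp S)" for k p q
    using that z by (simp add: smash_simps(6) bl_smult S_TT ract_scalar bl_closed del: AH.tensor_simps)
qed

lemma TS_smult:
  shows "\<And>z. z : T ==> additive_map ES.BB.T TS (\<lambda>t. t \<odot>\<^bsub>TS\<^esub> z)"
    and "\<And>p q z. [|p : S; q : S; z : T|] ==> ES.eb p q \<odot>\<^bsub>TS\<^esub> z = br_act (bl p z) q"
  unfolding tensor_smash_def
  using ES.bimodule_smult[where P=T and l=bl and r=br_act, OF T_ag TS_middle] by auto

lemma TS_ag: "abelian_group TS"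
  unfolding tensor_smash_def bimodule_def using T_ag by simp

end

section \<open>The adjunction\<close>

context tensor_mod
begin

text \<open>
  \<open>\<pi>(h\<^sub>1)(x \<otimes> 1)\<pi>(\<S>(h\<^sub>2)) = [h\<^sub>1]x \<otimes> \<pi>(h\<^sub>2)\<pi>(\<S>(h\<^sub>3)) = [h\<^sub>1]x \<otimes> \<iota>(h\<^sub>2\<cdot>1)\<close>.  Over \<open>B\<close> this is \<open>e(h\<^sub>2)[h\<^sub>1]x \<otimes> 1\<close>, and
  \<open>e(h\<^sub>2)[h\<^sub>1] = [h]\<close>.
\<close>

lemma twist_pure:
  assumes h: "h : H" and x: "x : X"
  shows "sw TB (\<lambda>u v. br_act (bl (\<pi> u) (\<tau> x \<one>\<^sub>S)) (\<pi> (\<S> v))) h = \<tau> (br h \<odot>\<^sub>X x) \<one>\<^sub>S"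
proof -
  let ?sw = "sw TB"
  have one: "\<one>\<^sub>S : S" by (rule SS.one_closed)
  have "?sw (\<lambda>u v. br_act (bl (\<pi> u) (\<tau> x \<one>\<^sub>S)) (\<pi> (\<S> v))) h =
    ?sw (\<lambda>u v. ?sw (\<lambda>p q. \<tau> (br p \<odot>\<^sub>X x) (\<pi> q \<bullet> \<pi> (\<S> v))) u) h"
  proof (intro sw_cong[OF TB_ag h])
    fix u v assume u: "u : H" and v: "v : H"
    have add: "additive_map TB TB (\<lambda>z. br_act z (\<pi> (\<S> v)))"
      using ract_additive[of "\<pi> (\<S> v)"] v by (simp add: additive_map_def)
    have "bl (\<pi> u) (\<tau> x \<one>\<^sub>S) = ?sw (\<lambda>p q. \<tau> (br p \<odot>\<^sub>X x) (\<pi> q)) u"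
      using bl_smel[of "\<one>\<^sub>A" u x "\<one>\<^sub>S"] u x one
      by (simp add: lact_TB \<pi>_def) (intro sw_cong[OF TB_ag u], auto)
    also have "br_act \<dots> (\<pi> (\<S> v)) = ?sw (\<lambda>p q. br_act (\<tau> (br p \<odot>\<^sub>X x) (\<pi> q)) (\<pi> (\<S> v))) u"
      using x by (intro sw_map[OF add TB_ag TB_ag u]) auto
    also have "\<dots> = ?sw (\<lambda>p q. \<tau> (br p \<odot>\<^sub>X x) (\<pi> q \<bullet> \<pi> (\<S> v))) u"
      using x v by (intro sw_cong[OF TB_ag u]) (auto simp: ract_pure)
    finally show "br_act (bl (\<pi> u) (\<tau> x \<one>\<^sub>S)) (\<pi> (\<S> v)) = \<dots>" .
  qed (use x in \<open>auto intro!: sw_closed[OF TB_ag, unfolded TB_simps]\<close>)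
  also have "\<dots> = ?sw (\<lambda>p w. ?sw (\<lambda>q v. \<tau> (br p \<odot>\<^sub>X x) (\<pi> q \<bullet> \<pi> (\<S> v))) w) h"
    using x by (intro sw_coassoc[OF TB_module h]) (auto intro!: linear_intros)
  also have "\<dots> = ?sw (\<lambda>p w. \<tau> ((eH w \<otimes>\<^sub>\<H> br p) \<odot>\<^sub>X x) \<one>\<^sub>S) h"
  proof (intro sw_cong[OF TB_ag h])
    fix p w assume p: "p : H" and w: "w : H"
    have "sw S (\<lambda>q v. \<pi> q \<bullet> \<pi> (\<S> v)) w = \<delta> w"
      using \<pi>_\<pi>_antipode[OF w H_one_closed] w by (simp add: \<pi>_one H_r_one cong: sw_cong[OF S_ag w])
    then have "?sw (\<lambda>q v. \<tau> (br p \<odot>\<^sub>X x) (\<pi> q \<bullet> \<pi> (\<S> v))) w = \<tau> (br p \<odot>\<^sub>X x) (\<delta> w)"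
      using p w x sw_linear_map[OF linear_\<tau>2[OF X_act_closed[OF _ x] linear_map_id] S_module TB_module w, of "br p" "\<lambda>q v. \<pi> q \<bullet> \<pi> (\<S> v)"]
      by simp
    also have "\<dots> = \<tau> ((eH w \<otimes>\<^sub>\<H> br p) \<odot>\<^sub>X x) \<one>\<^sub>S"
      using p w x one by (simp add: X.smult_assoc \<tau>_eH)
    finally show "?sw (\<lambda>q v. \<tau> (br p \<odot>\<^sub>X x) (\<pi> q \<bullet> \<pi> (\<S> v))) w = \<dots>" .
  qed (use x one in auto)
  also have "\<dots> = \<tau> (sw \<H> (\<lambda>p w. eH w \<otimes>\<^sub>\<H> br p) h \<odot>\<^sub>X x) \<one>\<^sub>S"
    using x one h
    by (intro sw_linear_map[where \<phi>="\<lambda>r. \<tau> (r \<odot>\<^sub>X x) \<one>\<^sub>S", symmetric])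
      (auto intro!: linear_intros TB_module Hp_module)
  finally show ?thesis by (simp add: eH_br_sum[OF h])
qed

lemma S_unique:
  assumes "additive_map S N \<phi>" "additive_map S N \<psi>" "abelian_group N"
    and "\<And>a h. [|a : A; h : H|] ==> \<phi> (smel a h) = \<psi> (smel a h)" and p: "p : S"
  shows "\<phi> p = \<psi> p"
  using p
proof (induction p rule: S_induct)
  case zero
  show ?case using additive_map_zero[OF assms(1) S_ag assms(3)] additive_map_zero[OF assms(2) S_ag assms(3)] by simp
qed (simp_all add: assms(4) additive_mapD[OF assms(1)] additive_mapD[OF assms(2)])

lemma bl_additive_S: "z : T ==> additive_map S T (\<lambda>p. bl p z)"
  using bl_additive1[of z] S_TT by (simp add: additive_map_def smash_simps(4) Pi_iff del: AH.tensor_simps)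

text \<open>
  Both sides are additive, so the bimodule property can be tested on pure tensors.
\<close>

lemma TS_linearI:
  assumes N: "abelian_group N" and add: "additive_map T N G"
    and N1: "\<And>y. y : N ==> additive_map ES.BB.T N (\<lambda>r. r \<odot>\<^sub>N y)"
    and N2: "\<And>p q. [|p : S; q : S|] ==> additive_map N N (\<lambda>y. ES.eb p q \<odot>\<^sub>N y)"
    and e: "\<And>p q x c. [|p : S; q : S; x : X; c : S|] ==>
      G (br_act (bl p (\<tau> x c)) q) = ES.eb p q \<odot>\<^sub>N G (\<tau> x c)"
  shows "linear_map (env K S) TS N G"
proof (rule ES.env_linearI[OF TS_ag N])
  show "additive_map TS N G" using add by (simp add: additive_map_def)
  show "\<And>x. x : TS ==> additive_map ES.BB.T TS (\<lambda>r. r \<odot>\<^bsub>TS\<^esub> x)" using TS_smult(1) by simp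
  fix p q z assume pq: "p : S" "q : S" and z: "z : TS"
  have 1: "additive_map T N (\<lambda>z. G (br_act (bl p z) q))"
    by (rule additive_map_comp[OF additive_map_comp[OF bl_additive2[OF S_TT[OF pq(1)]] ract_additive[OF pq(2)]] add])
  have "G (br_act (bl p z) q) = ES.eb p q \<odot>\<^sub>N G z"
    by (rule T_unique[OF 1 additive_map_comp[OF add N2[OF pq]] N]) (use e pq z in auto)
  then show "G (ES.eb p q \<odot>\<^bsub>TS\<^esub> z) = ES.eb p q \<odot>\<^sub>N G z" using pq z by (simp add: TS_smult(2))
qed (rule N1)

lemma TS_hom_eqI:
  assumes "G \<in> mod_hom (env K S) TS N" "G' \<in> mod_hom (env K S) TS N" "abelian_group N"
    and "\<And>x c. [|x : X; c : S|] ==> G (\<tau> x c) = G' (\<tau> x c)"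
  shows "G = G'"
proof (rule mod_hom_eqI[OF assms(1,2)])
  fix z assume "z : TS"
  then show "G z = G' z"
    using linear_map_additive[OF mod_homD(1)[OF assms(1)]] linear_map_additive[OF mod_homD(1)[OF assms(2)]]
    by (intro T_unique[OF _ _ assms(3), of G G' z]) (auto simp: additive_map_def assms(4))
qed

lemma TS_smult_closed: "[|r : (env K S); z : TS|] ==> r \<odot>\<^bsub>TS\<^esub> z : TS"
  using additive_mapD(1)[OF TS_smult(1)] by (simp add: ES.EB_simps(1))

lemma TS_add_closed: "[|y : TS; z : TS|] ==> y \<oplus>\<^bsub>TS\<^esub> z : TS"
  by (rule abelian_monoid.a_closed[OF abelian_group.axioms(1)[OF TS_ag]])

end

locale hom_tensor = tensor_mod K H A act X + env_module K H A act M
  for K :: "('k, 's) ring_scheme" (structure) and H :: "('k, 'h, 'z) hopf_scheme" (structure)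
    and A :: "('k, 'a, 'w) module_scheme" (structure) and act :: "'h \<Rightarrow> 'a \<Rightarrow> 'a"
    and X :: "('k, 'h, 'x) par_module"
    and M :: "('a, 'h, 'm) smash_env_module"
begin

lemma R_additive: "s : S ==> additive_map M M (\<lambda>m. R m s)"
  using ES.r_closed[OF M] ES.r_add2[OF M] by (intro additive_mapI)

context
  fixes F assumes F: "F \<in> mod_hom \<H> X HomA"
begin

lemma F_val:
  assumes x: "x : X"
  shows "central (F x \<one>\<^sub>A)" "F x = cfun (F x \<one>\<^sub>A)" "F x \<one>\<^sub>A : M"
proof -
  have Fx: "F x \<in> mod_hom (env K A) RA RM" using linear_mapD(1)[OF mod_homD(1)[OF F] x] by simp
  from hom_cfun[OF this] show "central (F x \<one>\<^sub>A)" "F x = cfun (F x \<one>\<^sub>A)" .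
  show "F x \<one>\<^sub>A : M" by (rule centralM[OF hom_cfun(1)[OF Fx]])
qed

lemma F_add: "[|x : X; y : X|] ==> F (x \<oplus>\<^sub>X y) \<one>\<^sub>A = F x \<one>\<^sub>A \<oplus>\<^sub>M F y \<one>\<^sub>A"
  by (subst linear_mapD(2)[OF mod_homD(1)[OF F]]) simp_all

lemma F_br:
  assumes h: "h : H" and x: "x : X"
  shows "F (br h \<odot>\<^sub>X x) \<one>\<^sub>A = twist h (F x \<one>\<^sub>A)"
proof -
  have "F (br h \<odot>\<^sub>X x) = br h \<odot>\<^bsub>HomA\<^esub> F x"
    using h x by (intro linear_mapD(3)[OF mod_homD(1)[OF F]]) auto
  also have "\<dots> = br h \<odot>\<^bsub>HomA\<^esub> cfun (F x \<one>\<^sub>A)" by (rule arg_cong[OF F_val(2)[OF x]])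
  also have "\<dots> = cfun (twist h (F x \<one>\<^sub>A))" by (rule HomA_module(2)[OF h F_val(1)[OF x]])
  finally show ?thesis using cfun_one[OF central_twist[OF h F_val(1)[OF x]]] by simp
qed

lemma F_scalar:
  assumes k: "k : K" and x: "x : X"
  shows "F ((sc k) \<odot>\<^sub>X x) \<one>\<^sub>A = k \<odot>\<^bsub>MK\<^esub> F x \<one>\<^sub>A"
proof -
  have "F ((sc k) \<odot>\<^sub>X x) = (sc k) \<odot>\<^bsub>HomA\<^esub> F x"
    using scalar_Hp[OF k] x by (intro linear_mapD(3)[OF mod_homD(1)[OF F]])
  also have "\<dots> = (sc k) \<odot>\<^bsub>HomA\<^esub> cfun (F x \<one>\<^sub>A)" by (rule arg_cong[OF F_val(2)[OF x]])
  also have "\<dots> = cfun (k \<odot>\<^bsub>MK\<^esub> F x \<one>\<^sub>A)" by (rule HomA_module(3)[OF k F_val(1)[OF x]])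
  finally show ?thesis using cfun_one[OF central_smult[OF k F_val(1)[OF x]]] by simp
qed

lemma F_additive: "additive_map X M (\<lambda>x. F x \<one>\<^sub>A)"
  by (intro additive_mapI F_val(3) F_add)

text \<open>
  \<open>F(e\<^sub>hx)(1) = [h\<^sub>1] \<triangleright> ([\<S>(h\<^sub>2)] \<triangleright> m)\<close> for the central element \<open>m = F(x)(1)\<close>, on which this is multiplication by
  \<open>\<iota>(h\<cdot>1)\<close>.
\<close>

lemma F_eH:
  assumes h: "h : H" and x: "x : X"
  shows "F (eH h \<odot>\<^sub>X x) \<one>\<^sub>A = L (\<delta> h) (F x \<one>\<^sub>A)"
proof -
  have "F (eH h \<odot>\<^sub>X x) \<one>\<^sub>A = F (sw X (\<lambda>u v. (br u \<otimes>\<^sub>\<H> br (\<S> v)) \<odot>\<^sub>X x) h) \<one>\<^sub>A"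
    unfolding hpar_e_def using h x by (subst module_sw[OF X]) auto
  also have "\<dots> = sw M (\<lambda>u v. F ((br u \<otimes>\<^sub>\<H> br (\<S> v)) \<odot>\<^sub>X x) \<one>\<^sub>A) h"
    using x by (intro sw_map[OF F_additive X_ag M_ag h]) auto
  also have "\<dots> = sw M (\<lambda>u v. twist u (twist (\<S> v) (F x \<one>\<^sub>A))) h"
    using x F_val(3)[OF x] by (intro sw_cong[OF M_ag h]) (auto simp: X.smult_assoc F_br)
  also have "\<dots> = L (\<delta> h) (F x \<one>\<^sub>A)"
    using twist_partial_rep(1)[OF h h F_val(1)[OF x]] by simp
  finally show ?thesis .
qed

lemma F_balanced: "middle_linear Bp RT SP M (\<lambda>x c. R (F x \<one>\<^sub>A) c)"
proof (rule balancedI[OF M_ag])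
  show "additive_map S M (R (F x \<one>\<^sub>A))" if "x : X" for x
    using linear_map_additive[OF ES.r_linear1[OF M F_val(3)[OF that]]] by (simp add: additive_map_def)
  show "additive_map X M (\<lambda>x. R (F x \<one>\<^sub>A) c)" if "c : S" for c
    by (rule additive_map_comp[OF F_additive R_additive[OF that]])
  show "R (F ((sc k) \<odot>\<^sub>X x) \<one>\<^sub>A) c = R (F x \<one>\<^sub>A) (k \<odot>\<^sub>S c)"
    if "k : K" "x : X" "c : S" for k x c
    unfolding F_scalar[OF that(1,2)] R_scalar[OF that(1,3) F_val(3)[OF that(2)]]
    using linear_mapD(3)[OF ES.r_linear1[OF M F_val(3)[OF that(2)]] that(1,3)] by simp
  show "R (F (eH h \<odot>\<^sub>X x) \<one>\<^sub>A) c = R (F x \<one>\<^sub>A) (\<delta> h \<bullet> c)"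
    if "h : H" "x : X" "c : S" for h x c
    unfolding F_eH[OF that(1,2)] using that F_val(3)[OF that(2)]
    by (simp add: centralD[OF F_val(1)[OF that(2)]] ES.r_mult[OF M])
qed

text \<open>
  With \<open>m = F(x)(1)\<close>: \<open>([h\<^sub>1] \<triangleright> m)\<iota>(a)\<pi>(h\<^sub>2)c = \<iota>(a)([h\<^sub>1] \<triangleright> m)\<pi>(h\<^sub>2)c = \<iota>(a)\<pi>(h)mc\<close>.
\<close>

lemma F_lact:
  assumes a: "a : A" and h: "h : H" and x: "x : X" and c: "c : S"
  shows "tensor_lift M (\<lambda>x c. R (F x \<one>\<^sub>A) c) (lact a h x c) = L (smel a h) (R (F x \<one>\<^sub>A) c)"
proof -
  let ?m = "F x \<one>\<^sub>A"
  note m = F_val(3)[OF x] and mc = F_val(1)[OF x]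
  have m': "?m : MK" using m by simp
  have "tensor_lift M (\<lambda>x c. R (F x \<one>\<^sub>A) c) (lact a h x c) =
    sw M (\<lambda>u v. tensor_lift M (\<lambda>x c. R (F x \<one>\<^sub>A) c) (\<tau> (br u \<odot>\<^sub>X x) (smel a v \<bullet> c))) h"
    unfolding lact_def using a x c by (intro sw_map[OF lift_additive[OF M_ag F_balanced] T_ag M_ag h]) auto
  also have "\<dots> = sw MK (\<lambda>u v. L (\<iota> a) (R (R (twist u ?m) (\<pi> v)) c)) h"
    unfolding sw_restrict_K
  proof (intro sw_cong[OF M_ag h])
    fix u v assume u: "u : H" and v: "v : H"
    have t: "twist u ?m : M" using u m by simp
    have "tensor_lift M (\<lambda>x c. R (F x \<one>\<^sub>A) c) (\<tau> (br u \<odot>\<^sub>X x) (smel a v \<bullet> c)) = R (twist u ?m) (smel a v \<bullet> c)"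
      using a c u v x by (subst lift_pure[OF M_ag F_balanced]) (auto simp: F_br)
    also have "\<dots> = R (R (R (twist u ?m) (\<iota> a)) (\<pi> v)) c"
      using a c u v t by (simp add: smel_factor ES.r_mult[OF M])
    also have "\<dots> = L (\<iota> a) (R (R (twist u ?m) (\<pi> v)) c)"
      using a c v t by (simp add: centralD[OF central_twist[OF u mc], symmetric] ES.l_r[OF M])
    finally show "tensor_lift M (\<lambda>x c. R (F x \<one>\<^sub>A) c) (\<tau> (br u \<odot>\<^sub>X x) (smel a v \<bullet> c)) = \<dots>" .
    show "L (\<iota> a) (R (R (twist u ?m) (\<pi> v)) c) : M" using a c v t by simp
  qed
  also have "\<dots> = L (\<iota> a) (R (sw MK (\<lambda>u v. R (twist u ?m) (\<pi> v)) h) c)"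
    using a c m' h by (subst R_sw, simp_all del: sw_restrict_K) (subst L_sw, simp_all del: sw_restrict_K)
  also have "\<dots> = L (\<iota> a) (R (L (\<pi> h) ?m) c)" by (subst twist_\<pi>[OF h mc]) simp
  also have "\<dots> = L (smel a h) (R ?m c)" using a h c m by (simp add: smel_factor ES.l_mult[OF M] ES.l_r[OF M])
  finally show ?thesis .
qed

lemma F_hom: "(\<lambda>z\<in>carrier TS. tensor_lift M (\<lambda>x c. R (F x \<one>\<^sub>A) c) z) \<in> mod_hom (env K S) TS M"
proof (rule mod_hom_restrictI[OF TS_linearI[OF M_ag lift_additive[OF M_ag F_balanced] ES.left_module_env(1)[OF M]]])
  let ?G = "tensor_lift M (\<lambda>x c. R (F x \<one>\<^sub>A) c)"
  note G = lift_additive[OF M_ag F_balanced]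
  fix p q x c assume p: "p : S" and q: "q : S" and x: "x : X" and c: "c : S"
  let ?m = "F x \<one>\<^sub>A"
  note m = F_val(3)[OF x]
  have t: "\<tau> x c : T" using x c by simp
  have r: "?G (br_act z q) = R (?G z) q" if "z : T" for z
  proof (rule T_unique[OF additive_map_comp[OF ract_additive[OF q] G] additive_map_comp[OF G R_additive[OF q]] M_ag _ that])
    fix x c assume "x : X" "c : S"
    then show "?G (br_act (\<tau> x c) q) = R (?G (\<tau> x c)) q"
      using q by (simp add: ract_pure lift_pure[OF M_ag F_balanced] ES.r_mult[OF M] F_val(3))
  qed
  have "additive_map S M (\<lambda>p. L p (R ?m c))"
    using linear_map_additive[OF ES.l_linear1[OF M], of "R ?m c"] m c by (simp add: additive_map_def)
  then have "?G (bl p (\<tau> x c)) = L p (R ?m c)"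
    by (rule S_unique[OF additive_map_comp[OF bl_additive_S[OF t] G] _ M_ag _ p]) (use x c in \<open>simp add: bl_smel F_lact\<close>)
  then show "?G (br_act (bl p (\<tau> x c)) q) = ES.eb p q \<odot>\<^sub>M ?G (\<tau> x c)"
    using r[OF bl_closed[OF S_TT[OF p] t]] p q x c m
    by (simp add: ES.eb_act[OF M] lift_pure[OF M_ag F_balanced])
next
  show "additive_map M M (\<lambda>y. ES.eb p q \<odot>\<^sub>M y)" if "p : S" "q : S" for p q
    by (rule left_module_smult_linear[OF M ES.eb_in[OF M that]])
qed (assumption | erule TS_add_closed TS_smult_closed)+

end

context
  fixes G assumes G: "G \<in> mod_hom (env K S) TS M"
begin

lemma G_additive: "additive_map T M G"
  using linear_map_additive[OF mod_homD(1)[OF G]] by (simp add: additive_map_def)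

lemma G_closed: "z : T ==> G z : M"
  by (rule additive_mapD(1)[OF G_additive])

lemma G_eb:
  assumes p: "p : S" and q: "q : S" and z: "z : T"
  shows "G (br_act (bl p z) q) = R (L p (G z)) q"
proof -
  have "G (ES.eb p q \<odot>\<^bsub>TS\<^esub> z) = ES.eb p q \<odot>\<^sub>M G z"
    using z by (intro linear_mapD(3)[OF mod_homD(1)[OF G]] ES.eb_in[OF M] p q) simp
  then show ?thesis using p q z by (simp add: TS_smult(2) ES.eb_act[OF M] G_closed)
qed

lemma G_left: "[|p : S; z : T|] ==> G (bl p z) = L p (G z)"
  using G_eb[of p "\<one>\<^sub>S" z] by (simp add: ract_one bl_closed S_TT ES.r_one[OF M] G_closed del: AH.tensor_simps)

lemma G_right: "[|q : S; z : T|] ==> G (br_act z q) = R (G z) q"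
  using G_eb[of "\<one>\<^sub>S" q z] by (simp add: bl_one ES.l_one[OF M] G_closed)

text \<open>
  \<open>\<iota>(a)(x \<otimes> 1) = x \<otimes> \<iota>(a) = (x \<otimes> 1)\<iota>(a)\<close>, because \<open>[1] = 1\<close>.
\<close>

lemma G_central:
  assumes x: "x : X" shows "central (G (\<tau> x \<one>\<^sub>S))"
proof -
  have t: "\<tau> x \<one>\<^sub>S : T" using x by simp
  have "L (\<iota> a) (G (\<tau> x \<one>\<^sub>S)) = R (G (\<tau> x \<one>\<^sub>S)) (\<iota> a)" if a: "a : A" for a
  proof -
    have "bl (\<iota> a) (\<tau> x \<one>\<^sub>S) = \<tau> x (\<iota> a)"
      using bl_smel[OF a H_one_closed x, of "\<one>\<^sub>S"] lact_one_left[OF a x, of "\<one>\<^sub>S"] a by (simp add: \<iota>_def)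
    moreover have "br_act (\<tau> x \<one>\<^sub>S) (\<iota> a) = \<tau> x (\<iota> a)" using a x by (simp add: ract_pure)
    ultimately show ?thesis using G_left[of "\<iota> a", OF _ t] G_right[of "\<iota> a", OF _ t] a by simp
  qed
  then show ?thesis using G_closed[OF t] by (simp add: central_iff)
qed

lemma G_br:
  assumes h: "h : H" and x: "x : X"
  shows "G (\<tau> (br h \<odot>\<^sub>X x) \<one>\<^sub>S) = twist h (G (\<tau> x \<one>\<^sub>S))"
proof -
  have t: "\<tau> x \<one>\<^sub>S : T" using x by simp
  have add: "additive_map TB MK G" using G_additive by (simp add: additive_map_def)
  have "G (\<tau> (br h \<odot>\<^sub>X x) \<one>\<^sub>S) =
    sw MK (\<lambda>u v. G (br_act (bl (\<pi> u) (\<tau> x \<one>\<^sub>S)) (\<pi> (\<S> v)))) h"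
    unfolding twist_pure[OF h x, symmetric]
  proof (rule sw_map[OF add TB_ag P_ag h])
    fix u v assume u: "u : H" and v: "v : H"
    show "br_act (bl (\<pi> u) (\<tau> x \<one>\<^sub>S)) (\<pi> (\<S> v)) : TB"
      using ract_closed[OF bl_closed[OF S_TT t], of "\<pi> u" "\<pi> (\<S> v)"] u v by simp
  qed
  also have "\<dots> = twist h (G (\<tau> x \<one>\<^sub>S))"
    unfolding twist_def using t G_closed[OF t] by (intro sw_cong[OF P_ag h]) (auto simp: G_eb)
  finally show ?thesis .
qed

lemma G_scalar:
  assumes k: "k : K" and x: "x : X"
  shows "G (\<tau> ((sc k) \<odot>\<^sub>X x) \<one>\<^sub>S) = k \<odot>\<^bsub>MK\<^esub> G (\<tau> x \<one>\<^sub>S)"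
proof -
  have t: "\<tau> x \<one>\<^sub>S : T" using x by simp
  have "br_act (\<tau> x \<one>\<^sub>S) (k \<odot>\<^sub>S \<one>\<^sub>S) = \<tau> ((sc k) \<odot>\<^sub>X x) \<one>\<^sub>S"
    using k x by (simp add: ract_pure \<tau>_scalar)
  then show ?thesis unfolding ES.scalar_r[OF M k] using G_right[of "k \<odot>\<^sub>S \<one>\<^sub>S", OF _ t] k by simp
qed

lemma G_hom: "(\<lambda>x\<in>carrier X. cfun (G (\<tau> x \<one>\<^sub>S))) \<in> mod_hom \<H> X HomA"
proof (rule mod_hom_restrictI[OF Hp_linearI[OF X HomA_module(1)]])
  show "additive_map X HomA (\<lambda>x. cfun (G (\<tau> x \<one>\<^sub>S)))"
  proof (rule additive_mapI)
    fix x y assume x: "x : X" and y: "y : X"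
    have "G (\<tau> (x \<oplus>\<^sub>X y) \<one>\<^sub>S) = G (\<tau> x \<one>\<^sub>S) \<oplus>\<^sub>M G (\<tau> y \<one>\<^sub>S)"
      using x y additive_mapD(2)[OF G_additive, of "\<tau> x \<one>\<^sub>S" "\<tau> y \<one>\<^sub>S"] by (simp add: \<tau>_add1)
    then show "cfun (G (\<tau> (x \<oplus>\<^sub>X y) \<one>\<^sub>S)) = cfun (G (\<tau> x \<one>\<^sub>S)) \<oplus>\<^bsub>HomA\<^esub> cfun (G (\<tau> y \<one>\<^sub>S))"
      unfolding HomA_simps(2) by (simp only: cfun_add[OF G_central[OF x] G_central[OF y]])
  qed (simp add: cfun_hom G_central)
  show "cfun (G (\<tau> (br h \<odot>\<^sub>X x) \<one>\<^sub>S)) = br h \<odot>\<^bsub>HomA\<^esub> cfun (G (\<tau> x \<one>\<^sub>S))" if "h : H" "x : X" for h x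
    using that by (simp add: G_br HomA_module(2) G_central)
  show "cfun (G (\<tau> ((sc k) \<odot>\<^sub>X x) \<one>\<^sub>S)) = (sc k) \<odot>\<^bsub>HomA\<^esub> cfun (G (\<tau> x \<one>\<^sub>S))"
    if "k : K" "x : X" for k x
    unfolding G_scalar[OF that] HomA_module(3)[OF that(1) G_central[OF that(2)]] by (rule refl)
qed auto

end

end

section \<open>Functors of homomorphisms\<close>

text \<open>
  Conditions on source and target under which the homomorphisms form a \<open>K\<close>-module: closed operations for the
  one, scalars that act \<open>K\<close>-linearly for the other.
\<close>

definition module_source where
  "module_source R X \<longleftrightarrow>
    (\<forall>x\<in>carrier X. \<forall>y\<in>carrier X. x \<oplus>\<^sub>X y : X) \<and> (\<forall>r\<in>carrier R. \<forall>x\<in>carrier X. r \<odot>\<^sub>X x : X)"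

definition module_target where
  "module_target K R Y \<longleftrightarrow> module K (restrict_K R Y) \<and>
    (\<forall>r\<in>carrier R. linear_map K (restrict_K R Y) (restrict_K R Y) (\<lambda>y. r \<odot>\<^sub>Y y)) \<and>
    (\<forall>k\<in>carrier K. k \<odot>\<^sub>R \<one>\<^sub>R : R)"

text \<open>
  Functoriality on morphisms, for functors whose values are sources or targets in the above sense; composed with
  Hom they give functors to \<open>K\<close>-modules.
\<close>

definition functorial where
  "functorial R Q F \<longleftrightarrow>
    (\<forall>X. left_module R X \<longrightarrow> fmor F X X (\<lambda>x\<in>carrier X. x) = (\<lambda>y\<in>carrier (fobj F X). y)) \<and>
    (\<forall>X Y u. left_module R X \<and> left_module R Y \<and> u \<in> mod_hom R X Y \<longrightarrow>
       fmor F X Y u \<in> mod_hom Q (fobj F X) (fobj F Y)) \<and>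
    (\<forall>X Y Z u v. left_module R X \<and> left_module R Y \<and> left_module R Z \<and>
       u \<in> mod_hom R X Y \<and> v \<in> mod_hom R Y Z \<longrightarrow>
       fmor F X Z (compose (carrier X) v u) = compose (carrier (fobj F X)) (fmor F Y Z v) (fmor F X Y u))"

lemma left_module_source: "left_module R X ==> module_source R X"
  using left_module.smult_closed[of R X] abelian_monoid.a_closed[OF abelian_group.axioms(1), of X]
  by (auto simp: module_source_def left_module_def)

lemma left_module_target:
  assumes "unital_algebra K R" "left_module R Y" shows "module_target K R Y"
proof -
  interpret R: unital_algebra K R by fact
  show ?thesis
    unfolding module_target_def
    using restrict_K_module[OF assms] linear_act_vector[OF assms _ linear_map_id] by auto
qed

lemma module_left_module:
  fixes P :: "('k, 'p) module"
  assumes "module K P" shows "left_module K P"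
proof -
  interpret P: module K P by fact
  show ?thesis
    by (intro left_module.intro left_module_axioms.intro P.R.ring_axioms P.abelian_group_axioms)
      (simp_all add: P.smult_l_distr P.smult_r_distr P.smult_assoc1)
qed

lemma hom_module_left_module:
  assumes "module_source R X" "module_target K R Y" shows "left_module K (hom_module R X Y)"
  using assms by (intro module_left_module hom_module_module) (auto simp: module_source_def module_target_def)

lemma mod_hom_closed: "[|u \<in> mod_hom R X Y; x : X|] ==> u x : Y"
  by (rule linear_mapD(1)[OF mod_homD(1)])

lemma mod_hom_compose:
  assumes X: "module_source R X" and u: "u \<in> mod_hom R X Y" and v: "v \<in> mod_hom R Y Z"
  shows "compose (carrier X) v u \<in> mod_hom R X Z"
  unfolding compose_def
  by (rule mod_hom_restrictI[OF linear_map_comp[OF mod_homD(1)[OF v] mod_homD(1)[OF u]]])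
    (use X in \<open>auto simp: module_source_def\<close>)

lemma compose_id_right: "u \<in> mod_hom R X Y ==> compose (carrier X) u (\<lambda>x\<in>carrier X. x) = u"
  using mod_homD(2)[of u R X Y] by (auto simp: compose_def extensional_def)

lemma compose_id_left: "u \<in> mod_hom R X Y ==> compose (carrier X) (\<lambda>y\<in>carrier Y. y) u = u"
  using mod_homD(2)[of u R X Y] mod_hom_closed[of u R X Y] by (auto simp: compose_def extensional_def)

lemma compose_assoc_hom:
  "u \<in> mod_hom R X Y ==> compose (carrier X) w (compose (carrier X) v u) = compose (carrier X) (compose (carrier Y) w v) u"
  using mod_hom_closed[of u R X Y] by (auto simp: compose_def)

lemma precompose_hom:
  assumes X: "module_source R X" and Y: "module_source R Y" and N: "module_target K R N"
    and u: "u \<in> mod_hom R X Y"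
  shows "(\<lambda>f\<in>mod_hom R Y N. compose (carrier X) f u) \<in> mod_hom K (hom_module R Y N) (hom_module R X N)"
proof -
  interpret HY: left_module K "hom_module R Y N" by (rule hom_module_left_module[OF Y N])
  have "linear_map K (hom_module R Y N) (hom_module R X N) (\<lambda>f. compose (carrier X) f u)"
    by (rule linear_mapI)
      (auto simp: mod_hom_compose[OF X u, unfolded compose_def] compose_def mod_hom_closed[OF u])
  from mod_hom_restrictI[OF this HY.M.a_closed HY.smult_closed] show ?thesis by simp
qed

lemma postcompose_hom:
  assumes X: "module_source R X" and N: "module_target K R N" and v: "v \<in> mod_hom R N N'"
  shows "(\<lambda>f\<in>mod_hom R X N. compose (carrier X) v f) \<in> mod_hom K (hom_module R X N) (hom_module R X N')"
proof -
  interpret HX: left_module K "hom_module R X N" by (rule hom_module_left_module[OF X N])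
  have k: "k \<odot>\<^sub>R \<one>\<^sub>R : R" if "k : K" for k using N that by (auto simp: module_target_def)
  have "linear_map K (hom_module R X N) (hom_module R X N') (\<lambda>f. compose (carrier X) v f)"
    by (rule linear_mapI)
      (auto simp: mod_hom_compose[OF X _ v, unfolded compose_def] compose_def mod_hom_closed k
        linear_mapD(2,3)[OF mod_homD(1)[OF v]] intro!: restrict_ext)
  from mod_hom_restrictI[OF this HX.M.a_closed HX.smult_closed] show ?thesis by simp
qed

lemma contravariant_Hom:
  fixes F :: "('r, 'x, 'q, 'y) mfunctor"
  assumes F: "functorial R Q F" and src: "\<And>X :: ('r, 'x) module. left_module R X ==> module_source Q (fobj F X)"
    and N: "module_target K Q N"
  shows "contravariant_functor R K (Hom_to Q N \<circ>\<^sub>F F)"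
  unfolding contravariant_functor_def
proof (intro conjI allI impI; (elim conjE)?)
  fix X :: "('r, 'x) module" assume X: "left_module R X"
  show "left_module K (fobj (Hom_to Q N \<circ>\<^sub>F F) X)"
    using hom_module_left_module[OF src[OF X] N] by (simp add: mcomp_def Hom_to_def)
  show "fmor (Hom_to Q N \<circ>\<^sub>F F) X X (\<lambda>x\<in>carrier X. x) = (\<lambda>y\<in>carrier (fobj (Hom_to Q N \<circ>\<^sub>F F) X). y)"
    using F X by (auto simp: mcomp_def Hom_to_def functorial_def compose_id_right intro!: restrict_ext)
next
  fix X Y :: "('r, 'x) module" and u assume X: "left_module R X" and Y: "left_module R Y" and u: "u \<in> mod_hom R X Y"
  have Fu: "fmor F X Y u \<in> mod_hom Q (fobj F X) (fobj F Y)" using F X Y u by (auto simp: functorial_def)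
  show "fmor (Hom_to Q N \<circ>\<^sub>F F) X Y u \<in> mod_hom K (fobj (Hom_to Q N \<circ>\<^sub>F F) Y) (fobj (Hom_to Q N \<circ>\<^sub>F F) X)"
    using precompose_hom[OF src[OF X] src[OF Y] N Fu] by (simp add: mcomp_def Hom_to_def)
next
  fix X Y Z :: "('r, 'x) module" and u v assume X: "left_module R X" and Y: "left_module R Y" and Z: "left_module R Z"
    and u: "u \<in> mod_hom R X Y" and v: "v \<in> mod_hom R Y Z"
  have Fu: "fmor F X Y u \<in> mod_hom Q (fobj F X) (fobj F Y)" using F X Y u by (auto simp: functorial_def)
  have Fv: "fmor F Y Z v \<in> mod_hom Q (fobj F Y) (fobj F Z)" using F Y Z v by (auto simp: functorial_def)
  have c: "fmor F X Z (compose (carrier X) v u) = compose (carrier (fobj F X)) (fmor F Y Z v) (fmor F X Y u)"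
    using F X Y Z u v unfolding functorial_def by blast
  show "fmor (Hom_to Q N \<circ>\<^sub>F F) X Z (compose (carrier X) v u) =
    compose (carrier (fobj (Hom_to Q N \<circ>\<^sub>F F) Z)) (fmor (Hom_to Q N \<circ>\<^sub>F F) X Y u) (fmor (Hom_to Q N \<circ>\<^sub>F F) Y Z v)"
    by (simp add: mcomp_def Hom_to_def c compose_def[of "mod_hom Q (fobj F Z) N"]
        mod_hom_compose[OF src[OF Y] Fv] compose_assoc_hom[OF Fu] cong: restrict_cong)
qed

lemma covariant_Hom:
  fixes F :: "('r, 'x, 'q, 'y) mfunctor"
  assumes F: "functorial R Q F" and tgt: "\<And>N :: ('r, 'x) module. left_module R N ==> module_target K Q (fobj F N)"
    and X: "module_source Q X"
  shows "covariant_functor R K (Hom_from Q X \<circ>\<^sub>F F)"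
  unfolding covariant_functor_def
proof (intro conjI allI impI; (elim conjE)?)
  fix N :: "('r, 'x) module" assume N: "left_module R N"
  show "left_module K (fobj (Hom_from Q X \<circ>\<^sub>F F) N)"
    using hom_module_left_module[OF X tgt[OF N]] by (simp add: mcomp_def Hom_from_def)
  show "fmor (Hom_from Q X \<circ>\<^sub>F F) N N (\<lambda>x\<in>carrier N. x) = (\<lambda>y\<in>carrier (fobj (Hom_from Q X \<circ>\<^sub>F F) N). y)"
    using F N by (auto simp: mcomp_def Hom_from_def functorial_def compose_id_left intro!: restrict_ext)
next
  fix N N' :: "('r, 'x) module" and u assume N: "left_module R N" and N': "left_module R N'" and u: "u \<in> mod_hom R N N'"
  have Fu: "fmor F N N' u \<in> mod_hom Q (fobj F N) (fobj F N')" using F N N' u by (auto simp: functorial_def)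
  show "fmor (Hom_from Q X \<circ>\<^sub>F F) N N' u \<in> mod_hom K (fobj (Hom_from Q X \<circ>\<^sub>F F) N) (fobj (Hom_from Q X \<circ>\<^sub>F F) N')"
    using postcompose_hom[OF X tgt[OF N] Fu] by (simp add: mcomp_def Hom_from_def)
next
  fix N N' N'' :: "('r, 'x) module" and u v assume N: "left_module R N" and N': "left_module R N'" and N'': "left_module R N''"
    and u: "u \<in> mod_hom R N N'" and v: "v \<in> mod_hom R N' N''"
  have Fu: "fmor F N N' u \<in> mod_hom Q (fobj F N) (fobj F N')" using F N N' u by (auto simp: functorial_def)
  have c: "fmor F N N'' (compose (carrier N) v u) = compose (carrier (fobj F N)) (fmor F N' N'' v) (fmor F N N' u)"
    using F N N' N'' u v unfolding functorial_def by blast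
  show "fmor (Hom_from Q X \<circ>\<^sub>F F) N N'' (compose (carrier N) v u) =
    compose (carrier (fobj (Hom_from Q X \<circ>\<^sub>F F) N)) (fmor (Hom_from Q X \<circ>\<^sub>F F) N' N'' v) (fmor (Hom_from Q X \<circ>\<^sub>F F) N N' u)"
    by (simp add: mcomp_def Hom_from_def c compose_def[of "mod_hom Q X (fobj F N)"]
        mod_hom_compose[OF X _ Fu] compose_assoc_hom cong: restrict_cong)
qed

definition id_functor where
  "id_functor = \<lparr>fobj = (\<lambda>X. X), fmor = (\<lambda>X Y u. u)\<rparr>"

lemma functorial_id: "functorial R R id_functor"
  by (simp add: functorial_def id_functor_def)

lemma mcomp_id: "G \<circ>\<^sub>F id_functor = \<lparr>fobj = fobj G, fmor = fmor G\<rparr>"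
  by (simp add: mcomp_def id_functor_def)

section \<open>The natural isomorphism\<close>

definition adjunct where
  "adjunct K H A act X M =
    (\<lambda>F\<in>mod_hom (Hpar K H) X (Hom_A K H A act M). \<lambda>z\<in>carrier (tensor_smash K H A act X).
      tensor_lift M (\<lambda>x c. right_act K (smash K H A act) M (F x \<one>\<^sub>A) c) z)"

text \<open>
  A scalar \<open>k\<close> acts as \<open>k1 \<otimes> 1\<close>, which commutes with every \<open>a \<otimes> b\<close>.
\<close>

lemma (in env_module) M_target: "module_target K (env K S) M"
  unfolding module_target_def
proof (intro conjI ballI)
  interpret M: left_module "env K S" M by (rule M)
  show "module K (restrict_K (env K S) M)" by (rule ES.restrict_EB_module[OF M])
  show k: "k \<odot>\<^bsub>env K S\<^esub> \<one>\<^bsub>env K S\<^esub> : (env K S)" if "k : K" for k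
    using that by (simp add: ES.EB_scalar ES.eb_in[OF M] module.smult_closed[OF S_module])
  fix r assume r: "r : (env K S)"
  show "linear_map K (restrict_K (env K S) M) (restrict_K (env K S) M) (\<lambda>y. r \<odot>\<^sub>M y)"
  proof (rule linear_mapI)
    fix c y assume c: "c : K" and y: "y : MK"
    have y': "y : M" using y by simp
    let ?s = "ES.eb (c \<odot>\<^sub>S \<one>\<^sub>S) \<one>\<^sub>S"
    have s: "?s : (env K S)" using k[OF c] c by (simp add: ES.EB_scalar)
    have "additive_map ES.BB.T M (\<lambda>r. r \<odot>\<^sub>M (?s \<odot>\<^sub>M y))"
      by (rule ES.left_module_env(1)[OF M M.smult_closed[OF s y']])
    moreover have "additive_map ES.BB.T M (\<lambda>r. ?s \<odot>\<^sub>M (r \<odot>\<^sub>M y))"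
      by (rule additive_map_comp[OF ES.left_module_env(1)[OF M y'] left_module_smult_linear[OF M s]])
    ultimately have "r \<odot>\<^sub>M (?s \<odot>\<^sub>M y) = ?s \<odot>\<^sub>M (r \<odot>\<^sub>M y)"
    proof (rule ES.BB.additive_map_unique[OF _ _ M_ag])
      fix a b assume ab: "a : S" "b : (opp S)"
      have "(c \<odot>\<^sub>S \<one>\<^sub>S) \<otimes>\<^sub>S a = a \<otimes>\<^sub>S (c \<odot>\<^sub>S \<one>\<^sub>S)" using c ab scalar_commute[OF S_algebra] by simp
      then have "ES.eb a b \<otimes>\<^bsub>env K S\<^esub> ?s = ?s \<otimes>\<^bsub>env K S\<^esub> ES.eb a b"
        using ab c module.smult_closed[OF S_module] by (simp add: ES.EB_mult)
      then show "ES.eb a b \<odot>\<^sub>M (?s \<odot>\<^sub>M y) = ?s \<odot>\<^sub>M (ES.eb a b \<odot>\<^sub>M y)"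
        using ab s y' M.smult_assoc[of "ES.eb a b" ?s y] M.smult_assoc[of ?s "ES.eb a b" y] ES.eb_in[OF M, of a b] by simp
    qed (use r in \<open>simp add: ES.EB_simps(1)\<close>)
    then show "r \<odot>\<^sub>M (c \<odot>\<^bsub>MK\<^esub> y) = c \<odot>\<^bsub>MK\<^esub> (r \<odot>\<^sub>M y)" using c by (simp add: ES.EB_scalar)
  qed (use r M.smult_closed M.smult_r_distr in auto)
qed

context hom_tensor
begin

lemma TS_source: "module_source (env K S) TS"
  using TS_add_closed TS_smult_closed by (auto simp: module_source_def)

lemma X_source: "module_source \<H> X" by (rule left_module_source[OF X])
lemma HomA_target: "module_target K \<H> HomA" by (rule left_module_target[OF Hp_algebra HomA_module(1)])

abbreviation "\<Phi> \<equiv> adjunct K H A act X M"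

lemma adjunct_hom:
  assumes F: "F \<in> mod_hom \<H> X HomA" shows "\<Phi> F \<in> mod_hom (env K S) TS M"
  unfolding adjunct_def using F_hom[OF F] F by simp

lemma adjunct_pure:
  assumes F: "F \<in> mod_hom \<H> X HomA" and x: "x : X" and c: "c : S"
  shows "\<Phi> F (\<tau> x c) = R (F x \<one>\<^sub>A) c"
  unfolding adjunct_def using F x c by (simp add: lift_pure[OF M_ag F_balanced[OF F]])

lemma adjunct_iso: "\<Phi> \<in> mod_iso K (hom_module \<H> X HomA) (hom_module (env K S) TS M)"
proof -
  let ?HX = "hom_module \<H> X HomA" and ?HT = "hom_module (env K S) TS M"
  interpret HX: left_module K ?HX by (rule hom_module_left_module[OF X_source HomA_target])
  interpret HT: left_module K ?HT by (rule hom_module_left_module[OF TS_source M_target])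
  let ?\<Psi> = "\<lambda>G. \<lambda>x\<in>carrier X. cfun (G (\<tau> x \<one>\<^sub>S))"
  have lin: "linear_map K ?HX ?HT \<Phi>"
  proof (rule linear_mapI)
    show "\<Phi> F : ?HT" if "F : ?HX" for F
      using that adjunct_hom by simp
  next
    fix F F' assume F0: "F : ?HX" "F' : ?HX"
    then have F: "F \<in> mod_hom \<H> X HomA" "F' \<in> mod_hom \<H> X HomA" by simp_all
    have s: "F \<oplus>\<^bsub>?HX\<^esub> F' \<in> mod_hom \<H> X HomA" using HX.M.a_closed[OF F0] by simp
    have t: "\<Phi> F \<oplus>\<^bsub>?HT\<^esub> \<Phi> F' \<in> mod_hom (env K S) TS M"
      using HT.M.a_closed[of "\<Phi> F" "\<Phi> F'"] adjunct_hom F by simp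
    show "\<Phi> (F \<oplus>\<^bsub>?HX\<^esub> F') = \<Phi> F \<oplus>\<^bsub>?HT\<^esub> \<Phi> F'"
    proof (rule TS_hom_eqI[OF adjunct_hom[OF s] t M_ag])
      fix x c assume x: "x : X" and c: "c : S"
      have "(F \<oplus>\<^bsub>?HX\<^esub> F') x \<one>\<^sub>A = F x \<one>\<^sub>A \<oplus>\<^sub>M F' x \<one>\<^sub>A" using x by simp
      then have "\<Phi> (F \<oplus>\<^bsub>?HX\<^esub> F') (\<tau> x c) = \<Phi> F (\<tau> x c) \<oplus>\<^sub>M \<Phi> F' (\<tau> x c)"
        unfolding adjunct_pure[OF s x c] adjunct_pure[OF F(1) x c] adjunct_pure[OF F(2) x c]
        using ES.r_add2[OF M c F_val(3)[OF F(1) x] F_val(3)[OF F(2) x]] by simp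
      then show "\<Phi> (F \<oplus>\<^bsub>?HX\<^esub> F') (\<tau> x c) = (\<Phi> F \<oplus>\<^bsub>?HT\<^esub> \<Phi> F') (\<tau> x c)"
        using x c by (subst hom_module_simps(3)) simp
    qed
  next
    fix k F assume k: "k : K" and F0: "F : ?HX"
    then have F: "F \<in> mod_hom \<H> X HomA" by simp
    have s: "k \<odot>\<^bsub>?HX\<^esub> F \<in> mod_hom \<H> X HomA" using HX.smult_closed[OF k F0] by simp
    have t: "k \<odot>\<^bsub>?HT\<^esub> \<Phi> F \<in> mod_hom (env K S) TS M"
      using HT.smult_closed[OF k, of "\<Phi> F"] adjunct_hom[OF F] by simp
    show "\<Phi> (k \<odot>\<^bsub>?HX\<^esub> F) = k \<odot>\<^bsub>?HT\<^esub> \<Phi> F"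
    proof (rule TS_hom_eqI[OF adjunct_hom[OF s] t M_ag])
      fix x c assume x: "x : X" and c: "c : S"
      have "(k \<odot>\<^bsub>?HX\<^esub> F) x = (sc k) \<odot>\<^bsub>HomA\<^esub> F x" using x by simp
      also have "\<dots> = F ((sc k) \<odot>\<^sub>X x)"
        by (rule linear_mapD(3)[OF mod_homD(1)[OF F] scalar_Hp[OF k] x, symmetric])
      finally have "(k \<odot>\<^bsub>?HX\<^esub> F) x \<one>\<^sub>A = k \<odot>\<^bsub>MK\<^esub> F x \<one>\<^sub>A" using F_scalar[OF F k x] by simp
      then have "\<Phi> (k \<odot>\<^bsub>?HX\<^esub> F) (\<tau> x c) = k \<odot>\<^bsub>MK\<^esub> \<Phi> F (\<tau> x c)"
        unfolding adjunct_pure[OF s x c] adjunct_pure[OF F x c] using R_scalar[OF k c F_val(3)[OF F x]] by simp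
      then show "\<Phi> (k \<odot>\<^bsub>?HX\<^esub> F) (\<tau> x c) = (k \<odot>\<^bsub>?HT\<^esub> \<Phi> F) (\<tau> x c)"
        using x c by (subst hom_module_simps(4)) simp
    qed
  qed
  have "bij_betw \<Phi> (mod_hom \<H> X HomA) (mod_hom (env K S) TS M)"
  proof (rule bij_betw_byWitness[where f' = ?\<Psi>])
    show "\<forall>F\<in>mod_hom \<H> X HomA. ?\<Psi> (\<Phi> F) = F"
    proof
      fix F assume F: "F \<in> mod_hom \<H> X HomA"
      show "?\<Psi> (\<Phi> F) = F"
      proof (rule mod_hom_eqI[OF G_hom[OF adjunct_hom[OF F]] F])
        fix x assume x: "x : X"
        have "\<Phi> F (\<tau> x \<one>\<^sub>S) = F x \<one>\<^sub>A" using x F F_val(3)[OF F x] by (simp add: adjunct_pure ES.r_one[OF M])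
        then show "?\<Psi> (\<Phi> F) x = F x" using x F_val(2)[OF F x] by simp
      qed
    qed
    show "\<forall>G\<in>mod_hom (env K S) TS M. \<Phi> (?\<Psi> G) = G"
    proof
      fix G assume G: "G \<in> mod_hom (env K S) TS M"
      show "\<Phi> (?\<Psi> G) = G"
      proof (rule TS_hom_eqI[OF adjunct_hom[OF G_hom[OF G]] G M_ag])
        fix x c assume x: "x : X" and c: "c : S"
        have t: "\<tau> x \<one>\<^sub>S : T" using x by simp
        have "\<Phi> (?\<Psi> G) (\<tau> x c) = R (G (\<tau> x \<one>\<^sub>S)) c"
          using x by (simp add: adjunct_pure[OF G_hom[OF G] x c] cfun_one[OF G_central[OF G x]])
        also have "\<dots> = G (\<tau> x c)" using G_right[OF G c t] x c by (simp add: ract_pure)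
        finally show "\<Phi> (?\<Psi> G) (\<tau> x c) = G (\<tau> x c)" .
      qed
    qed
  qed (use adjunct_hom G_hom in auto)
  moreover have "\<Phi> \<in> extensional (mod_hom \<H> X HomA)" by (simp add: adjunct_def)
  ultimately show ?thesis using lin by (simp add: mod_iso_def mod_hom_def[of K])
qed

end

section \<open>Naturality\<close>

text \<open>
  For an \<open>H\<^sub>p\<^sub>a\<^sub>r\<close>-linear \<open>u\<close>, the map \<open>u \<otimes> id\<close> is balanced because \<open>u\<close> commutes with \<open>e\<^sub>h\<close>, and left linear because
  \<open>u\<close> commutes with \<open>[h\<^sub>1]\<close> in \<open>[h\<^sub>1]x \<otimes> (a#h\<^sub>2)c\<close>.
\<close>

locale tensor_mod_map = X: tensor_mod K H A act X + Y: tensor_mod K H A act Y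
  for K :: "('k, 's) ring_scheme" (structure) and H :: "('k, 'h, 'z) hopf_scheme" (structure)
    and A :: "('k, 'a, 'w) module_scheme" (structure) and act :: "'h \<Rightarrow> 'a \<Rightarrow> 'a"
    and X :: "('k, 'h, 'x) par_module" and Y :: "('k, 'h, 'y) par_module" +
  fixes u assumes u: "u \<in> mod_hom (Hpar K H) X Y"
begin

abbreviation "tmap \<equiv> \<lambda>z\<in>carrier X.TS. tensor_lift Y.TS (\<lambda>x c. Y.\<tau> (u x) c) z"

lemmas u_linear = linear_mapD[OF mod_homD(1)[OF u]]

lemma rec: "tensor_lift Y.TS f z = tensor_lift Y.T f z"
  by (rule tensor_lift_cong_record) simp_all

lemma tmap_balanced: "middle_linear X.Bp X.RT X.SP Y.T (\<lambda>x c. Y.\<tau> (u x) c)"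
proof (rule X.balancedI[OF Y.T_ag])
  show "additive_map X Y.T (\<lambda>x. Y.\<tau> (u x) c)" if "c : X.S" for c
    using that u_linear(1,2) by (intro additive_mapI) (simp_all add: Y.\<tau>_add1)
  show "additive_map X.S Y.T (Y.\<tau> (u x))" if "x : X" for x
    using that u_linear(1) by (intro additive_mapI) (simp_all add: Y.\<tau>_add2)
  show "Y.\<tau> (u ((k \<odot>\<^bsub>X.\<H>\<^esub> \<one>\<^bsub>X.\<H>\<^esub>) \<odot>\<^sub>X x)) c = Y.\<tau> (u x) (k \<odot>\<^bsub>X.S\<^esub> c)"
    if "k : K" "x : X" "c : X.S" for k x c
    using that u_linear(1)[OF that(2)] by (simp add: u_linear(3)[OF X.scalar_Hp] Y.\<tau>_scalar)
  show "Y.\<tau> (u (X.eH h \<odot>\<^sub>X x)) c = Y.\<tau> (u x) (X.\<iota> (act h \<one>\<^sub>A) \<otimes>\<^bsub>X.S\<^esub> c)"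
    if "h : H" "x : X" "c : X.S" for h x c
    using that u_linear(1)[OF that(2)] by (simp add: u_linear(3)[OF X.Bp_Hp[OF X.eH_Bp]] Y.\<tau>_eH)
qed

lemma tmap_pure: "[|x : X; c : X.S|] ==> tmap (X.\<tau> x c) = Y.\<tau> (u x) c"
  using X.lift_pure[OF Y.T_ag tmap_balanced] by (simp add: rec)

lemma tmap_hom: "tmap \<in> mod_hom (env K X.S) X.TS Y.TS"
proof (rule mod_hom_restrictI[OF X.TS_linearI[OF Y.TS_ag]])
  let ?G = "tensor_lift Y.TS (\<lambda>x c. Y.\<tau> (u x) c)"
  have G: "additive_map X.T Y.T ?G"
    unfolding rec[abs_def] by (rule X.lift_additive[OF Y.T_ag tmap_balanced])
  have Gp: "?G (X.\<tau> x c) = Y.\<tau> (u x) c" if "x : X" "c : X.S" for x c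
    unfolding rec by (rule X.lift_pure[OF Y.T_ag tmap_balanced that])
  show "additive_map X.T Y.TS ?G" using G by (simp add: additive_map_def)
  show "additive_map X.ES.BB.T Y.TS (\<lambda>r. r \<odot>\<^bsub>Y.TS\<^esub> y)" if "y : Y.TS" for y
    using Y.TS_smult(1)[of y] that by simp
  show "additive_map Y.TS Y.TS (\<lambda>y. X.ES.eb p q \<odot>\<^bsub>Y.TS\<^esub> y)" if "p : X.S" "q : X.S" for p q
    using additive_map_comp[OF Y.bl_additive2[OF X.S_TT[OF that(1)]] Y.ract_additive[OF that(2)]]
    by (simp add: additive_map_def Y.TS_smult(2)[OF that] Y.TS_add_closed[simplified] Pi_iff)
  fix p q x c assume p: "p : X.S" and q: "q : X.S" and x: "x : X" and c: "c : X.S"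
  have ux: "u x : Y" by (rule u_linear(1)[OF x])
  have t: "X.\<tau> x c : X.T" "Y.\<tau> (u x) c : Y.T" using x c ux by simp_all
  have r: "?G (X.br_act z q) = Y.br_act (?G z) q" if "z : X.T" for z
  proof (rule X.T_unique[OF additive_map_comp[OF X.ract_additive[OF q] G] additive_map_comp[OF G Y.ract_additive[OF q]] Y.T_ag _ that])
    fix x c assume "x : X" "c : X.S"
    then show "?G (X.br_act (X.\<tau> x c) q) = Y.br_act (?G (X.\<tau> x c)) q"
      using q u_linear(1)[of x] by (simp add: X.ract_pure Y.ract_pure Gp)
  qed
  have "?G (X.bl p (X.\<tau> x c)) = Y.bl p (Y.\<tau> (u x) c)"
  proof (rule X.S_unique[OF additive_map_comp[OF X.bl_additive_S[OF t(1)] G] Y.bl_additive_S[OF t(2)] Y.T_ag _ p])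
    fix a h assume a: "a : A" and h: "h : H"
    have "?G (X.bl (X.smel a h) (X.\<tau> x c)) =
      sweedler H Y.T (\<lambda>w v. ?G (X.\<tau> (X.br w \<odot>\<^sub>X x) (X.smel a v \<otimes>\<^bsub>X.S\<^esub> c))) h"
      unfolding X.bl_smel[OF a h x c] X.lact_def using a x c by (intro X.sw_map[OF G X.T_ag Y.T_ag h]) auto
    also have "\<dots> = Y.lact a h (u x) c"
      unfolding Y.lact_def using a x c ux by (intro X.sw_cong[OF Y.T_ag h]) (auto simp: Gp u_linear(3))
    finally show "?G (X.bl (X.smel a h) (X.\<tau> x c)) = Y.bl (X.smel a h) (Y.\<tau> (u x) c)"
      by (simp add: Y.bl_smel[OF a h ux c])
  qed
  then show "?G (X.br_act (X.bl p (X.\<tau> x c)) q) = X.ES.eb p q \<odot>\<^bsub>Y.TS\<^esub> ?G (X.\<tau> x c)"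
    using r[OF X.bl_closed[OF X.S_TT[OF p] t(1)]] t by (simp add: Gp[OF x c] Y.TS_smult(2)[OF p q])
qed (assumption | erule X.TS_add_closed X.TS_smult_closed)+

end

context cocommutative_partial_action
begin

lemma tensor_modI: "left_module \<H> X ==> tensor_mod K H A act X"
  by (intro tensor_mod.intro tensor_mod_axioms.intro cocommutative_partial_action_axioms)

lemma tensor_mod_mapI:
  "[|left_module \<H> X; left_module \<H> Y; u \<in> mod_hom \<H> X Y|] ==> tensor_mod_map K H A act X Y u"
  by (intro tensor_mod_map.intro tensor_mod_map_axioms.intro tensor_modI)

lemma env_moduleI: "left_module (env K S) M ==> env_module K H A act M"
  by (intro env_module.intro env_module_axioms.intro cocommutative_partial_action_axioms)

lemma mod_hom_id: "left_module R X ==> (\<lambda>x\<in>carrier X. x) \<in> mod_hom R X X"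
  using left_module_source[of R X] by (intro mod_hom_restrictI linear_map_id) (auto simp: module_source_def)

abbreviation "TF \<equiv> tensor_smash_functor K H A act"
abbreviation "HF \<equiv> Hom_A_functor K H A act"

lemma tensor_smash_functorial:
  "functorial \<H> (env K S) (tensor_smash_functor K H A act)"
  unfolding functorial_def
proof (intro conjI allI impI; (elim conjE)?)
  fix X :: "('k, 'h, 'x) par_module" assume X: "left_module \<H> X"
  interpret X: tensor_mod_map K H A act X X "\<lambda>x\<in>carrier X. x" by (rule tensor_mod_mapI[OF X X mod_hom_id[OF X]])
  have id: "(\<lambda>z\<in>carrier X.X.TS. z) \<in> mod_hom (env K S) X.X.TS X.X.TS"
    by (rule mod_hom_restrictI[OF linear_map_id X.X.TS_add_closed X.X.TS_smult_closed])
  have "X.tmap = (\<lambda>z\<in>carrier X.X.TS. z)"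
  proof (rule X.X.TS_hom_eqI[OF X.tmap_hom id X.X.TS_ag])
    fix x c assume x: "x : X" and c: "c : S"
    show "X.tmap (X.X.\<tau> x c) = (\<lambda>z\<in>carrier X.X.TS. z) (X.X.\<tau> x c)"
      unfolding X.tmap_pure[OF x c] using x c by simp
  qed
  then show "fmor TF X X (\<lambda>x\<in>carrier X. x) = (\<lambda>y\<in>carrier (fobj TF X). y)"
    by (simp add: tensor_smash_functor_def)
next
  fix X Y :: "('k, 'h, 'x) par_module" and u
  assume X: "left_module \<H> X" and Y: "left_module \<H> Y" and u: "u \<in> mod_hom \<H> X Y"
  interpret U: tensor_mod_map K H A act X Y u by (rule tensor_mod_mapI[OF X Y u])
  show "fmor TF X Y u \<in>
    mod_hom (env K S) (fobj TF X) (fobj TF Y)"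
    using U.tmap_hom by (simp add: tensor_smash_functor_def)
next
  fix X Y Z :: "('k, 'h, 'x) par_module" and u v
  assume X: "left_module \<H> X" and Y: "left_module \<H> Y" and Z: "left_module \<H> Z"
    and u: "u \<in> mod_hom \<H> X Y" and v: "v \<in> mod_hom \<H> Y Z"
  interpret U: tensor_mod_map K H A act X Y u by (rule tensor_mod_mapI[OF X Y u])
  interpret V: tensor_mod_map K H A act Y Z v by (rule tensor_mod_mapI[OF Y Z v])
  have vu: "compose (carrier X) v u \<in> mod_hom \<H> X Z" by (rule mod_hom_compose[OF left_module_source[OF X] u v])
  interpret W: tensor_mod_map K H A act X Z "compose (carrier X) v u" by (rule tensor_mod_mapI[OF X Z vu])
  have src: "module_source (env K S) U.X.TS"
    using U.X.TS_add_closed U.X.TS_smult_closed by (auto simp: module_source_def)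
  have "W.tmap = compose (carrier U.X.TS) V.tmap U.tmap"
  proof (rule U.X.TS_hom_eqI[OF W.tmap_hom mod_hom_compose[OF src U.tmap_hom V.tmap_hom] V.Y.TS_ag])
    fix x c assume x: "x : X" and c: "c : S"
    have "compose (carrier U.X.TS) V.tmap U.tmap (U.X.\<tau> x c) = V.tmap (U.tmap (U.X.\<tau> x c))"
      using U.X.\<tau>_closed[OF x c] by (simp only: compose_eq U.X.TS_simps(1))
    also have "\<dots> = V.Y.\<tau> (v (u x)) c"
      unfolding U.tmap_pure[OF x c] by (rule V.tmap_pure[OF U.u_linear(1)[OF x] c])
    finally show "W.tmap (U.X.\<tau> x c) = compose (carrier U.X.TS) V.tmap U.tmap (U.X.\<tau> x c)"
      unfolding W.tmap_pure[OF x c] compose_eq[OF x] by simp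
  qed
  then show "fmor TF X Z (compose (carrier X) v u) =
    compose (carrier (fobj TF X)) (fmor TF Y Z v)
      (fmor TF X Y u)"
    by (simp add: tensor_smash_functor_def)
qed

end

text \<open>
  A bimodule map \<open>u\<close> commutes with \<open>[h] \<triangleright> _\<close> and preserves central elements; composition with \<open>u\<close> takes the
  map with value \<open>m\<close> at \<open>1\<close> to the one with value \<open>u(m)\<close>.
\<close>

locale env_module_map = M: env_module K H A act M + N: env_module K H A act N
  for K :: "('k, 's) ring_scheme" (structure) and H :: "('k, 'h, 'z) hopf_scheme" (structure)
    and A :: "('k, 'a, 'w) module_scheme" (structure) and act :: "'h \<Rightarrow> 'a \<Rightarrow> 'a"
    and M :: "('a, 'h, 'm) smash_env_module"
    and N :: "('a, 'h, 'n) smash_env_module" +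
  fixes u assumes u: "u \<in> mod_hom (env K (smash K H A act)) M N"
begin

lemmas u_linear = linear_mapD[OF mod_homD(1)[OF u]]

lemma u_left: "[|s : M.S; m : M|] ==> u (M.L s m) = N.L s (u m)"
  unfolding left_act_def by (rule u_linear(3)) (auto intro: M.ES.eb_in[OF M.M])

lemma u_right: "[|s : M.S; m : M|] ==> u (M.R m s) = N.R (u m) s"
  unfolding right_act_def by (rule u_linear(3)) (auto intro: M.ES.eb_in[OF M.M])

lemma u_scalar: "[|k : K; m : M|] ==> u (k \<odot>\<^bsub>M.MK\<^esub> m) = k \<odot>\<^bsub>N.MK\<^esub> u m"
  using u_left[of "k \<odot>\<^bsub>M.S\<^esub> \<one>\<^bsub>M.S\<^esub>" m] module.smult_closed[OF M.S_module]
  by (simp add: M.ES.scalar_l[OF M.M] M.ES.scalar_l[OF N.M] del: restrict_K_simps(4))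

lemma u_additive: "additive_map M N u"
  by (rule linear_map_additive[OF mod_homD(1)[OF u]])

lemma u_twist:
  assumes h: "h : H" and m: "m : M"
  shows "u (M.twist h m) = N.twist h (u m)"
proof -
  have "u (sweedler H M (\<lambda>x y. M.R (M.L (M.\<pi> x) m) (M.\<pi> (antipode H y))) h) =
    sweedler H N (\<lambda>x y. u (M.R (M.L (M.\<pi> x) m) (M.\<pi> (antipode H y)))) h"
    using m by (intro M.sw_map[OF u_additive M.M_ag N.M_ag h]) simp
  also have "\<dots> = sweedler H N (\<lambda>x y. N.R (N.L (M.\<pi> x) (u m)) (M.\<pi> (antipode H y))) h"
    using m u_linear(1)[OF m] by (intro M.sw_cong[OF N.M_ag h]) (auto simp: u_left u_right)
  finally show ?thesis by (simp add: M.twist_def N.twist_def)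
qed

lemma u_central:
  assumes m: "M.central m" shows "N.central (u m)"
proof -
  note mc = M.centralM[OF m]
  have "N.L (M.\<iota> a) (u m) = N.R (u m) (M.\<iota> a)" if "a : A" for a
    using M.centralD[OF m that] u_left[of "M.\<iota> a" m] u_right[of "M.\<iota> a" m] that mc by simp
  then show ?thesis using u_linear(1)[OF mc] by (simp add: N.central_iff)
qed

lemma u_cfun: "M.central m ==> compose (carrier A) u (M.cfun m) = N.cfun (u m)"
  unfolding compose_def M.cfun_def N.cfun_def
  by (rule restrict_ext) (simp add: u_left M.centralM)

lemma hom_map: "(\<lambda>f\<in>carrier M.HomA. compose (carrier A) u f) \<in> mod_hom M.\<H> M.HomA N.HomA"
proof (rule mod_hom_restrictI[OF M.Hp_linearI[OF M.HomA_module(1) N.HomA_module(1)]])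
  interpret HomM: left_module M.\<H> M.HomA by (rule M.HomA_module(1))
  have cases: "\<exists>m. M.central m \<and> f = M.cfun m" if "f : M.HomA" for f
    using M.hom_cfun[of f] that by auto
  show "additive_map M.HomA N.HomA (\<lambda>f. compose (carrier A) u f)"
  proof (rule additive_mapI)
    fix f assume "f : M.HomA"
    then show "compose (carrier A) u f : N.HomA"
      using cases[of f] N.cfun_hom[OF u_central] u_cfun by auto
  next
    fix f f' assume "f : M.HomA" "f' : M.HomA"
    then obtain m m' where m: "M.central m" "f = M.cfun m" "M.central m'" "f' = M.cfun m'" using cases by meson
    have "compose (carrier A) u (M.cfun m \<oplus>\<^bsub>M.HM\<^esub> M.cfun m') = N.cfun (u m) \<oplus>\<^bsub>N.HM\<^esub> N.cfun (u m')"
      unfolding M.cfun_add[OF m(1,3)] N.cfun_add[OF u_central[OF m(1)] u_central[OF m(3)]] u_cfun[OF M.central_add[OF m(1,3)]]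
      by (simp only: u_linear(2)[OF M.centralM[OF m(1)] M.centralM[OF m(3)]])
    then show "compose (carrier A) u (f \<oplus>\<^bsub>M.HomA\<^esub> f') = compose (carrier A) u f \<oplus>\<^bsub>N.HomA\<^esub> compose (carrier A) u f'"
      unfolding M.HomA_simps(2) N.HomA_simps(2) m(2,4) u_cfun[OF m(1)] u_cfun[OF m(3)] .
  qed
  show "compose (carrier A) u (M.br h \<odot>\<^bsub>M.HomA\<^esub> f) = M.br h \<odot>\<^bsub>N.HomA\<^esub> compose (carrier A) u f"
    if h: "h : H" and f: "f : M.HomA" for h f
  proof -
    obtain m where m: "M.central m" "f = M.cfun m" using cases[OF f] by auto
    show ?thesis
      unfolding m(2) M.HomA_module(2)[OF h m(1)] u_cfun[OF m(1)] u_cfun[OF M.central_twist[OF h m(1)]]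
        N.HomA_module(2)[OF h u_central[OF m(1)]] u_twist[OF h M.centralM[OF m(1)]] ..
  qed
  show "compose (carrier A) u ((k \<odot>\<^bsub>M.\<H>\<^esub> \<one>\<^bsub>M.\<H>\<^esub>) \<odot>\<^bsub>M.HomA\<^esub> f) = (k \<odot>\<^bsub>M.\<H>\<^esub> \<one>\<^bsub>M.\<H>\<^esub>) \<odot>\<^bsub>N.HomA\<^esub> compose (carrier A) u f"
    if k: "k : K" and f: "f : M.HomA" for k f
  proof -
    obtain m where m: "M.central m" "f = M.cfun m" using cases[OF f] by auto
    show ?thesis
      unfolding m(2) M.HomA_module(3)[OF k m(1)] u_cfun[OF m(1)] u_cfun[OF M.central_smult[OF k m(1)]]
        N.HomA_module(3)[OF k u_central[OF m(1)]] u_scalar[OF k M.centralM[OF m(1)]] ..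
  qed
qed (rule left_module.smult_closed[OF M.HomA_module(1)]
    abelian_monoid.a_closed[OF abelian_group.axioms(1)[OF left_module.axioms(2)[OF M.HomA_module(1)]]]; assumption)+

end

context cocommutative_partial_action
begin

lemma env_module_mapI:
  "[|left_module (env K S) M; left_module (env K S) N; u \<in> mod_hom (env K S) M N|] ==> env_module_map K H A act M N u"
  by (intro env_module_map.intro env_module_map_axioms.intro env_moduleI)

lemma Hom_A_functorial:
  "functorial (env K S) \<H> (Hom_A_functor K H A act ::
    ((('a, 'h) tensor, ('a, 'h) tensor) tensor, 'm, ('k, 'h) words set set, 'a \<Rightarrow> 'm) mfunctor)"
  unfolding functorial_def
proof (intro conjI allI impI; (elim conjE)?)
  fix M :: "('a, 'h, 'm) smash_env_module" assume M: "left_module (env K S) M"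
  interpret M: env_module K H A act M by (rule env_moduleI[OF M])
  have "compose (carrier A) (\<lambda>x\<in>carrier M. x) f = f" if "f \<in> mod_hom (env K A) M.RA M.RM" for f
    using compose_id_left[OF that] by simp
  then show "fmor HF M M (\<lambda>x\<in>carrier M. x) = (\<lambda>y\<in>carrier (fobj HF M). y)"
    by (auto simp: Hom_A_functor_def intro!: restrict_ext)
next
  fix M N :: "('a, 'h, 'm) smash_env_module" and u
  assume M: "left_module (env K S) M" and N: "left_module (env K S) N" and u: "u \<in> mod_hom (env K S) M N"
  interpret U: env_module_map K H A act M N u by (rule env_module_mapI[OF M N u])
  show "fmor HF M N u \<in> mod_hom \<H> (fobj HF M) (fobj HF N)"
    using U.hom_map by (simp add: Hom_A_functor_def)
next
  fix M N P :: "('a, 'h, 'm) smash_env_module" and u v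
  assume M: "left_module (env K S) M" and N: "left_module (env K S) N" and P: "left_module (env K S) P"
    and u: "u \<in> mod_hom (env K S) M N" and v: "v \<in> mod_hom (env K S) N P"
  interpret U: env_module_map K H A act M N u by (rule env_module_mapI[OF M N u])
  have cl: "compose (carrier A) u f : U.N.HomA" if "f : U.M.HomA" for f
    using mod_hom_closed[OF U.hom_map that] that by simp
  have as: "compose (carrier A) v (compose (carrier A) u f) = compose (carrier A) (compose (carrier M) v u) f"
    if "f : U.M.HomA" for f
    using compose_assoc_hom[of f "env K A" U.M.RA U.M.RM v u] that by simp
  show "fmor HF M P (compose (carrier M) v u) =
    compose (carrier (fobj HF M)) (fmor HF N P v)
      (fmor HF M N u)"
    using cl as by (auto simp: Hom_A_functor_def compose_def[of "mod_hom (env K A) U.M.RA U.M.RM"] intro!: restrict_ext)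
qed

lemma hom_tensorI: "[|left_module \<H> X; left_module (env K S) M|] ==> hom_tensor K H A act X M"
  by (intro hom_tensor.intro tensor_modI env_moduleI)

lemma adjunct_natural_X:
  assumes X: "left_module \<H> X" and Y: "left_module \<H> Y" and M: "left_module (env K S) M"
    and u: "u \<in> mod_hom \<H> X Y" and F: "F \<in> mod_hom \<H> Y (Hom_A K H A act M)"
  shows "adjunct K H A act X M (compose (carrier X) F u) =
    compose (carrier (tensor_smash K H A act X)) (adjunct K H A act Y M F) (fmor TF X Y u)"
proof -
  interpret XM: hom_tensor K H A act X M by (rule hom_tensorI[OF X M])
  interpret YM: hom_tensor K H A act Y M by (rule hom_tensorI[OF Y M])
  interpret U: tensor_mod_map K H A act X Y u by (rule tensor_mod_mapI[OF X Y u])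
  have Fu: "compose (carrier X) F u \<in> mod_hom \<H> X XM.HomA" by (rule mod_hom_compose[OF XM.X_source u F])
  have f: "fmor TF X Y u = U.tmap" by (simp add: tensor_smash_functor_def)
  show ?thesis
    unfolding f
  proof (rule XM.TS_hom_eqI[OF XM.adjunct_hom[OF Fu] mod_hom_compose[OF XM.TS_source U.tmap_hom YM.adjunct_hom[OF F]] XM.M_ag])
    fix x c assume x: "x : X" and c: "c : S"
    have "compose (carrier XM.TS) (YM.\<Phi> F) U.tmap (XM.\<tau> x c) = YM.\<Phi> F (U.tmap (XM.\<tau> x c))"
      using XM.\<tau>_closed[OF x c] by (simp only: compose_eq XM.TS_simps(1))
    also have "\<dots> = XM.R (F (u x) \<one>\<^sub>A) c"
      unfolding U.tmap_pure[OF x c] by (rule YM.adjunct_pure[OF F U.u_linear(1)[OF x] c])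
    finally show "XM.\<Phi> (compose (carrier X) F u) (XM.\<tau> x c) = compose (carrier XM.TS) (YM.\<Phi> F) U.tmap (XM.\<tau> x c)"
      unfolding XM.adjunct_pure[OF Fu x c] compose_eq[OF x] by simp
  qed
qed

lemma adjunct_natural_M:
  assumes X: "left_module \<H> X" and M: "left_module (env K S) M" and N: "left_module (env K S) N"
    and u: "u \<in> mod_hom (env K S) M N" and F: "F \<in> mod_hom \<H> X (Hom_A K H A act M)"
  shows "adjunct K H A act X N (compose (carrier X) (fmor HF M N u) F) =
    compose (carrier (tensor_smash K H A act X)) u (adjunct K H A act X M F)"
proof -
  interpret XM: hom_tensor K H A act X M by (rule hom_tensorI[OF X M])
  interpret XN: hom_tensor K H A act X N by (rule hom_tensorI[OF X N])
  interpret U: env_module_map K H A act M N u by (rule env_module_mapI[OF M N u])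
  let ?f = "fmor HF M N u"
  have f: "?f = (\<lambda>f\<in>carrier XM.HomA. compose (carrier A) u f)" by (simp add: Hom_A_functor_def)
  have fm: "?f \<in> mod_hom \<H> XM.HomA XN.HomA" using U.hom_map by (simp add: f)
  have uF: "compose (carrier X) ?f F \<in> mod_hom \<H> X XN.HomA" by (rule mod_hom_compose[OF XM.X_source F fm])
  show ?thesis
  proof (rule XM.TS_hom_eqI[OF XN.adjunct_hom[OF uF] mod_hom_compose[OF XM.TS_source XM.adjunct_hom[OF F] u] XN.M_ag])
    fix x c assume x: "x : X" and c: "c : S"
    have "compose (carrier X) ?f F x \<one>\<^sub>A = u (F x \<one>\<^sub>A)"
      using mod_hom_closed[OF F x] x by (simp add: f compose_def)
    moreover have "compose (carrier XM.TS) u (XM.\<Phi> F) (XM.\<tau> x c) = u (XM.\<Phi> F (XM.\<tau> x c))"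
      using XM.\<tau>_closed[OF x c] by (simp only: compose_eq XM.TS_simps(1))
    ultimately show "XN.\<Phi> (compose (carrier X) ?f F) (XM.\<tau> x c) = compose (carrier XM.TS) u (XM.\<Phi> F) (XM.\<tau> x c)"
      using U.u_right[OF c XM.F_val(3)[OF F x]] by (simp add: XN.adjunct_pure[OF uF x c] XM.adjunct_pure[OF F x c])
  qed
qed

end

theorem proposition4p3:
  fixes K :: "'k ring" and H :: "('k, 'h) hopf" and A :: "('k, 'a) module"
    and act :: "'h \<Rightarrow> 'a \<Rightarrow> 'a"
  assumes "cocommutative_hopf_algebra K H" and "symmetric_partial_action K H A act"
  shows
    "(\<forall>M :: ((('a, 'h) tensor, ('a, 'h) tensor) tensor, 'm) module.
        left_module (env K (smash K H A act)) M \<longrightarrow>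
        contravariant_nat_iso (Hpar K H) K
          (Hom_to (Hpar K H) (Hom_A K H A act M)
             :: (_, 'x, 'k, 'x \<Rightarrow> 'a \<Rightarrow> 'm) mfunctor)
          (Hom_to (env K (smash K H A act)) M \<circ>\<^sub>F tensor_smash_functor K H A act
             :: (_, 'x, 'k, ('x, ('a, 'h) tensor) tensor \<Rightarrow> 'm) mfunctor)) \<and>
     (\<forall>X :: (('k, 'h) words set set, 'x) module.
        left_module (Hpar K H) X \<longrightarrow>
        covariant_nat_iso (env K (smash K H A act)) K
          (Hom_from (Hpar K H) X \<circ>\<^sub>F Hom_A_functor K H A act
             :: (_, 'm, 'k, 'x \<Rightarrow> 'a \<Rightarrow> 'm) mfunctor)
          (Hom_from (env K (smash K H A act)) (tensor_smash K H A act X)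
             :: (_, 'm, 'k, ('x, ('a, 'h) tensor) tensor \<Rightarrow> 'm) mfunctor))"
proof (intro conjI allI impI)
  interpret C: cocommutative_partial_action K H A act
    by (intro cocommutative_partial_action.intro assms)
  let ?E = "env K (smash K H A act)"
  have to_id: "Hom_to R N \<circ>\<^sub>F id_functor = Hom_to R N" for R :: "('k, 'r, 's) module_scheme" and N :: "('r, 'y) module"
    by (simp add: mcomp_id Hom_to_def)
  have from_id: "Hom_from R X \<circ>\<^sub>F id_functor = Hom_from R X" for R :: "('k, 'r, 's) module_scheme" and X :: "('r, 'y) module"
    by (simp add: mcomp_id Hom_from_def)
  {
    fix M :: "('a, 'h, 'm) smash_env_module" assume M: "left_module ?E M"
    interpret M: env_module K H A act M by (rule C.env_moduleI[OF M])
    have src: "module_source ?E (fobj (tensor_smash_functor K H A act) X)"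
      if "left_module (Hpar K H) X" for X :: "('k, 'h, 'x) par_module"
      using hom_tensor.TS_source[OF C.hom_tensorI[OF that M]] by (simp add: tensor_smash_functor_def)
    show "contravariant_nat_iso (Hpar K H) K
          (Hom_to (Hpar K H) (Hom_A K H A act M) :: (_, 'x, 'k, 'x \<Rightarrow> 'a \<Rightarrow> 'm) mfunctor)
          (Hom_to ?E M \<circ>\<^sub>F tensor_smash_functor K H A act
             :: (_, 'x, 'k, ('x, ('a, 'h) tensor) tensor \<Rightarrow> 'm) mfunctor)"
      unfolding contravariant_nat_iso_def
    proof (intro conjI exI[of _ "\<lambda>X. adjunct K H A act X M"] allI impI ballI; (elim conjE)?)
      show "contravariant_functor (Hpar K H) K (Hom_to (Hpar K H) (Hom_A K H A act M) :: (_, 'x, 'k, 'x \<Rightarrow> 'a \<Rightarrow> 'm) mfunctor)"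
        by (subst to_id[symmetric], rule contravariant_Hom[OF functorial_id _ left_module_target[OF C.Hp_algebra M.HomA_module(1)]])
          (simp add: id_functor_def left_module_source)
      show "contravariant_functor (Hpar K H) K (Hom_to ?E M \<circ>\<^sub>F tensor_smash_functor K H A act
             :: (_, 'x, 'k, ('x, ('a, 'h) tensor) tensor \<Rightarrow> 'm) mfunctor)"
        by (rule contravariant_Hom[OF C.tensor_smash_functorial src M.M_target])
    next
      fix X :: "('k, 'h, 'x) par_module" assume X: "left_module (Hpar K H) X"
      show "adjunct K H A act X M \<in> mod_iso K (fobj (Hom_to (Hpar K H) (Hom_A K H A act M)) X)
        (fobj (Hom_to ?E M \<circ>\<^sub>F tensor_smash_functor K H A act) X)"
        using hom_tensor.adjunct_iso[OF C.hom_tensorI[OF X M]] by (simp add: Hom_to_def mcomp_def tensor_smash_functor_def)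
    next
      fix X Y :: "('k, 'h, 'x) par_module" and u F
      assume X: "left_module (Hpar K H) X" and Y: "left_module (Hpar K H) Y" and u: "u \<in> mod_hom (Hpar K H) X Y"
        and F: "F : (fobj (Hom_to (Hpar K H) (Hom_A K H A act M)) Y)"
      have F: "F \<in> mod_hom (Hpar K H) Y (Hom_A K H A act M)" using F by (simp add: Hom_to_def)
      then show "adjunct K H A act X M (fmor (Hom_to (Hpar K H) (Hom_A K H A act M)) X Y u F) =
        fmor (Hom_to ?E M \<circ>\<^sub>F tensor_smash_functor K H A act) X Y u (adjunct K H A act Y M F)"
        using C.adjunct_natural_X[OF X Y M u F] hom_tensor.adjunct_hom[OF C.hom_tensorI[OF Y M] F]
        by (simp add: Hom_to_def mcomp_def) (simp add: tensor_smash_functor_def)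
    qed
  next
    fix X :: "('k, 'h, 'x) par_module" assume X: "left_module (Hpar K H) X"
    have tgt: "module_target K (Hpar K H) (fobj (Hom_A_functor K H A act) M)"
      if "left_module ?E M" for M :: "('a, 'h, 'm) smash_env_module"
      using hom_tensor.HomA_target[OF C.hom_tensorI[OF X that]] by (simp add: Hom_A_functor_def)
    have src: "module_source (Hpar K H) X" by (rule left_module_source[OF X])
    interpret X: tensor_mod K H A act X by (rule C.tensor_modI[OF X])
    have TS: "module_source ?E (tensor_smash K H A act X)"
      using X.TS_add_closed X.TS_smult_closed by (auto simp: module_source_def)
    show "covariant_nat_iso ?E K
          (Hom_from (Hpar K H) X \<circ>\<^sub>F Hom_A_functor K H A act :: (_, 'm, 'k, 'x \<Rightarrow> 'a \<Rightarrow> 'm) mfunctor)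
          (Hom_from ?E (tensor_smash K H A act X)
             :: (_, 'm, 'k, ('x, ('a, 'h) tensor) tensor \<Rightarrow> 'm) mfunctor)"
      unfolding covariant_nat_iso_def
    proof (intro conjI exI[of _ "\<lambda>M. adjunct K H A act X M"] allI impI ballI; (elim conjE)?)
      show "covariant_functor ?E K (Hom_from (Hpar K H) X \<circ>\<^sub>F Hom_A_functor K H A act :: (_, 'm, 'k, 'x \<Rightarrow> 'a \<Rightarrow> 'm) mfunctor)"
        by (rule covariant_Hom[OF C.Hom_A_functorial tgt src])
      show "covariant_functor ?E K (Hom_from ?E (tensor_smash K H A act X)
             :: (_, 'm, 'k, ('x, ('a, 'h) tensor) tensor \<Rightarrow> 'm) mfunctor)"
        by (subst from_id[symmetric], rule covariant_Hom[OF functorial_id _ TS])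
          (simp add: id_functor_def env_module.M_target[OF C.env_moduleI])
    next
      fix M :: "('a, 'h, 'm) smash_env_module" assume M: "left_module ?E M"
      show "adjunct K H A act X M \<in> mod_iso K (fobj (Hom_from (Hpar K H) X \<circ>\<^sub>F Hom_A_functor K H A act) M)
        (fobj (Hom_from ?E (tensor_smash K H A act X)) M)"
        using hom_tensor.adjunct_iso[OF C.hom_tensorI[OF X M]] by (simp add: Hom_from_def mcomp_def Hom_A_functor_def)
    next
      fix M N :: "('a, 'h, 'm) smash_env_module" and u F
      assume M: "left_module ?E M" and N: "left_module ?E N" and u: "u \<in> mod_hom ?E M N"
        and F: "F : (fobj (Hom_from (Hpar K H) X \<circ>\<^sub>F Hom_A_functor K H A act) M)"
      have F: "F \<in> mod_hom (Hpar K H) X (Hom_A K H A act M)" using F by (simp add: Hom_from_def mcomp_def Hom_A_functor_def)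
      then show "adjunct K H A act X N (fmor (Hom_from (Hpar K H) X \<circ>\<^sub>F Hom_A_functor K H A act) M N u F) =
        fmor (Hom_from ?E (tensor_smash K H A act X)) M N u (adjunct K H A act X M F)"
        using C.adjunct_natural_M[OF X M N u F] hom_tensor.adjunct_hom[OF C.hom_tensorI[OF X M] F]
        by (simp add: Hom_from_def mcomp_def) (simp add: Hom_A_functor_def)
    qed
  }
qed

end
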